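(* Let $L\subseteq \{3,4,5,\dots\}$ be nonempty and set $\lambda_L(z)=\sum_{\ell\in L} \frac{z^\ell}{2\ell}$ for complex $|z|<1$. Let $X_{n,M}^{(L)}$ be the number of $L$-cycles in the random graph $G(n,M)$. For a sequence $\lambda_n\ge 0$, say that $X_{n,M}^{(L)}$ is asymptotically Poisson with parameter $\lambda_n$ if $\sup_{k\ge 0}\left|\Pr[X_{n,M}^{(L)}=k]-e^{-\lambda_n}\frac{\lambda_n^k}{k!}\right|\to 0$ as $n\to\infty$. Then: (A) (Subcritical regime.) Let $c=c(n)$ satisfy $0<\limsup_{n\to\infty}c<1/2$ and $M=cn$. Then $X_{n,M}^{(L)}$ is asymptotically Poisson with parameter $\lambda_L(2c)$. (B) (Barely subcritical regime.) Let $M=\frac{n}{2}(1-\mu n^{-1/3})$ with $\mu=\mu(n)\to+\infty$ and $\mu=o(n^{1/3})$. If $\lim_{n\to\infty}\lambda_L(2M/n)<+\infty$, then $X_{n,M}^{(L)}$ is asymptotically Poisson with parameter $\lambda_L(2M/n)$. If $\lim_{n\to\infty}\lambda_L(2M/n)=+\infty$, then $$\frac{X_{n,M}^{(L)}-\lambda_L\left(\frac{2M}{n}\right)}{\sqrt{\lambda_L\left(\frac{2M}{n}\right)}}\to \mathcal N(0,1)$$ in distribution as $n\to\infty$. (C) (Critical regime.) Let $M=\frac{n}{2}(1+\mu n^{-1/3})$ with $\mu=O(1)$, and let $\alpha$ be the unique positive solution of $\mu=\frac1\alpha-\alpha$. If $\lim_{n\to\infty}\lambda_L(e^{-\alpha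 n^{-1/3}})<+\infty$, then $X_{n,M}^{(L)}$ is asymptotically Poisson with parameter $\lambda_L(e^{-\alpha n^{-1/3}})$. If $\lim_{n\to\infty}\lambda_L(e^{-\alpha n^{-1/3}})=+\infty$, then $$\frac{X_{n,M}^{(L)}-\lambda_L\left(e^{-\alpha n^{-1/3}}\right)}{\sqrt{\lambda_L\left(e^{-\alpha n^{-1/3}}\right)}}\to \mathcal N(0,1)$$ in distribution as $n\to\infty$.
   Context: $G(n,M)$ is the Erdős–Rényi random graph: a graph on vertex set $\{1,\dots,n\}$ with exactly $M$ edges, chosen uniformly among all $\binom{\binom n2}{M}$ such graphs. A graph is unicyclic if it is connected and contains exactly one cycle. A cycle of a graph is isolated if it is the unique cycle of a connected component that is unicyclic. An $L$-cycle is an isolated cycle whose length belongs to $L$. *)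

theory Defs
  imports "HOL-Probability.Probability" "HOL-Library.Landau_Symbols"
begin

text \<open>
  A simple graph is given by a vertex set \<open>V\<close> and a set \<open>E\<close> of two-element subsets of \<open>V\<close>.
\<close>

definition reachable :: "'a set set \<Rightarrow> 'a \<Rightarrow> 'a \<Rightarrow> bool" where
  "reachable E = (\<lambda>u v. {u, v} \<in> E)\<^sup>*\<^sup>*"

definition connected_graph :: "'a set \<Rightarrow> 'a set set \<Rightarrow> bool" where
  "connected_graph V E \<longleftrightarrow> V \<noteq> {} \<and> (\<forall>u\<in>V. \<forall>v\<in>V. reachable E u v)"

definition component_verts :: "'a set \<Rightarrow> 'a set set \<Rightarrow> 'a set set" where
  "component_verts V E = {{u \<in> V. reachable E v u} | v. v \<in> V}"

definition induced_edges :: "'a set set \<Rightarrow> 'a set \<Rightarrow> 'a set set" where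
  "induced_edges E W = {e \<in> E. e \<subseteq> W}"

definition cycle_edges :: "'a list \<Rightarrow> 'a set set" where
  "cycle_edges vs = {{vs ! i, vs ! (Suc i mod length vs)} | i. i < length vs}"

text \<open>
  A cycle is a subgraph, identified with its edge set: different starting points and
  orientations give the same cycle, and the length of a cycle \<open>C\<close> is \<open>card C\<close>.
\<close>

definition cycles_of :: "'a set set \<Rightarrow> 'a set set set" where
  "cycles_of E = {C. C \<subseteq> E \<and> (\<exists>vs. distinct vs \<and> length vs \<ge> 3 \<and> C = cycle_edges vs)}"

definition unicyclic :: "'a set \<Rightarrow> 'a set set \<Rightarrow> bool" where
  "unicyclic V E \<longleftrightarrow> connected_graph V E \<and> (\<exists>!C. C \<in> cycles_of E)"

definition isolated_cycles :: "'a set \<Rightarrow> 'a set set \<Rightarrow> 'a set set set" where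
  "isolated_cycles V E =
     {C. \<exists>W \<in> component_verts V E.
           unicyclic W (induced_edges E W) \<and> C \<in> cycles_of (induced_edges E W)}"

definition num_L_cycles :: "nat set \<Rightarrow> 'a set \<Rightarrow> 'a set set \<Rightarrow> nat" where
  "num_L_cycles L V E = card {C \<in> isolated_cycles V E. card C \<in> L}"

definition graphs_with_edges :: "nat \<Rightarrow> nat \<Rightarrow> nat set set set" where
  "graphs_with_edges n M = {E. E \<subseteq> {e. e \<subseteq> {1..n} \<and> card e = 2} \<and> card E = M}"

text \<open>
  This is meaningful only for \<open>M \<le> n choose 2\<close>; otherwise \<^const>\<open>pmf_of_set\<close> is applied to the
  empty set.
\<close>

definition random_graph :: "nat \<Rightarrow> nat \<Rightarrow> nat set set pmf" where
  "random_graph n M = pmf_of_set (graphs_with_edges n M)"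

definition X_cycles :: "nat set \<Rightarrow> nat \<Rightarrow> nat set set \<Rightarrow> nat" where
  "X_cycles L n E = num_L_cycles L {1..n} E"

text \<open>
  Polymorphic so that it covers complex \<open>z\<close> as well as the real arguments that serve as Poisson
  parameters. Where the family is not summable (possible only for \<open>norm z \<ge> 1\<close>), \<^const>\<open>infsum\<close>
  returns the junk value 0.
\<close>

definition lambda_gf :: "nat set \<Rightarrow> 'a::real_normed_field \<Rightarrow> 'a" where
  "lambda_gf L z = (\<Sum>\<^sub>\<infinity>l\<in>L. z ^ l / (2 * of_nat l))"

definition asymp_Poisson :: "nat set \<Rightarrow> (nat \<Rightarrow> nat) \<Rightarrow> (nat \<Rightarrow> real) \<Rightarrow> bool" where
  "asymp_Poisson L M lam \<longleftrightarrow>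
     (\<lambda>n. SUP k. \<bar>measure_pmf.prob (random_graph n (M n)) {E. X_cycles L n E = k}
                    - exp (- lam n) * lam n ^ k / fact k\<bar>) \<longlonglongrightarrow> 0"

definition asymp_normal :: "nat set \<Rightarrow> (nat \<Rightarrow> nat) \<Rightarrow> (nat \<Rightarrow> real) \<Rightarrow> bool" where
  "asymp_normal L M lam \<longleftrightarrow>
     weak_conv_m
       (\<lambda>n. distr (measure_pmf (random_graph n (M n))) borel
              (\<lambda>E. (real (X_cycles L n E) - lam n) / sqrt (lam n)))
       std_normal_distribution"

definition crit_alpha :: "real \<Rightarrow> real" where
  "crit_alpha \<mu> = (THE \<alpha>. \<alpha> > 0 \<and> \<mu> = 1 / \<alpha> - \<alpha>)"

lemma crit_alpha_ex1: "\<exists>!\<alpha>::real. \<alpha> > 0 \<and> \<mu> = 1 / \<alpha> - \<alpha>"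
proof (rule ex1I)
  let ?a = "(sqrt (\<mu>\<^sup>2 + 4) - \<mu>) / 2"
  have "\<bar>\<mu>\<bar> < sqrt (\<mu>\<^sup>2 + 4)"
    by (rule real_less_rsqrt) simp
  then have pos: "?a > 0" by simp
  have sq: "(sqrt (\<mu>\<^sup>2 + 4))\<^sup>2 = \<mu>\<^sup>2 + 4"
    by (simp add: add_nonneg_nonneg)
  have "?a * ?a + \<mu> * ?a = 1"
    using sq by (simp add: field_simps power2_eq_square)
  then have "\<mu> = 1 / ?a - ?a"
    using pos by (metis add_diff_cancel_left' diff_divide_distrib less_irrefl nonzero_mult_div_cancel_right)
  with pos show "?a > 0 \<and> \<mu> = 1 / ?a - ?a" by blast
  fix b :: real assume b: "b > 0 \<and> \<mu> = 1 / b - b"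
  have mono: "1 / y - y < 1 / x - x" if "0 < x" "x < y" for x y :: real
    using frac_less2[of 1 1 x y] that by simp
  show "b = ?a"
    using mono[of b ?a] mono[of ?a b] b pos \<open>\<mu> = 1 / ?a - ?a\<close>
    by (smt (verit))
qed

end

theory Submission imports Defs begin

text \<open>
  Let \<open>\<phi>\<close> be the characteristic function of the number of \<open>L\<close>-cycles of \<open>G(n,M)\<close>. Conditioning on
  a cycle \<open>C\<close> being present and deleting it lowers the number of isolated cycles by exactly one
  provided \<open>C\<close> is isolated. Hence \<open>\<phi>'(t) = \<i> \<Lambda> e\<^sup>i\<^sup>t \<phi>(t)\<close> up to a small error, where \<open>\<Lambda>\<close> is the expected
  number of cycles with length in \<open>L\<close>, and so \<open>\<phi>\<close> is close to the characteristic function of a Poisson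
  variable. Fourier inversion and Levy's continuity theorem turn this into the two limit laws.

  A cycle fails to be isolated only if some path starting from it closes up. Below the critical
  density a first moment bound shows that this is rare. In the critical window the first moment
  is too large, and the probability that a cycle has a treelike component of a given size is instead
  compared with the same probability at a slightly smaller density \<open>M0\<close>, through the likelihood ratio.
  Cycles that are too long for this comparison are discarded; the expected number of long
  isolated cycles is bounded by the same change of density.
\<close>

subsection \<open>Uniformly random subsets of a given size\<close>

text \<open>Write \<open>n\<close> for the number of vertices, t = n^(1/3), and \<open>rho\<close>
  for essentially the average degree. The first moment of the obstructions to isolation is a power
  series in \<open>rho\<close>; for rho < 1 it is of order 1/(n (1 - rho)^3), which tends to 0 only
  as long as the distance to the critical window, measured in the scale of the window, tends to
  infinity. Inside the window \<open>M0\<close> is chosen with rho <= 1 - 1/t. There a cycle of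
  length l <= t fails to have a treelike component of size at most t^2 with probability O(l/t), and
  its mean component size is at most l t. From \<open>M0\<close> to \<open>M\<close> there are
  O(t^2) single edges. Adding one of them multiplies the weight of size k by at least 1 - O(l/t^3 +
  k/t^4), so that on average only O(l/t) is lost; and by at most 1 + O(k/t^4 + k^2/t^6), which stays
  bounded over all steps for k <= D t^2. Larger components are too few to carry many cycles. A
  second obstacle is that the parameter may tend to infinity. The error bound for the characteristic
  function at argument s therefore contains no exponential of the parameter, and it carries a factor
  |s|: bounded s serve the Poisson law, s of order parameter^(-1/2) the normal law.\<close>

definition subsets_of_card :: "'a set \<Rightarrow> nat \<Rightarrow> 'a set set" where
  "subsets_of_card U m = {G. G \<subseteq> U \<and> card G = m}"

text \<open>Probability that a uniform \<open>m\<close>-subset of an \<open>N\<close>-set contains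
  \<open>s\<close> given elements, as a quotient of falling factorials. For \<open>s > m\<close> the
  factor with \<open>i = m\<close> is 0, so no case distinction is needed.\<close>

definition incl_prob :: "nat \<Rightarrow> nat \<Rightarrow> nat \<Rightarrow> real" where
  "incl_prob N m s = (\<Prod>i<s. (real m - real i) / (real N - real i))"

lemma finite_subsets_of_card [simp]: "finite U \<Longrightarrow> finite (subsets_of_card U m)"
  by (simp add: subsets_of_card_def)

lemma card_subsets_of_card: "finite U \<Longrightarrow> card (subsets_of_card U m) = card U choose m"
  by (simp add: subsets_of_card_def n_subsets)

lemma subsets_of_card_nonempty: "finite U \<Longrightarrow> m \<le> card U \<Longrightarrow> subsets_of_card U m \<noteq> {}"
  using card_subsets_of_card[of U m] by fastforce

lemma sum_supersets:
  assumes "finite U" "F \<subseteq> U" "card F \<le> m"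
  shows "(\<Sum>G | G \<in> subsets_of_card U m \<and> F \<subseteq> G. f G)
       = (\<Sum>H\<in>subsets_of_card (U - F) (m - card F). f (H \<union> F))"
proof (rule sum.reindex_bij_witness[of _ "\<lambda>H. H \<union> F" "\<lambda>G. G - F"])
  have fF: "finite F" using assms finite_subset by blast
  fix G assume "G \<in> {G \<in> subsets_of_card U m. F \<subseteq> G}"
  then have G: "G \<subseteq> U" "card G = m" "F \<subseteq> G" by (auto simp: subsets_of_card_def)
  show "G - F \<union> F = G" using G by auto
  show "G - F \<in> subsets_of_card (U - F) (m - card F)"
    using G fF by (auto simp: subsets_of_card_def card_Diff_subset)
  show "f (G - F \<union> F) = f G" using G by (simp add: Un_absorb2)
next
  have fF: "finite F" using assms finite_subset by blast
  fix H assume "H \<in> subsets_of_card (U - F) (m - card F)"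
  then have H: "H \<subseteq> U - F" "card H = m - card F" by (auto simp: subsets_of_card_def)
  then have "finite H" using assms(1) finite_subset by blast
  then have "card (H \<union> F) = m" using H fF assms(3) by (subst card_Un_disjoint) auto
  then show "H \<union> F \<in> {G \<in> subsets_of_card U m. F \<subseteq> G}"
    using H assms(2) by (auto simp: subsets_of_card_def)
  show "H \<union> F - F = H" using H by auto
qed

lemma no_supersets:
  assumes "finite U" "m < card F"
  shows "{G \<in> subsets_of_card U m. F \<subseteq> G} = {}"
proof -
  have False if "G \<subseteq> U" "card G = m" "F \<subseteq> G" for G
    using card_mono[of G F] that assms finite_subset by fastforce
  then show ?thesis by (auto simp: subsets_of_card_def)
qed

lemma incl_prob_0 [simp]: "incl_prob N m 0 = 1"
  by (simp add: incl_prob_def)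

lemma incl_prob_Suc: "incl_prob N m (Suc s) = incl_prob N m s * ((real m - real s) / (real N - real s))"
  by (simp add: incl_prob_def)

lemma incl_prob_eq_0: "m < s \<Longrightarrow> incl_prob N m s = 0"
  unfolding incl_prob_def by (intro prod_zero) auto

lemma incl_prob_nonneg: "m \<le> N \<Longrightarrow> 0 \<le> incl_prob N m s"
proof (cases "s \<le> m")
  case True
  assume "m \<le> N"
  then show ?thesis unfolding incl_prob_def using True by (intro prod_nonneg) auto
qed (simp add: incl_prob_eq_0)

lemma incl_prob_le:
  assumes "m \<le> N"
  shows "incl_prob N m s \<le> (real m / real N) ^ s"
proof (cases "s \<le> m")
  case True
  have "incl_prob N m s \<le> (\<Prod>i<s. real m / real N)"
    unfolding incl_prob_def
  proof (rule prod_mono, safe)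
    fix i assume i: "i < s"
    then have "real i < real N" "real i \<le> real m" using True assms by auto
    moreover from this have "real m * real i \<le> real N * real i" using assms by (simp add: mult_right_mono)
    ultimately show "0 \<le> (real m - real i) / (real N - real i)"
      "(real m - real i) / (real N - real i) \<le> real m / real N"
      using assms by (auto simp: field_simps)
  qed
  then show ?thesis by simp
qed (use assms in \<open>simp add: incl_prob_eq_0\<close>)

lemma incl_prob_choose:
  assumes "s \<le> m" "m \<le> N"
  shows "real ((N - s) choose (m - s)) = incl_prob N m s * real (N choose m)"
  using assms(1)
proof (induction s)
  case (Suc s)
  then have s: "s < m" "s < N" using assms by auto
  have "Suc (m - Suc s) * (Suc (N - Suc s) choose Suc (m - Suc s)) = Suc (N - Suc s) * ((N - Suc s) choose (m - Suc s))"
    using Suc_times_binomial_eq[of "N - Suc s" "m - Suc s"] by (simp add: mult.commute)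
  then have "(m - s) * ((N - s) choose (m - s)) = (N - s) * ((N - Suc s) choose (m - Suc s))"
    using s by (simp add: Suc_diff_Suc)
  then have "real (m - s) * real ((N - s) choose (m - s)) = real (N - s) * real ((N - Suc s) choose (m - Suc s))"
    by (metis of_nat_mult)
  then have "real ((N - Suc s) choose (m - Suc s)) = (real m - real s) / (real N - real s) * real ((N - s) choose (m - s))"
    using s by (simp add: field_simps of_nat_diff)
  with Suc s show ?case by (simp add: incl_prob_Suc)
qed simp

lemma density_diff_le: "s \<le> m \<Longrightarrow> m \<le> N \<Longrightarrow> real (m - s) / real (N - s) \<le> real m / real N"
proof (cases "s = N")
  case False
  assume "s \<le> m" "m \<le> N"
  moreover have "real m * real s \<le> real N * real s" using calculation by (simp add: mult_right_mono)
  ultimately show ?thesis using False by (auto simp: field_simps of_nat_diff)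
qed simp

text \<open>Expectation over a uniform \<open>m\<close>-subset, as a finite sum with values in any
  normed field: the same rules then serve real counts and complex exponentials.\<close>

definition avg :: "'a set \<Rightarrow> nat \<Rightarrow> ('a set \<Rightarrow> 'b::real_normed_field) \<Rightarrow> 'b" where
  "avg U m f = (\<Sum>G\<in>subsets_of_card U m. f G) / of_nat (card U choose m)"

lemma avg_add: "avg U m (\<lambda>G. f G + g G) = avg U m f + avg U m g"
  by (simp add: avg_def sum.distrib add_divide_distrib)

lemma avg_diff: "avg U m (\<lambda>G. f G - g G) = avg U m f - avg U m g"
  by (simp add: avg_def sum_subtractf diff_divide_distrib)

lemma avg_cmult: "avg U m (\<lambda>G. c * f G) = c * avg U m f"
  by (simp add: avg_def sum_distrib_left)

lemma avg_sum: "avg U m (\<lambda>G. \<Sum>i\<in>I. f i G) = (\<Sum>i\<in>I. avg U m (f i))"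
  unfolding avg_def by (subst sum.swap) (simp add: sum_divide_distrib)

lemma avg_cong: "(\<And>G. G \<subseteq> U \<Longrightarrow> card G = m \<Longrightarrow> f G = g G) \<Longrightarrow> avg U m f = avg U m g"
  unfolding avg_def by (intro arg_cong2[where f="(/)"] sum.cong) (auto simp: subsets_of_card_def)

lemma avg_const: "finite U \<Longrightarrow> m \<le> card U \<Longrightarrow> avg U m (\<lambda>_. c) = c"
  by (simp add: avg_def card_subsets_of_card)

lemma avg_mono:
  fixes f g :: "'a set \<Rightarrow> real"
  shows "(\<And>G. G \<subseteq> U \<Longrightarrow> card G = m \<Longrightarrow> f G \<le> g G) \<Longrightarrow> avg U m f \<le> avg U m g"
  unfolding avg_def by (intro divide_right_mono sum_mono) (auto simp: subsets_of_card_def)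

lemma avg_nonneg:
  fixes f :: "'a set \<Rightarrow> real"
  shows "(\<And>G. G \<subseteq> U \<Longrightarrow> card G = m \<Longrightarrow> 0 \<le> f G) \<Longrightarrow> 0 \<le> avg U m f"
  unfolding avg_def by (intro divide_nonneg_nonneg sum_nonneg) (auto simp: subsets_of_card_def)

lemma norm_avg_le: "norm (avg U m f) \<le> avg U m (\<lambda>G. norm (f G))"
  unfolding avg_def by (simp add: norm_divide divide_right_mono norm_sum)

text \<open>Conditioned on containing \<open>F\<close>, the remaining elements form a uniform subset
  of \<open>U - F\<close>. If \<open>card F > m\<close>, the truncated subtraction makes the average
  on the right meaningless, but its factor \<open>incl_prob\<close> is then 0.\<close>

lemma avg_supersets:
  assumes "finite U" "F \<subseteq> U" "m \<le> card U"
  shows "avg U m (\<lambda>G. if F \<subseteq> G then f G else 0)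
       = of_real (incl_prob (card U) m (card F)) * avg (U - F) (m - card F) (\<lambda>H. f (H \<union> F))"
proof (cases "card F \<le> m")
  case True
  have fF: "finite F" using assms finite_subset by blast
  have ne: "real (card U choose m) \<noteq> 0" "real ((card U - card F) choose (m - card F)) \<noteq> 0"
    using assms(3) True by auto
  have "avg U m (\<lambda>G. if F \<subseteq> G then f G else 0) = (\<Sum>G | G \<in> subsets_of_card U m \<and> F \<subseteq> G. f G) / of_nat (card U choose m)"
    unfolding avg_def by (subst sum.inter_filter[symmetric]) (auto simp: assms)
  also have "\<dots> = (\<Sum>H\<in>subsets_of_card (U - F) (m - card F). f (H \<union> F)) / of_nat (card U choose m)"
    by (subst sum_supersets[OF assms(1,2) True]) simp
  also have "\<dots> = of_real (incl_prob (card U) m (card F)) * avg (U - F) (m - card F) (\<lambda>H. f (H \<union> F))"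
  proof -
    have "incl_prob (card U) m (card F) = real ((card U - card F) choose (m - card F)) / real (card U choose m)"
      using incl_prob_choose[OF True assms(3)] ne by simp
    then have 1: "of_real (incl_prob (card U) m (card F)) = (of_nat ((card U - card F) choose (m - card F)) / of_nat (card U choose m) :: 'b)"
      by (simp only: of_real_divide of_real_of_nat_eq)
    have 2: "card (U - F) = card U - card F"
      using fF assms by (simp add: card_Diff_subset)
    have 3: "of_nat ((card U - card F) choose (m - card F)) \<noteq> (0::'b)"
      using ne by simp
    show ?thesis unfolding avg_def 1 2 using 3 by simp
  qed
  finally show ?thesis .
next
  case False
  then have "avg U m (\<lambda>G. if F \<subseteq> G then f G else 0) = 0"
    unfolding avg_def using no_supersets[OF assms(1), of m F] by (auto intro!: sum.neutral)
  then show ?thesis using False by (simp add: incl_prob_eq_0)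
qed

lemma avg_superset_indicator:
  assumes "finite U" "F \<subseteq> U" "m \<le> card U"
  shows "avg U m (\<lambda>G. if F \<subseteq> G then 1 else 0) = (incl_prob (card U) m (card F) :: real)"
proof (cases "card F \<le> m")
  case True
  have "m - card F \<le> card (U - F)"
    using assms finite_subset[OF assms(2,1)] by (simp add: card_Diff_subset)
  then show ?thesis
    unfolding avg_supersets[OF assms, of "\<lambda>_. 1::real"] using assms(1) by (simp add: avg_const)
next
  case False
  then show ?thesis unfolding avg_supersets[OF assms, of "\<lambda>_. 1::real"] by (simp add: incl_prob_eq_0)
qed

text \<open>Two-stage sampling: a uniform subset of a uniform subset is uniform. This couples graphs
  with different numbers of edges as nested sets.\<close>

lemma avg_avg:
  fixes f :: "'a set \<Rightarrow> 'b::real_normed_field"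
  assumes "finite U" "m' \<le> m" "m \<le> card U"
  shows "avg U m (\<lambda>G. avg G m' f) = avg U m' f"
proof -
  let ?S = "subsets_of_card"
  have "(\<Sum>G\<in>?S U m. \<Sum>H\<in>?S G m'. f H) = (\<Sum>G\<in>?S U m. \<Sum>H\<in>?S U m'. if H \<subseteq> G then f H else 0)"
  proof (rule sum.cong[OF refl])
    fix G assume "G \<in> ?S U m"
    then have "?S G m' = {H \<in> ?S U m'. H \<subseteq> G}" by (auto simp: subsets_of_card_def)
    then show "(\<Sum>H\<in>?S G m'. f H) = (\<Sum>H\<in>?S U m'. if H \<subseteq> G then f H else 0)"
      using assms(1) by (simp add: sum.inter_filter)
  qed
  also have "\<dots> = (\<Sum>H\<in>?S U m'. \<Sum>G\<in>?S U m. if H \<subseteq> G then f H else 0)"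
    by (rule sum.swap)
  also have "\<dots> = (\<Sum>H\<in>?S U m'. f H * of_nat ((card U - m') choose (m - m')))"
  proof (rule sum.cong[OF refl])
    fix H assume "H \<in> ?S U m'"
    then have H: "H \<subseteq> U" "card H = m'" by (auto simp: subsets_of_card_def)
    have "(\<Sum>G\<in>?S U m. if H \<subseteq> G then f H else 0) = (\<Sum>G | G \<in> ?S U m \<and> H \<subseteq> G. f H)"
      using assms(1) by (subst sum.inter_filter) auto
    also have "\<dots> = (\<Sum>H'\<in>?S (U - H) (m - card H). f H)"
      using sum_supersets[OF assms(1) H(1), of m "\<lambda>_. f H"] H assms by simp
    also have "\<dots> = f H * of_nat ((card U - m') choose (m - m'))"
      using H assms finite_subset[OF H(1)] by (simp add: card_subsets_of_card card_Diff_subset)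
    finally show "(\<Sum>G\<in>?S U m. if H \<subseteq> G then f H else 0) = f H * of_nat ((card U - m') choose (m - m'))" .
  qed
  finally have *: "(\<Sum>G\<in>?S U m. \<Sum>H\<in>?S G m'. f H) = (\<Sum>H\<in>?S U m'. f H) * of_nat ((card U - m') choose (m - m'))"
    by (simp add: sum_distrib_right)
  have "avg U m (\<lambda>G. avg G m' f) = (\<Sum>G\<in>?S U m. \<Sum>H\<in>?S G m'. f H) / of_nat (m choose m') / of_nat (card U choose m)"
    unfolding avg_def sum_divide_distrib
    by (auto intro!: sum.cong simp: subsets_of_card_def)
  also have "\<dots> = (\<Sum>H\<in>?S U m'. f H) * (of_nat ((card U - m') choose (m - m')) / (of_nat (m choose m') * of_nat (card U choose m)))"
    using * by simp
  also have "of_nat ((card U - m') choose (m - m')) / (of_nat (m choose m') * of_nat (card U choose m)) = (1 / of_nat (card U choose m') :: 'b)"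
  proof -
    have e: "(card U choose m) * (m choose m') = (card U choose m') * ((card U - m') choose (m - m'))"
      using choose_mult[of m' m "card U"] assms by simp
    have "of_nat (card U choose m) * of_nat (m choose m') = (of_nat (card U choose m') * of_nat ((card U - m') choose (m - m')) :: 'b)"
      using arg_cong[OF e, of "of_nat :: nat \<Rightarrow> 'b"] by simp
    moreover have "of_nat (card U choose m') \<noteq> (0::'b)" "of_nat (card U choose m) \<noteq> (0::'b)" "of_nat (m choose m') \<noteq> (0::'b)"
      using assms by auto
    ultimately show ?thesis by (simp add: field_simps)
  qed
  finally show ?thesis by (simp add: avg_def)
qed

text \<open>The nested coupling turns a pointwise bound for \<open>H \<subseteq> G\<close> into one
  for the averages. The summand \<open>y G - y H\<close> is kept as a difference because its average
  is a difference of two explicit expectations.\<close>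

lemma norm_avg_diff_le:
  fixes f :: "'a set \<Rightarrow> 'b::real_normed_field"
  assumes "finite U" "m' \<le> m" "m \<le> card U"
    and "\<And>G H. G \<subseteq> U \<Longrightarrow> card G = m \<Longrightarrow> H \<subseteq> G \<Longrightarrow> card H = m' \<Longrightarrow> norm (f G - f H) \<le> h G + (y G - y H)"
  shows "norm (avg U m f - avg U m' f) \<le> avg U m h + (avg U m y - avg U m' y)"
proof -
  have "avg U m f - avg U m' f = avg U m (\<lambda>G. f G - avg G m' f)"
    using avg_avg[OF assms(1-3), of f] by (simp add: avg_diff)
  also have "\<dots> = avg U m (\<lambda>G. avg G m' (\<lambda>H. f G - f H))"
    using assms(1-3) by (intro avg_cong) (auto simp: avg_diff avg_const finite_subset[OF _ assms(1)])
  finally have "norm (avg U m f - avg U m' f) \<le> avg U m (\<lambda>G. norm (avg G m' (\<lambda>H. f G - f H)))"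
    by (simp only: norm_avg_le)
  also have "\<dots> \<le> avg U m (\<lambda>G. avg G m' (\<lambda>H. h G + (y G - y H)))"
    by (intro avg_mono order_trans[OF norm_avg_le] avg_mono assms(4)) auto
  also have "\<dots> = avg U m (\<lambda>G. h G + (y G - avg G m' y))"
    using assms(1-3) by (intro avg_cong) (auto simp: avg_add avg_diff avg_const finite_subset[OF _ assms(1)])
  also have "\<dots> = avg U m h + (avg U m y - avg U m' y)"
    using avg_avg[OF assms(1-3), of y] by (simp add: avg_diff avg_add)
  finally show ?thesis .
qed

subsection \<open>Rooted reachability\<close>

definition pairs :: "'a set \<Rightarrow> 'a set set" where
  "pairs V = {e. e \<subseteq> V \<and> card e = 2}"

definition rooted_comp :: "'a set \<Rightarrow> 'a set set \<Rightarrow> 'a set" where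
  "rooted_comp S G = {y. \<exists>x\<in>S. reachable G x y}"

text \<open>\<open>treelike S A G\<close>: outside the core \<open>A\<close>, the graph \<open>G\<close> hangs on the root set \<open>S\<close> like a forest.\<close>

definition treelike :: "'a set \<Rightarrow> 'a set set \<Rightarrow> 'a set set \<Rightarrow> bool" where
  "treelike S A G \<longleftrightarrow> (\<forall>x y. {x, y} \<in> G - A \<longrightarrow>
     \<not> (x \<in> rooted_comp S (G - {{x, y}}) \<and> y \<in> rooted_comp S (G - {{x, y}})))"

lemma pairs_mono: "W \<subseteq> V \<Longrightarrow> pairs W \<subseteq> pairs V"
  by (auto simp: pairs_def)

lemma finite_pairs [simp]: "finite V \<Longrightarrow> finite (pairs V)"
  by (simp add: pairs_def)

lemma card_pairs: "finite V \<Longrightarrow> card (pairs V) = card V choose 2"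
  by (simp add: pairs_def n_subsets)

lemma pairsE:
  assumes "e \<in> pairs V" obtains x y where "e = {x, y}" "x \<noteq> y" "x \<in> V" "y \<in> V"
  using assms by (auto simp: pairs_def card_2_iff)

lemma pairs_other_end: "e \<in> pairs V \<Longrightarrow> x \<in> e \<Longrightarrow> \<exists>y. e = {x, y} \<and> y \<noteq> x"
  by (erule pairsE) auto

lemma doubleton_in_pairs [simp]: "{x, y} \<in> pairs V \<longleftrightarrow> x \<in> V \<and> y \<in> V \<and> x \<noteq> y"
  by (auto simp: pairs_def card_2_iff doubleton_eq_iff)

lemma reachable_refl [simp]: "reachable G x x"
  by (simp add: reachable_def)

lemma reachable_trans: "reachable G x y \<Longrightarrow> reachable G y z \<Longrightarrow> reachable G x z"
  unfolding reachable_def by (rule rtranclp_trans)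

lemma reachable_edge: "{x, y} \<in> G \<Longrightarrow> reachable G x y"
  unfolding reachable_def by (rule r_into_rtranclp)

lemma reachable_sym: "reachable G x y \<Longrightarrow> reachable G y x"
  unfolding reachable_def
proof (induction rule: rtranclp_induct)
  case (step y z)
  then have "{z, y} \<in> G" by (simp add: insert_commute)
  then show ?case using step.IH by (rule converse_rtranclp_into_rtranclp)
qed simp

lemma reachable_mono: "reachable G x y \<Longrightarrow> G \<subseteq> H \<Longrightarrow> reachable H x y"
  unfolding reachable_def by (erule mono_rtranclp[rule_format, rotated]) auto

lemma rooted_comp_base: "S \<subseteq> rooted_comp S G"
  by (auto simp: rooted_comp_def intro!: bexI)

lemma rooted_comp_step: "x \<in> rooted_comp S G \<Longrightarrow> {x, y} \<in> G \<Longrightarrow> y \<in> rooted_comp S G"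
  unfolding rooted_comp_def by (blast intro: reachable_trans reachable_edge)

lemma rooted_comp_reachable: "x \<in> rooted_comp S G \<Longrightarrow> reachable G x y \<Longrightarrow> y \<in> rooted_comp S G"
  unfolding rooted_comp_def by (blast intro: reachable_trans)

lemma rooted_comp_mono: "G \<subseteq> H \<Longrightarrow> rooted_comp S G \<subseteq> rooted_comp S H"
  unfolding rooted_comp_def using reachable_mono[of G _ _ H] by blast

lemma rooted_comp_induct [consumes 1, case_names base step]:
  assumes "y \<in> rooted_comp S G"
    and "\<And>s. s \<in> S \<Longrightarrow> P s"
    and "\<And>x y. x \<in> rooted_comp S G \<Longrightarrow> P x \<Longrightarrow> {x, y} \<in> G \<Longrightarrow> P y"
  shows "P y"
proof -
  obtain s where s: "s \<in> S" "reachable G s y" using assms(1) by (auto simp: rooted_comp_def)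
  from s(2) have "y \<in> rooted_comp S G \<and> P y" unfolding reachable_def
  proof (induction rule: rtranclp_induct)
    case base
    then show ?case using s(1) assms(2) rooted_comp_base[of S G] by auto
  next
    case (step y z)
    then show ?case using assms(3)[of y z] rooted_comp_step[of y S G z] by auto
  qed
  then show ?thesis ..
qed

lemma rooted_comp_closed:
  assumes "S \<subseteq> W" "\<And>x y. x \<in> W \<Longrightarrow> {x, y} \<in> G \<Longrightarrow> y \<in> W"
  shows "rooted_comp S G \<subseteq> W"
proof
  fix y assume "y \<in> rooted_comp S G"
  then show "y \<in> W" by (induction rule: rooted_comp_induct) (use assms in auto)
qed

lemma rooted_comp_subset: "S \<subseteq> V \<Longrightarrow> G \<subseteq> pairs V \<Longrightarrow> rooted_comp S G \<subseteq> V"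
  by (rule rooted_comp_closed) (auto dest: subsetD)

lemma rooted_comp_cases:
  assumes "x \<in> rooted_comp S G" "x \<notin> S"
  obtains y where "{y, x} \<in> G" "y \<in> rooted_comp S G"
  using assms by (induction arbitrary: thesis rule: rooted_comp_induct) auto

lemma rooted_comp_Diff_edge:
  assumes "y \<in> rooted_comp S G"
  shows "y \<in> rooted_comp S (G - {{a, b}}) \<or> a \<in> rooted_comp S (G - {{a, b}}) \<or> b \<in> rooted_comp S (G - {{a, b}})"
  using assms
proof (induction rule: rooted_comp_induct)
  case (base s)
  then show ?case using rooted_comp_base[of S] by blast
next
  case (step x y)
  show ?case
  proof (cases "{x, y} = {a, b}")
    case True
    then have "x = a \<or> x = b" by (auto simp: doubleton_eq_iff)
    then show ?thesis using step by auto
  next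
    case False
    then have "{x, y} \<in> G - {{a, b}}" using step by auto
    then show ?thesis using step rooted_comp_step[of x S "G - {{a, b}}" y] by auto
  qed
qed

text \<open>Follow a walk from \<open>S\<close> until it first meets \<open>x\<close>. Up to that
  moment it uses no edge at \<open>x\<close>, hence not the edge by which it arrives.\<close>

lemma rooted_comp_first_arrival:
  assumes "x \<in> rooted_comp S G" "x \<notin> S"
  obtains y where "{y, x} \<in> G" "y \<in> rooted_comp S (G - {{y, x}})"
proof -
  define H where "H = {e \<in> G. x \<notin> e}"
  have *: "z \<in> rooted_comp S H \<or> (\<exists>y\<in>rooted_comp S H. {y, x} \<in> G)" if "z \<in> rooted_comp S G" for z
    using that
  proof (induction rule: rooted_comp_induct)
    case (base s)
    then show ?case using rooted_comp_base[of S] by blast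
  next
    case (step u v)
    consider "\<exists>y\<in>rooted_comp S H. {y, x} \<in> G" | "u \<in> rooted_comp S H" using step by auto
    then show ?case
    proof cases
      case 2
      have "u \<noteq> x"
      proof
        assume "u = x"
        then obtain y where "{y, x} \<in> H" using 2 assms(2) rooted_comp_cases[of x S H] by metis
        then show False by (simp add: H_def)
      qed
      show ?thesis
      proof (cases "v = x")
        case True
        then show ?thesis using 2 step by auto
      next
        case False
        then have "{u, v} \<in> H" using \<open>u \<noteq> x\<close> step by (simp add: H_def)
        then show ?thesis using rooted_comp_step[OF 2] by blast
      qed
    qed auto
  qed
  have "x \<notin> rooted_comp S H"
  proof
    assume "x \<in> rooted_comp S H"
    then obtain y where "{y, x} \<in> H" using assms(2) rooted_comp_cases[of x S H] by metis
    then show False by (simp add: H_def)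
  qed
  then obtain y where y: "y \<in> rooted_comp S H" "{y, x} \<in> G" using *[OF assms(1)] by auto
  have "H \<subseteq> G - {{y, x}}" by (auto simp: H_def)
  then have "y \<in> rooted_comp S (G - {{y, x}})" using y rooted_comp_mono by blast
  with y show ?thesis using that by blast
qed

text \<open>
  In a treelike graph every edge outside the core, when deleted, cuts off exactly one of its ends;
  this matches these edges with the vertices outside the root set.
\<close>

lemma treelike_card_edges:
  assumes "finite V" "G \<subseteq> pairs V" "S \<subseteq> V" "A \<subseteq> pairs S" "treelike S A G"
  shows "card {e \<in> G - A. e \<subseteq> rooted_comp S G} = card (rooted_comp S G - S)"
proof -
  let ?W = "rooted_comp S G" and ?E = "{e \<in> G - A. e \<subseteq> rooted_comp S G}"
  define R where "R e x \<longleftrightarrow> x \<in> e \<and> x \<notin> rooted_comp S (G - {e})" for e x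
  have ex1: "\<exists>!x. R e x" if e: "e \<in> ?E" for e
  proof -
    have "e \<in> pairs V" using e assms(2) by auto
    then obtain x y where xy: "e = {x, y}" "x \<noteq> y" by (rule pairsE)
    have n: "\<not> (x \<in> rooted_comp S (G - {e}) \<and> y \<in> rooted_comp S (G - {e}))"
      using assms(5) e xy unfolding treelike_def by blast
    have "x \<in> ?W" using e xy by auto
    then have "x \<in> rooted_comp S (G - {e}) \<or> y \<in> rooted_comp S (G - {e})"
      using rooted_comp_Diff_edge[of x S G x y] xy by auto
    then show ?thesis using n xy unfolding R_def by auto
  qed
  define c where "c e = (THE x. R e x)" for e
  have c: "R e (c e)" if "e \<in> ?E" for e
    unfolding c_def using theI'[OF ex1[OF that]] .
  have cu: "c e = x" if "e \<in> ?E" "R e x" for e x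
    using ex1[OF that(1)] c[OF that(1)] that(2) by blast
  \<comment> \<open>Suppose \<open>e\<close> and \<open>e'\<close> both cut off \<open>x\<close>.
    The other end of \<open>e\<close> is reached without \<open>e\<close>; splitting that walk at
    its use of \<open>e'\<close> shows that \<open>x\<close> is reached without \<open>e\<close> or
    without \<open>e'\<close> after all.\<close>
  have inj: "e = e'" if e: "e \<in> ?E" and e': "e' \<in> ?E" and eq: "c e = c e'" for e e'
  proof (rule ccontr)
    assume ne: "e \<noteq> e'"
    define x where "x = c e"
    have x: "x \<in> e" "x \<notin> rooted_comp S (G - {e})" "x \<in> e'" "x \<notin> rooted_comp S (G - {e'})"
      using c[OF e] c[OF e'] eq by (auto simp: R_def x_def)
    have "e \<in> pairs V" "e' \<in> pairs V" using e e' assms(2) by auto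
    then obtain y y' where y: "e = {x, y}" "y \<noteq> x" and y': "e' = {x, y'}" "y' \<noteq> x"
      using pairs_other_end x by metis
    have "x \<in> ?W" using e x by auto
    then have "y \<in> rooted_comp S (G - {e})"
      using rooted_comp_Diff_edge[of x S G x y] y x by auto
    then have "y \<in> rooted_comp S (G - {e} - {e'}) \<or> x \<in> rooted_comp S (G - {e} - {e'}) \<or> y' \<in> rooted_comp S (G - {e} - {e'})"
      using rooted_comp_Diff_edge[of y S "G - {e}" x y'] y' by auto
    then show False
    proof (elim disjE)
      assume "y \<in> rooted_comp S (G - {e} - {e'})"
      moreover have "G - {e} - {e'} \<subseteq> G - {e'}" by auto
      ultimately have "y \<in> rooted_comp S (G - {e'})" using rooted_comp_mono by blast
      moreover have "{y, x} \<in> G - {e'}" using e y ne by (auto simp: insert_commute)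
      ultimately show False using x rooted_comp_step by metis
    next
      assume "x \<in> rooted_comp S (G - {e} - {e'})"
      then show False using x rooted_comp_mono[of "G - {e} - {e'}" "G - {e}" S] by auto
    next
      assume "y' \<in> rooted_comp S (G - {e} - {e'})"
      then have "y' \<in> rooted_comp S (G - {e})"
        using rooted_comp_mono[of "G - {e} - {e'}" "G - {e}" S] by auto
      moreover have "{y', x} \<in> G - {e}" using e' y' ne by (auto simp: insert_commute)
      ultimately show False using x rooted_comp_step by metis
    qed
  qed
  have "bij_betw c ?E (?W - S)"
    unfolding bij_betw_def
  proof
    show "inj_on c ?E" by (intro inj_onI inj)
    show "c ` ?E = ?W - S"
    proof (intro equalityI subsetI)
      fix x assume "x \<in> c ` ?E"
      then obtain e where e: "e \<in> ?E" "x = c e" by auto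
      then have "x \<in> e" "x \<notin> rooted_comp S (G - {e})" using c[OF e(1)] by (auto simp: R_def)
      then show "x \<in> ?W - S" using e rooted_comp_base[of S "G - {e}"] by auto
    next
      fix x assume x: "x \<in> ?W - S"
      then obtain y where y: "{y, x} \<in> G" "y \<in> rooted_comp S (G - {{y, x}})"
        using rooted_comp_first_arrival[of x S G] by auto
      have "{y, x} \<notin> A" using x assms(4) by auto
      moreover have "y \<in> ?W" using y(2) rooted_comp_mono[of "G - {{y, x}}" G S] by auto
      ultimately have e: "{y, x} \<in> ?E" using y x by auto
      have "x \<notin> rooted_comp S (G - {{y, x}})"
        using assms(5) y \<open>{y, x} \<notin> A\<close> unfolding treelike_def by blast
      then have "c {y, x} = x" using cu[OF e] by (simp add: R_def)
      then show "x \<in> c ` ?E" using e by (metis imageI)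
    qed
  qed
  then show ?thesis by (rule bij_betw_same_card)
qed

subsection \<open>Decomposition along the component of the root set\<close>

lemma rooted_comp_Un_outside:
  assumes "rooted_comp S D \<subseteq> W" "S \<subseteq> W" "\<And>e. e \<in> H \<Longrightarrow> e \<inter> W = {}"
  shows "rooted_comp S (D \<union> H) = rooted_comp S D"
proof
  show "rooted_comp S (D \<union> H) \<subseteq> rooted_comp S D"
  proof (rule rooted_comp_closed[OF rooted_comp_base])
    fix x y assume xy: "x \<in> rooted_comp S D" "{x, y} \<in> D \<union> H"
    then have "x \<in> W" using assms(1) by blast
    then have "{x, y} \<notin> H" using assms(3)[of "{x, y}"] by auto
    then show "y \<in> rooted_comp S D" using xy rooted_comp_step[of x S D y] by auto
  qed
qed (rule rooted_comp_mono, simp)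

lemma treelike_Un_outside:
  assumes "rooted_comp S D \<subseteq> W" "S \<subseteq> W" "\<And>e. e \<in> H \<Longrightarrow> e \<inter> W = {}" "H \<inter> D = {}"
  shows "treelike S A (D \<union> H) \<longleftrightarrow> treelike S A D"
proof -
  have inside: "rooted_comp S (D \<union> H - {{x, y}}) = rooted_comp S (D - {{x, y}})" if "{x, y} \<in> D" for x y
  proof -
    have "D \<union> H - {{x, y}} = (D - {{x, y}}) \<union> H" using that assms(4) by auto
    moreover have "rooted_comp S (D - {{x, y}}) \<subseteq> W" using rooted_comp_mono[of "D - {{x, y}}" D S] assms(1) by blast
    ultimately show ?thesis using rooted_comp_Un_outside[of S "D - {{x, y}}" W H] assms by simp
  qed
  have outside: "x \<notin> rooted_comp S (D \<union> H - {{x, y}})" if "{x, y} \<in> H" for x y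
  proof -
    have "x \<notin> W" using assms(3)[OF that] by auto
    moreover have "rooted_comp S (D \<union> H - {{x, y}}) \<subseteq> rooted_comp S D"
      using rooted_comp_mono[of "D \<union> H - {{x, y}}" "D \<union> H" S] rooted_comp_Un_outside[OF assms(1-3)] by blast
    ultimately show ?thesis using assms(1) by auto
  qed
  show ?thesis
  proof
    assume "treelike S A (D \<union> H)"
    then show "treelike S A D" unfolding treelike_def by (metis inside Diff_iff UnCI)
  next
    assume "treelike S A D"
    then show "treelike S A (D \<union> H)" unfolding treelike_def by (metis inside outside Diff_iff UnE)
  qed
qed

text \<open>These are the candidates for the subgraph inside a treelike component of
  \<open>k\<close> vertices. As no edge leaves the component, the rest of the graph can be chosen
  freely on the other vertices.\<close>

definition treelike_shapes :: "'a set \<Rightarrow> 'a set \<Rightarrow> 'a set set \<Rightarrow> nat \<Rightarrow> 'a set set set" where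
  "treelike_shapes V S A k = {D. D \<subseteq> pairs V \<and> A \<subseteq> D \<and> treelike S A D \<and> card (rooted_comp S D) = k
     \<and> (\<forall>e\<in>D. e \<subseteq> rooted_comp S D)}"

lemma finite_treelike_shapes [simp]: "finite V \<Longrightarrow> finite (treelike_shapes V S A k)"
  unfolding treelike_shapes_def by (rule finite_subset[of _ "Pow (pairs V)"]) auto

text \<open>Every vertex outside \<open>S\<close> accounts for exactly one edge, so the number of
  edges depends on \<open>k\<close> alone. This is what makes the count of graphs below a
  product.\<close>

lemma card_treelike_shape:
  assumes "finite V" "S \<subseteq> V" "A \<subseteq> pairs S" "D \<in> treelike_shapes V S A k"
  shows "card D = card A + (k - card S)" "card S \<le> k"
proof -
  have D: "D \<subseteq> pairs V" "A \<subseteq> D" "treelike S A D" "card (rooted_comp S D) = k" "\<forall>e\<in>D. e \<subseteq> rooted_comp S D"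
    using assms(4) by (auto simp: treelike_shapes_def)
  have fin: "finite D" "finite S" "finite (rooted_comp S D)" "finite A"
    using finite_subset[OF D(1)] finite_subset[OF assms(2)] finite_subset[OF D(2)]
      finite_subset[OF rooted_comp_subset[OF assms(2) D(1)]] assms(1) by auto
  have "{e \<in> D - A. e \<subseteq> rooted_comp S D} = D - A" using D(5) by auto
  then have "card (D - A) = card (rooted_comp S D - S)"
    using treelike_card_edges[OF assms(1) D(1) assms(2,3) D(3)] by simp
  also have "\<dots> = k - card S" using fin D rooted_comp_base[of S D] by (simp add: card_Diff_subset)
  finally show "card D = card A + (k - card S)"
    using fin D(2) card_mono[OF fin(1) D(2)] by (simp add: card_Diff_subset)
  show "card S \<le> k" using card_mono[OF fin(3) rooted_comp_base] D(4) by simp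
qed

text \<open>A graph splits uniquely into the edges inside the component of \<open>S\<close> and an
  arbitrary graph on the remaining \<open>card V - k\<close> vertices, whose number of edges is
  determined by \<open>M\<close> and \<open>k\<close>. The edge count \<open>M\<close> enters only
  through the second factor.\<close>

lemma card_treelike_graphs:
  assumes "finite V" "S \<subseteq> V" "A \<subseteq> pairs S"
  shows "card {G \<in> subsets_of_card (pairs V) M. A \<subseteq> G \<and> treelike S A G \<and> card (rooted_comp S G) = k}
    = card (treelike_shapes V S A k) *
      (if card A + (k - card S) \<le> M then ((card V - k) choose 2) choose (M - (card A + (k - card S))) else 0)"
    (is "card ?L = card ?T * (if ?d \<le> M then _ else 0)")
proof -
  \<comment> \<open>Stated as a sum equal to \<open>M\<close>, the condition is correctly empty when
    \<open>?d > M\<close>; with a truncated difference it would admit the empty graph.\<close>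
  let ?R = "SIGMA D:?T. {H. H \<subseteq> pairs (V - rooted_comp S D) \<and> card H + ?d = M}"
  have "bij_betw (\<lambda>G. ({e \<in> G. e \<subseteq> rooted_comp S G}, {e \<in> G. \<not> e \<subseteq> rooted_comp S G})) ?L ?R"
  proof (rule bij_betw_byWitness[where f' = "\<lambda>(D, H). D \<union> H"])
    show "\<forall>G\<in>?L. (\<lambda>(D, H). D \<union> H) ({e \<in> G. e \<subseteq> rooted_comp S G}, {e \<in> G. \<not> e \<subseteq> rooted_comp S G}) = G"
      by auto
    have R: "rooted_comp S (D \<union> H) = rooted_comp S D \<and> treelike S A (D \<union> H) \<and> {e \<in> D \<union> H. e \<subseteq> rooted_comp S D} = D
       \<and> {e \<in> D \<union> H. \<not> e \<subseteq> rooted_comp S D} = H \<and> card (D \<union> H) = M \<and> D \<union> H \<subseteq> pairs V"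
      if DH: "(D, H) \<in> ?R" for D H
    proof -
      let ?W = "rooted_comp S D"
      have D: "D \<in> ?T" and H: "H \<subseteq> pairs (V - ?W)" "card H + ?d = M" using DH by auto
      have D': "D \<subseteq> pairs V" "A \<subseteq> D" "treelike S A D" "card ?W = k" "\<forall>e\<in>D. e \<subseteq> ?W"
        using D by (auto simp: treelike_shapes_def)
      have He: "e \<inter> ?W = {} \<and> e \<noteq> {}" if "e \<in> H" for e using that H by (auto simp: pairs_def)
      have dis: "H \<inter> D = {}" using He D' by fastforce
      have SW: "S \<subseteq> ?W" by (rule rooted_comp_base)
      have fin: "finite D" "finite H" using finite_subset[OF D'(1)] finite_subset[OF H(1)] assms(1) by auto
      have 1: "rooted_comp S (D \<union> H) = ?W" by (rule rooted_comp_Un_outside) (use SW He in auto)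
      have 2: "treelike S A (D \<union> H)" using treelike_Un_outside[of S D ?W H A] SW He dis D' by auto
      have 3: "{e \<in> D \<union> H. e \<subseteq> ?W} = D" "{e \<in> D \<union> H. \<not> e \<subseteq> ?W} = H" using D' He by fastforce+
      have 4: "card (D \<union> H) = M"
        using dis fin card_treelike_shape(1)[OF assms D] H by (subst card_Un_disjoint) auto
      have 5: "D \<union> H \<subseteq> pairs V" using D' H pairs_mono[of "V - ?W" V] by auto
      show ?thesis using 1 2 3 4 5 by simp
    qed
    show "\<forall>p\<in>?R. (\<lambda>G. ({e \<in> G. e \<subseteq> rooted_comp S G}, {e \<in> G. \<not> e \<subseteq> rooted_comp S G})) ((\<lambda>(D, H). D \<union> H) p) = p"
    proof
      fix p assume "p \<in> ?R"
      moreover obtain D H where "p = (D, H)" by (cases p)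
      ultimately show "(\<lambda>G. ({e \<in> G. e \<subseteq> rooted_comp S G}, {e \<in> G. \<not> e \<subseteq> rooted_comp S G})) ((\<lambda>(D, H). D \<union> H) p) = p"
        using R[of D H] by simp
    qed
    show "(\<lambda>(D, H). D \<union> H) ` ?R \<subseteq> ?L"
    proof
      fix G assume "G \<in> (\<lambda>(D, H). D \<union> H) ` ?R"
      then obtain D H where DH: "(D, H) \<in> ?R" "G = D \<union> H" by auto
      then show "G \<in> ?L" using R[OF DH(1)] by (auto simp: subsets_of_card_def treelike_shapes_def)
    qed
    show "(\<lambda>G. ({e \<in> G. e \<subseteq> rooted_comp S G}, {e \<in> G. \<not> e \<subseteq> rooted_comp S G})) ` ?L \<subseteq> ?R"
    proof
      fix p assume "p \<in> (\<lambda>G. ({e \<in> G. e \<subseteq> rooted_comp S G}, {e \<in> G. \<not> e \<subseteq> rooted_comp S G})) ` ?L"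
      then obtain G where G: "G \<in> ?L" and p: "p = ({e \<in> G. e \<subseteq> rooted_comp S G}, {e \<in> G. \<not> e \<subseteq> rooted_comp S G})"
        by auto
      let ?W = "rooted_comp S G" let ?D = "{e \<in> G. e \<subseteq> ?W}" let ?H = "{e \<in> G. \<not> e \<subseteq> ?W}"
      have G': "G \<subseteq> pairs V" "card G = M" "A \<subseteq> G" "treelike S A G" "card ?W = k"
        using G by (auto simp: subsets_of_card_def)
      have SW: "S \<subseteq> ?W" by (rule rooted_comp_base)
      have He: "e \<inter> ?W = {}" if "e \<in> ?H" for e
      proof -
        have "e \<in> pairs V" using that G' by auto
        then obtain x y where xy: "e = {x, y}" "x \<noteq> y" by (rule pairsE)
        have "x \<in> ?W \<longleftrightarrow> y \<in> ?W" using that xy rooted_comp_step[of x S G y] rooted_comp_step[of y S G x]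
          by (auto simp: insert_commute)
        then show ?thesis using that xy by auto
      qed
      have sub: "rooted_comp S ?D \<subseteq> ?W" by (rule rooted_comp_mono) auto
      have un: "?D \<union> ?H = G" by auto
      have "rooted_comp S (?D \<union> ?H) = rooted_comp S ?D" by (rule rooted_comp_Un_outside[OF sub SW He])
      then have rD: "rooted_comp S ?D = ?W" unfolding un by (rule sym)
      have "treelike S A (?D \<union> ?H) \<longleftrightarrow> treelike S A ?D" by (rule treelike_Un_outside[OF sub SW He]) auto
      then have tD: "treelike S A ?D" unfolding un using G' by simp
      have "e \<subseteq> S" if "e \<in> A" for e using that assms(3) by (auto simp: pairs_def)
      then have AD: "A \<subseteq> ?D" using G' SW by blast
      have D: "?D \<in> ?T" using rD tD AD G' by (auto simp: treelike_shapes_def)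
      have fin: "finite G" using finite_subset[OF G'(1)] assms(1) by auto
      have "?D \<inter> ?H = {}" by blast
      then have "card ?D + card ?H = card (?D \<union> ?H)"
        using fin by (intro card_Un_disjoint[symmetric]) auto
      then have "card ?D + card ?H = M" unfolding un using G' by simp
      then have "card ?H + ?d = M" using card_treelike_shape(1)[OF assms D] by simp
      moreover have "?H \<subseteq> pairs (V - ?W)" using He G' by (fastforce simp: pairs_def)
      ultimately show "p \<in> ?R" using D rD p by auto
    qed
  qed
  then have "card ?L = card ?R" by (rule bij_betw_same_card)
  also have "\<dots> = (\<Sum>D\<in>?T. card {H. H \<subseteq> pairs (V - rooted_comp S D) \<and> card H + ?d = M})"
    using assms(1) by (intro card_SigmaI) auto
  also have "\<dots> = (\<Sum>D\<in>?T. (if ?d \<le> M then ((card V - k) choose 2) choose (M - ?d) else 0))"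
  proof (rule sum.cong[OF refl])
    fix D assume D: "D \<in> ?T"
    then have "rooted_comp S D \<subseteq> V" "card (rooted_comp S D) = k"
      using rooted_comp_subset[OF assms(2)] by (auto simp: treelike_shapes_def)
    then have c: "card (pairs (V - rooted_comp S D)) = (card V - k) choose 2"
      using assms(1) finite_subset[of "rooted_comp S D" V] by (subst card_pairs) (auto simp: card_Diff_subset)
    show "card {H. H \<subseteq> pairs (V - rooted_comp S D) \<and> card H + ?d = M} = (if ?d \<le> M then ((card V - k) choose 2) choose (M - ?d) else 0)"
    proof (cases "?d \<le> M")
      case True
      then have "{H. H \<subseteq> pairs (V - rooted_comp S D) \<and> card H + ?d = M} = {H. H \<subseteq> pairs (V - rooted_comp S D) \<and> card H = M - ?d}"
        by auto
      then show ?thesis using n_subsets[of "pairs (V - rooted_comp S D)" "M - ?d"] assms(1) c True by simp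
    next
      case False
      then have "{H. H \<subseteq> pairs (V - rooted_comp S D) \<and> card H + ?d = M} = {}" by auto
      then show ?thesis using False by (metis card.empty)
    qed
  qed
  finally show ?thesis by simp
qed

subsection \<open>Paths from the root set and obstructions to being treelike\<close>

fun path_edges :: "'a list \<Rightarrow> 'a set set" where
  "path_edges (x # y # xs) = insert {x, y} (path_edges (y # xs))"
| "path_edges _ = {}"

lemma path_edges_append: "path_edges (xs @ z # ys) = path_edges (xs @ [z]) \<union> path_edges (z # ys)"
  by (induction xs rule: path_edges.induct) auto

lemma path_edges_snoc: "xs \<noteq> [] \<Longrightarrow> path_edges (xs @ [z]) = insert {last xs, z} (path_edges xs)"
  by (induction xs rule: path_edges.induct) auto

lemma path_edges_rev: "path_edges (rev xs) = path_edges xs"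
proof (induction xs rule: path_edges.induct)
  case (1 x y xs)
  have "path_edges (rev (x # y # xs)) = insert {last (rev (y # xs)), x} (path_edges (rev (y # xs)))"
    unfolding rev.simps(2)[of x] by (rule path_edges_snoc) simp
  also have "\<dots> = insert {y, x} (path_edges (y # xs))" unfolding 1 by simp
  finally show ?case by (simp add: insert_commute)
qed auto

lemma path_edges_subset: "e \<in> path_edges xs \<Longrightarrow> e \<subseteq> set xs"
  by (induction xs rule: path_edges.induct) auto

lemma finite_path_edges [simp]: "finite (path_edges xs)"
  by (induction xs rule: path_edges.induct) auto

lemma card_path_edges: "distinct xs \<Longrightarrow> card (path_edges xs) = length xs - 1"
proof (induction xs rule: path_edges.induct)
  case (1 x y xs)
  have "{x, y} \<notin> path_edges (y # xs)" using 1(2) path_edges_subset[of "{x, y}" "y # xs"] by auto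
  then show ?case using 1 by simp
qed auto

lemma path_edges_tl: "e \<in> path_edges xs \<Longrightarrow> e \<inter> set (tl xs) \<noteq> {}"
  by (induction xs rule: path_edges.induct) auto

definition rooted_path :: "'a set \<Rightarrow> 'a set set \<Rightarrow> 'a \<Rightarrow> 'a list \<Rightarrow> bool" where
  "rooted_path S G x ms \<longleftrightarrow> x \<in> S \<and> distinct ms \<and> set ms \<inter> S = {} \<and> path_edges (x # ms) \<subseteq> G"

text \<open>When a path is continued to \<open>z\<close>, it restarts at \<open>z\<close> if
  \<open>z\<close> is a root, is cut back to \<open>z\<close> if \<open>z\<close> already lies on
  it, and is prolonged otherwise.\<close>

lemma rooted_comp_path:
  assumes "y \<in> rooted_comp S G"
  shows "\<exists>x ms. rooted_path S G x ms \<and> last (x # ms) = y"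
  using assms
proof (induction rule: rooted_comp_induct)
  case (base s)
  then have "rooted_path S G s []" by (simp add: rooted_path_def)
  then show ?case by (intro exI[of _ s] exI[of _ "[]"]) simp
next
  case (step y z)
  then obtain x ms where P: "rooted_path S G x ms" "last (x # ms) = y" by auto
  consider "z \<in> S" | "z \<in> set ms" "z \<notin> S" | "z \<notin> set ms" "z \<notin> S" by blast
  then show ?case
  proof cases
    case 1
    then have "rooted_path S G z []" by (simp add: rooted_path_def)
    then show ?thesis by (intro exI[of _ z] exI[of _ "[]"]) simp
  next
    case 2
    then obtain as bs where ms: "ms = as @ z # bs" by (meson split_list)
    have "path_edges (x # ms) = path_edges ((x # as) @ [z]) \<union> path_edges (z # bs)"
      using path_edges_append[of "x # as" z bs] ms by simp
    then have "rooted_path S G x (as @ [z])" using P ms by (simp add: rooted_path_def) blast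
    then show ?thesis by (intro exI[of _ x] exI[of _ "as @ [z]"]) simp
  next
    case 3
    have "path_edges ((x # ms) @ [z]) = insert {y, z} (path_edges (x # ms))"
      using path_edges_snoc[of "x # ms" z] P by simp
    then have "rooted_path S G x (ms @ [z])" using P(1) \<open>{y, z} \<in> G\<close> 3 by (simp add: rooted_path_def)
    then show ?thesis by (intro exI[of _ x] exI[of _ "ms @ [z]"]) simp
  qed
qed

text \<open>
  If \<open>G\<close> is not treelike, it contains a walk that leaves the root set through new vertices and
  finally returns to the root set or to itself. Its number of edges exceeds the number of new
  vertices by one, which gains a factor \<open>1 / card V\<close> in first moment estimates.
\<close>

definition lasso :: "'a set \<Rightarrow> 'a set set \<Rightarrow> 'a \<Rightarrow> 'a list \<Rightarrow> 'a \<Rightarrow> bool" where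
  "lasso S H x ms z \<longleftrightarrow> x \<in> S \<and> distinct ms \<and> set ms \<inter> S = {} \<and> z \<in> S \<union> set ms
     \<and> path_edges (x # ms @ [z]) \<subseteq> H \<and> card (path_edges (x # ms @ [z])) = length ms + 1"

text \<open>Take an edge \<open>{u, v}\<close> whose ends are both reached without it. Walk from
  \<open>S\<close> to \<open>u\<close>, cross the edge, and follow the path of \<open>v\<close>
  backwards towards its root until the first vertex that is a root or lies on the first path; the
  walk stops there.\<close>

lemma not_treelike_lasso:
  assumes "A \<subseteq> pairs S" "\<not> treelike S A G"
  shows "\<exists>x ms z. lasso S (G - A) x ms z"
proof -
  obtain u v where uv: "{u, v} \<in> G - A" "u \<in> rooted_comp S (G - {{u, v}})" "v \<in> rooted_comp S (G - {{u, v}})"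
    using assms(2) by (auto simp: treelike_def)
  let ?H = "G - {{u, v}}"
  obtain x ms where P: "rooted_path S ?H x ms" "last (x # ms) = u" using rooted_comp_path[OF uv(2)] by auto
  obtain y ns where Q: "rooted_path S ?H y ns" "last (y # ns) = v" using rooted_comp_path[OF uv(3)] by auto
  have dms: "distinct (x # ms)" and dns: "distinct (y # ns)" using P(1) Q(1) by (auto simp: rooted_path_def)
  have "\<exists>z\<in>set (rev (y # ns)). z \<in> S \<union> set ms" using Q by (auto simp: rooted_path_def)
  then obtain as z bs where sp: "rev (y # ns) = as @ z # bs" "z \<in> S \<union> set ms" "\<forall>a\<in>set as. \<not> a \<in> S \<union> set ms"
    using split_list_first_prop[of "rev (y # ns)" "\<lambda>z. z \<in> S \<union> set ms"] by blast
  have hd: "as @ z # bs = v # butlast (as @ z # bs) \<or> hd (as @ z # bs) = v"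
    using sp(1) Q(2) by (metis hd_rev)
  then have hdv: "hd (as @ [z]) = v" using sp(1) Q(2) by (metis hd_append hd_rev list.sel(1) not_Cons_self2)
  have das: "distinct (as @ z # bs)" using dns sp(1) by (metis distinct_rev)
  have eas: "path_edges (as @ [z]) \<subseteq> ?H"
  proof -
    have "path_edges (as @ z # bs) = path_edges (y # ns)" using sp(1) path_edges_rev by metis
    then show ?thesis using path_edges_append[of as z bs] Q by (auto simp: rooted_path_def)
  qed
  define L where "L = x # ms @ as @ [z]"
  have L: "path_edges L = path_edges (x # ms) \<union> insert {u, v} (path_edges (as @ [z]))"
  proof -
    obtain c cs where c: "as @ [z] = c # cs" by (cases "as @ [z]") auto
    then have cv: "c = v" using hdv by simp
    have "L = (x # ms) @ c # cs" unfolding L_def using c by simp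
    then have "path_edges L = path_edges ((x # ms) @ [c]) \<union> path_edges (c # cs)"
      using path_edges_append by metis
    then show ?thesis using path_edges_snoc[of "x # ms" c] P(2) c cv by simp
  qed
  have sub: "path_edges L \<subseteq> G" using L P(1) eas uv(1) by (auto simp: rooted_path_def)
  \<comment> \<open>Core edges lie within \<open>S\<close>, whereas each edge of the walk meets a
    new vertex, unless the walk consists of \<open>{u, v}\<close> alone.\<close>
  have notA: "path_edges L \<inter> A = {}"
  proof (cases "ms @ as = []")
    case True
    then have "path_edges L = {{u, v}}" using L by simp
    then show ?thesis using uv(1) by simp
  next
    case False
    have *: "e \<inter> set (ms @ as) \<noteq> {}" if "e \<in> path_edges L" for e
    proof -
      have "L = (x # ms @ as) @ [z]" by (simp add: L_def)
      then have "path_edges L = insert {last (x # ms @ as), z} (path_edges (x # ms @ as))"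
        using path_edges_snoc[of "x # ms @ as" z] by simp
      moreover have "last (x # ms @ as) \<in> set (ms @ as)" using False by (metis last_ConsR last_in_set)
      ultimately show ?thesis using that path_edges_tl[of e "x # ms @ as"] by auto
    qed
    have "set (ms @ as) \<inter> S = {}" using P(1) sp(3) by (auto simp: rooted_path_def)
    then show ?thesis using * assms(1) by (fastforce simp: pairs_def)
  qed
  have dis: "distinct (x # ms @ as)"
    using dms das sp(3) P(1) by (auto simp: rooted_path_def)
  \<comment> \<open>The last edge must differ from all previous ones, for otherwise the surplus of
    one edge over the new vertices is lost. It could only repeat the edge just used; this is
    excluded because both paths avoid \<open>{u, v}\<close> and the second one has no repeated
    vertex.\<close>
  have "{last (x # ms @ as), z} \<notin> path_edges (x # ms @ as)"
  proof (cases as rule: rev_cases)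
    case Nil
    then have "z = v" using hdv by simp
    then show ?thesis using Nil P by (auto simp: rooted_path_def)
  next
    case (snoc as' w)
    have wz: "{w, z} \<in> ?H"
    proof -
      have "path_edges (as @ [z]) = insert {w, z} (path_edges as)" using snoc path_edges_snoc[of as z] by simp
      then show ?thesis using eas by auto
    qed
    have eq: "path_edges (x # ms @ as) = insert {last (x # ms @ as'), w} (path_edges (x # ms @ as'))"
      using path_edges_snoc[of "x # ms @ as'" w] snoc by simp
    have "{w, z} \<notin> path_edges (x # ms @ as')"
      using path_edges_subset[of "{w, z}" "x # ms @ as'"] dis snoc by auto
    moreover have "{w, z} \<noteq> {last (x # ms @ as'), w}"
    proof
      assume "{w, z} = {last (x # ms @ as'), w}"
      then have zl: "z = last (x # ms @ as')" by (auto simp: doubleton_eq_iff)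
      show False
      proof (cases "as' = []")
        case True
        then have "w = v" using hdv snoc by simp
        moreover have "z = u" using zl True P(2) by simp
        ultimately show False using wz by (simp add: insert_commute)
      next
        case False
        then have "z \<in> set as" using zl snoc by simp
        then show False using das by simp
      qed
    qed
    ultimately show ?thesis using eq snoc by simp
  qed
  then have "card (path_edges L) = length (ms @ as) + 1"
    using path_edges_snoc[of "x # ms @ as" z] card_path_edges[OF dis] by (simp add: L_def)
  then have "lasso S (G - A) x (ms @ as) z"
    using P(1) sp(2,3) sub notA dis unfolding lasso_def rooted_path_def L_def
    by (simp add: Diff_eq subset_iff disjoint_iff) blast
  then show ?thesis by blast
qed

section \<open>First moment bounds for lassos and for component sizes\<close>

lemma card_lists_of_length:
  assumes "finite V" shows "card {ms. set ms \<subseteq> V \<and> length ms = j} = card V ^ j"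
    "finite {ms. set ms \<subseteq> V \<and> length ms = j}"
  using card_lists_length_eq[OF assms] finite_lists_length_eq[OF assms] by auto

text \<open>The union bound.\<close>

lemma avg_ind_le_sum:
  fixes U :: "'b set"
  assumes "finite I" "\<And>H. H \<subseteq> U \<Longrightarrow> card H = m \<Longrightarrow> Q H \<Longrightarrow> \<exists>i\<in>I. R i H"
  shows "avg U m (\<lambda>H. if Q H then 1 else 0 :: real) \<le> (\<Sum>i\<in>I. avg U m (\<lambda>H. if R i H then 1 else 0))"
proof -
  have "avg U m (\<lambda>H. if Q H then 1 else 0 :: real) \<le> avg U m (\<lambda>H. \<Sum>i\<in>I. if R i H then 1 else 0)"
  proof (rule avg_mono)
    fix H assume H: "H \<subseteq> U" "card H = m"
    show "(if Q H then 1 else 0 :: real) \<le> (\<Sum>i\<in>I. if R i H then 1 else 0)"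
    proof (cases "Q H")
      case True
      then obtain i where i: "i \<in> I" "R i H" using assms(2) H by blast
      then have "(1::real) \<le> (if R i H then 1 else 0)" by simp
      also have "\<dots> \<le> (\<Sum>i\<in>I. if R i H then 1 else 0)" by (rule member_le_sum) (use i assms(1) in auto)
      finally show ?thesis using True by simp
    qed (auto intro: sum_nonneg)
  qed
  then show ?thesis by (simp add: avg_sum)
qed

lemma geometric_sum_le:
  fixes q :: real assumes "0 \<le> q" "q < 1" shows "(\<Sum>j\<le>k. q ^ j) \<le> 1 / (1 - q)"
proof -
  have s: "(\<lambda>j. q ^ j) sums (1 / (1 - q))" using geometric_sums[of q] assms by simp
  show ?thesis
    unfolding sums_unique[OF s] using assms by (intro sum_le_suminf sums_summable[OF s]) auto
qed

lemma arith_geometric_sum_le: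
  fixes q :: real assumes "0 \<le> q" "q < 1" shows "(\<Sum>j\<le>k. real (Suc j) * q ^ j) \<le> 1 / (1 - q)\<^sup>2"
proof -
  have s: "(\<lambda>j. real (Suc j) * q ^ j) sums (1 / (1 - q)\<^sup>2)"
    using geometric_deriv_sums[of q] assms by simp
  show ?thesis
    unfolding sums_unique[OF s] using assms by (intro sum_le_suminf sums_summable[OF s]) auto
qed

text \<open>The core \<open>A\<close> is a set of edges known to be present, and the other
  \<open>M - card A\<close> edges are uniform among the remaining pairs. The instances that matter
  are a cycle \<open>A\<close> with its vertex set \<open>S\<close>, and a single root with an empty
  core.\<close>

locale rooted_graphs =
  fixes V :: "'a set" and S :: "'a set" and A :: "'a set set" and M :: nat
  assumes fin: "finite V" and SV: "S \<subseteq> V" and AS: "A \<subseteq> pairs S"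
    and AM: "card A \<le> M" and MN: "M \<le> card (pairs V)" and V_ne: "card V \<ge> 2"
begin

abbreviation "n \<equiv> card V"
abbreviation "l \<equiv> card S"

text \<open>Equal to 2M/(n - 1): the factor by which the expected number of paths grows with each
  further vertex.\<close>

definition rho :: real where "rho = real n * (real M / real (card (pairs V)))"

lemma A_pairs: "A \<subseteq> pairs V"
  using AS pairs_mono[OF SV] by auto

lemma finA: "finite A" and finS: "finite S"
  using A_pairs SV fin finite_subset finite_pairs by metis+

lemma rho_nonneg: "0 \<le> rho"
  by (simp add: rho_def)

lemma card_rest: "card (pairs V - A) = card (pairs V) - card A"
  using A_pairs finA by (simp add: card_Diff_subset)

lemma rest_le: "M - card A \<le> card (pairs V - A)"
  using MN by (simp add: card_rest)

lemma avg_superset_le: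
  assumes "card F = j"
  shows "avg (pairs V - A) (M - card A) (\<lambda>H. if F \<subseteq> H then 1 else 0 :: real) \<le> (rho / real n) ^ j"
proof (cases "F \<subseteq> pairs V - A")
  case True
  have "avg (pairs V - A) (M - card A) (\<lambda>H. if F \<subseteq> H then 1 else 0 :: real)
      = incl_prob (card (pairs V) - card A) (M - card A) j"
    using avg_superset_indicator[OF _ True rest_le] fin assms by (simp add: card_rest)
  also have "\<dots> \<le> (real (M - card A) / real (card (pairs V) - card A)) ^ j"
    using MN by (intro incl_prob_le) simp
  also have "\<dots> \<le> (real M / real (card (pairs V))) ^ j"
    using density_diff_le[OF AM MN] by (intro power_mono) auto
  finally show ?thesis using V_ne by (simp add: rho_def)
next
  case False
  then have "avg (pairs V - A) (M - card A) (\<lambda>H. if F \<subseteq> H then 1 else 0 :: real) = avg (pairs V - A) (M - card A) (\<lambda>H. 0)"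
    by (intro avg_cong) auto
  also have "\<dots> = 0" by (simp add: avg_def)
  finally show ?thesis using rho_nonneg by simp
qed

text \<open>Union bound over lassos with \<open>j\<close> new vertices: \<open>l\<close> starting
  points, at most \<open>n ^ j\<close> vertex sequences, at most \<open>l + j\<close> end points,
  and \<open>j + 1\<close> edges that each contribute a factor \<open>rho / n\<close>. The surplus
  edge leaves the factor 1/n.\<close>

lemma prob_not_treelike_le_sum:
  "avg (pairs V - A) (M - card A) (\<lambda>H. if treelike S A (H \<union> A) then 0 else 1 :: real)
   \<le> (\<Sum>j\<le>n. real l / real n * real (l + j) * rho ^ (j + 1))"
proof -
  let ?U = "pairs V - A" and ?m = "M - card A"
  let ?I = "SIGMA j:{..n}. S \<times> (SIGMA ms:{ms. set ms \<subseteq> V \<and> length ms = j}. S \<union> set ms)"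
  let ?F = "\<lambda>(j, x, ms, z). path_edges (x # ms @ [z])"
  \<comment> \<open>The index set contains lists with repetitions, which makes it easy to count.
    Demanding exactly \<open>j + 1\<close> edges makes the event of a degenerate list impossible
    instead of too likely.\<close>
  let ?R = "\<lambda>(j, x, ms, z) H. ?F (j, x, ms, z) \<subseteq> H \<and> card (?F (j, x, ms, z)) = j + 1"
  have finI: "finite ?I" using finS card_lists_of_length(2)[OF fin] by auto
  have "avg ?U ?m (\<lambda>H. if \<not> treelike S A (H \<union> A) then 1 else 0 :: real)
      \<le> (\<Sum>i\<in>?I. avg ?U ?m (\<lambda>H. if ?R i H then 1 else 0))"
  proof (rule avg_ind_le_sum[OF finI])
    fix H assume H: "H \<subseteq> ?U" "card H = ?m" "\<not> treelike S A (H \<union> A)"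
    then obtain x ms z where l: "lasso S (H \<union> A - A) x ms z" using not_treelike_lasso[OF AS] by blast
    have HA: "H \<union> A - A = H" using H(1) by auto
    have ms: "set ms \<subseteq> V"
    proof
      fix v assume "v \<in> set ms"
      then obtain as bs where sp: "ms = as @ v # bs" by (meson split_list)
      have "path_edges (x # ms @ [z]) = path_edges ((x # as) @ [v]) \<union> path_edges (v # bs @ [z])"
        using path_edges_append[of "x # as" v "bs @ [z]"] sp by simp
      then have "{last (x # as), v} \<in> H" using l path_edges_snoc[of "x # as" v] HA by (auto simp: lasso_def)
      then show "v \<in> V" using H(1) by auto
    qed
    have "length ms = card (set ms)" using l by (simp add: lasso_def distinct_card)
    also have "\<dots> \<le> n" using ms fin by (rule card_mono[rotated])
    finally have "(length ms, x, ms, z) \<in> ?I" using ms l by (auto simp: lasso_def)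
    moreover have "?R (length ms, x, ms, z) H" using l HA by (simp add: lasso_def)
    ultimately show "\<exists>i\<in>?I. ?R i H" by (rule bexI[rotated])
  qed
  also have "\<dots> \<le> (\<Sum>i\<in>?I. (rho / real n) ^ (fst i + 1))"
  proof (rule sum_mono)
    fix i assume "i \<in> ?I"
    obtain j x ms z where i: "i = (j, x, ms, z)" by (cases i)
    show "avg ?U ?m (\<lambda>H. if ?R i H then 1 else 0) \<le> (rho / real n) ^ (fst i + 1)"
    proof (cases "card (?F i) = j + 1")
      case True
      then show ?thesis using avg_superset_le[OF True] i by simp
    next
      case False
      then show ?thesis using rho_nonneg i by (simp add: avg_def)
    qed
  qed
  also have "\<dots> = (\<Sum>j\<le>n. \<Sum>q\<in>S \<times> (SIGMA ms:{ms. set ms \<subseteq> V \<and> length ms = j}. S \<union> set ms). (rho / real n) ^ (j + 1))"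
    by (subst sum.Sigma) (use finS card_lists_of_length(2)[OF fin] in \<open>auto simp: case_prod_unfold\<close>)
  also have "\<dots> \<le> (\<Sum>j\<le>n. real l / real n * real (l + j) * rho ^ (j + 1))"
  proof (rule sum_mono)
    fix j assume "j \<in> {..n}"
    let ?J = "{ms. set ms \<subseteq> V \<and> length ms = j}"
    have "card (SIGMA ms:?J. S \<union> set ms) = (\<Sum>ms\<in>?J. card (S \<union> set ms))"
      using card_lists_of_length(2)[OF fin, of j] finS by (intro card_SigmaI) auto
    also have "\<dots> \<le> (\<Sum>ms\<in>?J. l + j)"
    proof (rule sum_mono)
      fix ms assume "ms \<in> ?J"
      then show "card (S \<union> set ms) \<le> l + j"
        using card_Un_le[of S "set ms"] card_length[of ms] by auto
    qed
    also have "\<dots> = n ^ j * (l + j)" using card_lists_of_length(1)[OF fin, of j] by simp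
    finally have "card (SIGMA ms:?J. S \<union> set ms) \<le> n ^ j * (l + j)" .
    then have "real (card (SIGMA ms:?J. S \<union> set ms)) \<le> real (n ^ j * (l + j))"
      by (rule of_nat_mono)
    then have "real (card (SIGMA ms:?J. S \<union> set ms)) \<le> real n ^ j * real (l + j)"
      by (simp only: of_nat_mult of_nat_power)
    then have "real l * real (card (SIGMA ms:?J. S \<union> set ms)) * (rho / real n) ^ (j + 1)
       \<le> real l * (real n ^ j * real (l + j)) * (rho / real n) ^ (j + 1)"
      using rho_nonneg by (intro mult_right_mono mult_left_mono) auto
    also have "\<dots> = real l / real n * real (l + j) * rho ^ (j + 1)"
    proof -
      have 1: "real n ^ j * (rho / real n) ^ (j + 1) = rho ^ (j + 1) / real n"
        using V_ne by (simp add: power_divide)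
      have 2: "real l * (real n ^ j * real (l + j)) * (rho / real n) ^ (j + 1)
         = real l * real (l + j) * (real n ^ j * (rho / real n) ^ (j + 1))" by (simp only: mult_ac)
      show ?thesis unfolding 2 unfolding 1 by simp
    qed
    finally show "(\<Sum>q\<in>S \<times> (SIGMA ms:?J. S \<union> set ms). (rho / real n) ^ (j + 1)) \<le> real l / real n * real (l + j) * rho ^ (j + 1)"
      by (simp add: card_cartesian_product)
  qed
  finally have *: "avg ?U ?m (\<lambda>H. if \<not> treelike S A (H \<union> A) then 1 else 0 :: real)
    \<le> (\<Sum>j\<le>n. real l / real n * real (l + j) * rho ^ (j + 1))" .
  have "(\<lambda>H. if treelike S A (H \<union> A) then 0 else 1 :: real) = (\<lambda>H. if \<not> treelike S A (H \<union> A) then 1 else 0)"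
    by auto
  then show ?thesis by (simp only: *)
qed

text \<open>Each vertex of the component is the end of a path with as many edges as new vertices. In
  contrast to the count of lassos, the powers of \<open>n\<close> cancel completely.\<close>

lemma expected_comp_le_sum:
  "avg (pairs V - A) (M - card A) (\<lambda>H. real (card (rooted_comp S (H \<union> A)))) \<le> (\<Sum>j\<le>n. real l * rho ^ j)"
proof -
  let ?U = "pairs V - A" and ?m = "M - card A"
  let ?I = "SIGMA j:{..n}. S \<times> {ms. set ms \<subseteq> V \<and> length ms = j}"
  let ?R = "\<lambda>(j, x, ms) H. path_edges (x # ms) \<subseteq> H \<and> card (path_edges (x # ms)) = j"
  have finI: "finite ?I" using finS card_lists_of_length(2)[OF fin] by auto
  have "avg ?U ?m (\<lambda>H. real (card (rooted_comp S (H \<union> A)))) \<le> avg ?U ?m (\<lambda>H. \<Sum>i\<in>?I. if ?R i H then 1 else 0)"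
  proof (rule avg_mono)
    fix H assume H: "H \<subseteq> ?U" "card H = ?m"
    have "rooted_comp S (H \<union> A) \<subseteq> (\<lambda>(j, x, ms). last (x # ms)) ` {i \<in> ?I. ?R i H}"
    proof
      fix y assume "y \<in> rooted_comp S (H \<union> A)"
      then obtain x ms where P: "rooted_path S (H \<union> A) x ms" "last (x # ms) = y"
        using rooted_comp_path by metis
      have "path_edges (x # ms) \<inter> A = {}"
        using path_edges_tl[of _ "x # ms"] P(1) AS by (fastforce simp: rooted_path_def pairs_def)
      then have sub: "path_edges (x # ms) \<subseteq> H" using P by (auto simp: rooted_path_def)
      have "distinct (x # ms)" using P by (auto simp: rooted_path_def)
      then have c: "card (path_edges (x # ms)) = length ms" using card_path_edges by fastforce
      have ms: "set ms \<subseteq> V"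
      proof
        fix v assume "v \<in> set ms"
        then obtain as bs where sp: "ms = as @ v # bs" by (meson split_list)
        have "path_edges (x # ms) = path_edges ((x # as) @ [v]) \<union> path_edges (v # bs)"
          using path_edges_append[of "x # as" v "bs"] sp by simp
        then have "{last (x # as), v} \<in> H" using sub path_edges_snoc[of "x # as" v] by auto
        then show "v \<in> V" using H(1) by auto
      qed
      have "length ms = card (set ms)" using P by (simp add: rooted_path_def distinct_card)
      also have "\<dots> \<le> n" using ms fin by (rule card_mono[rotated])
      finally have "(length ms, x, ms) \<in> {i \<in> ?I. ?R i H}" using ms P(1) sub c by (auto simp: rooted_path_def)
      then show "y \<in> (\<lambda>(j, x, ms). last (x # ms)) ` {i \<in> ?I. ?R i H}" using P(2) by (intro image_eqI[of _ _ "(length ms, x, ms)"]) auto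
    qed
    then have "card (rooted_comp S (H \<union> A)) \<le> card {i \<in> ?I. ?R i H}"
      using finI by (intro surj_card_le) auto
    also have "real (card {i \<in> ?I. ?R i H}) = (\<Sum>i\<in>?I. if ?R i H then 1 else 0)"
      using finI by (simp add: sum.inter_filter[symmetric])
    finally show "real (card (rooted_comp S (H \<union> A))) \<le> (\<Sum>i\<in>?I. if ?R i H then 1 else 0)" by simp
  qed
  also have "\<dots> = (\<Sum>i\<in>?I. avg ?U ?m (\<lambda>H. if ?R i H then 1 else 0))" by (rule avg_sum)
  also have "\<dots> \<le> (\<Sum>i\<in>?I. (rho / real n) ^ fst i)"
  proof (rule sum_mono)
    fix i assume "i \<in> ?I"
    obtain j x ms where i: "i = (j, x, ms)" by (cases i)
    show "avg ?U ?m (\<lambda>H. if ?R i H then 1 else 0) \<le> (rho / real n) ^ fst i"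
    proof (cases "card (path_edges (x # ms)) = j")
      case True
      then show ?thesis using avg_superset_le[OF True] i by simp
    next
      case False
      then show ?thesis using rho_nonneg i by (simp add: avg_def)
    qed
  qed
  also have "\<dots> = (\<Sum>j\<le>n. \<Sum>q\<in>S \<times> {ms. set ms \<subseteq> V \<and> length ms = j}. (rho / real n) ^ j)"
    by (subst sum.Sigma) (use finS card_lists_of_length(2)[OF fin] in \<open>auto simp: case_prod_unfold\<close>)
  also have "\<dots> = (\<Sum>j\<le>n. real l * rho ^ j)"
    using V_ne by (intro sum.cong) (auto simp: card_cartesian_product card_lists_of_length(1)[OF fin] power_divide)
  finally show ?thesis .
qed

lemma prob_not_treelike_le:
  assumes "rho < 1"
  shows "avg (pairs V - A) (M - card A) (\<lambda>H. if treelike S A (H \<union> A) then 0 else 1 :: real)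
    \<le> real l / real n * (real l / (1 - rho) + 1 / (1 - rho)\<^sup>2)"
proof -
  have "(\<Sum>j\<le>n. real l / real n * real (l + j) * rho ^ (j + 1))
     \<le> (\<Sum>j\<le>n. real l / real n * (real l * rho ^ j + real (Suc j) * rho ^ j))"
  proof (rule sum_mono)
    fix j
    have "real (l + j) * rho ^ (j + 1) \<le> real (l + j) * rho ^ j"
      using rho_nonneg assms by (intro mult_left_mono power_decreasing) auto
    also have "\<dots> \<le> real l * rho ^ j + real (Suc j) * rho ^ j"
      using rho_nonneg by (simp add: algebra_simps)
    finally show "real l / real n * real (l + j) * rho ^ (j + 1) \<le> real l / real n * (real l * rho ^ j + real (Suc j) * rho ^ j)"
      unfolding mult.assoc by (intro mult_left_mono) auto
  qed
  also have "\<dots> = real l / real n * (real l * (\<Sum>j\<le>n. rho ^ j) + (\<Sum>j\<le>n. real (Suc j) * rho ^ j))"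
    by (simp add: sum_distrib_left sum.distrib distrib_left)
  also have "\<dots> \<le> real l / real n * (real l * (1 / (1 - rho)) + 1 / (1 - rho)\<^sup>2)"
    using geometric_sum_le[OF rho_nonneg assms, of n] arith_geometric_sum_le[OF rho_nonneg assms, of n]
    by (intro mult_left_mono add_mono) auto
  finally show ?thesis using prob_not_treelike_le_sum by simp
qed

lemma expected_comp_le:
  assumes "rho < 1"
  shows "avg (pairs V - A) (M - card A) (\<lambda>H. real (card (rooted_comp S (H \<union> A)))) \<le> real l / (1 - rho)"
proof -
  have "(\<Sum>j\<le>n. real l * rho ^ j) = real l * (\<Sum>j\<le>n. rho ^ j)" by (simp add: sum_distrib_left)
  also have "\<dots> \<le> real l * (1 / (1 - rho))"
    using geometric_sum_le[OF rho_nonneg assms, of n] by (intro mult_left_mono) auto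
  finally show ?thesis using expected_comp_le_sum by simp
qed

end

subsection \<open>Cycles\<close>

lemma path_edges_nth: "path_edges vs = {{vs ! i, vs ! Suc i} | i. Suc i < length vs}"
proof (induction vs rule: path_edges.induct)
  case (1 x y xs)
  show ?case
  proof (intro equalityI subsetI)
    fix e assume "e \<in> path_edges (x # y # xs)"
    then consider "e = {x, y}" | i where "Suc i < length (y # xs)" "e = {(y # xs) ! i, (y # xs) ! Suc i}"
      using 1 by auto
    then show "e \<in> {{(x # y # xs) ! i, (x # y # xs) ! Suc i} | i. Suc i < length (x # y # xs)}"
    proof cases
      case 1 then show ?thesis by (intro CollectI exI[of _ 0]) simp
    next
      case 2 then show ?thesis by (intro CollectI exI[of _ "Suc i"]) simp
    qed
  next
    fix e assume "e \<in> {{(x # y # xs) ! i, (x # y # xs) ! Suc i} | i. Suc i < length (x # y # xs)}"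
    then obtain i where i: "e = {(x # y # xs) ! i, (x # y # xs) ! Suc i}" "Suc i < length (x # y # xs)" by blast
    show "e \<in> path_edges (x # y # xs)"
    proof (cases i)
      case 0 then show ?thesis using i by simp
    next
      case (Suc j)
      then have "e \<in> path_edges (y # xs)" unfolding 1 using i by auto
      then show ?thesis by simp
    qed
  qed
qed auto

lemma cycle_edges_path_edges:
  assumes "vs \<noteq> []" shows "cycle_edges vs = insert {last vs, hd vs} (path_edges vs)"
proof (intro equalityI subsetI)
  fix e assume "e \<in> cycle_edges vs"
  then obtain i where i: "e = {vs ! i, vs ! (Suc i mod length vs)}" "i < length vs" by (auto simp: cycle_edges_def)
  show "e \<in> insert {last vs, hd vs} (path_edges vs)"
  proof (cases "Suc i = length vs")
    case True
    then have "i = length vs - 1" by simp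
    then show ?thesis using i True assms by (simp add: last_conv_nth hd_conv_nth)
  next
    case False
    then have "Suc i < length vs" using i by simp
    then show ?thesis using i by (auto simp: path_edges_nth)
  qed
next
  fix e assume "e \<in> insert {last vs, hd vs} (path_edges vs)"
  then consider "e = {last vs, hd vs}" | i where "e = {vs ! i, vs ! Suc i}" "Suc i < length vs"
    by (auto simp: path_edges_nth)
  then show "e \<in> cycle_edges vs"
  proof cases
    case 1
    then show ?thesis using assms unfolding cycle_edges_def
      by (intro CollectI exI[of _ "length vs - 1"]) (simp add: last_conv_nth hd_conv_nth)
  next
    case 2
    then show ?thesis unfolding cycle_edges_def by (intro CollectI exI[of _ i]) simp
  qed
qed

lemma cycle_edges_rotate1: "cycle_edges (rotate1 vs) = cycle_edges vs"
proof (cases vs)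
  case (Cons x xs)
  show ?thesis
  proof (cases xs)
    case Nil then show ?thesis using Cons by simp
  next
    case (Cons y ys)
    then have "cycle_edges (xs @ [x]) = insert {x, y} (insert {last xs, x} (path_edges xs))"
      using path_edges_snoc[of xs x] by (simp add: cycle_edges_path_edges)
    moreover have "cycle_edges (x # xs) = insert {last xs, x} (insert {x, y} (path_edges xs))"
      using Cons by (simp add: cycle_edges_path_edges)
    ultimately show ?thesis using \<open>vs = x # xs\<close> by auto
  qed
qed simp

lemma cycle_edges_rotate: "cycle_edges (rotate k vs) = cycle_edges vs"
  by (induction k) (simp_all add: cycle_edges_rotate1)

lemma cycle_edges_rev: "cycle_edges (rev vs) = cycle_edges vs"
  by (cases "vs = []") (simp_all add: cycle_edges_path_edges path_edges_rev hd_rev last_rev insert_commute)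

definition is_cycle :: "'a list \<Rightarrow> bool" where
  "is_cycle vs \<longleftrightarrow> distinct vs \<and> 3 \<le> length vs"

lemma cycles_of_eq: "cycles_of E = {C. C \<subseteq> E \<and> (\<exists>vs. is_cycle vs \<and> C = cycle_edges vs)}"
  by (simp add: cycles_of_def is_cycle_def)

lemma is_cycle_rotate [simp]: "is_cycle (rotate k vs) \<longleftrightarrow> is_cycle vs"
  by (simp add: is_cycle_def)

lemma is_cycle_rev [simp]: "is_cycle (rev vs) \<longleftrightarrow> is_cycle vs"
  by (simp add: is_cycle_def)

lemma is_cycleE:
  assumes "is_cycle vs" obtains x y zs z where "vs = x # y # zs @ [z]" "distinct (x # y # zs @ [z])"
proof -
  have "length vs = Suc (Suc (length vs - 2))" using assms unfolding is_cycle_def by arith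
  then obtain x y ws where "vs = x # y # ws" by (metis length_Suc_conv)
  then have 1: "vs = x # y # ws" "ws \<noteq> []" using assms by (auto simp: is_cycle_def)
  then have "vs = x # y # butlast ws @ [last ws]" by simp
  then show ?thesis using that assms by (metis is_cycle_def)
qed

lemma is_cycle_not_Nil: "is_cycle vs \<Longrightarrow> vs \<noteq> []"
  by (auto simp: is_cycle_def)

lemma closing_edge_notin:
  assumes "is_cycle vs" shows "{last vs, hd vs} \<notin> path_edges vs"
proof -
  obtain x y zs z where vs: "vs = x # y # zs @ [z]" "distinct (x # y # zs @ [z])" using assms by (rule is_cycleE)
  then show ?thesis using path_edges_subset[of "{z, x}" "y # zs @ [z]"] by (auto simp: doubleton_eq_iff)
qed

lemma card_cycle_edges: "is_cycle vs \<Longrightarrow> card (cycle_edges vs) = length vs"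
  using closing_edge_notin[of vs] card_path_edges[of vs]
  by (subst cycle_edges_path_edges) (auto simp: is_cycle_def)

lemma cycle_rotate_hd:
  assumes "is_cycle vs" "v \<in> set vs"
  obtains ws where "is_cycle ws" "set ws = set vs" "cycle_edges ws = cycle_edges vs" "hd ws = v"
proof -
  obtain i where "i < length vs" "vs ! i = v" using assms by (auto simp: in_set_conv_nth)
  then have "hd (rotate i vs) = v" using hd_rotate_conv_nth[of vs i] by (cases vs) auto
  then show ?thesis using that[of "rotate i vs"] assms by (simp add: cycle_edges_rotate)
qed

text \<open>Any edge can be made the closing edge of the list. Deleting an edge from a cycle thus
  becomes passing from \<open>cycle_edges\<close> to the \<open>path_edges\<close> of a
  rotation.\<close>

lemma cycle_rotate_edge:
  assumes "is_cycle vs" "e \<in> cycle_edges vs"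
  obtains ws where "is_cycle ws" "set ws = set vs" "cycle_edges ws = cycle_edges vs" "e = {last ws, hd ws}"
proof -
  obtain i where i: "e = {vs ! i, vs ! (Suc i mod length vs)}" "i < length vs"
    using assms by (auto simp: cycle_edges_def)
  let ?ws = "rotate (Suc i) vs"
  have ne: "vs \<noteq> []" using i by auto
  have h: "hd ?ws = vs ! (Suc i mod length vs)" using ne by (rule hd_rotate_conv_nth)
  have "last ?ws = ?ws ! (length vs - 1)" using ne by (simp add: last_conv_nth del: rotate_Suc)
  also have "\<dots> = vs ! ((Suc i + (length vs - 1)) mod length vs)"
    using ne by (subst nth_rotate) auto
  also have "Suc i + (length vs - 1) = i + length vs" using i by simp
  also have "(i + length vs) mod length vs = i" using i by simp
  finally have "e = {last ?ws, hd ?ws}" using i h by simp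
  then show ?thesis using that[of ?ws] assms by (simp add: cycle_edges_rotate del: rotate_Suc)
qed

lemma path_edges_cover: "Suc 0 < length vs \<Longrightarrow> \<Union>(path_edges vs) = set vs"
proof (induction vs rule: path_edges.induct)
  case (1 x y xs)
  then show ?case by (cases xs) auto
qed auto

lemma Union_cycle_edges: "is_cycle vs \<Longrightarrow> \<Union>(cycle_edges vs) = set vs"
  using path_edges_cover[of vs] is_cycle_not_Nil[of vs]
  by (subst cycle_edges_path_edges) (auto simp: is_cycle_def insert_absorb)

lemma cycle_edges_pairs: "is_cycle vs \<Longrightarrow> cycle_edges vs \<subseteq> pairs (set vs)"
proof
  fix e assume "is_cycle vs" "e \<in> cycle_edges vs"
  then obtain ws where w: "is_cycle ws" "set ws = set vs" "e = {last ws, hd ws}" using cycle_rotate_edge[of vs e] by metis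
  obtain x y zs z where "ws = x # y # zs @ [z]" "distinct (x # y # zs @ [z])" using w(1) by (rule is_cycleE)
  then show "e \<in> pairs (set vs)" using w by auto
qed

lemma path_edges_reachable: "path_edges xs \<subseteq> G \<Longrightarrow> x \<in> set xs \<Longrightarrow> reachable G (hd xs) x"
proof (induction xs rule: path_edges.induct)
  case (1 a b xs)
  show ?case
  proof (cases "x = a")
    case False
    then have "reachable G b x" using 1 by simp
    moreover have "reachable G a b" using 1 by (intro reachable_edge) simp
    ultimately show ?thesis by (auto intro: reachable_trans)
  qed simp
qed auto

lemma cycle_reachable_avoiding:
  assumes "is_cycle vs" "x \<in> set vs" "y \<in> set vs" "e \<in> cycle_edges vs"
  shows "reachable (cycle_edges vs - {e}) x y"
proof -
  obtain ws where w: "is_cycle ws" "set ws = set vs" "cycle_edges ws = cycle_edges vs" "e = {last ws, hd ws}"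
    using cycle_rotate_edge[OF assms(1,4)] by blast
  have "path_edges ws \<subseteq> cycle_edges vs - {e}"
    using w closing_edge_notin[OF w(1)] cycle_edges_path_edges[OF is_cycle_not_Nil[OF w(1)]] by auto
  then show ?thesis
    using path_edges_reachable[of ws "cycle_edges vs - {e}"] assms w(2) by (metis reachable_sym reachable_trans)
qed

lemma cycle_edges_nonempty: "is_cycle vs \<Longrightarrow> cycle_edges vs \<noteq> {}"
  by (simp add: cycle_edges_path_edges is_cycle_not_Nil)

lemma cycle_reachable:
  assumes "is_cycle vs" "x \<in> set vs" "y \<in> set vs"
  shows "reachable (cycle_edges vs) x y"
proof -
  obtain e where "e \<in> cycle_edges vs" using cycle_edges_nonempty[OF assms(1)] by blast
  then show ?thesis using reachable_mono[OF cycle_reachable_avoiding[OF assms]] by blast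
qed

lemma cycle_two_neighbours:
  assumes "is_cycle vs" "v \<in> set vs"
  obtains a b where "a \<noteq> b" "{v, a} \<in> cycle_edges vs" "{v, b} \<in> cycle_edges vs"
proof -
  obtain ws where w: "is_cycle ws" "cycle_edges ws = cycle_edges vs" "hd ws = v"
    using cycle_rotate_hd[OF assms] by blast
  obtain x y zs z where ws: "ws = x # y # zs @ [z]" "distinct (x # y # zs @ [z])" using w(1) by (rule is_cycleE)
  have "cycle_edges ws = insert {z, x} (path_edges ws)" using ws by (simp add: cycle_edges_path_edges)
  then have "{x, y} \<in> cycle_edges ws" "{x, z} \<in> cycle_edges ws" using ws by (auto simp: insert_commute)
  then show ?thesis using that[of y z] ws w by auto
qed

text \<open>The first vertex of a path has only one neighbour on it, while a vertex of a cycle has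
  two. So the first vertex can be stripped off, and induction applies.\<close>

lemma path_contains_no_cycle:
  assumes "is_cycle vs" "distinct xs" shows "\<not> cycle_edges vs \<subseteq> path_edges xs"
  using assms(2)
proof (induction xs rule: path_edges.induct)
  case (1 x y xs)
  show ?case
  proof
    assume sub: "cycle_edges vs \<subseteq> path_edges (x # y # xs)"
    have nb: "a = y" if "{x, a} \<in> path_edges (x # y # xs)" for a
      using that path_edges_subset[of "{x, a}" "y # xs"] 1(2) by (auto simp: doubleton_eq_iff)
    have "x \<notin> set vs"
      using cycle_two_neighbours[OF assms(1), of x] nb sub by (metis subsetD)
    then have "{x, y} \<notin> cycle_edges vs" using Union_cycle_edges[OF assms(1)] by auto
    then have "cycle_edges vs \<subseteq> path_edges (y # xs)" using sub by auto
    then show False using 1 by simp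
  qed
qed (use cycle_edges_nonempty[OF assms(1)] in auto)

text \<open>If an edge of the larger cycle were missing, rotating that edge to the closing position
  would place the smaller cycle inside a path.\<close>

lemma cycle_subset_eq:
  assumes "is_cycle vs" "is_cycle us" "cycle_edges us \<subseteq> cycle_edges vs"
  shows "cycle_edges us = cycle_edges vs"
proof (rule ccontr)
  assume "cycle_edges us \<noteq> cycle_edges vs"
  then obtain e where e: "e \<in> cycle_edges vs" "e \<notin> cycle_edges us" using assms(3) by auto
  obtain ws where w: "is_cycle ws" "cycle_edges ws = cycle_edges vs" "e = {last ws, hd ws}"
    using cycle_rotate_edge[OF assms(1) e(1)] by blast
  have "cycle_edges us \<subseteq> path_edges ws"
  proof
    fix f assume f: "f \<in> cycle_edges us"
    then have "f \<in> cycle_edges ws" "f \<noteq> {last ws, hd ws}" using assms(3) w e by auto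
    then show "f \<in> path_edges ws" using cycle_edges_path_edges[OF is_cycle_not_Nil[OF w(1)]] by auto
  qed
  then show False using path_contains_no_cycle[OF assms(2), of ws] w by (simp add: is_cycle_def)
qed

lemma edge_on_cycle:
  assumes "{x, y} \<in> G" "x \<noteq> y" "reachable (G - {{x, y}}) x y"
  obtains vs where "is_cycle vs" "cycle_edges vs \<subseteq> G" "{x, y} \<in> cycle_edges vs"
proof -
  have "y \<in> rooted_comp {x} (G - {{x, y}})" using assms(3) by (simp add: rooted_comp_def)
  then obtain ms where P: "rooted_path {x} (G - {{x, y}}) x ms" "last (x # ms) = y"
    using rooted_comp_path[of y "{x}"] by (auto simp: rooted_path_def)
  have "ms \<noteq> []" using P assms(2) by auto
  moreover have "ms \<noteq> [y]"
  proof
    assume "ms = [y]"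
    then show False using P by (simp add: rooted_path_def)
  qed
  ultimately have "2 \<le> length ms" using P(2) by (cases ms; cases "tl ms") auto
  then have c: "is_cycle (x # ms)" using P by (auto simp: is_cycle_def rooted_path_def)
  have "cycle_edges (x # ms) = insert {x, y} (path_edges (x # ms))"
    using P by (simp add: cycle_edges_path_edges insert_commute)
  then show ?thesis using that[OF c] P assms(1) by (auto simp: rooted_path_def)
qed

subsection \<open>Isolated cycles\<close>

lemma cycles_ofE:
  assumes "C \<in> cycles_of E" obtains vs where "is_cycle vs" "C = cycle_edges vs" "C \<subseteq> E" "\<Union>C = set vs"
  using assms Union_cycle_edges by (auto simp: cycles_of_eq)

lemma cycles_of_mono: "E \<subseteq> F \<Longrightarrow> cycles_of E \<subseteq> cycles_of F"
  by (auto simp: cycles_of_def)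

text \<open>A second cycle has an edge outside \<open>C\<close>. If it touched the component, then
  the rest of that cycle would join both ends of this edge to the roots without using it, against
  \<open>treelike\<close>.\<close>

lemma treelike_other_cycle:
  assumes "C \<in> cycles_of G" "treelike (\<Union>C) C G" "D \<in> cycles_of G" "D \<noteq> C"
  shows "\<Union>D \<inter> rooted_comp (\<Union>C) G = {}"
proof (rule ccontr)
  assume "\<Union>D \<inter> rooted_comp (\<Union>C) G \<noteq> {}"
  then obtain w where w: "w \<in> \<Union>D" "w \<in> rooted_comp (\<Union>C) G" by blast
  obtain vs where vs: "is_cycle vs" "C = cycle_edges vs" "C \<subseteq> G" "\<Union>C = set vs" using assms(1) by (rule cycles_ofE)
  obtain us where us: "is_cycle us" "D = cycle_edges us" "D \<subseteq> G" "\<Union>D = set us" using assms(3) by (rule cycles_ofE)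
  have "\<not> D \<subseteq> C" using cycle_subset_eq vs us assms(4) by metis
  then obtain e where e: "e \<in> D" "e \<notin> C" by blast
  have "e \<in> pairs (set us)" using cycle_edges_pairs[OF us(1)] e us(2) by auto
  then obtain x y where xy: "e = {x, y}" "x \<in> set us" "y \<in> set us" by (rule pairsE)
  have sub: "cycle_edges us - {e} \<subseteq> G - {e}" using us by auto
  have "w \<in> rooted_comp (\<Union>C) (G - {e}) \<or> x \<in> rooted_comp (\<Union>C) (G - {e}) \<or> y \<in> rooted_comp (\<Union>C) (G - {e})"
    using rooted_comp_Diff_edge[OF w(2), of x y] xy by simp
  then obtain u where u: "u \<in> set us" "u \<in> rooted_comp (\<Union>C) (G - {e})" using w us xy by auto
  have r: "reachable (G - {e}) u v" if "v \<in> set us" for v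
    using reachable_mono[OF cycle_reachable_avoiding[OF us(1) u(1) that] sub] e us by simp
  have "x \<in> rooted_comp (\<Union>C) (G - {e})" "y \<in> rooted_comp (\<Union>C) (G - {e})"
    using rooted_comp_reachable[OF u(2) r] xy by auto
  moreover have "{x, y} \<in> G - C" using e us xy by auto
  ultimately show False using assms(2) xy unfolding treelike_def by blast
qed

lemma rooted_comp_connected_roots:
  assumes "\<And>x y. x \<in> S \<Longrightarrow> y \<in> S \<Longrightarrow> reachable G x y" "x \<in> rooted_comp S G" "y \<in> rooted_comp S G"
  shows "reachable G x y"
proof -
  obtain s t where "s \<in> S" "reachable G s x" "t \<in> S" "reachable G t y"
    using assms(2,3) by (auto simp: rooted_comp_def)
  then show ?thesis using assms(1)[of s t] reachable_sym[of G s x] by (blast intro: reachable_trans)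
qed

lemma reachable_induced:
  assumes "reachable E u v" "u \<in> W" "\<And>x y. x \<in> W \<Longrightarrow> {x, y} \<in> E \<Longrightarrow> y \<in> W"
  shows "reachable (induced_edges E W) u v \<and> v \<in> W"
  using assms(1) unfolding reachable_def
proof (induction rule: rtranclp_induct)
  case base
  then show ?case using assms(2) by simp
next
  case (step y z)
  then have "z \<in> W" "{y, z} \<in> induced_edges E W" using assms(3)[of y z] by (auto simp: induced_edges_def)
  then show ?case using step.IH rtranclp.rtrancl_into_rtrancl[of _ u y z] by simp
qed

text \<open>Replaces the definition through unicyclic components by a local condition on
  \<open>C\<close>, which can be analysed by exploration from \<open>C\<close>. An edge violating
  \<open>treelike\<close> closes a second cycle in the component; conversely, a treelike component
  admits no second cycle.\<close>

lemma isolated_iff_treelike: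
  assumes E: "E \<subseteq> pairs V" and C: "C \<in> cycles_of E"
  shows "C \<in> isolated_cycles V E \<longleftrightarrow> treelike (\<Union>C) C E"
proof -
  obtain vs where vs: "is_cycle vs" "C = cycle_edges vs" "C \<subseteq> E" "\<Union>C = set vs" using C by (rule cycles_ofE)
  have con: "reachable E x y" if "x \<in> \<Union>C" "y \<in> \<Union>C" for x y
  proof -
    have "x \<in> set vs" "y \<in> set vs" using that vs(4) by auto
    then have "reachable C x y" using cycle_reachable[OF vs(1)] vs(2) by simp
    then show ?thesis using vs(3) by (rule reachable_mono)
  qed
  have CV: "\<Union>C \<subseteq> V" using vs(3) E by (auto simp: pairs_def)
  let ?W = "rooted_comp (\<Union>C) E"
  have WV: "?W \<subseteq> V" by (rule rooted_comp_subset[OF CV E])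
  have cl: "y \<in> ?W" if "x \<in> ?W" "{x, y} \<in> E" for x y using rooted_comp_step that by metis
  obtain v where v: "v \<in> \<Union>C" using vs is_cycle_not_Nil[OF vs(1)] hd_in_set by metis
  have vW: "v \<in> ?W" using v rooted_comp_base[of "\<Union>C" E] by auto
  show ?thesis
  proof
    assume T: "treelike (\<Union>C) C E"
    have "{u \<in> V. reachable E v u} = ?W"
      using WV v rooted_comp_connected_roots[of "\<Union>C" E, OF con vW] rooted_comp_reachable[OF vW] by auto
    then have W: "?W \<in> component_verts V E" using v CV by (auto simp: component_verts_def)
    have "reachable (induced_edges E ?W) x y" if "x \<in> ?W" "y \<in> ?W" for x y
      using reachable_induced[OF rooted_comp_connected_roots[of "\<Union>C" E, OF con that]] that cl by blast
    then have conn: "connected_graph ?W (induced_edges E ?W)" using vW by (auto simp: connected_graph_def)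
    have "C \<subseteq> induced_edges E ?W"
      using vs(3) rooted_comp_base[of "\<Union>C" E] by (auto simp: induced_edges_def)
    then have CW: "C \<in> cycles_of (induced_edges E ?W)" using vs by (auto simp: cycles_of_eq)
    have "D = C" if D: "D \<in> cycles_of (induced_edges E ?W)" for D
    proof (rule ccontr)
      assume "D \<noteq> C"
      have "induced_edges E ?W \<subseteq> E" by (auto simp: induced_edges_def)
      then have "D \<in> cycles_of E" using D cycles_of_mono by blast
      then have dis: "\<Union>D \<inter> ?W = {}" using treelike_other_cycle[OF C T _ \<open>D \<noteq> C\<close>] by simp
      obtain us where us: "is_cycle us" "D \<subseteq> induced_edges E ?W" "\<Union>D = set us"
        using D by (rule cycles_ofE)
      have "\<Union>D \<subseteq> ?W" using us(2) by (auto simp: induced_edges_def)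
      then have "set us = {}" using dis us(3) by (simp add: inf.absorb1)
      then show False using is_cycle_not_Nil[OF us(1)] by simp
    qed
    then have "unicyclic ?W (induced_edges E ?W)" using conn CW by (auto simp: unicyclic_def)
    then show "C \<in> isolated_cycles V E" using W CW by (auto simp: isolated_cycles_def)
  next
    assume "C \<in> isolated_cycles V E"
    then obtain W where W: "W \<in> component_verts V E" "unicyclic W (induced_edges E W)" "C \<in> cycles_of (induced_edges E W)"
      by (auto simp: isolated_cycles_def)
    obtain r where r: "W = {u \<in> V. reachable E r u}" using W by (auto simp: component_verts_def)
    have Wcl: "y \<in> W" if "x \<in> W" "{x, y} \<in> E" for x y
      using that E r reachable_edge[of x y E] reachable_trans[of E r x y] by auto
    have CW: "\<Union>C \<subseteq> W" using W(3) by (auto simp: cycles_of_def induced_edges_def)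
    show "treelike (\<Union>C) C E"
      unfolding treelike_def
    proof (intro allI impI notI)
      fix x y assume e: "{x, y} \<in> E - C"
        and xy: "x \<in> rooted_comp (\<Union>C) (E - {{x, y}}) \<and> y \<in> rooted_comp (\<Union>C) (E - {{x, y}})"
      have con': "reachable (E - {{x, y}}) a b" if "a \<in> \<Union>C" "b \<in> \<Union>C" for a b
      proof -
        have "a \<in> set vs" "b \<in> set vs" using that vs(4) by auto
        then have "reachable C a b" using cycle_reachable[OF vs(1)] vs(2) by simp
        moreover have "C \<subseteq> E - {{x, y}}" using vs(3) e by auto
        ultimately show ?thesis by (rule reachable_mono)
      qed
      have "reachable (E - {{x, y}}) x y"
        using rooted_comp_connected_roots[of "\<Union>C" "E - {{x, y}}", OF con'] xy by auto
      moreover have "{x, y} \<in> pairs V" using e E by blast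
      then have "x \<noteq> y" by simp
      ultimately obtain us where us: "is_cycle us" "cycle_edges us \<subseteq> E" "{x, y} \<in> cycle_edges us"
        using e edge_on_cycle[of x y E] by auto
      have xW: "x \<in> W"
        using xy rooted_comp_closed[of "\<Union>C" W "E - {{x, y}}"] CW Wcl by auto
      have "x \<in> set us" using us Union_cycle_edges[OF us(1)] by auto
      then have "z \<in> W" if "z \<in> set us" for z
        using reachable_induced[OF reachable_mono[OF cycle_reachable[OF us(1) _ that] us(2)], of x W] xW Wcl by blast
      then have "cycle_edges us \<subseteq> induced_edges E W"
        using us(2) cycle_edges_pairs[OF us(1)] by (auto simp: induced_edges_def pairs_def)
      then have "cycle_edges us \<in> cycles_of (induced_edges E W)" using us(1) by (auto simp: cycles_of_eq)
      then have "cycle_edges us = C" using W by (auto simp: unicyclic_def)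
      then show False using us(3) e by simp
    qed
  qed
qed

lemma isolated_cycles_cycles: "isolated_cycles V E \<subseteq> cycles_of E"
  by (auto simp: isolated_cycles_def cycles_of_def induced_edges_def)

lemma isolated_cycles_eq:
  "E \<subseteq> pairs V \<Longrightarrow> isolated_cycles V E = {C \<in> cycles_of E. treelike (\<Union>C) C E}"
  using isolated_iff_treelike isolated_cycles_cycles by blast

lemma treelike_mono:
  assumes "treelike S A G" "H \<subseteq> G" shows "treelike S A H"
  unfolding treelike_def
proof (intro allI impI notI)
  fix x y assume e: "{x, y} \<in> H - A"
    and xy: "x \<in> rooted_comp S (H - {{x, y}}) \<and> y \<in> rooted_comp S (H - {{x, y}})"
  have "rooted_comp S (H - {{x, y}}) \<subseteq> rooted_comp S (G - {{x, y}})"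
    using assms(2) by (intro rooted_comp_mono) auto
  then show False using assms e xy unfolding treelike_def by blast
qed

text \<open>The combinatorial core of the argument. Every other cycle misses the component of
  \<open>C\<close>, so deleting \<open>C\<close> destroys no isolated cycle, and it creates none,
  since putting \<open>C\<close> back cannot affect a component disjoint from that of
  \<open>C\<close>.\<close>

lemma isolated_cycles_remove:
  assumes G: "G \<subseteq> pairs V" and C: "C \<in> isolated_cycles V G"
  shows "isolated_cycles V (G - C) = isolated_cycles V G - {C}"
proof -
  have CG: "C \<in> cycles_of G" "treelike (\<Union>C) C G" using C isolated_cycles_eq[OF G] by auto
  have GC: "G - C \<subseteq> pairs V" using G by auto
  let ?W = "rooted_comp (\<Union>C) G"
  have CW: "\<Union>C \<subseteq> ?W" by (rule rooted_comp_base)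
  show ?thesis
  proof (intro equalityI subsetI)
    fix D assume "D \<in> isolated_cycles V G - {C}"
    then have D: "D \<in> cycles_of G" "treelike (\<Union>D) D G" "D \<noteq> C" using isolated_cycles_eq[OF G] by auto
    have dj: "\<Union>D \<inter> \<Union>C = {}" using treelike_other_cycle[OF CG D(1,3)] CW by blast
    have ne: "{} \<notin> D"
    proof -
      obtain us where "is_cycle us" "D = cycle_edges us" using D(1) by (rule cycles_ofE)
      then show ?thesis using cycle_edges_pairs[of us] by (auto simp: pairs_def)
    qed
    have "D \<inter> C = {}"
    proof (rule ccontr)
      assume "D \<inter> C \<noteq> {}"
      then obtain e where "e \<in> D" "e \<in> C" by auto
      moreover then obtain z where "z \<in> e" using ne by fastforce
      ultimately have "z \<in> \<Union>D \<inter> \<Union>C" by auto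
      then show False using dj by simp
    qed
    then have "D \<in> cycles_of (G - C)" using D(1) by (auto simp: cycles_of_def)
    moreover have "treelike (\<Union>D) D (G - C)" using D(2) treelike_mono by blast
    ultimately show "D \<in> isolated_cycles V (G - C)" using isolated_cycles_eq[OF GC] by auto
  next
    fix D assume "D \<in> isolated_cycles V (G - C)"
    then have D: "D \<in> cycles_of (G - C)" "treelike (\<Union>D) D (G - C)" using isolated_cycles_eq[OF GC] by auto
    have DG: "D \<in> cycles_of G" using D(1) cycles_of_mono[of "G - C" G] by auto
    obtain us where us: "is_cycle us" "D = cycle_edges us" "D \<subseteq> G - C" "\<Union>D = set us" using D(1) by (rule cycles_ofE)
    have "D \<noteq> C" using us cycle_edges_nonempty[OF us(1)] by auto
    have dis: "\<Union>D \<inter> ?W = {}" using treelike_other_cycle[OF CG DG \<open>D \<noteq> C\<close>] .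
    have dis': "rooted_comp (\<Union>D) G \<inter> ?W = {}"
    proof (rule ccontr)
      assume "rooted_comp (\<Union>D) G \<inter> ?W \<noteq> {}"
      then obtain z d where "z \<in> ?W" "d \<in> \<Union>D" "reachable G d z" by (auto simp: rooted_comp_def)
      then have "d \<in> ?W" using rooted_comp_reachable reachable_sym by metis
      then show False using dis \<open>d \<in> \<Union>D\<close> by auto
    qed
    have CV: "e \<subseteq> ?W \<and> e \<noteq> {}" if "e \<in> C" for e
    proof -
      have "e \<in> pairs V" using that CG(1) G by (auto simp: cycles_of_def)
      then show ?thesis using CW that by (auto simp: pairs_def)
    qed
    \<comment> \<open>An edge violating the condition lies in the component of \<open>D\<close>, so
      it is not on \<open>C\<close>. As \<open>C\<close> lies off that component, reachability from
      \<open>D\<close> is the same with and without \<open>C\<close>, and the violation would occur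
      in \<open>G - C\<close> as well.\<close>
    have "treelike (\<Union>D) D G"
      unfolding treelike_def
    proof (intro allI impI notI)
      fix x y assume e: "{x, y} \<in> G - D"
        and xy: "x \<in> rooted_comp (\<Union>D) (G - {{x, y}}) \<and> y \<in> rooted_comp (\<Union>D) (G - {{x, y}})"
      have sub: "rooted_comp (\<Union>D) (G - {{x, y}}) \<subseteq> rooted_comp (\<Union>D) G" by (rule rooted_comp_mono) auto
      have "{x, y} \<notin> C" using CV[of "{x, y}"] xy sub dis' by blast
      have eq: "G - {{x, y}} = (G - C - {{x, y}}) \<union> C"
        using CG(1) \<open>{x, y} \<notin> C\<close> by (auto simp: cycles_of_def)
      have sub2: "rooted_comp (\<Union>D) (G - C - {{x, y}}) \<subseteq> rooted_comp (\<Union>D) G" by (rule rooted_comp_mono) auto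
      have "rooted_comp (\<Union>D) ((G - C - {{x, y}}) \<union> C) = rooted_comp (\<Union>D) (G - C - {{x, y}})"
        by (rule rooted_comp_Un_outside[OF sub2 rooted_comp_base]) (use CV dis' in blast)
      then have "rooted_comp (\<Union>D) (G - {{x, y}}) = rooted_comp (\<Union>D) (G - C - {{x, y}})"
        using eq by simp
      then show False using D(2) e xy \<open>{x, y} \<notin> C\<close> unfolding treelike_def by auto
    qed
    then show "D \<in> isolated_cycles V G - {C}" using DG \<open>D \<noteq> C\<close> isolated_cycles_eq[OF G] by auto
  qed
qed

subsection \<open>The number of cycles of a given length\<close>

lemma falling_factorial_eq:
  assumes "k \<le> n" shows "real (\<Prod>{n - k + 1..n}) = (\<Prod>i<k. real n - real i)"
proof -
  have "\<Prod>{n - k + 1..n} = (\<Prod>i<k. n - i)"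
    by (rule prod.reindex_bij_witness[of _ "\<lambda>i. n - i" "\<lambda>i. n - i"]) (use assms in auto)
  also have "real \<dots> = (\<Prod>i<k. real n - real i)"
    unfolding of_nat_prod by (rule prod.cong) (use assms in auto)
  finally show ?thesis .
qed

lemma card_ordered_ends:
  assumes "finite V" "C \<subseteq> pairs V"
  shows "card {(x, y). {x, y} \<in> C} = 2 * card C"
proof -
  have fC: "finite C" using assms finite_subset finite_pairs by blast
  have e: "finite {(x, y). {x, y} = e} \<and> card {(x, y). {x, y} = e} = 2" if "e \<in> C" for e
  proof -
    have "e \<in> pairs V" using that assms by auto
    then obtain a b where ab: "e = {a, b}" "a \<noteq> b" by (rule pairsE)
    then have "{(x, y). {x, y} = e} = {(a, b), (b, a)}" by (auto simp: doubleton_eq_iff)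
    then show ?thesis using ab by auto
  qed
  have "{(x, y). {x, y} \<in> C} = (\<Union>e\<in>C. {(x, y). {x, y} = e})" by auto
  also have "card \<dots> = (\<Sum>e\<in>C. card {(x, y). {x, y} = e})"
    by (rule card_UN_disjoint) (use fC e in auto)
  also have "\<dots> = (\<Sum>e\<in>C. 2)" using e by (intro sum.cong) auto
  finally show ?thesis by simp
qed

lemma cycle_inner_neighbour:
  assumes "distinct vs" "0 < i" "Suc i < length vs" "{vs ! i, w} \<in> cycle_edges vs"
  shows "w = vs ! (i - 1) \<or> w = vs ! Suc i"
proof -
  obtain j where j: "{vs ! i, w} = {vs ! j, vs ! (Suc j mod length vs)}" "j < length vs"
    using assms(4) by (auto simp: cycle_edges_def)
  have sj: "Suc j mod length vs < length vs" using j(2) by (intro mod_less_divisor) linarith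
  from j(1) consider "vs ! i = vs ! j" "w = vs ! (Suc j mod length vs)" | "vs ! i = vs ! (Suc j mod length vs)" "w = vs ! j"
    by (auto simp: doubleton_eq_iff)
  then show ?thesis
  proof cases
    case 1
    then have "i = j" using assms(1,3) j(2) nth_eq_iff_index_eq[of vs i j] by simp
    then show ?thesis using 1 assms(3) by simp
  next
    case 2
    then have i: "i = Suc j mod length vs" using assms(1,3) sj nth_eq_iff_index_eq[of vs i "Suc j mod length vs"] by simp
    then have "Suc j \<noteq> length vs" using assms(2) by auto
    then have "i = Suc j" using i j(2) by simp
    then show ?thesis using 2 by simp
  qed
qed

text \<open>An inner vertex of the list has only two neighbours on the cycle; one is its
  predecessor, so its successor is forced.\<close>

lemma cycle_determined:
  assumes "is_cycle vs" "is_cycle ws" "length vs = length ws" "cycle_edges vs = cycle_edges ws"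
    "vs ! 0 = ws ! 0" "vs ! 1 = ws ! 1"
  shows "vs = ws"
proof (rule nth_equalityI)
  have *: "Suc i < length vs \<Longrightarrow> vs ! i = ws ! i \<and> vs ! Suc i = ws ! Suc i" for i
  proof (induction i)
    case 0
    then show ?case using assms(5,6) by simp
  next
    case (Suc i)
    then have IH: "vs ! i = ws ! i" "vs ! Suc i = ws ! Suc i" by simp_all
    have "{ws ! Suc i, ws ! Suc (Suc i)} \<in> cycle_edges ws"
      unfolding cycle_edges_def using Suc(2) assms(3) by (intro CollectI exI[of _ "Suc i"]) simp
    then have "{vs ! Suc i, ws ! Suc (Suc i)} \<in> cycle_edges vs" using IH assms(4) by simp
    then have "ws ! Suc (Suc i) = vs ! i \<or> ws ! Suc (Suc i) = vs ! Suc (Suc i)"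
      using cycle_inner_neighbour[of vs "Suc i"] Suc(2) assms(1) by (simp add: is_cycle_def)
    moreover have "ws ! Suc (Suc i) \<noteq> ws ! i"
      using assms(2,3) Suc(2) nth_eq_iff_index_eq[of ws "Suc (Suc i)" i] by (simp add: is_cycle_def)
    ultimately show ?case using IH by simp
  qed
  fix i assume i: "i < length vs"
  show "vs ! i = ws ! i"
  proof (cases i)
    case 0 then show ?thesis using assms(5) by simp
  next
    case (Suc j) then show ?thesis using *[of j] i by simp
  qed
qed (use assms in simp)

text \<open>An ordering is determined by its first two entries, and these can be any edge of the
  cycle in either direction.\<close>

lemma card_cycle_orderings:
  assumes "is_cycle us"
  shows "card {vs. is_cycle vs \<and> cycle_edges vs = cycle_edges us} = 2 * length us"
proof -
  let ?C = "cycle_edges us" let ?F = "{vs. is_cycle vs \<and> cycle_edges vs = ?C}"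
  have len: "length vs = length us" if "vs \<in> ?F" for vs
    using that card_cycle_edges[of vs] card_cycle_edges[OF assms] by simp
  have "bij_betw (\<lambda>vs. (vs ! 0, vs ! 1)) ?F {(x, y). {x, y} \<in> ?C}"
    unfolding bij_betw_def
  proof
    show "inj_on (\<lambda>vs. (vs ! 0, vs ! 1)) ?F"
      by (intro inj_onI cycle_determined) (use len in auto)
    show "(\<lambda>vs. (vs ! 0, vs ! 1)) ` ?F = {(x, y). {x, y} \<in> ?C}"
    proof (intro equalityI subsetI)
      fix p assume "p \<in> (\<lambda>vs. (vs ! 0, vs ! 1)) ` ?F"
      then obtain vs where vs: "is_cycle vs" "cycle_edges vs = ?C" "p = (vs ! 0, vs ! 1)" by auto
      then have "{vs ! 0, vs ! 1} \<in> cycle_edges vs"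
        unfolding cycle_edges_def by (intro CollectI exI[of _ 0]) (auto simp: is_cycle_def)
      then show "p \<in> {(x, y). {x, y} \<in> ?C}" using vs by simp
    next
      fix p assume "p \<in> {(x, y). {x, y} \<in> ?C}"
      then obtain x y where p: "p = (x, y)" "{x, y} \<in> ?C" by auto
      obtain ws where ws: "is_cycle ws" "cycle_edges ws = ?C" "{x, y} = {last ws, hd ws}"
        using cycle_rotate_edge[OF assms p(2)] by metis
      obtain vs where vs: "is_cycle vs" "cycle_edges vs = ?C" "last vs = x" "hd vs = y"
      proof (cases "last ws = x \<and> hd ws = y")
        case True then show ?thesis using that[of ws] ws by simp
      next
        case False
        then have "last ws = y" "hd ws = x" using ws(3) by (auto simp: doubleton_eq_iff)
        then show ?thesis using that[of "rev ws"] ws is_cycle_not_Nil[OF ws(1)]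
          by (simp add: cycle_edges_rev last_rev hd_rev)
      qed
      \<comment> \<open>So far the step from \<open>x\<close> to \<open>y\<close> is the closing
        one, from the last entry to the first. Moving the last entry to the front makes
        \<open>x\<close> and \<open>y\<close> the first two entries.\<close>
      let ?r = "last vs # butlast vs"
      have ne: "vs \<noteq> []" using vs(1) by (rule is_cycle_not_Nil)
      have "rotate1 ?r = vs" using ne by simp
      then have r: "cycle_edges ?r = ?C" using cycle_edges_rotate1[of ?r] vs(2) by simp
      have "is_cycle (rotate1 ?r) = is_cycle ?r" by (auto simp: is_cycle_def)
      then have cr: "is_cycle ?r" using \<open>rotate1 ?r = vs\<close> vs(1) by simp
      obtain a b cs c where "vs = a # b # cs @ [c]" using vs(1) by (rule is_cycleE)
      then have "?r ! 0 = x" "?r ! 1 = y" using vs by auto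
      then show "p \<in> (\<lambda>vs. (vs ! 0, vs ! 1)) ` ?F" using r cr p(1) by (intro image_eqI[of _ _ ?r]) auto
    qed
  qed
  then have "card ?F = card {(x, y). {x, y} \<in> ?C}" by (rule bij_betw_same_card)
  also have "\<dots> = 2 * card ?C" using cycle_edges_pairs[OF assms] by (intro card_ordered_ends) auto
  finally show ?thesis using card_cycle_edges[OF assms] by simp
qed

text \<open>Double counting: there are as many lists of \<open>k\<close> distinct vertices as the
  falling factorial says, and each cycle arises from \<open>2 * k\<close> of them. This is the
  origin of the weights 1/(2l) in \<open>lambda_gf\<close>. For \<open>k > card V\<close> both sides
  are 0.\<close>

lemma card_cycles_of_length:
  assumes "finite V" "3 \<le> k"
  shows "real (card {C \<in> cycles_of (pairs V). card C = k}) = (\<Prod>i<k. real (card V) - real i) / (2 * real k)"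
proof -
  let ?A = "{vs. length vs = k \<and> distinct vs \<and> set vs \<subseteq> V}" and ?T = "{C \<in> cycles_of (pairs V). card C = k}"
  have fA: "finite ?A" using finite_lists_length_eq[OF assms(1), of k] by (rule finite_subset[rotated]) auto
  have fT: "finite ?T" by (rule finite_subset[of _ "Pow (pairs V)"]) (use assms(1) in \<open>auto simp: cycles_of_def\<close>)
  have cyc: "is_cycle vs" if "vs \<in> ?A" for vs using that assms(2) by (auto simp: is_cycle_def)
  have im: "cycle_edges ` ?A \<subseteq> ?T"
  proof
    fix C assume "C \<in> cycle_edges ` ?A"
    then obtain vs where vs: "vs \<in> ?A" "C = cycle_edges vs" by auto
    have "cycle_edges vs \<subseteq> pairs V"
      using cycle_edges_pairs[OF cyc[OF vs(1)]] pairs_mono[of "set vs" V] vs(1) by auto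
    then show "C \<in> ?T" using vs cyc[OF vs(1)] card_cycle_edges[OF cyc[OF vs(1)]] by (auto simp: cycles_of_eq)
  qed
  have fib: "card {vs \<in> ?A. cycle_edges vs = C} = 2 * k" if C: "C \<in> ?T" for C
  proof -
    have C': "C \<in> cycles_of (pairs V)" "card C = k" using C by auto
    obtain us where us: "is_cycle us" "C = cycle_edges us" "C \<subseteq> pairs V" "\<Union>C = set us" using C'(1) by (rule cycles_ofE)
    have "{vs \<in> ?A. cycle_edges vs = C} = {vs. is_cycle vs \<and> cycle_edges vs = cycle_edges us}"
    proof (intro equalityI subsetI)
      fix vs assume "vs \<in> {vs. is_cycle vs \<and> cycle_edges vs = cycle_edges us}"
      then have vs: "is_cycle vs" "cycle_edges vs = C" using us by auto
      have "set vs = \<Union>C" using Union_cycle_edges[OF vs(1)] vs(2) by simp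
      also have "\<dots> \<subseteq> V" using us(3) by (auto simp: pairs_def)
      finally show "vs \<in> {vs \<in> ?A. cycle_edges vs = C}"
        using vs card_cycle_edges[OF vs(1)] C'(2) by (simp add: is_cycle_def)
    qed (use cyc us in auto)
    then show ?thesis using card_cycle_orderings[OF us(1)] card_cycle_edges[OF us(1)] us(2) C'(2) by simp
  qed
  have "card ?A = (\<Sum>C\<in>?T. card {vs \<in> ?A. cycle_edges vs = C})"
    using sum.group[OF fA fT im, of "\<lambda>_. 1::nat"] by simp
  also have "\<dots> = 2 * k * card ?T" using fib by simp
  finally have "real (card ?A) = 2 * real k * real (card ?T)" by simp
  moreover have "real (card ?A) = (\<Prod>i<k. real (card V) - real i)"
  proof (cases "k \<le> card V")
    case True
    then show ?thesis using card_lists_distinct_length_eq[OF assms(1) True] falling_factorial_eq[OF True] by simp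
  next
    case False
    have "?A = {}"
    proof (rule ccontr)
      assume "?A \<noteq> {}"
      then obtain vs where "length vs = k" "distinct vs" "set vs \<subseteq> V" by auto
      then show False using False card_mono[OF assms(1), of "set vs"] by (simp add: distinct_card)
    qed
    then have "card ?A = 0" by (simp only: card.empty)
    moreover have "(\<Prod>i<k. real (card V) - real i) = 0" by (rule prod_zero) (use False in auto)
    ultimately show ?thesis by simp
  qed
  ultimately show ?thesis using assms(2) by (simp add: field_simps)
qed

subsection \<open>The characteristic function of the number of isolated cycles\<close>

lemma norm_iexp_diff_le: "norm (iexp x - iexp y) \<le> \<bar>x - y\<bar>"
proof -
  have "iexp x - iexp y = iexp y * (iexp (x - y) - 1)"
    by (simp add: algebra_simps flip: exp_add)
  moreover have "norm (iexp (x - y) - 1) \<le> \<bar>x - y\<bar>"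
    using iexp_approx1[of "x - y" 0] by simp
  ultimately show ?thesis by (simp add: norm_mult)
qed

text \<open>Forgetting the condition that the random set avoids \<open>C\<close> costs at most twice
  the probability of meeting \<open>C\<close>, and that probability is at most the expected size of
  the intersection.\<close>

lemma norm_avg_avoid_le:
  fixes f :: "'a set \<Rightarrow> complex"
  assumes "finite U" "C \<subseteq> U" "m \<le> card U - card C" "\<And>G. norm (f G) \<le> 1"
  shows "norm (avg (U - C) m f - avg U m f) \<le> 2 * (real (card C) * real m / real (card U))"
proof -
  let ?S = "subsets_of_card"
  have fC: "finite C" using assms finite_subset by blast
  have cUC: "card (U - C) = card U - card C" using assms fC by (simp add: card_Diff_subset)
  define a where "a = real (card (?S (U - C) m))"
  define c where "c = real (card (?S U m))"
  have a: "a > 0" unfolding a_def using assms by (simp add: card_subsets_of_card cUC zero_less_binomial_iff)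
  have ac: "a \<le> c" unfolding a_def c_def of_nat_le_iff
    by (rule card_mono) (use assms(1) in \<open>auto simp: subsets_of_card_def\<close>)
  let ?B = "{G \<in> ?S U m. G \<inter> C \<noteq> {}}"
  have split: "?S U m = ?S (U - C) m \<union> ?B" "?S (U - C) m \<inter> ?B = {}"
    by (auto simp: subsets_of_card_def)
  have fin: "finite (?S (U - C) m)" "finite ?B" using assms(1) by auto
  have "card (?S U m) = card (?S (U - C) m) + card ?B"
    by (subst split(1), rule card_Un_disjoint[OF fin split(2)])
  then have b: "real (card ?B) = c - a" by (simp add: a_def c_def)
  let ?s1 = "sum f (?S (U - C) m)" and ?s2 = "sum f ?B"
  have s: "sum f (?S U m) = ?s1 + ?s2" by (subst split(1), rule sum.union_disjoint[OF fin split(2)])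
  have n1: "norm ?s1 \<le> a" unfolding a_def using sum_norm_le[of "?S (U - C) m" f "\<lambda>_. 1"] assms(4) by simp
  have n2: "norm ?s2 \<le> c - a" unfolding b[symmetric] using sum_norm_le[of ?B f "\<lambda>_. 1"] assms(4) by simp
  have "avg (U - C) m f - avg U m f = ?s1 / of_real a - (?s1 + ?s2) / of_real c"
    using assms(1) unfolding avg_def s a_def c_def by (simp add: card_subsets_of_card)
  also have "\<dots> = (of_real (c - a) * ?s1 - of_real a * ?s2) / of_real (a * c)"
    using a ac by (simp add: field_simps)
  also have "norm \<dots> \<le> ((c - a) * a + a * (c - a)) / (a * c)"
    unfolding norm_divide norm_of_real
  proof (intro frac_le)
    have "norm (of_real (c - a) * ?s1 - of_real a * ?s2) \<le> norm (of_real (c - a) * ?s1) + norm (of_real a * ?s2)"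
      by (rule norm_triangle_ineq4)
    also have "\<dots> = (c - a) * norm ?s1 + a * norm ?s2" using a ac by (simp add: norm_mult del: of_real_diff)
    also have "\<dots> \<le> (c - a) * a + a * (c - a)" using n1 n2 a ac by (intro add_mono mult_left_mono) auto
    finally show "norm (of_real (c - a) * ?s1 - of_real a * ?s2) \<le> (c - a) * a + a * (c - a)" .
  qed (use a ac in auto)
  also have "\<dots> = 2 * ((c - a) / c)" using a ac by (simp add: field_simps)
  also have "(c - a) / c \<le> real (card C) * real m / real (card U)"
  proof -
    have "(c - a) / c = avg U m (\<lambda>G. if G \<inter> C \<noteq> {} then 1 else 0 :: real)"
      using assms(1) b unfolding avg_def c_def by (simp add: sum.inter_filter[symmetric] card_subsets_of_card)
    also have "\<dots> \<le> (\<Sum>e\<in>C. avg U m (\<lambda>G. if {e} \<subseteq> G then 1 else 0))"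
      by (rule avg_ind_le_sum[OF fC]) auto
    also have "\<dots> \<le> (\<Sum>e\<in>C. (real m / real (card U)) ^ 1)"
    proof (rule sum_mono)
      fix e assume e: "e \<in> C"
      then have "{e} \<subseteq> U" "m \<le> card U" using assms by auto
      then show "avg U m (\<lambda>G. if {e} \<subseteq> G then 1 else 0) \<le> (real m / real (card U)) ^ 1"
        using avg_superset_indicator[OF assms(1), of "{e}" m] incl_prob_le[of m "card U" 1] by simp
    qed
    finally show ?thesis by simp
  qed
  finally show ?thesis by simp
qed

locale cycle_count =
  fixes V :: "'a set" and Ls :: "nat set" and M :: nat
  assumes fin: "finite V" and V_ne: "card V \<ge> 2" and MN: "M \<le> card (pairs V)"
begin

abbreviation "U \<equiv> pairs V"
abbreviation "N \<equiv> card (pairs V)"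

definition cyc :: "'a set set set" where
  "cyc = {C \<in> cycles_of U. card C \<in> Ls}"

definition X :: "'a set set \<Rightarrow> nat" where
  "X G = card {C \<in> isolated_cycles V G. card C \<in> Ls}"

definition Y :: "'a set set \<Rightarrow> real" where
  "Y G = (\<Sum>C\<in>cyc. if C \<subseteq> G then 1 else 0)"

text \<open>The expectation of \<open>Y\<close> (see \<open>avg_Y\<close>). The number of edges is
  an argument because \<open>M\<close> will be compared with \<open>M - card C\<close> and, in the
  critical window, with \<open>M0\<close>.\<close>

definition Lam :: "nat \<Rightarrow> real" where
  "Lam m = (\<Sum>C\<in>cyc. incl_prob N m (card C))"

abbreviation p :: "'a set set \<Rightarrow> real" where
  "p C \<equiv> incl_prob N M (card C)"

text \<open>Probability that \<open>C\<close> is not isolated, conditioned on its being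
  present.\<close>

definition bad :: "'a set set \<Rightarrow> real" where
  "bad C = avg (U - C) (M - card C) (\<lambda>H. if treelike (\<Union>C) C (H \<union> C) then 0 else 1)"

text \<open>The three sources of error. \<open>B1\<close> is the expected number of cycles present
  but not isolated (see \<open>avg_bad\<close>), \<open>B2\<close> accounts for the loss of
  \<open>card C\<close> edges when \<open>C\<close> is removed, and \<open>B3\<close> for the fact
  that the remaining edges must avoid \<open>C\<close>.\<close>

definition B1 :: real where "B1 = (\<Sum>C\<in>cyc. p C * bad C)"
definition B2 :: real where "B2 = (\<Sum>C\<in>cyc. p C * (Lam M - Lam (M - card C)))"
definition B3 :: real where "B3 = (\<Sum>C\<in>cyc. p C * (2 * (real (card C) * real M / real N)))"

definition phi :: "real \<Rightarrow> complex" where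
  "phi t = avg U M (\<lambda>G. iexp (t * real (X G)))"

lemma finU [simp]: "finite U" using fin by simp

lemma cyc_sub: "C \<in> cyc \<Longrightarrow> C \<subseteq> U" by (auto simp: cyc_def cycles_of_def)

lemma finite_cyc [simp]: "finite cyc"
  by (rule finite_subset[of _ "Pow U"]) (auto dest: cyc_sub)

lemma p_nonneg: "0 \<le> p C" using MN by (rule incl_prob_nonneg)

lemma X_eq: "G \<subseteq> U \<Longrightarrow> real (X G) = (\<Sum>C\<in>cyc. if C \<subseteq> G \<and> treelike (\<Union>C) C G then 1 else 0)"
proof -
  assume G: "G \<subseteq> U"
  have "{C \<in> isolated_cycles V G. card C \<in> Ls} = {C \<in> cyc. C \<subseteq> G \<and> treelike (\<Union>C) C G}"
    using isolated_cycles_eq[OF G] G by (auto simp: cyc_def cycles_of_def)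
  then show ?thesis unfolding X_def by (simp add: sum.inter_filter[symmetric])
qed

lemma avg_Y: "m \<le> N \<Longrightarrow> avg U m Y = Lam m"
  unfolding Y_def Lam_def avg_sum by (intro sum.cong refl avg_superset_indicator) (auto dest: cyc_sub)

lemma avg_bad: "avg U M (\<lambda>G. Y G - real (X G)) = B1"
proof -
  have "avg U M (\<lambda>G. Y G - real (X G))
      = avg U M (\<lambda>G. \<Sum>C\<in>cyc. if C \<subseteq> G then (if treelike (\<Union>C) C G then 0 else 1) else 0)"
    by (rule avg_cong) (auto simp: Y_def X_eq sum_subtractf[symmetric] intro!: sum.cong)
  also have "\<dots> = (\<Sum>C\<in>cyc. p C * bad C)"
    unfolding avg_sum
  proof (rule sum.cong[OF refl])
    fix C assume "C \<in> cyc"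
    then show "avg U M (\<lambda>G. if C \<subseteq> G then (if treelike (\<Union>C) C G then 0 else 1) else 0) = p C * bad C"
      using avg_supersets[OF finU cyc_sub MN, of C "\<lambda>G. if treelike (\<Union>C) C G then 0 else 1 :: real"]
      by (simp add: bad_def)
  qed
  finally show ?thesis by (simp add: B1_def)
qed

text \<open>A cycle counted only in \<open>G\<close> is absent from \<open>H\<close> and contributes
  to \<open>Y G - Y H\<close>. A cycle counted only in \<open>H\<close> is present but not isolated
  in \<open>G\<close> and contributes to \<open>Y G - X G\<close>.\<close>

lemma X_diff_le:
  assumes "G \<subseteq> U" "H \<subseteq> G"
  shows "\<bar>real (X G) - real (X H)\<bar> \<le> (Y G - real (X G)) + (Y G - Y H)"
proof -
  have H: "H \<subseteq> U" using assms by auto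
  have "\<bar>real (X G) - real (X H)\<bar>
     \<le> (\<Sum>C\<in>cyc. \<bar>(if C \<subseteq> G \<and> treelike (\<Union>C) C G then 1 else 0) - (if C \<subseteq> H \<and> treelike (\<Union>C) C H then 1 else 0 :: real)\<bar>)"
    unfolding X_eq[OF assms(1)] X_eq[OF H] sum_subtractf[symmetric] by (rule sum_abs)
  also have "\<dots> \<le> (\<Sum>C\<in>cyc. ((if C \<subseteq> G then 1 else 0) - (if C \<subseteq> G \<and> treelike (\<Union>C) C G then 1 else 0))
      + ((if C \<subseteq> G then 1 else 0) - (if C \<subseteq> H then 1 else 0)))"
  proof (rule sum_mono)
    fix C
    have "C \<subseteq> H \<Longrightarrow> C \<subseteq> G" using assms by auto
    moreover have "treelike (\<Union>C) C G \<Longrightarrow> treelike (\<Union>C) C H" using treelike_mono assms(2) by blast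
    ultimately show "\<bar>(if C \<subseteq> G \<and> treelike (\<Union>C) C G then 1 else 0) - (if C \<subseteq> H \<and> treelike (\<Union>C) C H then 1 else 0 :: real)\<bar>
      \<le> ((if C \<subseteq> G then 1 else 0) - (if C \<subseteq> G \<and> treelike (\<Union>C) C G then 1 else 0))
      + ((if C \<subseteq> G then 1 else 0) - (if C \<subseteq> H then 1 else 0))" by auto
  qed
  also have "\<dots> = (Y G - real (X G)) + (Y G - Y H)"
    unfolding X_eq[OF assms(1)] Y_def by (simp only: sum.distrib sum_subtractf)
  finally show ?thesis .
qed

lemma X_insert_isolated:
  assumes "C \<in> cyc" "H \<subseteq> U - C" "treelike (\<Union>C) C (H \<union> C)"
  shows "X (H \<union> C) = Suc (X H)"
proof -
  have G: "H \<union> C \<subseteq> U" using assms cyc_sub by auto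
  have "C \<in> isolated_cycles V (H \<union> C)"
    using isolated_cycles_eq[OF G] assms(1,3) by (auto simp: cyc_def cycles_of_def)
  moreover have "H \<union> C - C = H" using assms(2) by auto
  ultimately have "isolated_cycles V H = isolated_cycles V (H \<union> C) - {C}"
    using isolated_cycles_remove[OF G] by metis
  then have "{D \<in> isolated_cycles V (H \<union> C). card D \<in> Ls} = insert C {D \<in> isolated_cycles V H. card D \<in> Ls}"
    "C \<notin> isolated_cycles V H"
    using \<open>C \<in> isolated_cycles V (H \<union> C)\<close> assms(1) by (auto simp: cyc_def)
  moreover have "finite {D \<in> isolated_cycles V H. card D \<in> Ls}"
  proof (rule finite_subset[OF _ finite_Pow_iff[THEN iffD2, OF finU]])
    show "{D \<in> isolated_cycles V H. card D \<in> Ls} \<subseteq> Pow U"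
      using isolated_cycles_cycles[of V H] assms(2) by (auto simp: cycles_of_def)
  qed
  ultimately show ?thesis unfolding X_def by simp
qed

text \<open>
  The approximate differential equation for the characteristic function: exactly as for a Poisson
  variable, \<open>phi' t = \<i> * Lam * iexp t * phi t\<close> up to a small error.
\<close>

lemma biased_avg:
  assumes "0 \<le> s"
  shows "norm (avg U M (\<lambda>G. of_nat (X G) * iexp (s * real (X G))) - of_real (Lam M) * iexp s * phi s)
    \<le> (B1 + B3) + s * (Lam M * B1 + B2)"
proof -
  define f where "f G = iexp (s * real (X G))" for G
  have nf: "norm (f G) = 1" for G by (simp add: f_def)
  \<comment> \<open>The factor \<open>X G\<close> is expanded over the cycles, and the average is
    conditioned on each of them. The rest of the estimate replaces the conditional average for
    \<open>C\<close> by \<open>iexp s * avg U M f\<close> in three moves.\<close>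
  have "avg U M (\<lambda>G. of_nat (X G) * f G)
      = avg U M (\<lambda>G. \<Sum>C\<in>cyc. if C \<subseteq> G then (if treelike (\<Union>C) C G then f G else 0) else 0)"
  proof (rule avg_cong)
    fix G assume G: "G \<subseteq> U"
    have "complex_of_nat (X G) = of_real (real (X G))" by simp
    also have "\<dots> = of_real (\<Sum>C\<in>cyc. if C \<subseteq> G \<and> treelike (\<Union>C) C G then 1 else 0)"
      by (simp only: X_eq[OF G])
    finally have 0: "complex_of_nat (X G) = of_real (\<Sum>C\<in>cyc. if C \<subseteq> G \<and> treelike (\<Union>C) C G then 1 else 0)" .
    show "of_nat (X G) * f G = (\<Sum>C\<in>cyc. if C \<subseteq> G then (if treelike (\<Union>C) C G then f G else 0) else 0)"
      unfolding 0 of_real_sum sum_distrib_right by (rule sum.cong) auto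
  qed
  also have "\<dots> = (\<Sum>C\<in>cyc. of_real (p C) * avg (U - C) (M - card C) (\<lambda>H. if treelike (\<Union>C) C (H \<union> C) then f (H \<union> C) else 0))"
    unfolding avg_sum by (intro sum.cong refl avg_supersets) (use MN in \<open>auto dest: cyc_sub\<close>)
  finally have 1: "avg U M (\<lambda>G. of_nat (X G) * f G)
     = (\<Sum>C\<in>cyc. of_real (p C) * avg (U - C) (M - card C) (\<lambda>H. if treelike (\<Union>C) C (H \<union> C) then f (H \<union> C) else 0))" .
  have 2: "norm (avg U M (\<lambda>G. of_nat (X G) * f G) - of_real (Lam M) * iexp s * avg U M f)
      \<le> (\<Sum>C\<in>cyc. p C * norm (avg (U - C) (M - card C) (\<lambda>H. if treelike (\<Union>C) C (H \<union> C) then f (H \<union> C) else 0) - iexp s * avg U M f))"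
  proof -
    have "of_real (Lam M) * iexp s * avg U M f = (\<Sum>C\<in>cyc. of_real (p C) * (iexp s * avg U M f))"
      by (simp add: Lam_def sum_distrib_right mult.assoc)
    then have "avg U M (\<lambda>G. of_nat (X G) * f G) - of_real (Lam M) * iexp s * avg U M f
      = (\<Sum>C\<in>cyc. of_real (p C) * (avg (U - C) (M - card C) (\<lambda>H. if treelike (\<Union>C) C (H \<union> C) then f (H \<union> C) else 0) - iexp s * avg U M f))"
      unfolding 1 by (simp add: sum_subtractf[symmetric] right_diff_distrib)
    then show ?thesis using p_nonneg by (auto intro!: order_trans[OF norm_sum] simp: norm_mult)
  qed
  have 3: "p C * norm (avg (U - C) (M - card C) (\<lambda>H. if treelike (\<Union>C) C (H \<union> C) then f (H \<union> C) else 0) - iexp s * avg U M f)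
     \<le> p C * (bad C + 2 * (real (card C) * real M / real N) + s * (B1 + (Lam M - Lam (M - card C))))"
    if C: "C \<in> cyc" for C
  proof (cases "card C \<le> M")
    case True
    let ?m = "M - card C"
    \<comment> \<open>First move: if \<open>C\<close> is isolated, then deleting it lowers the count
      by one and splits off the factor \<open>iexp s\<close>.\<close>
    have A1: "norm (avg (U - C) ?m (\<lambda>H. if treelike (\<Union>C) C (H \<union> C) then f (H \<union> C) else 0) - iexp s * avg (U - C) ?m f) \<le> bad C"
    proof -
      have "avg (U - C) ?m (\<lambda>H. if treelike (\<Union>C) C (H \<union> C) then f (H \<union> C) else 0) - iexp s * avg (U - C) ?m f
        = avg (U - C) ?m (\<lambda>H. (if treelike (\<Union>C) C (H \<union> C) then f (H \<union> C) else 0) - iexp s * f H)"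
        by (simp only: avg_diff avg_cmult)
      also have "norm \<dots> \<le> avg (U - C) ?m (\<lambda>H. norm ((if treelike (\<Union>C) C (H \<union> C) then f (H \<union> C) else 0) - iexp s * f H))"
        by (rule norm_avg_le)
      also have "\<dots> \<le> avg (U - C) ?m (\<lambda>H. if treelike (\<Union>C) C (H \<union> C) then 0 else 1)"
      proof (rule avg_mono)
        fix H assume H: "H \<subseteq> U - C"
        show "norm ((if treelike (\<Union>C) C (H \<union> C) then f (H \<union> C) else 0) - iexp s * f H) \<le> (if treelike (\<Union>C) C (H \<union> C) then 0 else 1)"
        proof (cases "treelike (\<Union>C) C (H \<union> C)")
          case True
          then have "f (H \<union> C) = iexp s * f H"
            using X_insert_isolated[OF C H True] by (simp add: f_def algebra_simps flip: exp_add)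
          then show ?thesis using True by simp
        next
          case False
          then show ?thesis using nf by (simp add: norm_mult)
        qed
      qed
      finally show ?thesis by (simp add: bad_def)
    qed
    have mle: "?m \<le> N - card C" using MN by simp
    \<comment> \<open>Second move: the remaining edges need no longer avoid
      \<open>C\<close>.\<close>
    have A2: "norm (avg (U - C) ?m f - avg U ?m f) \<le> 2 * (real (card C) * real M / real N)"
    proof -
      have "norm (avg (U - C) ?m f - avg U ?m f) \<le> 2 * (real (card C) * real ?m / real N)"
        by (rule norm_avg_avoid_le) (use C mle nf in \<open>auto dest: cyc_sub\<close>)
      also have "\<dots> \<le> 2 * (real (card C) * real M / real N)"
        by (intro mult_left_mono divide_right_mono) auto
      finally show ?thesis .
    qed
    \<comment> \<open>Third move: the number of edges is restored to \<open>M\<close> by the nested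
      coupling, with \<open>X_diff_le\<close> as the pointwise bound.\<close>
    have A3: "norm (avg U M f - avg U ?m f) \<le> s * (B1 + (Lam M - Lam ?m))"
    proof -
      have "norm (avg U M f - avg U ?m f) \<le> avg U M (\<lambda>G. s * (Y G - real (X G))) + (avg U M (\<lambda>G. s * Y G) - avg U ?m (\<lambda>G. s * Y G))"
      proof (rule norm_avg_diff_le[OF finU _ MN])
        fix G H assume GH: "G \<subseteq> U" "H \<subseteq> G"
        have "norm (f G - f H) \<le> \<bar>s * real (X G) - s * real (X H)\<bar>"
          unfolding f_def by (rule norm_iexp_diff_le)
        also have "\<dots> = s * \<bar>real (X G) - real (X H)\<bar>"
          using assms by (simp add: abs_mult flip: right_diff_distrib)
        also have "\<dots> \<le> s * ((Y G - real (X G)) + (Y G - Y H))"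
          using X_diff_le[OF GH] assms by (rule mult_left_mono)
        finally show "norm (f G - f H) \<le> s * (Y G - real (X G)) + (s * Y G - s * Y H)"
          by (simp add: algebra_simps)
      qed simp
      also have "\<dots> = s * (B1 + (Lam M - Lam ?m))"
        using avg_Y[OF MN] avg_Y[of ?m] MN by (simp only: avg_cmult avg_bad) (simp add: algebra_simps)
      finally show ?thesis .
    qed
    have "norm (avg (U - C) ?m (\<lambda>H. if treelike (\<Union>C) C (H \<union> C) then f (H \<union> C) else 0) - iexp s * avg U M f)
       = norm ((avg (U - C) ?m (\<lambda>H. if treelike (\<Union>C) C (H \<union> C) then f (H \<union> C) else 0) - iexp s * avg (U - C) ?m f)
         + iexp s * (avg (U - C) ?m f - avg U ?m f) - iexp s * (avg U M f - avg U ?m f))"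
      by (simp add: algebra_simps)
    also have "\<dots> \<le> norm (avg (U - C) ?m (\<lambda>H. if treelike (\<Union>C) C (H \<union> C) then f (H \<union> C) else 0) - iexp s * avg (U - C) ?m f)
        + norm (iexp s * (avg (U - C) ?m f - avg U ?m f)) + norm (iexp s * (avg U M f - avg U ?m f))"
      by (intro order_trans[OF norm_triangle_ineq4] add_mono norm_triangle_ineq order_refl)
    also have "\<dots> \<le> bad C + 2 * (real (card C) * real M / real N) + s * (B1 + (Lam M - Lam ?m))"
      using A1 A2 A3 by (simp add: norm_mult)
    finally show ?thesis by (intro mult_left_mono p_nonneg)
  next
    case False
    then show ?thesis by (simp add: incl_prob_eq_0)
  qed
  have "norm (avg U M (\<lambda>G. of_nat (X G) * f G) - of_real (Lam M) * iexp s * avg U M f)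
     \<le> (\<Sum>C\<in>cyc. p C * (bad C + 2 * (real (card C) * real M / real N) + s * (B1 + (Lam M - Lam (M - card C)))))"
    using 2 3 by (meson order_trans sum_mono)
  also have "\<dots> = (\<Sum>C\<in>cyc. p C * bad C + p C * (2 * (real (card C) * real M / real N)) + s * (p C * B1 + p C * (Lam M - Lam (M - card C))))"
    by (intro sum.cong refl) (simp only: distrib_left mult.left_commute)
  also have "\<dots> = B1 + B3 + s * (Lam M * B1 + B2)"
    by (simp only: sum.distrib sum_distrib_left[symmetric] sum_distrib_right[symmetric] B1_def[symmetric] B2_def[symmetric] B3_def[symmetric] Lam_def[symmetric])
  finally show ?thesis unfolding f_def phi_def .
qed

lemma bad_nonneg: "0 \<le> bad C" unfolding bad_def by (rule avg_nonneg) auto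

lemma Lam_nonneg: "0 \<le> Lam M"
  unfolding Lam_def by (intro sum_nonneg p_nonneg)

lemma B1_nonneg: "0 \<le> B1" unfolding B1_def by (intro sum_nonneg mult_nonneg_nonneg p_nonneg bad_nonneg)

lemma B3_nonneg: "0 \<le> B3" unfolding B3_def by (intro sum_nonneg mult_nonneg_nonneg p_nonneg) auto

lemma Lam_mono: "m \<le> m' \<Longrightarrow> m' \<le> N \<Longrightarrow> Lam m \<le> Lam m'"
proof -
  assume m: "m \<le> m'" "m' \<le> N"
  have "avg U m Y = avg U m' (\<lambda>G. avg G m Y)" using avg_avg[OF finU m, of Y] by simp
  also have "\<dots> \<le> avg U m' Y"
  proof (rule avg_mono)
    fix G assume G: "G \<subseteq> U" "card G = m'"
    have "Y H \<le> Y G" if "H \<subseteq> G" for H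
      unfolding Y_def by (rule sum_mono) (use that in auto)
    then have "avg G m Y \<le> avg G m (\<lambda>_. Y G)"
      by (intro avg_mono)
    then show "avg G m Y \<le> Y G" using m G finite_subset[OF G(1) finU] by (simp add: avg_const)
  qed
  finally show ?thesis using m avg_Y by simp
qed

lemma B2_nonneg: "0 \<le> B2"
  unfolding B2_def by (intro sum_nonneg mult_nonneg_nonneg p_nonneg) (use Lam_mono MN in simp)

lemma phi_minus: "phi (- t) = cnj (phi t)"
  unfolding phi_def avg_def by (simp add: exp_cnj)

text \<open>Integrates the approximate differential equation by means of the factor
  \<open>exp (- Lam M * (iexp t - 1))\<close>. Its modulus at \<open>s\<close> is
  \<open>exp (Lam M * (1 - cos s))\<close>, which increases on the interval from 0 to
  \<open>pi\<close>, so its largest value is at the end point. There it is cancelled exactly when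
  the factor is divided out, and no exponential of \<open>Lam M\<close> remains.\<close>

lemma phi_approx_nonneg:
  assumes "0 \<le> t" "t \<le> pi"
  shows "norm (phi t - exp (of_real (Lam M) * (iexp t - 1))) \<le> t * ((B1 + B3) + t * (Lam M * B1 + B2))"
proof (cases "t = 0")
  case True
  have "phi 0 = 1" using MN by (simp add: phi_def avg_const)
  then show ?thesis using True by simp
next
  case False
  then have t: "0 < t" using assms by simp
  define err where "err = (B1 + B3) + t * (Lam M * B1 + B2)"
  \<comment> \<open>Defined for complex arguments so that the rules for complex derivatives apply;
    only its restriction to the real line matters.\<close>
  define F where "F z = (\<Sum>G\<in>subsets_of_card U M. exp (\<i> * z * of_nat (X G))) / of_nat (N choose M) * exp (- of_real (Lam M) * (exp (\<i> * z) - 1))" for z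
  define F' where "F' z = (\<Sum>G\<in>subsets_of_card U M. \<i> * of_nat (X G) * exp (\<i> * z * of_nat (X G))) / of_nat (N choose M) * exp (- of_real (Lam M) * (exp (\<i> * z) - 1))
     + (\<Sum>G\<in>subsets_of_card U M. exp (\<i> * z * of_nat (X G))) / of_nat (N choose M) * (- of_real (Lam M) * \<i> * exp (\<i> * z) * exp (- of_real (Lam M) * (exp (\<i> * z) - 1)))" for z
  have D: "(F has_field_derivative F' z) (at z)" for z
  proof -
    have "((\<lambda>z. exp (\<i> * z * of_nat (X G))) has_field_derivative \<i> * of_nat (X G) * exp (\<i> * z * of_nat (X G))) (at z)" for G
      by (auto intro!: derivative_eq_intros)
    then have 1: "((\<lambda>z. (\<Sum>G\<in>subsets_of_card U M. exp (\<i> * z * of_nat (X G))) / of_nat (N choose M)) has_field_derivative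
      (\<Sum>G\<in>subsets_of_card U M. \<i> * of_nat (X G) * exp (\<i> * z * of_nat (X G))) / of_nat (N choose M)) (at z)"
      by (intro DERIV_cdivide DERIV_sum)
    have 2: "((\<lambda>z. exp (- of_real (Lam M) * (exp (\<i> * z) - 1))) has_field_derivative
      - of_real (Lam M) * \<i> * exp (\<i> * z) * exp (- of_real (Lam M) * (exp (\<i> * z) - 1))) (at z)"
      by (auto intro!: derivative_eq_intros)
    show ?thesis using DERIV_mult[OF 1 2] unfolding F_def F'_def by (simp only: mult.commute add.commute)
  qed
  have Fe: "F (of_real s) = phi s * exp (- of_real (Lam M) * (iexp s - 1))" for s
    unfolding F_def phi_def avg_def by (simp add: mult_ac)
  have F'e: "F' (of_real s) = \<i> * (avg U M (\<lambda>G. of_nat (X G) * iexp (s * real (X G))) - of_real (Lam M) * iexp s * phi s) * exp (- of_real (Lam M) * (iexp s - 1))" for s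
  proof -
    have 1: "exp (\<i> * complex_of_real s * of_nat (X G)) = iexp (s * real (X G))" for G
      by (simp add: mult.assoc)
    have 2: "(\<Sum>G\<in>subsets_of_card U M. \<i> * of_nat (X G) * iexp (s * real (X G)))
       = \<i> * (\<Sum>G\<in>subsets_of_card U M. of_nat (X G) * iexp (s * real (X G)))"
      by (simp only: sum_distrib_left mult.assoc)
    have ring: "\<i> * a / c * e + b / c * (- L * \<i> * x * e) = \<i> * (a / c - L * x * (b / c)) * e" for a b c e L x :: complex
      by (simp add: divide_inverse algebra_simps)
    show ?thesis unfolding F'_def phi_def avg_def 1 2 by (rule ring)
  qed
  have vd: "((\<lambda>s. F (of_real s)) has_vector_derivative F' (of_real s)) (at s)" for s
    by (rule has_vector_derivative_real_field[OF D])
  have "\<exists>s\<in>{0<..<t}. norm (F (of_real t) - F (of_real 0)) \<le> norm ((t - 0) *\<^sub>R F' (of_real s))"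
  proof (rule mvt_general[OF t])
    show "continuous_on {0..t} (\<lambda>s. F (of_real s))"
      by (rule continuous_at_imp_continuous_on) (use vd has_vector_derivative_continuous in blast)
    show "((\<lambda>s. F (of_real s)) has_derivative (\<lambda>h. h *\<^sub>R F' (of_real s))) (at s)" for s
      using vd by (simp add: has_vector_derivative_def)
  qed
  then obtain s where s: "0 < s" "s < t" "norm (F (of_real t) - F (of_real 0)) \<le> t * norm (F' (of_real s))"
    using t by auto
  have ne: "norm (exp (- of_real (Lam M) * (iexp u - 1))) = exp (Lam M * (1 - cos u))" for u
    by (simp add: algebra_simps Re_exp)
  have "norm (F' (of_real s)) = norm (avg U M (\<lambda>G. of_nat (X G) * iexp (s * real (X G))) - of_real (Lam M) * iexp s * phi s) * exp (Lam M * (1 - cos s))"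
    unfolding F'e norm_mult ne by simp
  \<comment> \<open>Monotonicity of \<open>1 - cos\<close> is used here; it is the reason for the
    restriction to \<open>t \<le> pi\<close>.\<close>
  also have "\<dots> \<le> err * exp (Lam M * (1 - cos t))"
  proof (intro mult_mono)
    have "norm (avg U M (\<lambda>G. of_nat (X G) * iexp (s * real (X G))) - of_real (Lam M) * iexp s * phi s) \<le> (B1 + B3) + s * (Lam M * B1 + B2)"
      using s by (intro biased_avg) simp
    also have "\<dots> \<le> err" unfolding err_def
      using s B1_nonneg B2_nonneg Lam_nonneg by (intro add_left_mono mult_right_mono) auto
    finally show "norm (avg U M (\<lambda>G. of_nat (X G) * iexp (s * real (X G))) - of_real (Lam M) * iexp s * phi s) \<le> err" .
    have "cos t \<le> cos s" using s assms by (intro cos_monotone_0_pi_le) auto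
    then show "exp (Lam M * (1 - cos s)) \<le> exp (Lam M * (1 - cos t))"
      using Lam_nonneg by (simp add: mult_left_mono)
    show "0 \<le> err" unfolding err_def using t B1_nonneg B2_nonneg B3_nonneg Lam_nonneg by simp
  qed simp
  finally have "norm (F (of_real t) - F (of_real 0)) \<le> t * (err * exp (Lam M * (1 - cos t)))"
    using s(3) t by (meson mult_left_mono order_less_imp_le order_trans)
  moreover have "F (of_real 0) = 1" using MN unfolding Fe by (simp add: phi_def avg_const)
  ultimately have *: "norm (phi t * exp (- of_real (Lam M) * (iexp t - 1)) - 1) \<le> t * (err * exp (Lam M * (1 - cos t)))"
    by (simp only: Fe)
  have "phi t - exp (of_real (Lam M) * (iexp t - 1)) = exp (of_real (Lam M) * (iexp t - 1)) * (phi t * exp (- of_real (Lam M) * (iexp t - 1)) - 1)"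
    by (simp add: right_diff_distrib mult.left_commute flip: exp_add)
  also have "norm \<dots> \<le> exp (- (Lam M * (1 - cos t))) * (t * (err * exp (Lam M * (1 - cos t))))"
  proof -
    have "norm (exp (of_real (Lam M) * (iexp t - 1))) = exp (- (Lam M * (1 - cos t)))"
      by (simp add: algebra_simps Re_exp)
    then show ?thesis unfolding norm_mult using * by (intro mult_mono) auto
  qed
  also have "\<dots> = t * err"
  proof -
    have "exp (- a) * (t * (err * exp a)) = t * err" for a :: real by (simp add: exp_minus)
    then show ?thesis .
  qed
  finally show ?thesis by (simp only: err_def)
qed

theorem phi_approx:
  assumes "\<bar>t\<bar> \<le> pi"
  shows "norm (phi t - exp (of_real (Lam M) * (iexp t - 1))) \<le> \<bar>t\<bar> * ((B1 + B3) + \<bar>t\<bar> * (Lam M * B1 + B2))"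
proof (cases "0 \<le> t")
  case True
  then show ?thesis using phi_approx_nonneg[of t] assms by simp
next
  case False
  have "phi t - exp (of_real (Lam M) * (iexp t - 1)) = cnj (phi (-t) - exp (of_real (Lam M) * (iexp (-t) - 1)))"
    using phi_minus[of "-t"] by (simp add: exp_cnj)
  then show ?thesis using phi_approx_nonneg[of "-t"] assms False by (simp only: complex_mod_cnj) simp
qed

end

subsection \<open>Comparing component probabilities at two densities\<close>

text \<open>
  The number of ways to complete \<open>A\<close> to a treelike component on \<open>k\<close> vertices does not depend on
  the number of edges of the random graph, so the likelihood ratio of the event at two densities is
  an explicit quotient of binomial coefficients.
\<close>

definition comp_prob :: "'a set \<Rightarrow> 'a set \<Rightarrow> 'a set set \<Rightarrow> nat \<Rightarrow> nat \<Rightarrow> real" where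
  "comp_prob V S A M k = avg (pairs V - A) (M - card A)
     (\<lambda>H. if treelike S A (H \<union> A) \<and> card (rooted_comp S (H \<union> A)) = k then 1 else 0)"

text \<open>Probability that a uniform \<open>m\<close>-subset of an \<open>N\<close>-set contains
  \<open>u\<close> given elements and takes the others from \<open>Q\<close> allowed ones. Here the
  former are the edges of a given shape, and the latter are the pairs disjoint from it.\<close>

definition comp_weight :: "nat \<Rightarrow> nat \<Rightarrow> nat \<Rightarrow> nat \<Rightarrow> real" where
  "comp_weight Q N u m = (if u \<le> m then real (Q choose (m - u)) / real (N choose m) else 0)"

lemma comp_prob_nonneg: "0 \<le> comp_prob V S A M k"
  unfolding comp_prob_def by (rule avg_nonneg) auto

lemma comp_weight_nonneg: "0 \<le> comp_weight Q N u m"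
  by (simp add: comp_weight_def)

context rooted_graphs
begin

lemma comp_prob_eq:
  "comp_prob V S A M k = real (card (treelike_shapes V S A k)) *
     comp_weight ((n - k) choose 2) (card (pairs V) - card A) (k - l) (M - card A)"
proof -
  let ?U = "pairs V" and ?P = "\<lambda>G. treelike S A G \<and> card (rooted_comp S G) = k"
  let ?c = "real ((card (pairs V) - card A) choose (M - card A))"
  have finU: "finite ?U" using fin by simp
  have "(\<Sum>H\<in>subsets_of_card (?U - A) (M - card A). if ?P (H \<union> A) then 1 else 0 :: real)
      = (\<Sum>G | G \<in> subsets_of_card ?U M \<and> A \<subseteq> G. if ?P G then 1 else 0)"
    using sum_supersets[OF finU A_pairs AM, of "\<lambda>G. if ?P G then 1 else 0 :: real"] by simp
  also have "\<dots> = real (card {G \<in> {G \<in> subsets_of_card ?U M. A \<subseteq> G}. ?P G})"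
    using finU by (simp add: sum.inter_filter[symmetric])
  also have "{G \<in> {G \<in> subsets_of_card ?U M. A \<subseteq> G}. ?P G}
      = {G \<in> subsets_of_card ?U M. A \<subseteq> G \<and> treelike S A G \<and> card (rooted_comp S G) = k}" by auto
  also have "card \<dots> = card (treelike_shapes V S A k) *
      (if card A + (k - l) \<le> M then ((n - k) choose 2) choose (M - (card A + (k - l))) else 0)"
    by (rule card_treelike_graphs[OF fin SV AS])
  finally have *: "(\<Sum>H\<in>subsets_of_card (?U - A) (M - card A). if ?P (H \<union> A) then 1 else 0 :: real)
     = real (card (treelike_shapes V S A k) * (if card A + (k - l) \<le> M then ((n - k) choose 2) choose (M - (card A + (k - l))) else 0))" .
  have *: "(\<Sum>H\<in>subsets_of_card (?U - A) (M - card A). if ?P (H \<union> A) then 1 else 0 :: real)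
     = real (card (treelike_shapes V S A k)) * (if k - l \<le> M - card A then real (((n - k) choose 2) choose (M - card A - (k - l))) else 0)"
  proof -
    have "(card A + (k - l) \<le> M) = (k - l \<le> M - card A)" "M - (card A + (k - l)) = M - card A - (k - l)"
      using AM by linarith+
    then show ?thesis using * by simp
  qed
  have "comp_prob V S A M k = (\<Sum>H\<in>subsets_of_card (?U - A) (M - card A). if ?P (H \<union> A) then 1 else 0 :: real) / ?c"
    unfolding comp_prob_def avg_def card_rest by simp
  also have "\<dots> = real (card (treelike_shapes V S A k)) * ((if k - l \<le> M - card A then real (((n - k) choose 2) choose (M - card A - (k - l))) else 0) / ?c)"
    unfolding * by simp
  also have "(if k - l \<le> M - card A then real (((n - k) choose 2) choose (M - card A - (k - l))) else 0) / ?c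
     = comp_weight ((n - k) choose 2) (card (pairs V) - card A) (k - l) (M - card A)"
    by (simp add: comp_weight_def)
  finally show ?thesis .
qed

lemma comp_prob_eq_0: "k < l \<Longrightarrow> comp_prob V S A M k = 0"
proof -
  assume "k < l"
  then have "treelike_shapes V S A k = {}" using card_treelike_shape(2)[OF fin SV AS] by fastforce
  then show ?thesis by (simp add: comp_prob_eq)
qed

text \<open>If the core has as many edges as vertices, a treelike component of size \<open>k\<close>
  has exactly \<open>k\<close> edges. The probability of the core then merges with the conditional
  weight into one weight over all pairs, in which the length of the cycle no longer appears.\<close>

lemma incl_comp_prob_eq:
  assumes "card A = l" "l \<le> k"
  shows "incl_prob (card (pairs V)) M l * comp_prob V S A M k
    = real (card (treelike_shapes V S A k)) * comp_weight ((n - k) choose 2) (card (pairs V)) k M"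
proof -
  have c: "real ((card (pairs V) - l) choose (M - l)) = incl_prob (card (pairs V)) M l * real (card (pairs V) choose M)"
    using incl_prob_choose[of l M "card (pairs V)"] AM MN assms by simp
  have "real ((card (pairs V) - l) choose (M - l)) \<noteq> 0" "real (card (pairs V) choose M) \<noteq> 0"
    using MN AM assms by auto
  then have "incl_prob (card (pairs V)) M l * comp_weight ((n - k) choose 2) (card (pairs V) - l) (k - l) (M - l)
     = comp_weight ((n - k) choose 2) (card (pairs V)) k M"
    using c AM assms unfolding comp_weight_def by auto
  then show ?thesis unfolding comp_prob_eq assms(1) by (simp add: mult.left_commute)
qed

lemma avg_by_comp:
  "(\<Sum>k\<in>K. f k * comp_prob V S A M k) = avg (pairs V - A) (M - card A)
     (\<lambda>H. \<Sum>k\<in>K. f k * (if treelike S A (H \<union> A) \<and> card (rooted_comp S (H \<union> A)) = k then 1 else 0))"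
  unfolding comp_prob_def avg_sum avg_cmult ..

lemma sum_comp_prob_le_1: "finite K \<Longrightarrow> (\<Sum>k\<in>K. comp_prob V S A M k) \<le> 1"
proof -
  assume K: "finite K"
  have "(\<Sum>k\<in>K. comp_prob V S A M k) = (\<Sum>k\<in>K. 1 * comp_prob V S A M k)" by simp
  also have "\<dots> \<le> avg (pairs V - A) (M - card A) (\<lambda>_. 1)"
    unfolding avg_by_comp
  proof (rule avg_mono)
    fix H
    show "(\<Sum>k\<in>K. 1 * (if treelike S A (H \<union> A) \<and> card (rooted_comp S (H \<union> A)) = k then 1 else 0)) \<le> (1 :: real)"
      by (cases "treelike S A (H \<union> A)") (use K in \<open>auto simp: sum.delta'\<close>)
  qed
  also have "\<dots> = 1" using fin rest_le by (simp add: avg_const)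
  finally show ?thesis .
qed

lemma sum_comp_prob_weighted_le:
  assumes "finite K" "rho < 1"
  shows "(\<Sum>k\<in>K. real k * comp_prob V S A M k) \<le> real l / (1 - rho)"
proof -
  have "(\<Sum>k\<in>K. real k * comp_prob V S A M k)
     \<le> avg (pairs V - A) (M - card A) (\<lambda>H. real (card (rooted_comp S (H \<union> A))))"
    unfolding avg_by_comp
  proof (rule avg_mono)
    fix H
    show "(\<Sum>k\<in>K. real k * (if treelike S A (H \<union> A) \<and> card (rooted_comp S (H \<union> A)) = k then 1 else 0))
       \<le> real (card (rooted_comp S (H \<union> A)))"
      by (cases "treelike S A (H \<union> A)") (use assms(1) in \<open>auto simp: if_distrib sum.delta' cong: if_cong\<close>)
  qed
  then show ?thesis using expected_comp_le[OF assms(2)] by linarith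
qed

text \<open>Two things can go wrong: the component is not treelike, which the lasso bound controls,
  or it is larger than \<open>b\<close>, which Markov's inequality controls.\<close>

lemma sum_comp_prob_ge:
  assumes "rho < 1" "0 < b"
  shows "1 - real l / real n * (real l / (1 - rho) + 1 / (1 - rho)\<^sup>2) - real l / (1 - rho) / b
    \<le> (\<Sum>k | real k \<le> b. comp_prob V S A M k)"
proof -
  let ?U = "pairs V - A" and ?m = "M - card A" and ?K = "{k. real k \<le> b}"
  have finK: "finite ?K" by (rule finite_subset[of _ "{..nat \<lceil>b\<rceil>}"]) (auto simp: le_nat_iff, linarith)
  have "avg ?U ?m (\<lambda>H. 1 - (if treelike S A (H \<union> A) then 0 else 1) - real (card (rooted_comp S (H \<union> A))) / b)
    \<le> (\<Sum>k\<in>?K. 1 * comp_prob V S A M k)"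
    unfolding avg_by_comp
  proof (rule avg_mono)
    fix H
    show "1 - (if treelike S A (H \<union> A) then 0 else 1) - real (card (rooted_comp S (H \<union> A))) / b
      \<le> (\<Sum>k\<in>?K. 1 * (if treelike S A (H \<union> A) \<and> card (rooted_comp S (H \<union> A)) = k then 1 else 0 :: real))"
    proof (cases "treelike S A (H \<union> A) \<and> real (card (rooted_comp S (H \<union> A))) \<le> b")
      case True
      then show ?thesis using finK assms(2) by (simp add: sum.delta')
    next
      case False
      then have "1 - (if treelike S A (H \<union> A) then 0 else 1) - real (card (rooted_comp S (H \<union> A))) / b \<le> 0"
        using assms(2) by (auto simp: field_simps)
      also have "0 \<le> (\<Sum>k\<in>?K. 1 * (if treelike S A (H \<union> A) \<and> card (rooted_comp S (H \<union> A)) = k then 1 else 0 :: real))"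
        by (rule sum_nonneg) auto
      finally show ?thesis .
    qed
  qed
  moreover have "avg ?U ?m (\<lambda>H. 1 - (if treelike S A (H \<union> A) then 0 else 1) - real (card (rooted_comp S (H \<union> A))) / b)
    = 1 - avg ?U ?m (\<lambda>H. if treelike S A (H \<union> A) then 0 else 1) - avg ?U ?m (\<lambda>H. real (card (rooted_comp S (H \<union> A)))) / b"
  proof -
    have "avg ?U ?m (\<lambda>H. (1 / b) * real (card (rooted_comp S (H \<union> A)))) = (1 / b) * avg ?U ?m (\<lambda>H. real (card (rooted_comp S (H \<union> A))))"
      by (rule avg_cmult)
    then show ?thesis using fin rest_le by (simp add: avg_diff avg_const)
  qed
  moreover have "avg ?U ?m (\<lambda>H. real (card (rooted_comp S (H \<union> A)))) / b \<le> real l / (1 - rho) / b"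
    using expected_comp_le[OF assms(1)] assms(2) by (intro divide_right_mono) auto
  ultimately show ?thesis using prob_not_treelike_le[OF assms(1)] by simp
qed

end

section \<open>Effect of one additional edge on the weights\<close>

lemma choose_Suc_real: "real (Q choose Suc j) * (real j + 1) = real (Q choose j) * (real Q - real j)"
proof (cases "j \<le> Q")
  case True
  have "Suc j * (Q choose Suc j) = (Q - j) * (Q choose j)"
    using binomial_absorption[of j Q] binomial_absorb_comp[of Q j] by simp
  then have "real (Suc j) * real (Q choose Suc j) = real (Q - j) * real (Q choose j)" by (metis of_nat_mult)
  then show ?thesis using True by (simp add: of_nat_diff algebra_simps)
next
  case False
  then show ?thesis by (simp add: binomial_eq_0)
qed

lemma comp_weight_Suc:
  assumes "u \<le> i" "i < N"
  shows "comp_weight Q N u (Suc i) * ((real i + 1 - real u) * (real N - real i))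
       = comp_weight Q N u i * ((real Q - real i + real u) * (real i + 1))"
proof -
  have c: "real (N choose Suc i) \<noteq> 0" "real (N choose i) \<noteq> 0" using assms by auto
  have 1: "real (Q choose Suc (i - u)) * (real i - real u + 1) = real (Q choose (i - u)) * (real Q - real i + real u)"
    using choose_Suc_real[of Q "i - u"] assms by (simp add: of_nat_diff algebra_simps)
  have 2: "real (N choose Suc i) * (real i + 1) = real (N choose i) * (real N - real i)"
    by (rule choose_Suc_real)
  have s: "Suc i - u = Suc (i - u)" using assms by simp
  have "real (Q choose Suc (i - u)) / real (N choose Suc i) * ((real i + 1 - real u) * (real N - real i))
     = (real (Q choose Suc (i - u)) * (real i - real u + 1)) * (real N - real i) / real (N choose Suc i)"
  proof -
    have "a / c * ((x + 1 - y) * z) = a * (x - y + 1) * z / c" for a c x y z :: real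
      by (simp add: add_diff_eq diff_add_eq)
    then show ?thesis .
  qed
  also have "\<dots> = real (Q choose (i - u)) * (real Q - real i + real u) * (real N - real i) / real (N choose Suc i)"
    unfolding 1 ..
  also have "(real N - real i) / real (N choose Suc i) = (real i + 1) / real (N choose i)"
    using 2 c by (simp add: field_simps)
  then have "real (Q choose (i - u)) * (real Q - real i + real u) * (real N - real i) / real (N choose Suc i)
     = real (Q choose (i - u)) * (real Q - real i + real u) * ((real i + 1) / real (N choose i))"
    by (simp only: times_divide_eq_right[symmetric])
  finally show ?thesis using assms unfolding comp_weight_def s by simp
qed

text \<open>
  The quotient of consecutive weights is \<open>1 + num / den\<close>. Near the critical density, where
  \<open>i\<close> is about \<open>n / 2\<close>, the leading terms \<open>k n\<^sup>2 / 2\<close> of \<open>num\<close> cancel.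
\<close>

lemma weight_ratio_lower:
  fixes n k l s i u t B :: real
  assumes "n = t ^ 3" "1 \<le> t" "1 \<le> B" "1 \<le> l" "l \<le> k" "u = k - l" "0 \<le> s" "0 \<le> i"
    and i: "i + s + 1 \<le> n / 2 + B * t\<^sup>2"
    and d1: "n / 4 \<le> i + 1 - u" and d2: "n\<^sup>2 / 4 \<le> n * (n - 1) / 2 - s - i"
  shows "(1 - (8 * l / t ^ 3 + 16 * (1 + 2 * B) * k / t ^ 4)) * ((i + 1 - u) * (n * (n - 1) / 2 - s - i))
     \<le> ((n - k) * (n - k - 1) / 2 - i + u) * (i + 1)"
proof -
  define den where "den = (i + 1 - u) * (n * (n - 1) / 2 - s - i)"
  define num where "num = - (i + 1) * (k * n - k * (k + 1) / 2 - s - u) + u * (n * (n - 1) / 2 - s - i)"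
  have n: "n \<ge> 1" using assms(1,2) by simp
  have nt: "n = t\<^sup>2 * t" using assms(1) by (simp add: power3_eq_cube power2_eq_square)
  have t2: "1 \<le> t\<^sup>2" using assms(2) by simp
  have tn: "t\<^sup>2 \<le> n" unfolding nt using t2 assms(2) by simp
  have eq: "((n - k) * (n - k - 1) / 2 - i + u) * (i + 1) = den + num"
    unfolding den_def num_def by (simp add: field_simps power2_eq_square)
  have "n / 4 * (n\<^sup>2 / 4) \<le> den" unfolding den_def
    using d1 d2 n by (intro mult_mono) auto
  then have den: "n ^ 3 / 16 \<le> den" by (simp add: power3_eq_cube power2_eq_square)
  have k: "0 \<le> k" "0 \<le> u" using assms by auto
  have "0 \<le> (i + 1) * (k * (k + 1) / 2 + s + u)" using assms k by simp
  moreover have "num = - (i + 1) * (k * n) + (i + 1) * (k * (k + 1) / 2 + s + u) + u * (n * (n - 1) / 2 - s - i)"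
    unfolding num_def by (simp add: field_simps)
  ultimately have "num \<ge> - (i + 1) * (k * n) + u * (n * (n - 1) / 2 - s - i)" by linarith
  moreover have "(i + 1) * (k * n) \<le> (n / 2 + B * t\<^sup>2) * (k * n)"
    using i assms(7) k n by (intro mult_right_mono) auto
  moreover have "u * (n * (n - 1) / 2 - s - i) \<ge> k * n\<^sup>2 / 2 - l * n\<^sup>2 / 2 - k * (1 + B) * n"
  proof -
    have "n / 2 + s + i \<le> (1 + B) * n"
    proof -
      have "B * t\<^sup>2 \<le> B * n" using tn assms(3) by (intro mult_left_mono) auto
      moreover have "(1 + B) * n = n + B * n" by (simp add: distrib_right)
      ultimately show ?thesis using i by linarith
    qed
    then have "k * (n / 2 + s + i) \<le> k * ((1 + B) * n)" using k by (intro mult_left_mono) auto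
    moreover have "0 \<le> l * (n / 2 + s + i)" using assms n by simp
    moreover have "u * (n * (n - 1) / 2 - s - i) = k * n\<^sup>2 / 2 - l * n\<^sup>2 / 2 - k * (n / 2 + s + i) + l * (n / 2 + s + i)"
      unfolding assms(6) by (simp add: field_simps power2_eq_square)
    moreover have "k * ((1 + B) * n) = k * (1 + B) * n" by simp
    ultimately show ?thesis by linarith
  qed
  ultimately have "num \<ge> - (n / 2 + B * t\<^sup>2) * (k * n) + (k * n\<^sup>2 / 2 - l * n\<^sup>2 / 2 - k * (1 + B) * n)" by linarith
  also have "- (n / 2 + B * t\<^sup>2) * (k * n) + (k * n\<^sup>2 / 2 - l * n\<^sup>2 / 2 - k * (1 + B) * n) = - (l * n\<^sup>2 / 2 + k * n * (B * t\<^sup>2 + (1 + B)))"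
    by (simp add: algebra_simps power2_eq_square)
  finally have num: "num \<ge> - (l * n\<^sup>2 / 2 + k * n * (B * t\<^sup>2 + (1 + B)))" .
  have "k * n * (B * t\<^sup>2 + (1 + B)) \<le> k * n * ((1 + 2 * B) * t\<^sup>2)"
  proof (rule mult_left_mono)
    have "1 + B \<le> (1 + B) * t\<^sup>2" using t2 assms(3) by simp
    then show "B * t\<^sup>2 + (1 + B) \<le> (1 + 2 * B) * t\<^sup>2" by (simp add: algebra_simps)
  qed (use k n in simp)
  then have num2: "- num \<le> l * n\<^sup>2 / 2 + (1 + 2 * B) * k * n * t\<^sup>2" using num by (simp add: algebra_simps)
  \<comment> \<open>The coefficients 8 and 16 (1 + 2B) are made so that the relative error times the
    lower bound n^3/16 of \<open>den\<close> is exactly the bound just obtained for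
    \<open>- num\<close>.\<close>
  have "(8 * l / t ^ 3 + 16 * (1 + 2 * B) * k / t ^ 4) * (n ^ 3 / 16) = l * n\<^sup>2 / 2 + (1 + 2 * B) * k * n * t\<^sup>2"
    using assms(1,2) by (simp add: field_simps power_numeral_reduce)
  moreover have "(8 * l / t ^ 3 + 16 * (1 + 2 * B) * k / t ^ 4) * (n ^ 3 / 16) \<le> (8 * l / t ^ 3 + 16 * (1 + 2 * B) * k / t ^ 4) * den"
    using den assms k by (intro mult_left_mono) auto
  ultimately have "- num \<le> (8 * l / t ^ 3 + 16 * (1 + 2 * B) * k / t ^ 4) * den" using num2 by linarith
  then show ?thesis unfolding eq den_def[symmetric] by (simp add: algebra_simps)
qed

text \<open>All \<open>k\<close> edges of the component are counted, core included, so no separate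
  term in the cycle length arises. The positive term of order k^2, which the lower bound could
  discard, must be kept here; it is what confines the comparison to \<open>k\<close> of order
  t^2.\<close>

lemma weight_ratio_upper:
  fixes n k i t B :: real
  assumes "n = t ^ 3" "1 \<le> t" "1 \<le> B" "1 \<le> k" "0 \<le> i"
    and i: "n / 2 - B * t\<^sup>2 \<le> i" "i + 1 \<le> n"
    and d1: "n / 4 \<le> i + 1 - k" and d2: "n\<^sup>2 / 4 \<le> n * (n - 1) / 2 - i"
  shows "((n - k) * (n - k - 1) / 2 - i + k) * (i + 1)
    \<le> (1 + (16 * B * k / t ^ 4 + 32 * k\<^sup>2 / t ^ 6)) * ((i + 1 - k) * (n * (n - 1) / 2 - i))"
proof -
  define den where "den = (i + 1 - k) * (n * (n - 1) / 2 - i)"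
  define num where "num = - (i + 1) * (k * n - k * (k + 1) / 2 - k) + k * (n * (n - 1) / 2 - i)"
  have n: "n \<ge> 1" using assms(1,2) by simp
  have eq: "((n - k) * (n - k - 1) / 2 - i + k) * (i + 1) = den + num"
    unfolding den_def num_def by (simp add: field_simps power2_eq_square)
  have "n / 4 * (n\<^sup>2 / 4) \<le> den" unfolding den_def
    using d1 d2 n by (intro mult_mono) auto
  then have den: "n ^ 3 / 16 \<le> den" by (simp add: power3_eq_cube power2_eq_square)
  have "num = - (i + 1) * (k * n) + (i + 1) * (k * (k + 3) / 2) + k * (n\<^sup>2 / 2) - k * (n / 2 + i)"
    unfolding num_def by (simp add: field_simps power2_eq_square)
  also have "\<dots> \<le> - (n / 2 - B * t\<^sup>2) * (k * n) + n * (2 * k\<^sup>2) + k * (n\<^sup>2 / 2) - 0"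
  proof (intro add_mono diff_mono order_refl)
    show "- (i + 1) * (k * n) \<le> - (n / 2 - B * t\<^sup>2) * (k * n)"
      using i assms n by (intro mult_right_mono) auto
    have "k * (k + 3) / 2 \<le> 2 * k\<^sup>2" using assms(4) by (simp add: power2_eq_square)
    then show "(i + 1) * (k * (k + 3) / 2) \<le> n * (2 * k\<^sup>2)"
      using i assms n by (intro mult_mono) auto
    show "0 \<le> k * (n / 2 + i)" using assms n by simp
  qed
  also have "\<dots> = B * k * n * t\<^sup>2 + 2 * n * k\<^sup>2" by (simp add: algebra_simps power2_eq_square)
  finally have num: "num \<le> B * k * n * t\<^sup>2 + 2 * n * k\<^sup>2" .
  have "(16 * B * k / t ^ 4 + 32 * k\<^sup>2 / t ^ 6) * (n ^ 3 / 16) = B * k * n * t\<^sup>2 + 2 * n * k\<^sup>2"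
    using assms(1,2) by (simp add: field_simps power_numeral_reduce)
  moreover have "(16 * B * k / t ^ 4 + 32 * k\<^sup>2 / t ^ 6) * (n ^ 3 / 16) \<le> (16 * B * k / t ^ 4 + 32 * k\<^sup>2 / t ^ 6) * den"
    using den assms by (intro mult_left_mono) auto
  ultimately have "num \<le> (16 * B * k / t ^ 4 + 32 * k\<^sup>2 / t ^ 6) * den" using num by linarith
  then show ?thesis unfolding eq den_def[symmetric] by (simp add: algebra_simps)
qed

text \<open>Bernoulli's inequality along the steps. For \<open>d > 1\<close> the factor may be
  negative and the induction breaks down, but then the claimed lower bound is not positive.\<close>

lemma iterate_lower:
  fixes w :: "nat \<Rightarrow> real"
  assumes "m0 \<le> m" "0 \<le> d" "\<And>i. 0 \<le> w i" "\<And>i. m0 \<le> i \<Longrightarrow> i < m \<Longrightarrow> (1 - d) * w i \<le> w (Suc i)"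
  shows "(1 - real (m - m0) * d) * w m0 \<le> w m"
  using assms(1,4)
proof (induction rule: dec_induct)
  case (step j)
  then have IH: "(1 - real (j - m0) * d) * w m0 \<le> w j" by simp
  have st: "(1 - d) * w j \<le> w (Suc j)" using step by simp
  have e: "real (Suc j - m0) = real (j - m0) + 1" using step by (simp add: Suc_diff_le)
  show ?case
  proof (cases "d \<le> 1")
    case True
    have "(1 - real (Suc j - m0) * d) * w m0 \<le> (1 - d) * ((1 - real (j - m0) * d) * w m0)"
    proof -
      have "0 \<le> real (j - m0) * d * d * w m0" using assms(2,3) by simp
      then show ?thesis unfolding e by (simp add: algebra_simps)
    qed
    also have "\<dots> \<le> (1 - d) * w j" using IH True by (intro mult_left_mono) auto
    finally show ?thesis using st by linarith
  next
    case False
    have "1 * 1 \<le> real (Suc j - m0) * d" unfolding e using False by (intro mult_mono) auto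
    then have "1 - real (Suc j - m0) * d \<le> 0" by linarith
    then have "(1 - real (Suc j - m0) * d) * w m0 \<le> 0" using assms(3) by (rule mult_nonpos_nonneg)
    then show ?thesis using assms(3)[of "Suc j"] by linarith
  qed
qed simp

lemma iterate_upper:
  fixes w :: "nat \<Rightarrow> real"
  assumes "m0 \<le> m" "0 \<le> d" "\<And>i. 0 \<le> w i" "\<And>i. m0 \<le> i \<Longrightarrow> i < m \<Longrightarrow> w (Suc i) \<le> (1 + d) * w i"
  shows "w m \<le> exp (real (m - m0) * d) * w m0"
  using assms(1,4)
proof (induction rule: dec_induct)
  case (step j)
  then have IH: "w j \<le> exp (real (j - m0) * d) * w m0" by simp
  have "w (Suc j) \<le> (1 + d) * w j" using step by simp
  also have "\<dots> \<le> exp d * w j" using assms(3) exp_ge_add_one_self[of d] by (intro mult_right_mono) auto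
  also have "\<dots> \<le> exp d * (exp (real (j - m0) * d) * w m0)" using IH by (intro mult_left_mono) auto
  also have "\<dots> = exp (real (Suc j - m0) * d) * w m0"
  proof -
    have "real (Suc j - m0) = real (j - m0) + 1" using step by (simp add: Suc_diff_le)
    then have "real (Suc j - m0) * d = d + real (j - m0) * d" by (simp add: distrib_right)
    then show ?thesis by (simp only: exp_add mult.assoc)
  qed
  finally show ?case .
qed simp

subsection \<open>The critical window\<close>

lemma real_choose_two: "real (x choose 2) = real x * (real x - 1) / 2"
proof (induction x)
  case (Suc x)
  have "Suc x choose 2 = x + (x choose 2)" by (simp add: numeral_2_eq_2)
  then show ?case using Suc by (simp add: field_simps)
qed simp

text \<open>Here t = n^(1/3), so that the window around n/2 has width of order t^2. \<open>B\<close>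
  bounds the position of \<open>M\<close> and \<open>M0\<close> in it, \<open>rho0\<close> says that
  \<open>M0\<close> is subcritical by 1/t, and D t^2 is the largest component size at which the two
  densities are compared. The lower bound on \<open>t\<close> ensures that such components use only
  a small part of the vertices and edges.\<close>

locale critical_window =
  fixes V :: "'a set" and M M0 :: nat and t B D :: real
  assumes fin: "finite V" and nt: "real (card V) = t ^ 3"
    and B: "1 \<le> B" and D: "1 \<le> D" and t: "4 * (1 + B + 2 * D) \<le> t"
    and M0_lower: "real (card V) / 2 - B * t\<^sup>2 \<le> real M0" and M0_le: "M0 \<le> M"
    and M_upper: "real M \<le> real (card V) / 2 + B * t\<^sup>2"
    and M_le: "M \<le> card (pairs V)"
    and rho0: "real (card V) * (real M0 / real (card (pairs V))) \<le> 1 - 1 / t"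
begin

abbreviation "n \<equiv> card V"
abbreviation "N \<equiv> card (pairs V)"

lemma t_ge: "16 \<le> t"
proof -
  have "4 * (1 + B + 2 * D) = 4 + 4 * B + 8 * D" by (simp add: algebra_simps)
  then show ?thesis using t B D by linarith
qed

lemma t2_le: "4 * (1 + B + 2 * D) * t\<^sup>2 \<le> real n"
proof -
  have "4 * (1 + B + 2 * D) * t\<^sup>2 \<le> t * t\<^sup>2" using t by (intro mult_right_mono) auto
  then show ?thesis by (simp add: nt power3_eq_cube power2_eq_square)
qed

lemma t2_ge: "t \<le> t\<^sup>2" "1 \<le> t\<^sup>2" using t_ge by (auto simp: power2_eq_square intro: order_trans[of 1 t])

lemma n_ge: "2 \<le> n"
proof -
  have "4 * 1 * 1 \<le> 4 * (1 + B + 2 * D) * t\<^sup>2" using B D t2_ge by (intro mult_mono) auto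
  then show ?thesis using t2_le by linarith
qed

lemma n_pos: "0 < real n" "0 < (real n)\<^sup>2"
  using n_ge by auto

lemma N_eq: "real N = real n * (real n - 1) / 2"
  using fin by (simp add: card_pairs real_choose_two)

lemma le_M0:
  assumes "real k \<le> D * t\<^sup>2" shows "k \<le> M0"
proof -
  have "0 \<le> D * t\<^sup>2" "0 \<le> B * t\<^sup>2" "0 \<le> t\<^sup>2" using D B by auto
  moreover have "4 * (1 + B + 2 * D) * t\<^sup>2 = 4 * t\<^sup>2 + 4 * (B * t\<^sup>2) + 8 * (D * t\<^sup>2)" by (simp add: algebra_simps)
  ultimately have "real k \<le> real M0" using assms t2_le M0_lower by linarith
  then show ?thesis by simp
qed

lemma bounds:
  assumes "real k \<le> D * t\<^sup>2" "M0 \<le> I" "I < M" "s \<le> k"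
  shows "real n / 4 \<le> real I - real s + 1 - real k" "(real n)\<^sup>2 / 4 \<le> real n * (real n - 1) / 2 - real I"
    "k < n"
proof -
  have d: "D * t\<^sup>2 \<ge> 0" "B * t\<^sup>2 \<ge> 0" "t\<^sup>2 \<ge> 0" using D B by auto
  have e: "4 * (1 + B + 2 * D) * t\<^sup>2 = 4 * t\<^sup>2 + 4 * (B * t\<^sup>2) + 8 * (D * t\<^sup>2)" by (simp add: algebra_simps)
  have s: "real s \<le> real k" "real M0 \<le> real I" "real I + 1 \<le> real M" using assms by auto
  show "real n / 4 \<le> real I - real s + 1 - real k" using s assms(1) t2_le e M0_lower d by linarith
  have "real k < real n" using assms(1) t2_le e d t2_ge by linarith
  then show "k < n" by simp
  have "real I \<le> real n" using s M_upper t2_le e d by linarith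
  moreover have "real n * 16 \<le> real n * real n"
  proof (rule mult_left_mono)
    have "16 * 1 \<le> 4 * (1 + B + 2 * D) * t\<^sup>2" using B D t2_ge by (intro mult_mono) auto
    then show "16 \<le> real n" using t2_le by linarith
  qed simp
  moreover have "real n * (real n - 1) / 2 = real n * real n / 2 - real n / 2" by (simp add: field_simps)
  moreover have "(real n)\<^sup>2 = real n * real n" by (rule power2_eq_square)
  ultimately show "(real n)\<^sup>2 / 4 \<le> real n * (real n - 1) / 2 - real I"
    by linarith
qed

lemma steps_le: "real (M - M0) \<le> 2 * B * t\<^sup>2"
  using M0_lower M_upper M0_le by (simp add: of_nat_diff)

text \<open>The single-step loss from \<open>weight_ratio_lower\<close> is multiplied by the at most
  2 B t^2 steps between \<open>M0\<close> and \<open>M\<close>. The condition relating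
  \<open>card S\<close> and \<open>card A\<close> admits both a cycle and a single root.\<close>

lemma comp_prob_lower:
  assumes SV: "S \<subseteq> V" and AS: "A \<subseteq> pairs S" and l: "1 \<le> card S" "card A \<le> card S" "card S \<le> card A + 1"
    and AM0: "card A \<le> M0" and k: "real k \<le> D * t\<^sup>2"
  shows "(1 - (16 * B * real (card S) / t + 32 * B * (1 + 2 * B) * real k / t\<^sup>2)) * comp_prob V S A M0 k \<le> comp_prob V S A M k"
proof (cases "M0 < M \<and> card S \<le> k")
  case True
  then have MM: "M0 < M" and kl: "card S \<le> k" by auto
  let ?s = "card A" and ?l = "card S"
  have sk: "?s \<le> k" using l kl by simp
  have kM0: "k \<le> M0" and kn: "k < n" using bounds[OF k order_refl MM sk] le_M0[OF k] by auto
  interpret R: rooted_graphs V S A M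
    by unfold_locales (use fin SV AS kM0 sk M_le n_ge M0_le in auto)
  interpret R0: rooted_graphs V S A M0
    by unfold_locales (use fin SV AS kM0 sk M_le n_ge M0_le in auto)
  let ?Q = "(n - k) choose 2" and ?u = "k - ?l"
  let ?w = "comp_weight ?Q (N - ?s) ?u"
  define d where "d = 8 * real ?l / t ^ 3 + 16 * (1 + 2 * B) * real k / t ^ 4"
  have d0: "0 \<le> d" unfolding d_def using B t_ge by simp
  have sN: "?s \<le> N" using sk kM0 M0_le M_le by linarith
  have "(1 - real ((M - ?s) - (M0 - ?s)) * d) * ?w (M0 - ?s) \<le> ?w (M - ?s)"
  proof (rule iterate_lower)
    fix i assume i: "M0 - ?s \<le> i" "i < M - ?s"
    define I where "I = i + ?s"
    have I: "M0 \<le> I" "I < M" using i unfolding I_def by linarith+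
    have iI: "real i = real I - real ?s" unfolding I_def by simp
    note b = bounds[OF k I sk]
    have ui: "?u \<le> i" using i sk kM0 l by linarith
    have iN: "i < N - ?s" using i M_le by linarith
    have real_u: "real ?u = real k - real ?l" using kl by (simp add: of_nat_diff)
    have den: "real n / 4 \<le> real i + 1 - real ?u" using b(1) real_u iI by linarith
    have den2: "(real n)\<^sup>2 / 4 \<le> real n * (real n - 1) / 2 - real ?s - real i" using b(2) iI by linarith
    have Nr: "real (N - ?s) - real i = real n * (real n - 1) / 2 - real ?s - real i"
      using sN N_eq by (simp add: of_nat_diff)
    have Qr: "real ?Q = (real n - real k) * (real n - real k - 1) / 2"
      using kn by (simp add: real_choose_two of_nat_diff)
    have "real i + real ?s + 1 \<le> real n / 2 + B * t\<^sup>2" using I M_upper iI by linarith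
    then have R: "(1 - d) * ((real i + 1 - real ?u) * (real (N - ?s) - real i)) \<le> (real ?Q - real i + real ?u) * (real i + 1)"
      unfolding Nr Qr d_def
      by (intro weight_ratio_lower) (use nt t_ge B l kl real_u den den2 in auto)
    have pos: "0 < (real i + 1 - real ?u) * (real (N - ?s) - real i)"
      unfolding Nr
    proof (rule mult_pos_pos)
      show "0 < real i + 1 - real ?u" using den n_pos by linarith
      show "0 < real n * (real n - 1) / 2 - real ?s - real i" using den2 n_pos by linarith
    qed
    have "(1 - d) * ?w i * ((real i + 1 - real ?u) * (real (N - ?s) - real i))
       = ?w i * ((1 - d) * ((real i + 1 - real ?u) * (real (N - ?s) - real i)))" by (simp only: mult_ac)
    also have "\<dots> \<le> ?w i * ((real ?Q - real i + real ?u) * (real i + 1))"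
      using R comp_weight_nonneg by (intro mult_left_mono)
    also have "\<dots> = ?w (Suc i) * ((real i + 1 - real ?u) * (real (N - ?s) - real i))"
      using comp_weight_Suc[OF ui iN] by simp
    finally show "(1 - d) * ?w i \<le> ?w (Suc i)" using pos by (rule mult_right_le_imp_le)
  qed (use MM d0 comp_weight_nonneg in auto)
  then have 1: "(1 - real ((M - ?s) - (M0 - ?s)) * d) * comp_prob V S A M0 k \<le> comp_prob V S A M k"
    unfolding R.comp_prob_eq R0.comp_prob_eq
    using mult_left_mono[of "(1 - real ((M - ?s) - (M0 - ?s)) * d) * ?w (M0 - ?s)" "?w (M - ?s)" "real (card (treelike_shapes V S A k))"]
    by (simp add: mult.left_commute)
  have "real ((M - ?s) - (M0 - ?s)) * d \<le> 2 * B * t\<^sup>2 * d"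
  proof (rule mult_right_mono[OF _ d0])
    have "(M - ?s) - (M0 - ?s) \<le> M - M0" using sk kM0 MM by linarith
    then show "real ((M - ?s) - (M0 - ?s)) \<le> 2 * B * t\<^sup>2" using steps_le by linarith
  qed
  also have "\<dots> = 16 * B * real ?l / t + 32 * B * (1 + 2 * B) * real k / t\<^sup>2"
    unfolding d_def using t_ge by (simp add: field_simps power_numeral_reduce)
  finally have "(1 - (16 * B * real ?l / t + 32 * B * (1 + 2 * B) * real k / t\<^sup>2)) * comp_prob V S A M0 k
     \<le> (1 - real ((M - ?s) - (M0 - ?s)) * d) * comp_prob V S A M0 k"
    by (intro mult_right_mono comp_prob_nonneg) simp
  then show ?thesis using 1 by linarith
next
  case False
  then consider "M0 = M" | "k < card S" using M0_le by linarith
  then show ?thesis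
  proof cases
    case 1
    have "0 \<le> (16 * B * real (card S) / t + 32 * B * (1 + 2 * B) * real k / t\<^sup>2) * comp_prob V S A M k"
      using B t_ge comp_prob_nonneg by (intro mult_nonneg_nonneg) auto
    then show ?thesis using 1 by (simp add: left_diff_distrib)
  next
    case 2
    interpret R: rooted_graphs V S A M
      by unfold_locales (use fin SV AS AM0 M_le n_ge M0_le in auto)
    interpret R0: rooted_graphs V S A M0
      by unfold_locales (use fin SV AS AM0 M_le n_ge M0_le in auto)
    show ?thesis using R.comp_prob_eq_0[OF 2] R0.comp_prob_eq_0[OF 2] by simp
  qed
qed

text \<open>Over at most 2 B t^2 steps the gain from \<open>weight_ratio_upper\<close> adds up to 32
  B^2 x + 64 B x^2 in the exponent with x = k/t^2, and x is at most \<open>D\<close>. The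
  probability that the cycle is present is included on both sides.\<close>

lemma comp_prob_upper:
  assumes SV: "S \<subseteq> V" and AS: "A \<subseteq> pairs S" and l: "1 \<le> card S" "card A = card S" "card A \<le> M0"
    and k: "real k \<le> D * t\<^sup>2"
  shows "incl_prob N M (card A) * comp_prob V S A M k
    \<le> exp (32 * B\<^sup>2 * D + 64 * B * D\<^sup>2) * (incl_prob N M0 (card A) * comp_prob V S A M0 k)"
proof -
  let ?l = "card S"
  interpret R: rooted_graphs V S A M
    by unfold_locales (use fin SV AS l M_le n_ge M0_le in auto)
  interpret R0: rooted_graphs V S A M0
    by unfold_locales (use fin SV AS l M_le n_ge M0_le in auto)
  let ?Q = "(n - k) choose 2"
  let ?w = "comp_weight ?Q N k"
  show ?thesis
  proof (cases "?l \<le> k")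
    case kl: True
    define d where "d = 16 * B * real k / t ^ 4 + 32 * (real k)\<^sup>2 / t ^ 6"
    have d0: "0 \<le> d" unfolding d_def using B t_ge by simp
    have "?w M \<le> exp (real (M - M0) * d) * ?w M0"
    proof (rule iterate_upper)
      fix i assume i: "M0 \<le> i" "i < M"
      note b = bounds[OF k i, of 0]
      have Nr: "real N - real i = real n * (real n - 1) / 2 - real i" using N_eq by simp
      have Qr: "real ?Q = (real n - real k) * (real n - real k - 1) / 2"
        using b(3) by (simp add: real_choose_two of_nat_diff)
      have "real i + 1 \<le> real n"
      proof -
        have "4 * (1 + B + 2 * D) * t\<^sup>2 = 4 * t\<^sup>2 + 4 * (B * t\<^sup>2) + 8 * (D * t\<^sup>2)" by (simp add: algebra_simps)
        moreover have "0 \<le> D * t\<^sup>2" "0 \<le> B * t\<^sup>2" using D B by auto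
        moreover have "real i + 1 \<le> real M" using i by simp
        ultimately show ?thesis using M_upper t2_le t2_ge by linarith
      qed
      then have R: "(real ?Q - real i + real k) * (real i + 1) \<le> (1 + d) * ((real i + 1 - real k) * (real N - real i))"
        unfolding Nr Qr d_def
        by (intro weight_ratio_upper) (use nt t_ge B l kl b M0_lower i in auto)
      have pos: "0 < (real i + 1 - real k) * (real N - real i)"
        unfolding Nr
      proof (rule mult_pos_pos)
        show "0 < real i + 1 - real k" using b(1) n_pos by simp
        show "0 < real n * (real n - 1) / 2 - real i" using b(2) n_pos by linarith
      qed
      have ki: "k \<le> i" using le_M0[OF k] i by simp
      have iN: "i < N" using i M_le by simp
      have "?w (Suc i) * ((real i + 1 - real k) * (real N - real i)) = ?w i * ((real ?Q - real i + real k) * (real i + 1))"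
        by (rule comp_weight_Suc[OF ki iN])
      also have "\<dots> \<le> ?w i * ((1 + d) * ((real i + 1 - real k) * (real N - real i)))"
        using R comp_weight_nonneg by (intro mult_left_mono)
      also have "\<dots> = (1 + d) * ?w i * ((real i + 1 - real k) * (real N - real i))" by (simp only: mult_ac)
      finally show "?w (Suc i) \<le> (1 + d) * ?w i" using pos by (rule mult_right_le_imp_le)
    qed (use M0_le d0 comp_weight_nonneg in auto)
    also have "\<dots> \<le> exp (32 * B\<^sup>2 * D + 64 * B * D\<^sup>2) * ?w M0"
    proof (intro mult_right_mono comp_weight_nonneg)
      have kt: "real k / t\<^sup>2 \<le> D" using k t_ge by (simp add: field_simps)
      have kt2: "(real k / t\<^sup>2)\<^sup>2 \<le> D\<^sup>2" using kt by (intro power_mono) auto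
      have "real (M - M0) * d \<le> 2 * B * t\<^sup>2 * d" using steps_le d0 by (rule mult_right_mono)
      also have "\<dots> = 32 * B\<^sup>2 * (real k / t\<^sup>2) + 64 * B * (real k / t\<^sup>2)\<^sup>2"
        unfolding d_def using t_ge by (simp add: field_simps power_numeral_reduce)
      also have "\<dots> \<le> 32 * B\<^sup>2 * D + 64 * B * D\<^sup>2"
        using kt kt2 B by (intro add_mono mult_left_mono) auto
      finally show "exp (real (M - M0) * d) \<le> exp (32 * B\<^sup>2 * D + 64 * B * D\<^sup>2)" by simp
    qed
    finally have "real (card (treelike_shapes V S A k)) * ?w M
        \<le> real (card (treelike_shapes V S A k)) * (exp (32 * B\<^sup>2 * D + 64 * B * D\<^sup>2) * ?w M0)"
      by (intro mult_left_mono) auto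
    then show ?thesis
      using R.incl_comp_prob_eq[OF l(2) kl] R0.incl_comp_prob_eq[OF l(2) kl] l(2) by (simp add: mult.left_commute)
  next
    case False
    then show ?thesis using R.comp_prob_eq_0[of k] R0.comp_prob_eq_0[of k] by simp
  qed
qed

end

subsection \<open>Sums over cycles\<close>

text \<open>The expected number of cycles of length \<open>l\<close>, multiplied by
  \<open>2 * l\<close>; it plays the role of z^l in \<open>lambda_gf\<close>.\<close>

definition cycle_weight :: "nat \<Rightarrow> nat \<Rightarrow> nat \<Rightarrow> nat \<Rightarrow> real" where
  "cycle_weight n N m l = (\<Prod>i<l. real n - real i) * incl_prob N m l"

lemma falling_nonneg: "0 \<le> (\<Prod>i<l. real n - real i)"
proof (cases "l \<le> n")
  case False
  then have "(\<Prod>i<l. real n - real i) = 0" by (intro prod_zero) auto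
  then show ?thesis by (simp only: order.refl)
qed (intro prod_nonneg, auto)

lemma falling_le: "(\<Prod>i<l. real n - real i) \<le> real n ^ l"
proof (cases "l \<le> n")
  case True
  have "(\<Prod>i<l. real n - real i) \<le> (\<Prod>i<l. real n)" by (rule prod_mono) (use True in auto)
  then show ?thesis by simp
next
  case False
  then have "(\<Prod>i<l. real n - real i) = 0" by (intro prod_zero) auto
  then show ?thesis by (simp only: zero_le_power of_nat_0_le_iff)
qed

lemma cycle_weight_nonneg: "m \<le> N \<Longrightarrow> 0 \<le> cycle_weight n N m l"
  unfolding cycle_weight_def by (intro mult_nonneg_nonneg falling_nonneg incl_prob_nonneg)

lemma cycle_weight_le: "m \<le> N \<Longrightarrow> cycle_weight n N m l \<le> (real n * (real m / real N)) ^ l"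
  unfolding cycle_weight_def power_mult_distrib
  by (intro mult_mono falling_le incl_prob_le incl_prob_nonneg) auto

text \<open>Consecutive falling factorials of order b, at m and at m - 1, differ by b times the one
  of order b - 1 at m - 1. So the increment is an inclusion probability with one element
  fewer.\<close>

lemma incl_prob_step:
  assumes "1 \<le> m" "m \<le> N" "1 \<le> b"
  shows "incl_prob N m b - incl_prob N (m - 1) b \<le> real b / real N * (real m / real N) ^ (b - 1)"
proof -
  obtain c where b: "b = Suc c" using assms(3) by (cases b) auto
  have s: "incl_prob (N - 1) (m - 1) c = (\<Prod>i<c. (real m - 1 - real i) / (real N - 1 - real i))"
    using assms by (simp add: incl_prob_def of_nat_diff)
  have Nc: "(\<Prod>i<Suc c. real N - real i) = real N * (\<Prod>i<c. real N - 1 - real i)"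
    by (subst prod.lessThan_Suc_shift) (simp add: algebra_simps)
  have 1: "incl_prob N m b = real m / real N * incl_prob (N - 1) (m - 1) c"
  proof -
    have "(\<Prod>i<Suc c. real m - real i) = real m * (\<Prod>i<c. real m - 1 - real i)"
      by (subst prod.lessThan_Suc_shift) (simp add: algebra_simps)
    then show ?thesis unfolding incl_prob_def[of N] b s prod_dividef Nc by simp
  qed
  have 2: "incl_prob N (m - 1) b = (real m - 1 - real c) / real N * incl_prob (N - 1) (m - 1) c"
  proof -
    have "(\<Prod>i<Suc c. real (m - 1) - real i) = (real m - 1 - real c) * (\<Prod>i<c. real m - 1 - real i)"
      using assms by (simp add: of_nat_diff)
    then show ?thesis unfolding incl_prob_def[of N] b s prod_dividef Nc by simp
  qed
  have "incl_prob N m b - incl_prob N (m - 1) b = (real m - (real m - 1 - real c)) / real N * incl_prob (N - 1) (m - 1) c"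
  proof -
    have "x / N' * z - y / N' * z = (x - y) / N' * z" for x y z N' :: real
      by (simp add: left_diff_distrib diff_divide_distrib)
    then show ?thesis unfolding 1 2 .
  qed
  also have "\<dots> = real b / real N * incl_prob (N - 1) (m - 1) c"
  proof -
    have e: "real m - (real m - 1 - real c) = real b" by (simp add: b)
    show ?thesis unfolding e ..
  qed
  also have "\<dots> \<le> real b / real N * (real m / real N) ^ c"
  proof (intro mult_left_mono)
    have "incl_prob (N - 1) (m - 1) c \<le> (real (m - 1) / real (N - 1)) ^ c" using assms by (intro incl_prob_le) simp
    also have "\<dots> \<le> (real m / real N) ^ c" using density_diff_le[of 1 m N] assms by (intro power_mono) auto
    finally show "incl_prob (N - 1) (m - 1) c \<le> (real m / real N) ^ c" .
  qed simp
  finally show ?thesis by (simp add: b)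
qed

lemma incl_prob_diff_le:
  assumes "c \<le> m" "m \<le> N" "1 \<le> b"
  shows "incl_prob N m b - incl_prob N (m - c) b \<le> real c * (real b / real N * (real m / real N) ^ (b - 1))"
proof -
  define K where "K = real b / real N * (real m / real N) ^ (b - 1)"
  have "c \<le> m \<Longrightarrow> incl_prob N m b - incl_prob N (m - c) b \<le> real c * K"
  proof (induction c)
    case (Suc c)
    have "incl_prob N (m - c) b - incl_prob N (m - c - 1) b \<le> real b / real N * (real (m - c) / real N) ^ (b - 1)"
      using Suc assms by (intro incl_prob_step) auto
    also have "\<dots> \<le> K"
      unfolding K_def by (intro mult_left_mono power_mono divide_right_mono) auto
    finally have "incl_prob N (m - c) b - incl_prob N (m - Suc c) b \<le> K" by simp
    moreover have "incl_prob N m b - incl_prob N (m - c) b \<le> real c * K" using Suc by simp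
    moreover have "real (Suc c) * K = real c * K + K" by (simp add: algebra_simps)
    ultimately show ?case by linarith
  qed simp
  then show ?thesis using assms(1) by (simp add: K_def)
qed

lemma incl_prob_mono:
  assumes "m' \<le> m" "m \<le> N" shows "incl_prob N m' b \<le> incl_prob N m b"
proof (cases "b \<le> m'")
  case True
  show ?thesis unfolding incl_prob_def
    by (intro prod_mono conjI divide_right_mono divide_nonneg_nonneg) (use assms True in auto)
next
  case False
  then show ?thesis using incl_prob_nonneg[OF assms(2)] by (simp add: incl_prob_eq_0)
qed

section \<open>Summing the error terms over cycle lengths\<close>

context cycle_count
begin

abbreviation "n \<equiv> card V"

definition rho :: real where "rho = real n * (real M / real N)"

lemma rho_nonneg: "0 \<le> rho" by (simp add: rho_def)

definition lens :: "nat set" where "lens = Ls \<inter> {3..n}"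

lemma finite_lens [simp]: "finite lens" by (simp add: lens_def)

lemma cyc_length:
  assumes "C \<in> cyc" shows "card C \<in> lens" "card (\<Union>C) = card C" "\<Union>C \<subseteq> V" "C \<subseteq> pairs (\<Union>C)" "3 \<le> card C"
proof -
  have "C \<in> cycles_of U" "card C \<in> Ls" using assms by (auto simp: cyc_def)
  then obtain vs where vs: "is_cycle vs" "C = cycle_edges vs" "C \<subseteq> U" "\<Union>C = set vs" by (elim cycles_ofE)
  have c: "card C = length vs" using card_cycle_edges vs by simp
  show u: "card (\<Union>C) = card C" using c vs by (simp add: is_cycle_def distinct_card)
  show s: "\<Union>C \<subseteq> V" using vs(3) by (auto simp: pairs_def)
  show "C \<subseteq> pairs (\<Union>C)" using cycle_edges_pairs[OF vs(1)] vs by simp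
  show "3 \<le> card C" using c vs by (simp add: is_cycle_def)
  then show "card C \<in> lens" using \<open>card C \<in> Ls\<close> card_mono[OF fin s] u by (simp add: lens_def)
qed

lemma sum_cyc:
  fixes g :: "nat \<Rightarrow> real"
  shows "(\<Sum>C\<in>cyc. g (card C)) = (\<Sum>l\<in>lens. (\<Prod>i<l. real n - real i) / (2 * real l) * g l)"
proof -
  have im: "card ` cyc \<subseteq> lens" using cyc_length(1) by auto
  have "(\<Sum>C\<in>cyc. g (card C)) = (\<Sum>l\<in>lens. \<Sum>C | C \<in> cyc \<and> card C = l. g (card C))"
    by (rule sum.group[OF finite_cyc finite_lens im, symmetric])
  also have "\<dots> = (\<Sum>l\<in>lens. (\<Prod>i<l. real n - real i) / (2 * real l) * g l)"
  proof (rule sum.cong[OF refl])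
    fix l assume l: "l \<in> lens"
    then have "{C. C \<in> cyc \<and> card C = l} = {C \<in> cycles_of U. card C = l}" by (auto simp: cyc_def lens_def)
    moreover have "(\<Sum>C | C \<in> cyc \<and> card C = l. g (card C)) = real (card {C. C \<in> cyc \<and> card C = l}) * g l" by simp
    moreover have "3 \<le> l" using l by (simp add: lens_def)
    ultimately show "(\<Sum>C | C \<in> cyc \<and> card C = l. g (card C)) = (\<Prod>i<l. real n - real i) / (2 * real l) * g l"
      using card_cycles_of_length[OF fin, of l] by simp
  qed
  finally show ?thesis .
qed

lemma Lam_eq: "Lam m = (\<Sum>l\<in>lens. cycle_weight n N m l / (2 * real l))"
  unfolding Lam_def sum_cyc cycle_weight_def by (simp add: mult.commute)

lemma Lam_le: "m \<le> N \<Longrightarrow> Lam m \<le> (\<Sum>l\<in>lens. (real n * (real m / real N)) ^ l / (2 * real l))"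
  unfolding Lam_eq by (intro sum_mono divide_right_mono cycle_weight_le) auto

lemma B1_le:
  assumes "\<And>C. C \<in> cyc \<Longrightarrow> card C \<le> M \<Longrightarrow> bad C \<le> g (card C)" "\<And>l. 0 \<le> g l"
  shows "B1 \<le> (\<Sum>l\<in>lens. rho ^ l / (2 * real l) * g l)"
proof -
  have "B1 \<le> (\<Sum>C\<in>cyc. p C * g (card C))"
    unfolding B1_def
  proof (rule sum_mono)
    fix C assume C: "C \<in> cyc"
    show "p C * bad C \<le> p C * g (card C)"
    proof (cases "card C \<le> M")
      case True
      then show ?thesis using assms(1)[OF C] p_nonneg by (intro mult_left_mono)
    next
      case False
      then show ?thesis by (simp add: incl_prob_eq_0)
    qed
  qed
  also have "\<dots> = (\<Sum>l\<in>lens. cycle_weight n N M l / (2 * real l) * g l)"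
    unfolding sum_cyc[of "\<lambda>l. incl_prob N M l * g l"] cycle_weight_def by (intro sum.cong) auto
  also have "\<dots> \<le> (\<Sum>l\<in>lens. rho ^ l / (2 * real l) * g l)"
    unfolding rho_def using assms(2) MN by (intro sum_mono mult_right_mono divide_right_mono cycle_weight_le) auto
  finally show ?thesis .
qed

lemma B3_le: "B3 \<le> rho / real n * (\<Sum>l\<in>lens. rho ^ l)"
proof -
  have "B3 = (\<Sum>l\<in>lens. cycle_weight n N M l / (2 * real l) * (2 * (real l * real M / real N)))"
    unfolding B3_def sum_cyc[of "\<lambda>l. incl_prob N M l * (2 * (real l * real M / real N))"] cycle_weight_def
    by (intro sum.cong) auto
  also have "\<dots> = (\<Sum>l\<in>lens. real M / real N * cycle_weight n N M l)"
    by (intro sum.cong refl) (auto simp: lens_def)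
  also have "\<dots> \<le> (\<Sum>l\<in>lens. real M / real N * rho ^ l)"
    unfolding rho_def using MN by (intro sum_mono mult_left_mono cycle_weight_le) auto
  also have "\<dots> = rho / real n * (\<Sum>l\<in>lens. rho ^ l)"
    using V_ne unfolding rho_def by (simp add: sum_distrib_left)
  finally show ?thesis .
qed

lemma Lam_diff_le:
  assumes "c \<le> M"
  shows "Lam M - Lam (M - c) \<le> real c * (real n / real N / 2 * (\<Sum>b\<in>lens. rho ^ (b - 1)))"
proof -
  have "Lam M - Lam (M - c) = (\<Sum>b\<in>lens. (\<Prod>i<b. real n - real i) / (2 * real b) * (incl_prob N M b - incl_prob N (M - c) b))"
    unfolding Lam_eq cycle_weight_def sum_subtractf[symmetric]
    by (intro sum.cong refl) (simp add: diff_divide_distrib right_diff_distrib)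
  also have "\<dots> \<le> (\<Sum>b\<in>lens. real c * (real n / real N / 2 * rho ^ (b - 1)))"
  proof (rule sum_mono)
    fix b assume "b \<in> lens"
    then have b: "3 \<le> b" by (simp add: lens_def)
    have "(\<Prod>i<b. real n - real i) / (2 * real b) * (incl_prob N M b - incl_prob N (M - c) b)
       \<le> real n ^ b / (2 * real b) * (real c * (real b / real N * (real M / real N) ^ (b - 1)))"
    proof (intro mult_mono divide_right_mono falling_le)
      show "incl_prob N M b - incl_prob N (M - c) b \<le> real c * (real b / real N * (real M / real N) ^ (b - 1))"
        using assms MN b by (intro incl_prob_diff_le) auto
      show "0 \<le> incl_prob N M b - incl_prob N (M - c) b"
        using incl_prob_mono[of "M - c" M N b] MN by simp
    qed auto
    also have "real n ^ b = real n * real n ^ (b - 1)" using b by (cases b) auto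
    also have "real n * real n ^ (b - 1) / (2 * real b) * (real c * (real b / real N * (real M / real N) ^ (b - 1)))
      = real c * (real n / real N / 2 * rho ^ (b - 1))"
      using b unfolding rho_def power_mult_distrib by (simp add: mult_ac)
    finally show "(\<Prod>i<b. real n - real i) / (2 * real b) * (incl_prob N M b - incl_prob N (M - c) b)
       \<le> real c * (real n / real N / 2 * rho ^ (b - 1))" .
  qed
  also have "\<dots> = real c * (real n / real N / 2 * (\<Sum>b\<in>lens. rho ^ (b - 1)))" by (simp add: sum_distrib_left)
  finally show ?thesis .
qed

lemma n_over_N: "real n / real N = 2 / (real n - 1)"
proof -
  have "real N = real n * (real n - 1) / 2" using fin by (simp add: card_pairs real_choose_two)
  moreover have "real n \<noteq> 0" "real n - 1 \<noteq> 0" using V_ne by linarith+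
  ultimately show ?thesis by (simp only: divide_divide_eq_right) simp
qed

text \<open>The loss of \<open>card C\<close> edges costs at most \<open>card C\<close> times a
  constant. This factor cancels the 1/l in the number of cycles and leaves a product of two
  geometric sums.\<close>

lemma B2_le: "B2 \<le> (\<Sum>l\<in>lens. rho ^ l) * (\<Sum>l\<in>lens. rho ^ (l - 1)) / (2 * (real n - 1))"
proof -
  let ?K = "real n / real N / 2 * (\<Sum>b\<in>lens. rho ^ (b - 1))"
  have K: "0 \<le> ?K" using rho_nonneg by (intro mult_nonneg_nonneg sum_nonneg) auto
  have "B2 \<le> (\<Sum>C\<in>cyc. p C * (real (card C) * ?K))"
    unfolding B2_def
  proof (rule sum_mono)
    fix C assume C: "C \<in> cyc"
    show "p C * (Lam M - Lam (M - card C)) \<le> p C * (real (card C) * ?K)"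
    proof (cases "card C \<le> M")
      case True
      then show ?thesis using Lam_diff_le p_nonneg by (intro mult_left_mono)
    next
      case False
      then show ?thesis by (simp add: incl_prob_eq_0)
    qed
  qed
  also have "\<dots> = (\<Sum>l\<in>lens. cycle_weight n N M l / (2 * real l) * (real l * ?K))"
    unfolding sum_cyc[of "\<lambda>l. incl_prob N M l * (real l * ?K)"] cycle_weight_def by (intro sum.cong) auto
  also have "\<dots> = (\<Sum>l\<in>lens. cycle_weight n N M l * (?K / 2))"
    by (intro sum.cong refl) (auto simp: lens_def)
  also have "\<dots> \<le> (\<Sum>l\<in>lens. rho ^ l * (?K / 2))"
    unfolding rho_def using MN K by (intro sum_mono mult_right_mono cycle_weight_le) (auto simp: rho_def)
  also have "\<dots> = (\<Sum>l\<in>lens. rho ^ l) * (?K / 2)" by (rule sum_distrib_right[symmetric])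
  also have "?K / 2 = (\<Sum>l\<in>lens. rho ^ (l - 1)) / (2 * (real n - 1))"
  proof -
    have "2 / y / 2 * s / 2 = s / (2 * y)" for s y :: real by (cases "y = 0") (auto simp: field_simps)
    then show ?thesis unfolding n_over_N .
  qed
  finally show ?thesis by simp
qed

lemma bad_le:
  assumes "C \<in> cyc" "card C \<le> M" "rho < 1"
  shows "bad C \<le> real (card C) / real n * (real (card C) / (1 - rho) + 1 / (1 - rho)\<^sup>2)"
proof -
  note c = cyc_length[OF assms(1)]
  interpret R: rooted_graphs V "\<Union>C" C M
    by unfold_locales (use fin c assms(2) MN V_ne in auto)
  have "R.rho = rho" by (simp add: R.rho_def rho_def)
  then show ?thesis using R.prob_not_treelike_le assms(3) c(2) unfolding bad_def by simp
qed

lemma sum_lens_le: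
  assumes "rho < 1"
  shows "(\<Sum>l\<in>lens. rho ^ l) \<le> 1 / (1 - rho)" "(\<Sum>l\<in>lens. rho ^ (l - 1)) \<le> 1 / (1 - rho)"
    "(\<Sum>l\<in>lens. real l * rho ^ l) \<le> 1 / (1 - rho)\<^sup>2"
proof -
  have "(\<Sum>l\<in>lens. rho ^ l) \<le> (\<Sum>l\<le>n. rho ^ l)"
    by (rule sum_mono2) (use rho_nonneg in \<open>auto simp: lens_def\<close>)
  then show "(\<Sum>l\<in>lens. rho ^ l) \<le> 1 / (1 - rho)" using geometric_sum_le[OF rho_nonneg assms, of n] by linarith
  have "(\<Sum>l\<in>lens. rho ^ (l - 1)) = (\<Sum>l\<in>(\<lambda>l. l - 1) ` lens. rho ^ l)"
    by (subst sum.reindex) (auto simp: lens_def inj_on_def)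
  also have "\<dots> \<le> (\<Sum>l\<le>n. rho ^ l)"
    by (rule sum_mono2) (use rho_nonneg in \<open>auto simp: lens_def\<close>)
  finally show "(\<Sum>l\<in>lens. rho ^ (l - 1)) \<le> 1 / (1 - rho)" using geometric_sum_le[OF rho_nonneg assms, of n] by linarith
  have "(\<Sum>l\<in>lens. real l * rho ^ l) \<le> (\<Sum>l\<in>lens. real (Suc l) * rho ^ l)"
    using rho_nonneg by (intro sum_mono mult_right_mono) auto
  also have "\<dots> \<le> (\<Sum>l\<le>n. real (Suc l) * rho ^ l)"
    by (rule sum_mono2) (use rho_nonneg in \<open>auto simp: lens_def\<close>)
  finally show "(\<Sum>l\<in>lens. real l * rho ^ l) \<le> 1 / (1 - rho)\<^sup>2"
    using arith_geometric_sum_le[OF rho_nonneg assms, of n] by linarith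
qed

text \<open>\<open>B1\<close> dominates: the lasso bound contributes (1 - rho)^(-2), or l/(1 - rho),
  and the sum over cycle lengths raises both to the third power. This is why the subcritical regime
  requires n (1 - rho)^3 to tend to infinity.\<close>

lemma subcritical_errors:
  assumes "rho < 1"
  shows "B1 \<le> 1 / (real n * (1 - rho) ^ 3)" "B2 \<le> 1 / ((real n - 1) * (1 - rho)\<^sup>2)" "B3 \<le> 1 / (real n * (1 - rho))"
proof -
  define e where "e = 1 - rho"
  have e: "0 < e" "e \<le> 1" using assms rho_nonneg by (auto simp: e_def)
  have n: "2 \<le> real n" using V_ne by simp
  note s = sum_lens_le[OF assms, folded e_def]
  have "B1 \<le> (\<Sum>l\<in>lens. rho ^ l / (2 * real l) * (real l / real n * (real l / e + 1 / e\<^sup>2)))"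
    unfolding e_def by (rule B1_le) (use bad_le[OF _ _ assms] e in \<open>auto simp: e_def\<close>)
  also have "\<dots> = (\<Sum>l\<in>lens. 1 / (2 * real n) * (real l * rho ^ l / e + rho ^ l / e\<^sup>2))"
  proof (intro sum.cong refl)
    fix l assume "l \<in> lens"
    then have "real l \<noteq> 0" by (auto simp: lens_def)
    moreover have "real n \<noteq> 0" "e \<noteq> 0" using n e by auto
    moreover have "x / (2 * L) * (L / n' * (L / e + 1 / e\<^sup>2)) = 1 / (2 * n') * (L * x / e + x / e\<^sup>2)"
      if "L \<noteq> 0" "n' \<noteq> 0" "e \<noteq> 0" for L n' e x :: real
      using that by (simp add: field_simps)
    ultimately show "rho ^ l / (2 * real l) * (real l / real n * (real l / e + 1 / e\<^sup>2)) = 1 / (2 * real n) * (real l * rho ^ l / e + rho ^ l / e\<^sup>2)"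
      by blast
  qed
  also have "\<dots> = 1 / (2 * real n) * ((\<Sum>l\<in>lens. real l * rho ^ l) / e + (\<Sum>l\<in>lens. rho ^ l) / e\<^sup>2)"
    by (simp only: sum_distrib_left[symmetric] sum.distrib sum_divide_distrib[symmetric])
  also have "\<dots> \<le> 1 / (2 * real n) * (1 / e\<^sup>2 / e + 1 / e / e\<^sup>2)"
    using s e by (intro mult_left_mono add_mono divide_right_mono) auto
  also have "\<dots> = 1 / (real n * e ^ 3)"
    using e n by (simp add: field_simps power3_eq_cube power2_eq_square)
  finally show "B1 \<le> 1 / (real n * (1 - rho) ^ 3)" by (simp add: e_def)
  have "B2 \<le> (\<Sum>l\<in>lens. rho ^ l) * (\<Sum>l\<in>lens. rho ^ (l - 1)) / (2 * (real n - 1))" by (rule B2_le)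
  also have "\<dots> \<le> 1 / e * (1 / e) / (2 * (real n - 1))"
    using s e n rho_nonneg by (intro divide_right_mono mult_mono sum_nonneg) auto
  also have "\<dots> \<le> 1 / e * (1 / e) / (real n - 1)"
    using e n by (intro divide_left_mono) auto
  also have "\<dots> = 1 / ((real n - 1) * e\<^sup>2)" by (simp add: power2_eq_square)
  finally show "B2 \<le> 1 / ((real n - 1) * (1 - rho)\<^sup>2)" by (simp add: e_def)
  have "B3 \<le> rho / real n * (\<Sum>l\<in>lens. rho ^ l)" by (rule B3_le)
  also have "\<dots> \<le> 1 / real n * (1 / e)"
    using s e n rho_nonneg assms by (intro mult_mono divide_right_mono sum_nonneg) auto
  finally show "B3 \<le> 1 / (real n * (1 - rho))" by (simp add: e_def)
qed

end

subsection \<open>Isolated cycles in the critical window\<close>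

lemma treelike_comps_disjoint:
  assumes "C \<in> cycles_of G" "treelike (\<Union>C) C G" "F \<in> cycles_of G" "F \<noteq> C"
  shows "rooted_comp (\<Union>C) G \<inter> rooted_comp (\<Union>F) G = {}"
proof (rule ccontr)
  assume "rooted_comp (\<Union>C) G \<inter> rooted_comp (\<Union>F) G \<noteq> {}"
  then obtain z d where z: "z \<in> rooted_comp (\<Union>C) G" "d \<in> \<Union>F" "reachable G d z"
    unfolding rooted_comp_def[of "\<Union>F"] by auto
  then have "d \<in> rooted_comp (\<Union>C) G" using rooted_comp_reachable reachable_sym by metis
  then show False using treelike_other_cycle[OF assms] z(2) by auto
qed

context critical_window
begin

text \<open>Collects the losses below: 3 from the first moment bounds at \<open>M0\<close> and one
  unit to spare, 16 B from the length term and 32 B (1 + 2B) from the size term of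
  \<open>comp_prob_lower\<close>.\<close>

definition cK :: real where "cK = 16 * B + 32 * B * (1 + 2 * B) + 4"

lemma cK_pos: "0 < cK" using B by (simp add: cK_def add_pos_pos)

lemma finite_small: "finite {k. real k \<le> b}"
  by (rule finite_subset[of _ "{..nat \<lceil>b\<rceil>}"]) (auto simp: le_nat_iff, linarith)

text \<open>At \<open>M0\<close> the first moment method works, and \<open>comp_prob_lower\<close>
  carries the result over to \<open>M\<close>. The loss proportional to k/t^2 is harmless on
  average, because the mean component size at \<open>M0\<close> is at most \<open>card S\<close>
  times t.\<close>

lemma sum_comp_prob_critical:
  assumes SV: "S \<subseteq> V" and AS: "A \<subseteq> pairs S" and l: "1 \<le> card S" "card A \<le> card S" "card S \<le> card A + 1"
    and lt: "real (card S) \<le> t"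
  shows "1 - cK * real (card S) / t \<le> (\<Sum>k | real k \<le> t\<^sup>2. comp_prob V S A M k)"
proof -
  let ?l = "real (card S)" and ?K = "{k. real k \<le> t\<^sup>2}"
  have tpos: "0 < t" using t_ge by simp
  have Dt: "t\<^sup>2 \<le> D * t\<^sup>2" using D by (simp add: mult_le_cancel_right1)
  have "real (card A) \<le> D * t\<^sup>2" using l(2) lt t2_ge Dt by linarith
  then have AM0: "card A \<le> M0" by (rule le_M0)
  interpret R0: rooted_graphs V S A M0
    by unfold_locales (use fin SV AS AM0 M_le n_ge M0_le in auto)
  define e where "e = 1 - R0.rho"
  have e: "1 / t \<le> e" using rho0 by (simp add: e_def R0.rho_def)
  then have e0: "0 < e" using tpos by (meson divide_pos_pos less_le_trans zero_less_one)
  have r1: "R0.rho < 1" using e0 by (simp add: e_def)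
  have ie: "1 / e \<le> t" using e e0 tpos by (simp add: field_simps)
  have ie2: "1 / e\<^sup>2 \<le> t\<^sup>2"
    using power_mono[OF ie, of 2] e0 by (simp add: power_divide)
  have fK: "finite ?K" by (rule finite_small)
  \<comment> \<open>With 1/(1 - rho) <= t, n = t^3 and l <= t, the lasso bound is at most 2l/t, and
    Markov's inequality at size t^2 gives a further l/t.\<close>
  have base: "1 - 3 * ?l / t \<le> (\<Sum>k\<in>?K. comp_prob V S A M0 k)"
  proof -
    have "?l / real n * (?l / e + 1 / e\<^sup>2) \<le> ?l / real n * (t * t + t\<^sup>2)"
    proof (intro mult_left_mono add_mono ie2)
      have "?l * (1 / e) \<le> t * t" using lt ie e0 tpos by (intro mult_mono) auto
      then show "?l / e \<le> t * t" by simp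
    qed auto
    also have "\<dots> = 2 * ?l / t" unfolding nt using tpos by (simp add: field_simps power_numeral_reduce)
    finally have 1: "?l / real n * (?l / e + 1 / e\<^sup>2) \<le> 2 * ?l / t" .
    have "?l / e / t\<^sup>2 \<le> ?l * t / t\<^sup>2"
      using mult_left_mono[OF ie, of ?l] by (intro divide_right_mono) auto
    also have "\<dots> = ?l / t" using tpos by (simp add: power2_eq_square)
    finally have 2: "?l / e / t\<^sup>2 \<le> ?l / t" .
    have "3 * ?l / t = 2 * ?l / t + ?l / t" by (simp add: field_simps)
    then show ?thesis using R0.sum_comp_prob_ge[OF r1, of "t\<^sup>2"] 1 2 tpos unfolding e_def[symmetric] by simp
  qed
  let ?a = "16 * B * ?l / t" and ?b = "32 * B * (1 + 2 * B)"
  have "(\<Sum>k\<in>?K. (1 - (?a + ?b * real k / t\<^sup>2)) * comp_prob V S A M0 k) \<le> (\<Sum>k\<in>?K. comp_prob V S A M k)"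
  proof (rule sum_mono)
    fix k assume "k \<in> ?K"
    then have "real k \<le> D * t\<^sup>2" using Dt by simp
    then show "(1 - (?a + ?b * real k / t\<^sup>2)) * comp_prob V S A M0 k \<le> comp_prob V S A M k"
      by (rule comp_prob_lower[OF SV AS l AM0])
  qed
  moreover have "(\<Sum>k\<in>?K. (1 - (?a + ?b * real k / t\<^sup>2)) * comp_prob V S A M0 k)
    = (\<Sum>k\<in>?K. comp_prob V S A M0 k) - ?a * (\<Sum>k\<in>?K. comp_prob V S A M0 k) - ?b / t\<^sup>2 * (\<Sum>k\<in>?K. real k * comp_prob V S A M0 k)"
  proof -
    have e: "(1 - (a + b * k / T)) * c = c - a * c - b / T * (k * c)" for a b k T c :: real
      by (simp add: left_diff_distrib distrib_right)
    show ?thesis by (simp only: e sum_subtractf sum_distrib_left)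
  qed
  moreover have "?a * (\<Sum>k\<in>?K. comp_prob V S A M0 k) \<le> ?a"
    by (intro mult_left_le R0.sum_comp_prob_le_1 fK) (use B tpos in auto)
  moreover have "?b / t\<^sup>2 * (\<Sum>k\<in>?K. real k * comp_prob V S A M0 k) \<le> ?b * ?l / t"
  proof -
    have "(\<Sum>k\<in>?K. real k * comp_prob V S A M0 k) \<le> ?l / e"
      using R0.sum_comp_prob_weighted_le[OF fK r1] by (simp add: e_def)
    also have "\<dots> \<le> ?l * t" using mult_left_mono[OF ie, of ?l] by simp
    finally have "?b / t\<^sup>2 * (\<Sum>k\<in>?K. real k * comp_prob V S A M0 k) \<le> ?b / t\<^sup>2 * (?l * t)"
      using B by (intro mult_left_mono) auto
    also have "\<dots> = ?b * ?l / t" using tpos by (simp add: power2_eq_square)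
    finally show ?thesis .
  qed
  moreover have "cK * ?l / t = 3 * ?l / t + ?a + ?b * ?l / t + ?l / t"
    unfolding cK_def using tpos by (simp add: field_simps)
  moreover have "0 \<le> ?l / t" using tpos by simp
  ultimately show ?thesis using base by linarith
qed

lemma prob_outside_le:
  assumes "S \<subseteq> V" "A \<subseteq> pairs S" "1 \<le> card S" "card A \<le> card S" "card S \<le> card A + 1" "real (card S) \<le> t"
    and Q: "\<And>H. Q H \<Longrightarrow> \<not> (treelike S A (H \<union> A) \<and> real (card (rooted_comp S (H \<union> A))) \<le> t\<^sup>2)"
  shows "avg (pairs V - A) (M - card A) (\<lambda>H. if Q H then 1 else 0 :: real) \<le> cK * real (card S) / t"
proof -
  let ?U = "pairs V - A" and ?m = "M - card A" and ?K = "{k. real k \<le> t\<^sup>2}"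
  have Dt: "t\<^sup>2 \<le> D * t\<^sup>2" using D by (simp add: mult_le_cancel_right1)
  have "real (card A) \<le> D * t\<^sup>2" using assms(4,6) t2_ge Dt by linarith
  then have "card A \<le> M0" by (rule le_M0)
  then have AM: "card A \<le> M" using M0_le by simp
  interpret R: rooted_graphs V S A M
    by unfold_locales (use fin assms AM M_le n_ge in auto)
  have "(\<Sum>k\<in>?K. 1 * comp_prob V S A M k) \<le> avg ?U ?m (\<lambda>H. 1 - (if Q H then 1 else 0))"
    unfolding R.avg_by_comp
  proof (rule avg_mono)
    fix H
    show "(\<Sum>k\<in>?K. 1 * (if treelike S A (H \<union> A) \<and> card (rooted_comp S (H \<union> A)) = k then 1 else 0 :: real)) \<le> 1 - (if Q H then 1 else 0)"
    proof (cases "Q H")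
      case True
      have "(\<Sum>k\<in>?K. 1 * (if treelike S A (H \<union> A) \<and> card (rooted_comp S (H \<union> A)) = k then 1 else 0 :: real)) = 0"
        by (rule sum.neutral) (use Q[OF True] in auto)
      then show ?thesis using True by simp
    next
      case False
      then show ?thesis
        by (cases "treelike S A (H \<union> A)") (use finite_small[of "t\<^sup>2"] in \<open>auto simp: sum.delta'\<close>)
    qed
  qed
  also have "\<dots> = 1 - avg ?U ?m (\<lambda>H. if Q H then 1 else 0)"
    using fin R.rest_le by (simp add: avg_diff avg_const)
  finally show ?thesis using sum_comp_prob_critical[OF assms(1-6)] by simp
qed

text \<open>A single vertex counts as a root set with empty core, so the estimate made for cycles
  applies.\<close>

lemma prob_big_component:
  assumes "v \<in> V"
  shows "avg (pairs V) M (\<lambda>G. if t\<^sup>2 < real (card (rooted_comp {v} G)) then 1 else 0 :: real) \<le> cK / t"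
  using prob_outside_le[of "{v}" "{}" "\<lambda>G. t\<^sup>2 < real (card (rooted_comp {v} G))"] assms t_ge by simp

text \<open>The components of distinct isolated cycles are disjoint. Each of those in
  \<open>K\<close> consists of more than D t^2 vertices, all of which see a component of more than
  t^2 vertices.\<close>

lemma big_isolated_le:
  assumes G: "G \<subseteq> pairs V" and K: "K \<subseteq> {C \<in> cycles_of G. treelike (\<Union>C) C G \<and> D * t\<^sup>2 < real (card (rooted_comp (\<Union>C) G))}"
  shows "D * t\<^sup>2 * real (card K) \<le> (\<Sum>v\<in>V. if t\<^sup>2 < real (card (rooted_comp {v} G)) then 1 else 0)"
proof -
  have fK: "finite K"
    by (rule finite_subset[of _ "Pow (pairs V)"]) (use K G fin in \<open>auto simp: cycles_of_def\<close>)
  have sub: "rooted_comp (\<Union>C) G \<subseteq> V" if "C \<in> K" for C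
  proof (rule rooted_comp_subset[OF _ G])
    have "C \<subseteq> pairs V" using that K G by (auto simp: cycles_of_def)
    then show "\<Union>C \<subseteq> V" by (auto simp: pairs_def)
  qed
  have fc: "finite (rooted_comp (\<Union>C) G)" if "C \<in> K" for C using sub[OF that] fin finite_subset by blast
  have Dt: "t\<^sup>2 \<le> D * t\<^sup>2" using D by (simp add: mult_le_cancel_right1)
  have "D * t\<^sup>2 * real (card K) = (\<Sum>C\<in>K. D * t\<^sup>2)" by simp
  also have "\<dots> \<le> (\<Sum>C\<in>K. real (card (rooted_comp (\<Union>C) G)))"
    by (rule sum_mono) (use K in auto)
  also have "\<dots> = real (card (\<Union>C\<in>K. rooted_comp (\<Union>C) G))"
  proof -
    have "\<forall>C\<in>K. \<forall>F\<in>K. C \<noteq> F \<longrightarrow> rooted_comp (\<Union>C) G \<inter> rooted_comp (\<Union>F) G = {}"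
    proof (intro ballI impI)
      fix C F assume "C \<in> K" "F \<in> K" "C \<noteq> F"
      then show "rooted_comp (\<Union>C) G \<inter> rooted_comp (\<Union>F) G = {}"
        using treelike_comps_disjoint[of C G F] K by blast
    qed
    then show ?thesis using card_UN_disjoint[OF fK, of "\<lambda>C. rooted_comp (\<Union>C) G"] fc by simp
  qed
  also have "\<dots> \<le> real (card {v \<in> V. t\<^sup>2 < real (card (rooted_comp {v} G))})"
    unfolding of_nat_le_iff
  proof (rule card_mono)
    show "(\<Union>C\<in>K. rooted_comp (\<Union>C) G) \<subseteq> {v \<in> V. t\<^sup>2 < real (card (rooted_comp {v} G))}"
    proof
      fix v assume "v \<in> (\<Union>C\<in>K. rooted_comp (\<Union>C) G)"
      then obtain C where C: "C \<in> K" "v \<in> rooted_comp (\<Union>C) G" by auto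
      have "C \<in> cycles_of G" using C K by auto
      then obtain vs where vs: "is_cycle vs" "C = cycle_edges vs" "C \<subseteq> G" "\<Union>C = set vs" by (rule cycles_ofE)
      have con: "reachable G x y" if "x \<in> \<Union>C" "y \<in> \<Union>C" for x y
        using reachable_mono[OF cycle_reachable[OF vs(1)], of x y G] that vs by auto
      have "rooted_comp (\<Union>C) G \<subseteq> rooted_comp {v} G"
        using rooted_comp_connected_roots[of "\<Union>C" G, OF con C(2)] by (auto simp: rooted_comp_def[of "{v}"])
      moreover have "finite (rooted_comp {v} G)"
        using rooted_comp_subset[of "{v}" V G] G sub[OF C(1)] C(2) fin finite_subset by blast
      ultimately have "card (rooted_comp (\<Union>C) G) \<le> card (rooted_comp {v} G)" by (rule card_mono[rotated])
      moreover have "D * t\<^sup>2 < real (card (rooted_comp (\<Union>C) G))" using C K by auto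
      ultimately show "v \<in> {v \<in> V. t\<^sup>2 < real (card (rooted_comp {v} G))}"
        using sub[OF C(1)] C(2) Dt by auto
    qed
  qed (use fin in simp)
  also have "\<dots> = (\<Sum>v\<in>V. if t\<^sup>2 < real (card (rooted_comp {v} G)) then 1 else 0)"
    using fin by (simp add: sum.inter_filter[symmetric])
  finally show ?thesis .
qed

sublocale CC: cycle_count V Ls M for Ls
  by unfold_locales (use fin n_ge M_le in auto)

text \<open>Isolated cycles are split by component size at D t^2. Small components are transferred
  to \<open>M0\<close> at the cost of a constant factor; large ones are few since the expected
  number of vertices in components beyond t^2 is at most n cK / t. Here \<open>D\<close> is free: it
  trades the constant factor against cK / D, and the lengths in \<open>Ls\<close> need not be at
  most \<open>t\<close>.\<close>

lemma expected_isolated_critical: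
  "avg (pairs V) M (\<lambda>G. real (CC.X Ls G))
    \<le> exp (32 * B\<^sup>2 * D + 64 * B * D\<^sup>2) * (\<Sum>C\<in>CC.cyc Ls. incl_prob N M0 (card C)) + cK / D"
proof -
  let ?E = "exp (32 * B\<^sup>2 * D + 64 * B * D\<^sup>2)" and ?U = "pairs V"
  let ?comp = "\<lambda>C G. rooted_comp (\<Union>C) G"
  let ?small = "\<lambda>C G. treelike (\<Union>C) C G \<and> real (card (?comp C G)) \<le> D * t\<^sup>2"
  let ?big = "\<lambda>C G. treelike (\<Union>C) C G \<and> D * t\<^sup>2 < real (card (?comp C G))"
  have Dt: "0 < D * t\<^sup>2" using D t_ge by simp
  have "avg ?U M (\<lambda>G. real (CC.X Ls G))
    = avg ?U M (\<lambda>G. (\<Sum>C\<in>CC.cyc Ls. if C \<subseteq> G then (if ?small C G then 1 else 0) else 0) + (\<Sum>C\<in>CC.cyc Ls. if C \<subseteq> G \<and> ?big C G then 1 else 0))"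
  proof (rule avg_cong)
    fix G assume G: "G \<subseteq> ?U"
    show "real (CC.X Ls G) = (\<Sum>C\<in>CC.cyc Ls. if C \<subseteq> G then (if ?small C G then 1 else 0) else 0) + (\<Sum>C\<in>CC.cyc Ls. if C \<subseteq> G \<and> ?big C G then 1 else 0)"
      unfolding CC.X_eq[OF G] sum.distrib[symmetric]
    proof (rule sum.cong[OF refl])
      fix C
      show "(if C \<subseteq> G \<and> treelike (\<Union>C) C G then 1 else 0 :: real) = (if C \<subseteq> G then (if ?small C G then 1 else 0) else 0) + (if C \<subseteq> G \<and> ?big C G then 1 else 0)"
        by (cases "real (card (?comp C G)) \<le> D * t\<^sup>2") simp_all
    qed
  qed
  also have "\<dots> = (\<Sum>C\<in>CC.cyc Ls. avg ?U M (\<lambda>G. if C \<subseteq> G then (if ?small C G then 1 else 0) else 0))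
     + avg ?U M (\<lambda>G. \<Sum>C\<in>CC.cyc Ls. if C \<subseteq> G \<and> ?big C G then 1 else 0)"
    by (simp only: avg_add avg_sum)
  also have "\<dots> \<le> (\<Sum>C\<in>CC.cyc Ls. ?E * incl_prob N M0 (card C)) + cK / D"
  proof (rule add_mono)
    show "(\<Sum>C\<in>CC.cyc Ls. avg ?U M (\<lambda>G. if C \<subseteq> G then (if ?small C G then 1 else 0) else 0)) \<le> (\<Sum>C\<in>CC.cyc Ls. ?E * incl_prob N M0 (card C))"
    proof (rule sum_mono)
      fix C assume C: "C \<in> CC.cyc Ls"
      note c = CC.cyc_length[OF C]
      let ?K = "{k. real k \<le> D * t\<^sup>2}"
      show "avg ?U M (\<lambda>G. if C \<subseteq> G then (if ?small C G then 1 else 0) else 0) \<le> ?E * incl_prob N M0 (card C)"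
      proof (cases "card C \<le> M")
        case False
        then have "incl_prob N M (card C) = 0" by (simp add: incl_prob_eq_0)
        then show ?thesis
          using avg_supersets[OF CC.finU CC.cyc_sub[OF C] M_le, of "\<lambda>G. if ?small C G then 1 else 0 :: real"]
            incl_prob_nonneg[of M0 N "card C"] M0_le M_le by simp
      next
        case True
        interpret R: rooted_graphs V "\<Union>C" C M
          by unfold_locales (use fin c True M_le n_ge in auto)
        have eq: "avg ?U M (\<lambda>G. if C \<subseteq> G then (if ?small C G then 1 else 0) else 0) = incl_prob N M (card C) * (\<Sum>k\<in>?K. 1 * comp_prob V (\<Union>C) C M k)"
        proof -
          have "(\<lambda>H. if ?small C (H \<union> C) then 1 else 0 :: real)
            = (\<lambda>H. \<Sum>k\<in>?K. 1 * (if treelike (\<Union>C) C (H \<union> C) \<and> card (rooted_comp (\<Union>C) (H \<union> C)) = k then 1 else 0))"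
          proof
            fix H
            show "(if ?small C (H \<union> C) then 1 else 0 :: real)
              = (\<Sum>k\<in>?K. 1 * (if treelike (\<Union>C) C (H \<union> C) \<and> card (rooted_comp (\<Union>C) (H \<union> C)) = k then 1 else 0))"
              by (cases "treelike (\<Union>C) C (H \<union> C)") (use finite_small[of "D * t\<^sup>2"] in \<open>auto simp: sum.delta'\<close>)
          qed
          then show ?thesis
            using avg_supersets[OF CC.finU CC.cyc_sub[OF C] M_le, of "\<lambda>G. if ?small C G then 1 else 0 :: real"]
            unfolding R.avg_by_comp by simp
        qed
        show ?thesis
        proof (cases "card C \<le> M0")
          case True
          interpret R0: rooted_graphs V "\<Union>C" C M0
            by unfold_locales (use fin c(3,4) True M_le M0_le n_ge in simp_all)
          have l: "1 \<le> card (\<Union>C)" "card C = card (\<Union>C)" using c(2,5) by simp_all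
          have "incl_prob N M (card C) * (\<Sum>k\<in>?K. 1 * comp_prob V (\<Union>C) C M k)
             \<le> (\<Sum>k\<in>?K. ?E * (incl_prob N M0 (card C) * comp_prob V (\<Union>C) C M0 k))"
            unfolding sum_distrib_left
          proof (rule sum_mono)
            fix k assume "k \<in> ?K"
            then have "real k \<le> D * t\<^sup>2" by simp
            from comp_prob_upper[OF c(3,4) l True this]
            show "incl_prob N M (card C) * (1 * comp_prob V (\<Union>C) C M k) \<le> ?E * (incl_prob N M0 (card C) * comp_prob V (\<Union>C) C M0 k)"
              by (simp only: mult_1)
          qed
          also have "\<dots> = ?E * incl_prob N M0 (card C) * (\<Sum>k\<in>?K. comp_prob V (\<Union>C) C M0 k)"
            by (simp add: sum_distrib_left mult.assoc)
          also have "\<dots> \<le> ?E * incl_prob N M0 (card C) * 1"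
            using M0_le M_le by (intro mult_left_mono R0.sum_comp_prob_le_1 finite_small mult_nonneg_nonneg incl_prob_nonneg) auto
          finally show ?thesis using eq by simp
        next
          case False
          \<comment> \<open>A cycle with more than \<open>M0\<close> edges has more than D t^2
            vertices by \<open>le_M0\<close>, so it cannot have a small component.\<close>
          have "comp_prob V (\<Union>C) C M k = 0" if "k \<in> ?K" for k
            using R.comp_prob_eq_0[of k] le_M0[of k] that False c(2) by simp
          then show ?thesis using eq incl_prob_nonneg[of M0 N "card C"] M0_le M_le by simp
        qed
      qed
    qed
    have "avg ?U M (\<lambda>G. \<Sum>C\<in>CC.cyc Ls. if C \<subseteq> G \<and> ?big C G then 1 else 0)
      \<le> avg ?U M (\<lambda>G. \<Sum>v\<in>V. 1 / (D * t\<^sup>2) * (if t\<^sup>2 < real (card (rooted_comp {v} G)) then 1 else 0))"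
    proof (rule avg_mono)
      fix G assume G: "G \<subseteq> ?U"
      let ?K = "{C \<in> CC.cyc Ls. C \<subseteq> G \<and> ?big C G}"
      have "(\<Sum>C\<in>CC.cyc Ls. if C \<subseteq> G \<and> ?big C G then 1 else 0) = real (card ?K)"
        by (simp add: sum.inter_filter[symmetric])
      moreover have "?K \<subseteq> {C \<in> cycles_of G. ?big C G}" by (auto simp: CC.cyc_def cycles_of_def)
      then have "D * t\<^sup>2 * real (card ?K) \<le> (\<Sum>v\<in>V. if t\<^sup>2 < real (card (rooted_comp {v} G)) then 1 else 0)"
        by (rule big_isolated_le[OF G])
      then have "real (card ?K) \<le> 1 / (D * t\<^sup>2) * (\<Sum>v\<in>V. if t\<^sup>2 < real (card (rooted_comp {v} G)) then 1 else 0)"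
        using Dt by (simp add: pos_le_divide_eq mult.commute)
      ultimately show "(\<Sum>C\<in>CC.cyc Ls. if C \<subseteq> G \<and> ?big C G then 1 else 0)
        \<le> (\<Sum>v\<in>V. 1 / (D * t\<^sup>2) * (if t\<^sup>2 < real (card (rooted_comp {v} G)) then 1 else 0))"
        by (simp only: sum_distrib_left)
    qed
    also have "\<dots> = (\<Sum>v\<in>V. 1 / (D * t\<^sup>2) * avg ?U M (\<lambda>G. if t\<^sup>2 < real (card (rooted_comp {v} G)) then 1 else 0))"
      by (simp only: avg_sum avg_cmult)
    also have "\<dots> \<le> (\<Sum>v\<in>V. 1 / (D * t\<^sup>2) * (cK / t))"
      using Dt by (intro sum_mono mult_left_mono prob_big_component) auto
    \<comment> \<open>Summing over the t^3 vertices cancels both t^2 and t.\<close>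
    also have "\<dots> = cK / D"
      using nt t_ge D by (simp add: field_simps power_numeral_reduce)
    finally show "avg ?U M (\<lambda>G. \<Sum>C\<in>CC.cyc Ls. if C \<subseteq> G \<and> ?big C G then 1 else 0) \<le> cK / D" .
  qed
  finally show ?thesis by (simp add: sum_distrib_left)
qed

lemma critical_B1:
  assumes "\<And>l. l \<in> Ls \<Longrightarrow> real l \<le> t"
  shows "CC.B1 Ls \<le> cK / (2 * t) * (\<Sum>l\<in>CC.lens Ls. CC.rho ^ l)"
proof -
  have "CC.B1 Ls \<le> (\<Sum>l\<in>CC.lens Ls. CC.rho ^ l / (2 * real l) * (cK * real l / t))"
  proof (rule CC.B1_le)
    fix C assume C: "C \<in> CC.cyc Ls" "card C \<le> M"
    note c = CC.cyc_length[OF C(1)]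
    have "real (card C) \<le> t" using assms C(1) by (auto simp: CC.cyc_def)
    then show "CC.bad C \<le> cK * real (card C) / t"
    proof -
      have e: "(\<lambda>H. if treelike (\<Union>C) C (H \<union> C) then 0 else 1 :: real) = (\<lambda>H. if \<not> treelike (\<Union>C) C (H \<union> C) then 1 else 0)"
        by auto
      show ?thesis
        unfolding CC.bad_def e
        using prob_outside_le[of "\<Union>C" C "\<lambda>H. \<not> treelike (\<Union>C) C (H \<union> C)"] c \<open>real (card C) \<le> t\<close> by simp
    qed
  qed (use cK_pos t_ge in auto)
  also have "\<dots> = cK / (2 * t) * (\<Sum>l\<in>CC.lens Ls. CC.rho ^ l)"
    unfolding sum_distrib_left by (intro sum.cong refl) (auto simp: CC.lens_def)
  finally show ?thesis .
qed

end

subsection \<open>Fourier inversion on the natural numbers\<close>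

lemma integral_iexp_period:
  fixes m :: int
  shows "((\<lambda>t. iexp (of_int m * t)) has_integral (if m = 0 then 2 * of_real pi else 0)) {-pi..pi}"
proof (cases "m = 0")
  case True
  have "((\<lambda>t::real. 1::complex) has_integral (measure lborel {-pi..pi} *\<^sub>R 1)) {-pi..pi}" by (rule has_integral_const_real)
  then show ?thesis using True by (simp add: scaleR_conv_of_real)
next
  case False
  let ?F = "\<lambda>t::real. iexp (of_int m * t) / (\<i> * of_int m)"
  have d: "(?F has_vector_derivative iexp (of_int m * t)) (at t within {-pi..pi})" for t
  proof -
    have "((\<lambda>z. exp (\<i> * (of_int m * z)) / (\<i> * of_int m)) has_field_derivative exp (\<i> * (of_int m * of_real t))) (at (of_real t))"
      using False by (auto intro!: derivative_eq_intros simp: field_simps)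
    from has_vector_derivative_real_field[OF this, of "{-pi..pi}"] show ?thesis by simp
  qed
  have "((\<lambda>t. iexp (of_int m * t)) has_integral (?F pi - ?F (- pi))) {-pi..pi}"
    by (rule fundamental_theorem_of_calculus) (use d in auto)
  moreover have "iexp (of_int m * pi) = iexp (of_int m * (- pi))"
    unfolding exp_eq by (rule exI[of _ m]) simp
  ultimately show ?thesis using False by simp
qed

text \<open>Orthogonality of the exponentials extracts the coefficient as a mean of the transform
  over one period.\<close>

lemma fourier_coefficient_le_finite:
  fixes d :: "nat \<Rightarrow> real"
  assumes "k < K" "\<And>t. \<bar>t\<bar> \<le> pi \<Longrightarrow> norm (\<Sum>j<K. of_real (d j) * iexp (t * real j)) \<le> B"
  shows "\<bar>d k\<bar> \<le> B"
proof -
  have B: "0 \<le> B" by (rule order_trans[OF norm_ge_zero assms(2)[of 0]]) simp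
  have "((\<lambda>t. \<Sum>j<K. of_real (d j) * iexp (of_int (int j - int k) * t)) has_integral
      (\<Sum>j<K. of_real (d j) * (if int j - int k = 0 then 2 * of_real pi else 0))) {-pi..pi}"
    by (intro has_integral_sum has_integral_mult_right integral_iexp_period) auto
  moreover have "(\<Sum>j<K. of_real (d j) * (if int j - int k = 0 then 2 * of_real pi else 0)) = (of_real (d k * (2 * pi)) :: complex)"
  proof -
    have "(\<Sum>j<K. of_real (d j) * (if int j - int k = 0 then 2 * of_real pi else 0)) = (\<Sum>j<K. if k = j then of_real (d j) * (2 * of_real pi) else (0::complex))"
      by (intro sum.cong) auto
    then show ?thesis using assms(1) by simp
  qed
  ultimately have i: "((\<lambda>t. \<Sum>j<K. of_real (d j) * iexp (of_int (int j - int k) * t)) has_integral (of_real (d k * (2 * pi)) :: complex)) (cbox (-pi) pi)"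
    by simp
  have "norm (of_real (d k * (2 * pi)) :: complex) \<le> B * measure lborel (cbox (-pi) pi)"
  proof (rule has_integral_bound[OF B i])
    fix t assume t: "t \<in> cbox (-pi) pi"
    have "(\<Sum>j<K. of_real (d j) * iexp (of_int (int j - int k) * t)) = iexp (- (real k * t)) * (\<Sum>j<K. of_real (d j) * iexp (t * real j))"
      unfolding sum_distrib_left by (intro sum.cong refl) (simp add: algebra_simps flip: exp_add)
    then show "norm (\<Sum>j<K. of_real (d j) * iexp (of_int (int j - int k) * t)) \<le> B"
      using assms(2)[of t] t by (simp add: norm_mult abs_le_iff)
  qed
  moreover have "norm (of_real (d k * (2 * pi)) :: complex) = \<bar>d k\<bar> * (2 * pi)"
    unfolding norm_of_real abs_mult by simp
  ultimately have "\<bar>d k\<bar> * (2 * pi) \<le> B * (2 * pi)" by simp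
  then show ?thesis by simp
qed

text \<open>Only a finite partial sum is integrated; its distance from \<open>D t\<close> is at most
  the tail of the absolutely convergent series, uniformly in \<open>t\<close>. This avoids
  exchanging an infinite sum with the integral.\<close>

lemma fourier_coefficient_le:
  fixes d :: "nat \<Rightarrow> real"
  assumes "summable (\<lambda>j. \<bar>d j\<bar>)" "\<And>t. (\<lambda>j. of_real (d j) * iexp (t * real j)) sums D t"
    "\<And>t. \<bar>t\<bar> \<le> pi \<Longrightarrow> norm (D t) \<le> B"
  shows "\<bar>d k\<bar> \<le> B"
proof (rule field_le_epsilon)
  fix e :: real assume "0 < e"
  then obtain K0 where K0: "\<And>n. K0 \<le> n \<Longrightarrow> norm (\<Sum>i. \<bar>d (i + n)\<bar>) < e"
    using suminf_exist_split[OF _ assms(1)] by blast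
  define K where "K = max K0 (Suc k)"
  have tail: "(\<Sum>i. \<bar>d (i + K)\<bar>) < e" using K0[of K] by (simp add: K_def)
  show "\<bar>d k\<bar> \<le> B + e"
  proof (rule fourier_coefficient_le_finite)
    show "k < K" by (simp add: K_def)
    fix t :: real assume t: "\<bar>t\<bar> \<le> pi"
    let ?f = "\<lambda>j. of_real (d j) * iexp (t * real j)"
    have nf: "norm (?f j) = \<bar>d j\<bar>" for j by (simp add: norm_mult)
    have sK: "summable (\<lambda>i. norm (?f (i + K)))" unfolding nf using assms(1) by (subst summable_iff_shift)
    have "D t = (\<Sum>i. ?f (i + K)) + (\<Sum>j<K. ?f j)"
      using assms(2)[of t] suminf_split_initial_segment[of ?f K] by (simp add: sums_iff)
    then have "norm (\<Sum>j<K. ?f j) = norm (D t - (\<Sum>i. ?f (i + K)))" by simp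
    also have "\<dots> \<le> norm (D t) + norm (\<Sum>i. ?f (i + K))" by (rule norm_triangle_ineq4)
    also have "norm (\<Sum>i. ?f (i + K)) \<le> (\<Sum>i. norm (?f (i + K)))" by (rule summable_norm[OF sK])
    finally show "norm (\<Sum>j<K. ?f j) \<le> B + e" unfolding nf using tail assms(3)[OF t] by simp
  qed
qed

subsection \<open>Poisson probabilities\<close>

definition poisson_prob :: "real \<Rightarrow> nat \<Rightarrow> real" where
  "poisson_prob r k = exp (- r) * r ^ k / fact k"

lemma poisson_prob_sums: "poisson_prob r sums 1"
proof -
  have "(\<lambda>k. exp (- r) * (r ^ k /\<^sub>R fact k)) sums (exp (- r) * exp r)"
    by (intro sums_mult exp_converges)
  then show ?thesis by (simp add: poisson_prob_def[abs_def] exp_minus field_simps scaleR_conv_of_real)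
qed

lemma poisson_prob_nonneg: "0 \<le> r \<Longrightarrow> 0 \<le> poisson_prob r k"
  by (simp add: poisson_prob_def)

lemma poisson_prob_le_1: "0 \<le> r \<Longrightarrow> poisson_prob r k \<le> 1"
proof -
  assume r: "0 \<le> r"
  have "(\<Sum>j\<in>{k}. poisson_prob r j) \<le> 1"
    using sum_le_suminf[OF sums_summable[OF poisson_prob_sums[of r]], of "{k}"] poisson_prob_nonneg[OF r]
      sums_unique[OF poisson_prob_sums[of r]] by simp
  then show ?thesis by simp
qed

lemma poisson_char_sums:
  "(\<lambda>k. of_real (poisson_prob r k) * iexp (t * real k)) sums exp (of_real r * (iexp t - 1))"
proof -
  have "(\<lambda>k. exp (- of_real r) * ((of_real r * iexp t) ^ k /\<^sub>R fact k)) sums (exp (- of_real r) * exp (of_real r * iexp t))"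
    by (intro sums_mult exp_converges)
  moreover have "exp (- of_real r) * ((of_real r * iexp t) ^ k /\<^sub>R fact k) = of_real (poisson_prob r k) * iexp (t * real k)" for k
  proof -
    have "(iexp t) ^ k = iexp (t * real k)" by (simp add: exp_of_nat_mult[symmetric] algebra_simps)
    moreover have "exp (- of_real r) = (of_real (exp (- r)) :: complex)" by (simp flip: exp_of_real)
    ultimately show ?thesis by (simp add: poisson_prob_def power_mult_distrib scaleR_conv_of_real field_simps)
  qed
  moreover have "exp (- of_real r) * exp (of_real r * iexp t) = exp (of_real r * (iexp t - 1))"
    by (simp flip: exp_add add: algebra_simps)
  ultimately show ?thesis by simp
qed

text \<open>The derivative in the parameter is the difference of two neighbouring Poisson
  probabilities. Both lie between 0 and 1, so it is at most 1 in modulus.\<close>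

lemma poisson_prob_diff_le:
  assumes "0 \<le> r" "0 \<le> s" shows "\<bar>poisson_prob r k - poisson_prob s k\<bar> \<le> \<bar>r - s\<bar>"
proof -
  define q where "q x = (if k = 0 then 0 else poisson_prob x (k - 1))" for x
  have der: "((\<lambda>x. poisson_prob x k) has_field_derivative (q x - poisson_prob x k)) (at x within {0..})" for x
  proof (cases k)
    case 0
    then show ?thesis unfolding poisson_prob_def q_def by (auto intro!: derivative_eq_intros)
  next
    case (Suc j)
    have "((\<lambda>x. exp (- x) * x ^ Suc j / fact (Suc j)) has_field_derivative
       (exp (- x) * (real (Suc j) * x ^ j) - exp (- x) * x ^ Suc j) / fact (Suc j)) (at x within {0..})"
      by (rule derivative_eq_intros refl | simp)+
    moreover have "real (Suc j) / fact (Suc j) = (1 / fact j :: real)" by (simp del: of_nat_Suc)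
    then have "(exp (- x) * (real (Suc j) * x ^ j) - exp (- x) * x ^ Suc j) / fact (Suc j) = q x - poisson_prob x k"
      unfolding q_def poisson_prob_def Suc by (simp add: diff_divide_distrib)
    ultimately show ?thesis unfolding poisson_prob_def Suc by simp
  qed
  have "norm (poisson_prob r k - poisson_prob s k) \<le> 1 * norm (r - s)"
  proof (rule field_differentiable_bound[of "{0..}" "\<lambda>x. poisson_prob x k" "\<lambda>x. q x - poisson_prob x k"])
    fix x :: real assume x: "x \<in> {0..}"
    have "0 \<le> q x" "q x \<le> 1" using x poisson_prob_nonneg poisson_prob_le_1 by (auto simp: q_def)
    moreover have "0 \<le> poisson_prob x k" "poisson_prob x k \<le> 1" using x poisson_prob_nonneg poisson_prob_le_1 by auto
    ultimately show "norm (q x - poisson_prob x k) \<le> 1" by simp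
  qed (use assms der in auto)
  then show ?thesis by simp
qed

context cycle_count
begin

lemma prob_X_sums:
  "(\<lambda>k. of_real (avg U M (\<lambda>G. if X G = k then 1 else 0 :: real)) * iexp (t * real k)) sums phi t"
  "summable (\<lambda>k. avg U M (\<lambda>G. if X G = k then 1 else 0 :: real))"
proof -
  define K where "K = X ` Pow U"
  have fK: "finite K" by (simp add: K_def)
  have out: "avg U M (\<lambda>G. if X G = k then 1 else 0 :: real) = 0" if "k \<notin> K" for k
  proof -
    have "avg U M (\<lambda>G. if X G = k then 1 else 0 :: real) = avg U M (\<lambda>G. 0)"
      by (rule avg_cong) (use that in \<open>auto simp: K_def\<close>)
    also have "\<dots> = 0" by (simp add: avg_def)
    finally show ?thesis .
  qed
  have "phi t = avg U M (\<lambda>G. \<Sum>k\<in>K. iexp (t * real k) * (if X G = k then 1 else 0))"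
    unfolding phi_def
  proof (rule avg_cong)
    fix G assume "G \<subseteq> U"
    then have "X G \<in> K" by (simp add: K_def)
    then show "iexp (t * real (X G)) = (\<Sum>k\<in>K. iexp (t * real k) * (if X G = k then 1 else 0))"
      using fK by (simp add: if_distrib sum.delta' cong: if_cong)
  qed
  also have "\<dots> = (\<Sum>k\<in>K. of_real (avg U M (\<lambda>G. if X G = k then 1 else 0 :: real)) * iexp (t * real k))"
    unfolding avg_sum avg_cmult by (intro sum.cong refl) (simp add: avg_def if_distrib cong: if_cong)
  finally have phi: "phi t = (\<Sum>k\<in>K. of_real (avg U M (\<lambda>G. if X G = k then 1 else 0 :: real)) * iexp (t * real k))" .
  show "(\<lambda>k. of_real (avg U M (\<lambda>G. if X G = k then 1 else 0 :: real)) * iexp (t * real k)) sums phi t"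
    unfolding phi by (rule sums_finite[OF fK]) (use out in simp)
  show "summable (\<lambda>k. avg U M (\<lambda>G. if X G = k then 1 else 0 :: real))"
    by (rule summable_finite[OF fK]) (use out in simp)
qed

lemma prob_X_approx:
  "\<bar>avg U M (\<lambda>G. if X G = k then 1 else 0 :: real) - poisson_prob (Lam M) k\<bar> \<le> pi * ((B1 + B3) + pi * (Lam M * B1 + B2))"
proof (rule fourier_coefficient_le[of "\<lambda>k. avg U M (\<lambda>G. if X G = k then 1 else 0 :: real) - poisson_prob (Lam M) k"])
  let ?P = "\<lambda>k. avg U M (\<lambda>G. if X G = k then 1 else 0 :: real)"
  have P: "0 \<le> ?P k" for k by (rule avg_nonneg) auto
  have sp: "summable (poisson_prob (Lam M))" using poisson_prob_sums by (rule sums_summable)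
  show "summable (\<lambda>j. \<bar>?P j - poisson_prob (Lam M) j\<bar>)"
  proof (rule summable_comparison_test')
    show "summable (\<lambda>j. ?P j + poisson_prob (Lam M) j)" by (intro summable_add prob_X_sums(2) sp)
    show "norm \<bar>?P j - poisson_prob (Lam M) j\<bar> \<le> ?P j + poisson_prob (Lam M) j" if "0 \<le> j" for j
      using P[of j] poisson_prob_nonneg[OF Lam_nonneg, of j] by simp
  qed
  show "(\<lambda>j. of_real (?P j - poisson_prob (Lam M) j) * iexp (t * real j)) sums (phi t - exp (of_real (Lam M) * (iexp t - 1)))" for t
    using sums_diff[OF prob_X_sums(1) poisson_char_sums] by (simp add: left_diff_distrib)
  fix t :: real assume t: "\<bar>t\<bar> \<le> pi"
  have "norm (phi t - exp (of_real (Lam M) * (iexp t - 1))) \<le> \<bar>t\<bar> * ((B1 + B3) + \<bar>t\<bar> * (Lam M * B1 + B2))"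
    using t by (rule phi_approx)
  also have "\<dots> \<le> pi * ((B1 + B3) + pi * (Lam M * B1 + B2))"
    using t B1_nonneg B2_nonneg B3_nonneg Lam_nonneg
    by (intro mult_mono add_left_mono mult_right_mono) (auto intro!: add_nonneg_nonneg mult_nonneg_nonneg)
  finally show "norm (phi t - exp (of_real (Lam M) * (iexp t - 1))) \<le> pi * ((B1 + B3) + pi * (Lam M * B1 + B2))" .
qed

end

subsection \<open>Passing to the limit\<close>

lemma graphs_with_edges_eq: "graphs_with_edges n m = subsets_of_card (pairs {1..n}) m"
  by (simp add: graphs_with_edges_def subsets_of_card_def pairs_def)

lemma expectation_random_graph:
  fixes f :: "nat set set \<Rightarrow> 'b::{banach, second_countable_topology, real_normed_field}"
  assumes "m \<le> card (pairs {1..n})"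
  shows "(LINT E|random_graph n m. f E) = avg (pairs {1..n}) m f"
proof -
  let ?S = "subsets_of_card (pairs {1..n}) m"
  have S: "finite ?S" "?S \<noteq> {}" using subsets_of_card_nonempty[OF _ assms] by simp_all
  have "(LINT E|random_graph n m. f E) = (\<Sum>E\<in>?S. pmf (pmf_of_set ?S) E *\<^sub>R f E)"
    unfolding random_graph_def graphs_with_edges_eq
    by (rule integral_measure_pmf[OF S(1)]) (use S in auto)
  also have "\<dots> = (\<Sum>E\<in>?S. f E / of_nat (card ?S))"
  proof (intro sum.cong refl)
    fix E assume "E \<in> ?S"
    then have "pmf (pmf_of_set ?S) E = 1 / real (card ?S)"
      unfolding pmf_of_set[OF S(2,1)] by simp
    then show "pmf (pmf_of_set ?S) E *\<^sub>R f E = f E / of_nat (card ?S)"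
      by (simp add: scaleR_conv_of_real)
  qed
  also have "\<dots> = avg (pairs {1..n}) m f"
    by (simp add: avg_def sum_divide_distrib card_subsets_of_card)
  finally show ?thesis .
qed

lemma prob_random_graph:
  assumes "m \<le> card (pairs {1..n})"
  shows "measure_pmf.prob (random_graph n m) {E. P E} = avg (pairs {1..n}) m (\<lambda>E. if P E then 1 else 0)"
proof -
  have "measure_pmf.prob (random_graph n m) {E. P E} = (LINT E|random_graph n m. indicat_real {E. P E} E)" by simp
  also have "\<dots> = avg (pairs {1..n}) m (indicat_real {E. P E})" by (rule expectation_random_graph[OF assms])
  also have "indicat_real {E. P E} = (\<lambda>E. if P E then 1 else 0)" by (auto simp: indicator_def)
  finally show ?thesis .
qed

lemma num_L_cycles_split:
  assumes "finite V" "G \<subseteq> pairs V" "K \<subseteq> L"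
  shows "num_L_cycles L V G = num_L_cycles K V G + num_L_cycles (L - K) V G"
proof -
  have "isolated_cycles V G \<subseteq> Pow (pairs V)"
    using isolated_cycles_cycles[of V G] assms(2) by (auto simp: cycles_of_def)
  then have f: "finite (isolated_cycles V G)" by (rule finite_subset) (use assms(1) in simp)
  have "{C \<in> isolated_cycles V G. card C \<in> L}
    = {C \<in> isolated_cycles V G. card C \<in> K} \<union> {C \<in> isolated_cycles V G. card C \<in> L - K}" using assms(3) by auto
  then show ?thesis unfolding num_L_cycles_def using f by (simp add: card_Un_disjoint disjoint_iff)
qed

context cycle_count
begin

lemma X_eq_num: "X G = num_L_cycles Ls V G"
  by (simp add: X_def num_L_cycles_def)

text \<open>The full count and the count over \<open>Ls\<close> differ only if an isolated cycle of
  a discarded length exists. The probability of this is at most the expected number of such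
  cycles.\<close>

lemma prob_num_approx:
  assumes "Ls \<subseteq> L" "0 \<le> lam"
  shows "\<bar>avg U M (\<lambda>G. if num_L_cycles L V G = k then 1 else 0) - poisson_prob lam k\<bar>
    \<le> pi * ((B1 + B3) + pi * (Lam M * B1 + B2)) + \<bar>Lam M - lam\<bar> + avg U M (\<lambda>G. real (num_L_cycles (L - Ls) V G))"
proof -
  have "\<bar>avg U M (\<lambda>G. if num_L_cycles L V G = k then 1 else 0 :: real) - avg U M (\<lambda>G. if X G = k then 1 else 0)\<bar>
     = norm (avg U M (\<lambda>G. (if num_L_cycles L V G = k then 1 else 0) - (if X G = k then 1 else 0 :: real)))"
    by (simp add: avg_diff)
  also have "\<dots> \<le> avg U M (\<lambda>G. norm ((if num_L_cycles L V G = k then 1 else 0) - (if X G = k then 1 else 0 :: real)))"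
    by (rule norm_avg_le)
  also have "\<dots> \<le> avg U M (\<lambda>G. real (num_L_cycles (L - Ls) V G))"
    by (rule avg_mono) (use num_L_cycles_split[OF fin _ assms(1)] in \<open>auto simp: X_eq_num\<close>)
  finally have "\<bar>avg U M (\<lambda>G. if num_L_cycles L V G = k then 1 else 0 :: real) - avg U M (\<lambda>G. if X G = k then 1 else 0)\<bar>
     \<le> avg U M (\<lambda>G. real (num_L_cycles (L - Ls) V G))" .
  then show ?thesis
    using prob_X_approx[of k] poisson_prob_diff_le[OF Lam_nonneg assms(2), of k] by linarith
qed

text \<open>Discarding cycles costs at most |s| times their expected number, because
  \<open>iexp\<close> is Lipschitz. Thus every error term keeps a factor |s|, which pays for the
  normalisation in the normal limit.\<close>

lemma char_num_approx:
  assumes "Ls \<subseteq> L" "\<bar>s\<bar> \<le> pi"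
  shows "norm (avg U M (\<lambda>G. iexp (s * (real (num_L_cycles L V G) - lam))) - exp (of_real (Lam M) * (iexp s - 1) - \<i> * of_real (s * lam)))
    \<le> \<bar>s\<bar> * ((B1 + B3) + \<bar>s\<bar> * (Lam M * B1 + B2)) + \<bar>s\<bar> * avg U M (\<lambda>G. real (num_L_cycles (L - Ls) V G))"
proof -
  let ?c = "iexp (- (s * lam))"
  have 1: "norm (avg U M (\<lambda>G. iexp (s * (real (num_L_cycles L V G) - lam))) - avg U M (\<lambda>G. iexp (s * (real (X G) - lam))))
     \<le> \<bar>s\<bar> * avg U M (\<lambda>G. real (num_L_cycles (L - Ls) V G))"
  proof -
    have "norm (avg U M (\<lambda>G. iexp (s * (real (num_L_cycles L V G) - lam))) - avg U M (\<lambda>G. iexp (s * (real (X G) - lam))))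
      \<le> avg U M (\<lambda>G. norm (iexp (s * (real (num_L_cycles L V G) - lam)) - iexp (s * (real (X G) - lam))))"
      unfolding avg_diff[symmetric] by (rule norm_avg_le)
    also have "\<dots> \<le> avg U M (\<lambda>G. \<bar>s\<bar> * real (num_L_cycles (L - Ls) V G))"
    proof (rule avg_mono)
      fix G assume "G \<subseteq> U"
      then have "s * (real (num_L_cycles L V G) - lam) - s * (real (X G) - lam) = s * real (num_L_cycles (L - Ls) V G)"
        using num_L_cycles_split[OF fin _ assms(1), of G] by (simp add: X_eq_num algebra_simps)
      then show "norm (iexp (s * (real (num_L_cycles L V G) - lam)) - iexp (s * (real (X G) - lam))) \<le> \<bar>s\<bar> * real (num_L_cycles (L - Ls) V G)"
        using norm_iexp_diff_le[of "s * (real (num_L_cycles L V G) - lam)" "s * (real (X G) - lam)"] by (simp add: abs_mult)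
    qed
    finally show ?thesis by (simp only: avg_cmult)
  qed
  have 2: "avg U M (\<lambda>G. iexp (s * (real (X G) - lam))) = ?c * phi s"
    unfolding phi_def avg_cmult[symmetric] by (rule avg_cong) (simp add: algebra_simps flip: exp_add)
  have 3: "exp (of_real (Lam M) * (iexp s - 1) - \<i> * of_real (s * lam)) = ?c * exp (of_real (Lam M) * (iexp s - 1))"
    by (simp add: algebra_simps flip: exp_add)
  have "norm (?c * phi s - ?c * exp (of_real (Lam M) * (iexp s - 1))) = norm (phi s - exp (of_real (Lam M) * (iexp s - 1)))"
    unfolding right_diff_distrib[symmetric] norm_mult by simp
  then have 4: "norm (avg U M (\<lambda>G. iexp (s * (real (X G) - lam))) - exp (of_real (Lam M) * (iexp s - 1) - \<i> * of_real (s * lam)))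
     \<le> \<bar>s\<bar> * ((B1 + B3) + \<bar>s\<bar> * (Lam M * B1 + B2))"
    unfolding 2 3 using phi_approx[OF assms(2)] by simp
  have tri: "norm (a - c) \<le> y + x" if "norm (a - b) \<le> x" "norm (b - c) \<le> y" for a b c :: complex and x y
    using norm_triangle_ineq[of "a - b" "b - c"] that by simp
  show ?thesis by (rule tri[OF 1 4])
qed

end

section \<open>Limit laws for sequences with discarded cycle lengths\<close>

definition truncation_error :: "nat set \<Rightarrow> (nat \<Rightarrow> nat set) \<Rightarrow> (nat \<Rightarrow> nat) \<Rightarrow> nat \<Rightarrow> real" where
  "truncation_error L Lr M n = avg (pairs {1..n}) (M n) (\<lambda>G. real (num_L_cycles (L - Lr n) {1..n} G))"

text \<open>\<open>Lr n\<close> contains the lengths that are kept: all of \<open>L\<close> below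
  the window, and only those up to a cutoff smaller than n^(1/3) inside it.\<close>

locale truncated_sequence =
  fixes L :: "nat set" and Lr :: "nat \<Rightarrow> nat set" and M :: "nat \<Rightarrow> nat" and lam :: "nat \<Rightarrow> real"
  assumes ev: "\<forall>\<^sub>F n in sequentially. 2 \<le> n \<and> M n \<le> card (pairs {1..n}) \<and> 0 \<le> lam n"
    and Lr: "\<And>n. Lr n \<subseteq> L"
    and b1: "(\<lambda>n. cycle_count.B1 {1..n} (Lr n) (M n)) \<longlonglongrightarrow> 0"
    and b2: "(\<lambda>n. cycle_count.B2 {1..n} (Lr n) (M n)) \<longlonglongrightarrow> 0"
    and b3: "(\<lambda>n. cycle_count.B3 {1..n} (Lr n) (M n)) \<longlonglongrightarrow> 0"
begin

abbreviation "b1 n \<equiv> cycle_count.B1 {1..n} (Lr n) (M n)"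
abbreviation "b2 n \<equiv> cycle_count.B2 {1..n} (Lr n) (M n)"
abbreviation "b3 n \<equiv> cycle_count.B3 {1..n} (Lr n) (M n)"
abbreviation "Lam n \<equiv> cycle_count.Lam {1..n} (Lr n) (M n)"

lemma Poisson_limit:
  assumes "\<forall>\<^sub>F n in sequentially. lam n \<le> K"
    and "(\<lambda>n. Lam n - lam n) \<longlonglongrightarrow> 0" "truncation_error L Lr M \<longlonglongrightarrow> 0"
  shows "asymp_Poisson L M lam"
proof -
  let ?f = "\<lambda>n k. \<bar>measure_pmf.prob (random_graph n (M n)) {E. X_cycles L n E = k} - exp (- lam n) * lam n ^ k / fact k\<bar>"
  define r where "r n = pi * ((b1 n + b3 n) + pi * ((\<bar>Lam n - lam n\<bar> + \<bar>K\<bar>) * b1 n + b2 n)) + \<bar>Lam n - lam n\<bar> + truncation_error L Lr M n" for n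
  have r: "r \<longlonglongrightarrow> pi * ((0 + 0) + pi * ((\<bar>0\<bar> + \<bar>K\<bar>) * 0 + 0)) + \<bar>0\<bar> + 0"
    unfolding r_def by (intro tendsto_intros b1 b2 b3 assms)
  have le: "\<forall>\<^sub>F n in sequentially. \<forall>k. ?f n k \<le> r n"
    using ev assms(1)
  proof eventually_elim
    case (elim n)
    then interpret C: cycle_count "{1..n}" "Lr n" "M n" by unfold_locales auto
    show ?case
    proof
      fix k
      have "?f n k = \<bar>avg (pairs {1..n}) (M n) (\<lambda>G. if num_L_cycles L {1..n} G = k then 1 else 0) - poisson_prob (lam n) k\<bar>"
        unfolding X_cycles_def poisson_prob_def using elim by (subst prob_random_graph) auto
      also have "\<dots> \<le> pi * ((b1 n + b3 n) + pi * (Lam n * b1 n + b2 n)) + \<bar>Lam n - lam n\<bar> + truncation_error L Lr M n"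
        unfolding truncation_error_def by (rule C.prob_num_approx[OF Lr]) (use elim in auto)
      also have "\<dots> \<le> r n"
      proof -
        have "Lam n \<le> \<bar>Lam n - lam n\<bar> + \<bar>K\<bar>" using elim by linarith
        then have "Lam n * b1 n \<le> (\<bar>Lam n - lam n\<bar> + \<bar>K\<bar>) * b1 n" using C.B1_nonneg by (rule mult_right_mono)
        then show ?thesis unfolding r_def
          by (intro add_right_mono mult_left_mono add_left_mono) auto
      qed
      finally show "?f n k \<le> r n" .
    qed
  qed
  have hi: "\<forall>\<^sub>F n in sequentially. (SUP k. ?f n k) \<le> r n"
    using le by eventually_elim (rule cSUP_least, auto)
  have lo: "\<forall>\<^sub>F n in sequentially. 0 \<le> (SUP k. ?f n k)"
    using le
  proof eventually_elim
    case (elim n)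
    \<comment> \<open>Needed since the supremum of an unbounded set of reals is unspecified.\<close>
    then have "bdd_above (range (?f n))" by (auto intro: bdd_aboveI)
    then show ?case by (rule cSUP_upper2[of _ _ 0]) auto
  qed
  have "r \<longlonglongrightarrow> 0" using r by simp
  then show ?thesis unfolding asymp_Poisson_def
    by (rule tendsto_sandwich[OF lo hi tendsto_const])
qed

text \<open>The characteristic function is evaluated at s = t / sqrt lam. There
  \<open>Lam n * (s n)^2\<close> stays bounded, so the critical error term s^2 Lam B1 vanishes with
  \<open>B1\<close> although the parameter tends to infinity.\<close>

lemma normal_limit:
  assumes "filterlim lam at_top sequentially"
    and d: "(\<lambda>n. (Lam n - lam n) / sqrt (lam n)) \<longlonglongrightarrow> 0" "(\<lambda>n. truncation_error L Lr M n / sqrt (lam n)) \<longlonglongrightarrow> 0"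
  shows "asymp_normal L M lam"
  unfolding asymp_normal_def
proof (rule levy_continuity)
  show "real_distribution (distr (measure_pmf (random_graph n (M n))) borel (\<lambda>E. (real (X_cycles L n E) - lam n) / sqrt (lam n)))" for n
    by (rule prob_space.real_distribution_distr[OF prob_space_measure_pmf]) simp
  show "real_distribution std_normal_distribution" by (rule real_dist_normal_dist)
next
  fix t :: real
  define s where "s n = t / sqrt (lam n)" for n
  have sq: "filterlim (\<lambda>n. sqrt (lam n)) at_top sequentially"
    by (rule filterlim_compose[OF sqrt_at_top assms(1)])
  have s0: "s \<longlonglongrightarrow> 0" unfolding s_def
    by (rule tendsto_divide_0[OF tendsto_const filterlim_at_top_imp_at_infinity[OF sq]])
  have pos: "\<forall>\<^sub>F n in sequentially. 0 < lam n" using assms(1) by (simp add: filterlim_at_top_dense)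
  have s_small: "\<forall>\<^sub>F n in sequentially. \<bar>s n\<bar> \<le> pi"
  proof -
    have "\<forall>\<^sub>F n in sequentially. \<bar>s n\<bar> < pi" using order_tendstoD(2)[OF tendsto_rabs_zero[OF s0], of pi] by simp
    then show ?thesis by eventually_elim simp
  qed
  have ratio: "(\<lambda>n. Lam n / lam n) \<longlonglongrightarrow> 1"
  proof -
    have "(\<lambda>n. (Lam n - lam n) / sqrt (lam n) * inverse (sqrt (lam n)) + 1) \<longlonglongrightarrow> 0 * 0 + 1"
      by (intro tendsto_intros d tendsto_inverse_0_at_top sq)
    moreover have "\<forall>\<^sub>F n in sequentially. (Lam n - lam n) / sqrt (lam n) * inverse (sqrt (lam n)) + 1 = Lam n / lam n"
      using pos by eventually_elim (simp add: field_simps)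
    ultimately have "(\<lambda>n. Lam n / lam n) \<longlonglongrightarrow> 0 * 0 + 1" by (rule Lim_transform_eventually)
    then show ?thesis by simp
  qed
  let ?z = "\<lambda>n. of_real (Lam n) * (iexp (s n) - 1) - \<i> * of_real (s n * lam n) :: complex"
  have sl2: "(\<lambda>n. Lam n * (s n)\<^sup>2) \<longlonglongrightarrow> t\<^sup>2"
  proof -
    have "(\<lambda>n. Lam n / lam n * t\<^sup>2) \<longlonglongrightarrow> 1 * t\<^sup>2" by (intro tendsto_intros ratio)
    moreover have "\<forall>\<^sub>F n in sequentially. Lam n / lam n * t\<^sup>2 = Lam n * (s n)\<^sup>2"
      using pos by eventually_elim (simp add: s_def power_divide)
    ultimately have "(\<lambda>n. Lam n * (s n)\<^sup>2) \<longlonglongrightarrow> 1 * t\<^sup>2" by (rule Lim_transform_eventually)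
    then show ?thesis by simp
  qed
  \<comment> \<open>Taylor expansion to second order. The linear part leaves the difference of
    \<open>Lam n\<close> and \<open>lam n\<close> divided by sqrt lam, the quadratic part tends to -
    t^2 / 2, and the cubic remainder is Lam s^2 times |s| / 6.\<close>
  have z: "?z \<longlonglongrightarrow> of_real (- t\<^sup>2 / 2)"
  proof -
    have "(\<lambda>n. norm (?z n - (\<i> * of_real (t * ((Lam n - lam n) / sqrt (lam n))) - of_real (Lam n * (s n)\<^sup>2 / 2)))) \<longlonglongrightarrow> 0"
    proof (rule tendsto_sandwich[OF _ _ tendsto_const])
      have "(\<lambda>n. Lam n * (s n)\<^sup>2 * (\<bar>s n\<bar> / 6)) \<longlonglongrightarrow> t\<^sup>2 * (0 / 6)"
        by (intro tendsto_intros sl2 tendsto_rabs_zero s0) simp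
      then show "(\<lambda>n. Lam n * (s n)\<^sup>2 * (\<bar>s n\<bar> / 6)) \<longlonglongrightarrow> 0" by simp
      show "\<forall>\<^sub>F n in sequentially. norm (?z n - (\<i> * of_real (t * ((Lam n - lam n) / sqrt (lam n))) - of_real (Lam n * (s n)\<^sup>2 / 2)))
          \<le> Lam n * (s n)\<^sup>2 * (\<bar>s n\<bar> / 6)"
        using ev pos
      proof eventually_elim
        case (elim n)
        then interpret C: cycle_count "{1..n}" "Lr n" "M n" by unfold_locales auto
        have ts: "t * ((Lam n - lam n) / sqrt (lam n)) = s n * (Lam n - lam n)" by (simp add: s_def)
        have a: "(\<Sum>k\<le>2. (\<i> * of_real (s n)) ^ k / fact k) = 1 + \<i> * of_real (s n) - of_real ((s n)\<^sup>2 / 2)"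
          by (simp add: numeral_2_eq_2 power2_eq_square power_mult_distrib)
        have "?z n - (\<i> * of_real (t * ((Lam n - lam n) / sqrt (lam n))) - of_real (Lam n * (s n)\<^sup>2 / 2))
          = of_real (Lam n) * (iexp (s n) - (\<Sum>k\<le>2. (\<i> * of_real (s n)) ^ k / fact k))"
          unfolding ts a by (simp add: algebra_simps)
        also have "norm \<dots> \<le> Lam n * (\<bar>s n\<bar> ^ Suc 2 / fact (Suc 2))"
          unfolding norm_mult using C.Lam_nonneg iexp_approx1[of "s n" 2]
          by (intro mult_mono) auto
        also have "\<dots> = Lam n * (s n)\<^sup>2 * (\<bar>s n\<bar> / 6)"
          by (simp add: power_Suc2 fact_numeral numeral_2_eq_2 power2_eq_square abs_mult_self_eq flip: abs_mult)
        finally show ?case .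
      qed
    qed simp
    then have 1: "(\<lambda>n. ?z n - (\<i> * of_real (t * ((Lam n - lam n) / sqrt (lam n))) - of_real (Lam n * (s n)\<^sup>2 / 2))) \<longlonglongrightarrow> 0"
      by (rule tendsto_norm_zero_cancel)
    have 2: "(\<lambda>n. \<i> * of_real (t * ((Lam n - lam n) / sqrt (lam n))) - of_real (Lam n * (s n)\<^sup>2 / 2)) \<longlonglongrightarrow> \<i> * of_real (t * 0) - of_real (t\<^sup>2 / 2)"
      by (intro tendsto_intros d sl2) simp
    show ?thesis using tendsto_add[OF 1 2] by simp
  qed
  let ?ch = "\<lambda>n. avg (pairs {1..n}) (M n) (\<lambda>G. iexp (s n * (real (num_L_cycles L {1..n} G) - lam n)))"
  have "(\<lambda>n. norm (?ch n - exp (?z n))) \<longlonglongrightarrow> 0"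
  proof (rule tendsto_sandwich[OF _ _ tendsto_const])
    define r where "r n = \<bar>s n\<bar> * ((b1 n + b3 n) + \<bar>s n\<bar> * b2 n) + Lam n * (s n)\<^sup>2 * b1 n + \<bar>t\<bar> * (truncation_error L Lr M n / sqrt (lam n))" for n
    have "r \<longlonglongrightarrow> 0 * ((0 + 0) + 0 * 0) + t\<^sup>2 * 0 + \<bar>t\<bar> * 0"
      unfolding r_def by (intro tendsto_intros tendsto_rabs_zero s0 b1 b2 b3 sl2 d)
    then show "r \<longlonglongrightarrow> 0" by simp
    show "\<forall>\<^sub>F n in sequentially. norm (?ch n - exp (?z n)) \<le> r n"
      using ev pos s_small
    proof eventually_elim
      case (elim n)
      then interpret C: cycle_count "{1..n}" "Lr n" "M n" by unfold_locales auto
      have "norm (?ch n - exp (?z n)) \<le> \<bar>s n\<bar> * ((b1 n + b3 n) + \<bar>s n\<bar> * (Lam n * b1 n + b2 n)) + \<bar>s n\<bar> * truncation_error L Lr M n"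
        unfolding truncation_error_def by (rule C.char_num_approx[OF Lr]) (use elim in auto)
      also have "\<dots> = r n"
      proof -
        have "\<bar>s n\<bar> * \<bar>s n\<bar> = (s n)\<^sup>2" by (simp add: power2_eq_square flip: abs_mult)
        then have "\<bar>s n\<bar> * (\<bar>s n\<bar> * (Lam n * b1 n)) = Lam n * (s n)\<^sup>2 * b1 n" by (metis mult.assoc mult.commute)
        moreover have "\<bar>s n\<bar> = \<bar>t\<bar> / sqrt (lam n)" using elim by (simp add: s_def abs_divide)
        ultimately show ?thesis unfolding r_def by (simp add: distrib_left)
      qed
      finally show ?case .
    qed
  qed simp
  then have "(\<lambda>n. ?ch n - exp (?z n)) \<longlonglongrightarrow> 0" by (rule tendsto_norm_zero_cancel)
  from tendsto_add[OF this tendsto_exp[OF z]] have "?ch \<longlonglongrightarrow> exp (of_real (- t\<^sup>2 / 2))" by simp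
  moreover have "\<forall>\<^sub>F n in sequentially. ?ch n = char (distr (measure_pmf (random_graph n (M n))) borel (\<lambda>E. (real (X_cycles L n E) - lam n) / sqrt (lam n))) t"
    using ev
  proof eventually_elim
    case (elim n)
    have "char (distr (measure_pmf (random_graph n (M n))) borel (\<lambda>E. (real (X_cycles L n E) - lam n) / sqrt (lam n))) t
      = (LINT E|random_graph n (M n). iexp (t * ((real (X_cycles L n E) - lam n) / sqrt (lam n))))"
      unfolding char_def by (subst integral_distr) auto
    also have "\<dots> = avg (pairs {1..n}) (M n) (\<lambda>E. iexp (t * ((real (X_cycles L n E) - lam n) / sqrt (lam n))))"
      using elim by (intro expectation_random_graph) auto
    also have "\<dots> = ?ch n" by (simp add: s_def X_cycles_def)
    finally show ?case by simp
  qed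
  ultimately have "(\<lambda>n. char (distr (measure_pmf (random_graph n (M n))) borel (\<lambda>E. (real (X_cycles L n E) - lam n) / sqrt (lam n))) t)
      \<longlonglongrightarrow> exp (of_real (- t\<^sup>2 / 2))" by (rule Lim_transform_eventually)
  then show "(\<lambda>n. char (distr (measure_pmf (random_graph n (M n))) borel (\<lambda>E. (real (X_cycles L n E) - lam n) / sqrt (lam n))) t) \<longlonglongrightarrow> char std_normal_distribution t"
    unfolding char_std_normal_distribution by (simp only: exp_of_real)
qed

end

subsection \<open>Estimates for the Poisson parameter\<close>

lemma power_diff_le:
  fixes x y :: real assumes "0 \<le> y" "y \<le> x" shows "x ^ l - y ^ l \<le> real l * (x - y) * x ^ (l - 1)"
proof (induction l)
  case (Suc l)
  have "x ^ Suc l - y ^ Suc l = x * (x ^ l - y ^ l) + (x - y) * y ^ l" by (simp add: algebra_simps)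
  also have "\<dots> \<le> x * (real l * (x - y) * x ^ (l - 1)) + (x - y) * x ^ l"
    using assms Suc by (intro add_mono mult_left_mono power_mono) auto
  also have "\<dots> = real (Suc l) * (x - y) * x ^ (Suc l - 1)"
    by (cases l) (simp_all add: algebra_simps)
  finally show ?case .
qed simp

lemma one_minus_power_le:
  fixes x :: real assumes "x \<le> 1" "0 \<le> x" shows "1 - real l * (1 - x) \<le> x ^ l"
  using power_diff_le[of x 1 l] assms by simp

text \<open>The products for the falling factorials of \<open>n\<close> and \<open>M\<close> are
  bounded below by Weierstrass' inequality, with relative losses l^2/(2n) and l^2/(2M). One factor z
  = 2M/n is spent on turning the second into l^2/n; hence the exponent l - 1, and no trouble for
  small \<open>M\<close>.\<close>

lemma cycle_weight_ge:
  assumes l: "1 \<le> l" and M: "M \<le> N" "2 * real N \<le> (real n)\<^sup>2" "0 < n" and z: "z = 2 * real M / real n" "z \<le> 2"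
  shows "z ^ l - 2 * z ^ (l - 1) * (real l)\<^sup>2 / real n \<le> cycle_weight n N M l"
proof -
  have z0: "0 \<le> z" unfolding z by simp
  have zl: "z ^ l = z * z ^ (l - 1)" using l by (cases l) auto
  have nn: "0 < real n" using M by simp
  show ?thesis
  proof (cases "l \<le> M \<and> l \<le> n")
    case True
    then have lM: "l \<le> M" "l \<le> n" and M0: "0 < real M" using l by auto
    have N0: "0 < real N" using M0 M by simp
    define P where "P = (\<Prod>i<l. 1 - real i / real n)"
    define Q where "Q = (\<Prod>i<l. 1 - real i / real M)"
    have si: "(\<Sum>i<l. real i) \<le> (real l)\<^sup>2 / 2"
    proof -
      have "(\<Sum>i<l. real i) = real l * (real l - 1) / 2" by (induction l) (auto simp: field_simps)
      also have "\<dots> \<le> (real l)\<^sup>2 / 2" by (simp add: power2_eq_square mult_left_mono)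
      finally show ?thesis .
    qed
    have W: "1 - (real l)\<^sup>2 / 2 / c \<le> (\<Prod>i<l. 1 - real i / c) \<and> 0 \<le> (\<Prod>i<l. 1 - real i / c) \<and> (\<Prod>i<l. 1 - real i / c) \<le> 1"
      if c: "real l \<le> c" "0 < c" for c :: real
    proof -
      have i: "0 \<le> real i / c \<and> real i / c \<le> 1" if "i < l" for i using that c by (simp add: field_simps)
      have "1 - (\<Sum>i<l. real i / c) \<le> (\<Prod>i<l. 1 - real i / c)"
        by (rule Weierstrass_prod_ineq) (use i in auto)
      moreover have "(\<Sum>i<l. real i / c) \<le> (real l)\<^sup>2 / 2 / c"
        unfolding sum_divide_distrib[symmetric] using si c by (intro divide_right_mono) auto
      moreover have "0 \<le> (\<Prod>i<l. 1 - real i / c)" by (intro prod_nonneg) (use i in auto)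
      moreover have "(\<Prod>i<l. 1 - real i / c) \<le> 1" by (intro prod_le_1) (use i in auto)
      ultimately show ?thesis by linarith
    qed
    have P: "1 - (real l)\<^sup>2 / 2 / real n \<le> P" "0 \<le> P" "P \<le> 1" using W[of "real n"] lM nn unfolding P_def by auto
    have Q: "1 - (real l)\<^sup>2 / 2 / real M \<le> Q" "0 \<le> Q" "Q \<le> 1" using W[of "real M"] lM M0 unfolding Q_def by auto
    have "0 \<le> (1 - P) * (1 - Q)" using P Q by simp
    then have PQ: "P * Q \<ge> P + Q - 1" by (simp add: algebra_simps)
    have e1: "(\<Prod>i<l. real n - real i) = real n ^ l * P"
    proof -
      have "(\<Prod>i<l. real n - real i) = (\<Prod>i<l. real n * (1 - real i / real n))" using nn by (intro prod.cong) (auto simp: field_simps)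
      then show ?thesis by (simp add: prod.distrib P_def)
    qed
    have e2: "incl_prob N M l \<ge> (real M / real N) ^ l * Q"
    proof -
      have "(real M / real N) ^ l * Q = (\<Prod>i<l. real M / real N * (1 - real i / real M))"
        by (simp only: prod.distrib Q_def prod_constant card_lessThan)
      also have "\<dots> \<le> incl_prob N M l" unfolding incl_prob_def
      proof (rule prod_mono)
        fix i assume "i \<in> {..<l}"
        then have i: "real i < real M" "real i < real N" using lM M by auto
        have "real M / real N * (1 - real i / real M) = (real M - real i) / real N" using M0 N0 by (simp add: field_simps)
        moreover have "\<dots> \<le> (real M - real i) / (real N - real i)" using i by (intro divide_left_mono) auto
        ultimately show "0 \<le> real M / real N * (1 - real i / real M) \<and> real M / real N * (1 - real i / real M) \<le> (real M - real i) / (real N - real i)"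
          using i by simp
      qed
      finally show ?thesis .
    qed
    have zr: "z \<le> real n * (real M / real N)"
    proof -
      have "2 * real M / real n = 2 * real M * real n / (real n)\<^sup>2" using nn by (simp add: power2_eq_square)
      also have "\<dots> \<le> 2 * real M * real n / (2 * real N)" using M(2) N0 nn by (intro divide_left_mono) auto
      also have "\<dots> = real n * (real M / real N)" by simp
      finally show ?thesis unfolding z .
    qed
    have "z ^ l - 2 * z ^ (l - 1) * (real l)\<^sup>2 / real n \<le> z ^ l * (1 - (real l)\<^sup>2 / 2 / real n - (real l)\<^sup>2 / 2 / real M)"
    proof -
      have "z * ((real l)\<^sup>2 / 2 / real M) = (real l)\<^sup>2 / real n" unfolding z using M0 nn by (simp add: field_simps)
      moreover have "z * ((real l)\<^sup>2 / 2 / real n) \<le> 2 * ((real l)\<^sup>2 / 2 / real n)" using z(2) by (intro mult_right_mono) auto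
      ultimately have "z * ((real l)\<^sup>2 / 2 / real n + (real l)\<^sup>2 / 2 / real M) \<le> 2 * (real l)\<^sup>2 / real n" by (simp add: distrib_left)
      then have "z ^ (l - 1) * (z * ((real l)\<^sup>2 / 2 / real n + (real l)\<^sup>2 / 2 / real M)) \<le> z ^ (l - 1) * (2 * (real l)\<^sup>2 / real n)"
        using z0 by (intro mult_left_mono) auto
      then show ?thesis unfolding zl by (simp add: algebra_simps)
    qed
    also have "\<dots> \<le> z ^ l * (P * Q)" using P Q PQ z0 by (intro mult_left_mono) auto
    also have "\<dots> \<le> (real n * (real M / real N)) ^ l * (P * Q)"
      using zr z0 P Q by (intro mult_right_mono power_mono) auto
    also have "\<dots> = real n ^ l * P * ((real M / real N) ^ l * Q)" by (simp only: power_mult_distrib mult_ac)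
    also have "\<dots> \<le> cycle_weight n N M l" unfolding cycle_weight_def e1 using e2 P by (intro mult_left_mono) auto
    finally show ?thesis .
  next
    case False
    \<comment> \<open>When the cycle does not fit, the claimed lower bound is not positive.\<close>
    have "z * real n \<le> 2 * (real l)\<^sup>2"
    proof -
      have "real l \<le> (real l)\<^sup>2" using l by (simp add: power2_eq_square)
      moreover have "z * real n = 2 * real M" using nn unfolding z by simp
      moreover have "z * real n \<le> 2 * real n" using z(2) by (intro mult_right_mono) auto
      moreover have "real M < real l \<or> real n < real l" using False by auto
      ultimately show ?thesis by linarith
    qed
    then have "z \<le> 2 * (real l)\<^sup>2 / real n" using nn by (simp add: field_simps)
    then have "z * z ^ (l - 1) \<le> 2 * (real l)\<^sup>2 / real n * z ^ (l - 1)" using z0 by (intro mult_right_mono) auto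
    then have "z ^ l - 2 * z ^ (l - 1) * (real l)\<^sup>2 / real n \<le> 0" unfolding zl by (simp add: mult_ac)
    then show ?thesis using cycle_weight_nonneg[OF M(1), of n l] by linarith
  qed
qed

text \<open>The terms of \<open>lambda_gf\<close> extended by 0 to all indices, so that series over
  the natural numbers can be compared term by term instead of unordered sums over
  \<open>L\<close>.\<close>

definition lambda_term :: "nat set \<Rightarrow> real \<Rightarrow> nat \<Rightarrow> real" where
  "lambda_term L z l = (if l \<in> L then z ^ l / (2 * real l) else 0)"

lemma lambda_term_le: "0 \<le> z \<Longrightarrow> lambda_term L z l \<le> z ^ l"
proof -
  assume z: "0 \<le> z"
  have "z ^ l / (2 * real l) \<le> z ^ l" if "0 < l"
  proof -
    have "z ^ l / (2 * real l) \<le> z ^ l / 1" using that z by (intro divide_left_mono) auto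
    then show ?thesis by simp
  qed
  then show ?thesis using z by (cases "l = 0") (auto simp: lambda_term_def)
qed

lemma lambda_term_nonneg: "0 \<le> z \<Longrightarrow> 0 \<le> lambda_term L z l"
  by (simp add: lambda_term_def)

lemma lambda_gf_sums:
  fixes z :: real assumes "0 \<le> z" "z < 1"
  shows "lambda_term L z sums lambda_gf L z"
proof -
  have s: "summable (lambda_term L z)"
    by (rule summable_comparison_test'[of "\<lambda>l. z ^ l" 0])
      (use assms lambda_term_le lambda_term_nonneg in \<open>auto simp: summable_geometric\<close>)
  then have "(lambda_term L z has_sum suminf (lambda_term L z)) UNIV"
    using lambda_term_nonneg[OF assms(1)] by (intro norm_summable_imp_has_sum summable_sums) auto
  then have "((\<lambda>l. z ^ l / (2 * of_nat l)) has_sum suminf (lambda_term L z)) L"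
    by (rule has_sum_cong_neutral[THEN iffD1, rotated -1]) (auto simp: lambda_term_def)
  then have "lambda_gf L z = suminf (lambda_term L z)" unfolding lambda_gf_def by (rule infsumI)
  then show ?thesis using s by (simp add: summable_sums)
qed

lemma lambda_gf_nonneg: "0 \<le> z \<Longrightarrow> z < 1 \<Longrightarrow> 0 \<le> lambda_gf L (z :: real)"
  using lambda_gf_sums[of z L] lambda_term_nonneg[of z L] by (metis suminf_nonneg sums_summable sums_unique)

lemma lambda_gf_le: "0 \<le> z \<Longrightarrow> z < 1 \<Longrightarrow> lambda_gf L (z :: real) \<le> 1 / (1 - z)"
proof -
  assume z: "0 \<le> z" "z < 1"
  have "(\<lambda>l. z ^ l) sums (1 / (1 - z))" using geometric_sums[of z] z by simp
  then show ?thesis using sums_le[OF _ lambda_gf_sums[OF z]] lambda_term_le[OF z(1)] by blast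
qed

section \<open>The expected number of cycles compared with \<open>lambda_gf\<close>\<close>

context cycle_count
begin

lemma two_N_le: "2 * real N \<le> (real n)\<^sup>2"
  using fin by (simp add: card_pairs real_choose_two algebra_simps power2_eq_square)

lemma Lam_sums:
  assumes "Ls \<subseteq> {3..}"
  shows "(\<lambda>l. if l \<in> Ls then cycle_weight n N M l / (2 * real l) else 0) sums Lam M"
proof -
  have "(\<lambda>l. if l \<in> Ls then cycle_weight n N M l / (2 * real l) else 0) sums
    (\<Sum>l\<in>lens. if l \<in> Ls then cycle_weight n N M l / (2 * real l) else 0)"
  proof (rule sums_finite[OF finite_lens])
    fix l assume "l \<notin> lens"
    then have "l \<notin> Ls \<or> n < l" using assms by (auto simp: lens_def)
    moreover have "cycle_weight n N M l = 0" if "n < l"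
    proof -
      have "(\<Prod>i<l. real n - real i) = 0" using that by (intro prod_zero) auto
      then show ?thesis by (simp only: cycle_weight_def mult_zero_left)
    qed
    ultimately show "(if l \<in> Ls then cycle_weight n N M l / (2 * real l) else 0) = 0" by auto
  qed
  moreover have "(\<Sum>l\<in>lens. if l \<in> Ls then cycle_weight n N M l / (2 * real l) else 0) = Lam M"
    unfolding Lam_eq by (intro sum.cong) (auto simp: lens_def)
  ultimately show ?thesis by simp
qed

text \<open>Term by term, the weight lies between the lower bound of \<open>cycle_weight_ge\<close>
  and rho^l, while \<open>rho\<close> exceeds z = 2M/n by at most 2/n. Both deviations are O(l^2
  rho^(l - 1) / n), and after division by 2l they sum to a derived geometric series.\<close>

lemma subcritical_Lam:
  assumes "Ls \<subseteq> {3..}" "rho < 1"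
  shows "\<bar>Lam M - lambda_gf Ls (2 * real M / real n)\<bar> \<le> 2 / (real n * (1 - rho)\<^sup>2)"
proof -
  let ?z = "2 * real M / real n"
  have n: "2 \<le> real n" using V_ne by simp
  have rz: "rho = ?z * (real n / (real n - 1))"
  proof -
    have "rho = real M * (real n / real N)" by (simp add: rho_def)
    then show ?thesis unfolding n_over_N using n by (simp add: field_simps)
  qed
  have z0: "0 \<le> ?z" by simp
  have dz: "rho - ?z = ?z / (real n - 1)" unfolding rz using n by (simp add: field_simps)
  have zr: "?z \<le> rho" using dz z0 n by (smt (verit) divide_nonneg_nonneg)
  have z1: "?z < 1" using zr assms(2) by linarith
  have d2: "rho - ?z \<le> 2 / real n"
  proof -
    have "?z / (real n - 1) \<le> 1 / (real n - 1)" using z1 n by (intro divide_right_mono) auto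
    also have "\<dots> \<le> 2 / real n" using n by (simp add: field_simps)
    finally show ?thesis using dz by simp
  qed
  let ?a = "\<lambda>l. if l \<in> Ls then cycle_weight n N M l / (2 * real l) else 0"
  let ?g = "\<lambda>l. 2 / real n * (real (Suc l) * rho ^ l)"
  have tm: "\<bar>?a (Suc l) - lambda_term Ls ?z (Suc l)\<bar> \<le> ?g l" for l
  proof (cases "Suc l \<in> Ls")
    case True
    have up: "cycle_weight n N M (Suc l) - ?z ^ Suc l \<le> real (Suc l) * (2 / real n) * rho ^ l"
    proof -
      have "cycle_weight n N M (Suc l) \<le> rho ^ Suc l" unfolding rho_def by (rule cycle_weight_le[OF MN])
      moreover have "rho ^ Suc l - ?z ^ Suc l \<le> real (Suc l) * (rho - ?z) * rho ^ l" using power_diff_le[OF z0 zr, of "Suc l"] by simp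
      moreover have "real (Suc l) * (rho - ?z) * rho ^ l \<le> real (Suc l) * (2 / real n) * rho ^ l"
        using d2 rho_nonneg by (intro mult_right_mono mult_left_mono) auto
      ultimately show ?thesis by linarith
    qed
    have lo: "?z ^ Suc l - cycle_weight n N M (Suc l) \<le> 2 * rho ^ l * (real (Suc l))\<^sup>2 / real n"
    proof -
      have "?z ^ Suc l - 2 * ?z ^ l * (real (Suc l))\<^sup>2 / real n \<le> cycle_weight n N M (Suc l)"
        using cycle_weight_ge[of "Suc l" M N n ?z] MN two_N_le n z1 by simp
      moreover have "2 * ?z ^ l * (real (Suc l))\<^sup>2 / real n \<le> 2 * rho ^ l * (real (Suc l))\<^sup>2 / real n"
        using zr z0 by (intro divide_right_mono mult_right_mono mult_left_mono power_mono) auto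
      ultimately show ?thesis by linarith
    qed
    have up2: "real (Suc l) * (2 / real n) * rho ^ l \<le> 2 * rho ^ l * (real (Suc l))\<^sup>2 / real n"
    proof -
      have "real (Suc l) * (2 / real n * rho ^ l) \<le> (real (Suc l))\<^sup>2 * (2 / real n * rho ^ l)"
        using rho_nonneg by (intro mult_right_mono) (auto simp: power2_eq_square)
      then show ?thesis by (simp add: mult_ac del: of_nat_Suc)
    qed
    have "\<bar>?a (Suc l) - lambda_term Ls ?z (Suc l)\<bar> = \<bar>cycle_weight n N M (Suc l) - ?z ^ Suc l\<bar> / (2 * real (Suc l))"
      using True by (simp add: lambda_term_def diff_divide_distrib[symmetric] del: power_Suc of_nat_Suc)
    also have "\<dots> \<le> (2 * rho ^ l * (real (Suc l))\<^sup>2 / real n) / (2 * real (Suc l))"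
      using up lo up2 by (intro divide_right_mono) auto
    also have "\<dots> = 1 / real n * (real (Suc l) * rho ^ l)" by (simp add: power2_eq_square field_simps del: of_nat_Suc)
    also have "\<dots> \<le> ?g l" using rho_nonneg by (intro mult_right_mono divide_right_mono) auto
    finally show ?thesis .
  next
    case False
    then show ?thesis using rho_nonneg by (simp add: lambda_term_def)
  qed
  have s0: "0 \<notin> Ls" using assms(1) by auto
  have "(\<lambda>l. ?a l - lambda_term Ls ?z l) sums (Lam M - lambda_gf Ls ?z)"
    by (intro sums_diff Lam_sums[OF assms(1)] lambda_gf_sums z0 z1)
  \<comment> \<open>Index 0 carries no term, and the shift by one aligns the series with that of (l
    + 1) rho^l.\<close>
  then have s: "(\<lambda>l. ?a (Suc l) - lambda_term Ls ?z (Suc l)) sums (Lam M - lambda_gf Ls ?z)"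
    using s0 by (subst sums_Suc_iff) (simp add: lambda_term_def)
  have g: "?g sums (2 / real n * (1 / (1 - rho)\<^sup>2))"
    using geometric_deriv_sums[of rho] rho_nonneg assms(2) by (intro sums_mult) simp
  have "Lam M - lambda_gf Ls ?z \<le> 2 / real n * (1 / (1 - rho)\<^sup>2)"
    by (rule sums_le[OF _ s g]) (use tm in \<open>meson abs_le_D1\<close>)
  moreover have "- (Lam M - lambda_gf Ls ?z) \<le> 2 / real n * (1 / (1 - rho)\<^sup>2)"
    by (rule sums_le[OF _ sums_minus[OF s] g]) (use tm in \<open>meson abs_le_D2\<close>)
  ultimately show ?thesis by simp
qed

end

lemma truncation_error_self: "truncation_error L (\<lambda>_. L) M n = 0"
  by (simp add: truncation_error_def num_L_cycles_def avg_def)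

subsection \<open>The subcritical regimes\<close>

text \<open>Treats the subcritical and the barely subcritical regime at once: the only quantitative
  input is that n (1 - 2M/n)^3 tends to infinity. No length has to be discarded.\<close>

proposition subcritical_limit:
  fixes M :: "nat \<Rightarrow> nat" and lam :: "nat \<Rightarrow> real"
  assumes L: "L \<subseteq> {3..}"
    and sub: "\<forall>\<^sub>F n in sequentially. 2 * real (M n) < real n"
    and gap: "filterlim (\<lambda>n. real n * (1 - 2 * real (M n) / real n) ^ 3) at_top sequentially"
    and lam: "\<forall>\<^sub>F n in sequentially. lam n = lambda_gf L (2 * real (M n) / real n)"
  shows "(\<forall>\<^sub>F n in sequentially. lam n \<le> K) \<Longrightarrow> asymp_Poisson L M lam"
    and "filterlim lam at_top sequentially \<Longrightarrow> asymp_normal L M lam"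
proof -
  define g where "g n = real n * (1 - 2 * real (M n) / real n) ^ 3" for n
  have g0: "(\<lambda>n. 8 * inverse (g n)) \<longlonglongrightarrow> 0"
    using tendsto_mult[OF tendsto_const tendsto_inverse_0_at_top[OF gap[folded g_def]], of 8] by (simp add: g_def[abs_def])
  let ?P = "\<lambda>n b. 0 \<le> b \<and> b \<le> 8 * inverse (g n)"
  have ev: "\<forall>\<^sub>F n in sequentially. (2 \<le> n \<and> M n \<le> card (pairs {1..n}) \<and> 0 \<le> lam n)
     \<and> ?P n (cycle_count.B1 {1..n} L (M n)) \<and> ?P n (cycle_count.B2 {1..n} L (M n)) \<and> ?P n (cycle_count.B3 {1..n} L (M n))
     \<and> \<bar>cycle_count.Lam {1..n} L (M n) - lam n\<bar> \<le> 8 * inverse (g n)"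
    using sub lam eventually_ge_at_top[of 2] gap[folded g_def, unfolded filterlim_at_top, rule_format, of 4]
  proof eventually_elim
    case (elim n)
    define e where "e = 1 - 2 * real (M n) / real n"
    have n: "2 \<le> n" "2 \<le> real n" using elim by auto
    have e: "0 < e" "e \<le> 1" using elim n by (auto simp: e_def field_simps)
    have gn: "g n = real n * e ^ 3" by (simp add: g_def e_def)
    have MN: "M n \<le> card (pairs {1..n})"
    proof -
      have N: "real (card (pairs {1..n})) = real n * (real n - 1) / 2" by (simp add: card_pairs real_choose_two)
      have "real n * 1 \<le> real n * (real n - 1)" using n by (intro mult_left_mono) auto
      then have "real (M n) \<le> real (card (pairs {1..n}))" unfolding N using elim(1) by linarith
      then show ?thesis by simp
    qed
    interpret C: cycle_count "{1..n}" L "M n" by unfold_locales (use n MN in auto)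
    have cn: "C.n = n" by simp
    have r: "C.rho = (1 - e) * (real n / (real n - 1))"
    proof -
      have "C.rho = real (M n) * (real C.n / real C.N)" unfolding C.rho_def by simp
      also have "real C.n / real C.N = 2 / (real C.n - 1)" by (rule C.n_over_N)
      also have "real (M n) * (2 / (real C.n - 1)) = (1 - e) * (real n / (real n - 1))"
        using n by (simp add: e_def)
      finally show ?thesis .
    qed
    have e23: "e ^ 3 \<le> e" "e ^ 3 \<le> e\<^sup>2" using e power_decreasing[of 1 3 e] power_decreasing[of 2 3 e] by simp_all
    have ne: "4 \<le> real n * e"
    proof -
      have "real n * e ^ 3 \<le> real n * e" using e23 by (intro mult_left_mono) auto
      then show ?thesis using elim(4) gn by simp
    qed
    \<comment> \<open>The passage from 2M/n to rho = 2M/(n - 1) costs at most half of the gap, once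
      n e >= 4. The third power of this 2 is the constant 8 in all the bounds.\<close>
    have re: "e / 2 \<le> 1 - C.rho"
    proof -
      have "1 - C.rho = (real n * e - 1) / (real n - 1)" unfolding r using n by (simp add: field_simps)
      moreover have "e / 2 * (real n - 1) = real n * e / 2 - e / 2" by (simp add: field_simps)
      then have "e / 2 * (real n - 1) \<le> real n * e - 1" using ne e by linarith
      ultimately show ?thesis using n by (simp add: pos_le_divide_eq)
    qed
    have r1: "C.rho < 1" using re e by linarith
    have pw: "(e / 2) ^ k \<le> (1 - C.rho) ^ k" for k using re e by (intro power_mono) auto
    have b: "1 / (real n * (1 - C.rho) ^ 3) \<le> 8 * inverse (g n)"
    proof -
      have "1 / (real n * (1 - C.rho) ^ 3) \<le> 1 / (real n * (e / 2) ^ 3)"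
        using pw[of 3] n e r1 by (intro divide_left_mono mult_left_mono mult_pos_pos) auto
      then show ?thesis unfolding gn by (simp add: field_simps power3_eq_cube)
    qed
    have d1: "0 < 1 - C.rho" "1 - C.rho \<le> 1" using r1 C.rho_nonneg by auto
    have b2: "1 / (real n * (1 - C.rho)) \<le> 8 * inverse (g n)"
    proof -
      have "1 / (real n * (1 - C.rho)) \<le> 1 / (real n * (e / 2))"
        using re n e d1 by (intro divide_left_mono mult_left_mono mult_pos_pos) auto
      also have "\<dots> = 2 * inverse (real n * e)" by (simp add: field_simps)
      also have "\<dots> \<le> 8 * inverse (real n * e ^ 3)"
        using e23 e n by (intro mult_mono le_imp_inverse_le mult_left_mono) auto
      finally show ?thesis by (simp add: gn)
    qed
    have b3: "2 / (real n * (1 - C.rho)\<^sup>2) \<le> 8 * inverse (g n)"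
    proof -
      have "2 / (real n * (1 - C.rho)\<^sup>2) \<le> 2 / (real n * (e / 2)\<^sup>2)"
        using pw[of 2] n e d1 by (intro divide_left_mono mult_left_mono mult_pos_pos) auto
      also have "\<dots> = 8 * inverse (real n * e\<^sup>2)" by (simp add: field_simps power2_eq_square)
      also have "\<dots> \<le> 8 * inverse (real n * e ^ 3)"
        using e23 e n by (intro mult_mono le_imp_inverse_le mult_left_mono) auto
      finally show ?thesis by (simp add: gn)
    qed
    have b4: "1 / ((real n - 1) * (1 - C.rho)\<^sup>2) \<le> 2 / (real n * (1 - C.rho)\<^sup>2)"
    proof -
      have "1 / (real n - 1) \<le> 2 / real n" using n by (simp add: field_simps)
      then have "1 / (real n - 1) / (1 - C.rho)\<^sup>2 \<le> 2 / real n / (1 - C.rho)\<^sup>2" by (rule divide_right_mono) simp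
      then show ?thesis by simp
    qed
    have z: "2 * real (M n) / real n < 1" "0 \<le> 2 * real (M n) / real n" using e by (auto simp: e_def)
    have l0: "0 \<le> lam n" unfolding elim(2) using z by (intro lambda_gf_nonneg)
    note se = C.subcritical_errors[OF r1, unfolded cn]
    have Ld: "\<bar>C.Lam (M n) - lam n\<bar> \<le> 8 * inverse (g n)"
      using C.subcritical_Lam[OF L r1] b3 unfolding cn elim(2) by linarith
    show ?case using n MN l0 C.B1_nonneg C.B2_nonneg C.B3_nonneg se b b2 b3 b4 Ld by linarith
  qed
  have sandwich: "f \<longlonglongrightarrow> 0" if "\<forall>\<^sub>F n in sequentially. ?P n (f n)" for f
  proof (rule tendsto_sandwich[OF _ _ tendsto_const g0])
    show "\<forall>\<^sub>F n in sequentially. 0 \<le> f n" using that by eventually_elim simp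
    show "\<forall>\<^sub>F n in sequentially. f n \<le> 8 * inverse (g n)" using that by eventually_elim simp
  qed
  interpret T: truncated_sequence L "\<lambda>_. L" M lam
  proof
    show "\<forall>\<^sub>F n in sequentially. 2 \<le> n \<and> M n \<le> card (pairs {1..n}) \<and> 0 \<le> lam n" using ev by eventually_elim simp
    show "(\<lambda>n. cycle_count.B1 {1..n} L (M n)) \<longlonglongrightarrow> 0" by (rule sandwich) (use ev in eventually_elim, simp)
    show "(\<lambda>n. cycle_count.B2 {1..n} L (M n)) \<longlonglongrightarrow> 0" by (rule sandwich) (use ev in eventually_elim, simp)
    show "(\<lambda>n. cycle_count.B3 {1..n} L (M n)) \<longlonglongrightarrow> 0" by (rule sandwich) (use ev in eventually_elim, simp)
  qed simp
  have Ld: "(\<lambda>n. cycle_count.Lam {1..n} L (M n) - lam n) \<longlonglongrightarrow> 0"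
    by (rule tendsto_rabs_zero_cancel, rule sandwich) (use ev in eventually_elim, simp)
  show "asymp_Poisson L M lam" if "\<forall>\<^sub>F n in sequentially. lam n \<le> K"
    by (rule T.Poisson_limit[OF that Ld]) (simp add: truncation_error_self[abs_def])
  show "asymp_normal L M lam" if lt: "filterlim lam at_top sequentially"
  proof (rule T.normal_limit[OF lt])
    have sq: "filterlim (\<lambda>n. sqrt (lam n)) at_top sequentially" by (rule filterlim_compose[OF sqrt_at_top lt])
    show "(\<lambda>n. (cycle_count.Lam {1..n} L (M n) - lam n) / sqrt (lam n)) \<longlonglongrightarrow> 0"
      by (rule tendsto_divide_0[OF Ld filterlim_at_top_imp_at_infinity[OF sq]])
  qed (simp add: truncation_error_self)
qed

subsection \<open>Estimates in the critical window\<close>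

lemma lambda_gf_mono_set:
  fixes z :: real assumes "0 \<le> z" "z < 1" "K \<subseteq> L" shows "lambda_gf K z \<le> lambda_gf L z"
  by (rule sums_le[OF _ lambda_gf_sums lambda_gf_sums]) (use assms in \<open>auto simp: lambda_term_def\<close>)

lemma lambda_gf_split:
  fixes z :: real assumes "0 \<le> z" "z < 1" "K \<subseteq> L"
  shows "lambda_gf L z = lambda_gf K z + lambda_gf (L - K) z"
proof -
  have "(\<lambda>l. lambda_term K z l + lambda_term (L - K) z l) sums (lambda_gf K z + lambda_gf (L - K) z)"
    by (intro sums_add lambda_gf_sums assms)
  moreover have "(\<lambda>l. lambda_term K z l + lambda_term (L - K) z l) = lambda_term L z"
    using assms(3) by (intro ext) (auto simp: lambda_term_def)
  ultimately show ?thesis using lambda_gf_sums[OF assms(1,2), of L] sums_unique2 by metis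
qed

lemma lambda_gf_finite:
  fixes z :: real assumes "0 \<le> z" "z < 1" "finite K" shows "lambda_gf K z = (\<Sum>l\<in>K. z ^ l / (2 * real l))"
proof -
  have "lambda_term K z sums (\<Sum>l\<in>K. lambda_term K z l)"
    by (rule sums_finite[OF assms(3)]) (simp add: lambda_term_def)
  moreover have "(\<Sum>l\<in>K. lambda_term K z l) = (\<Sum>l\<in>K. z ^ l / (2 * real l))"
    by (intro sum.cong) (auto simp: lambda_term_def)
  ultimately show ?thesis using lambda_gf_sums[OF assms(1,2), of K] sums_unique2 by metis
qed

lemma lambda_gf_tail_le:
  fixes z r :: real assumes "0 \<le> z" "z < 1" "0 < r" "\<And>l. l \<in> K \<Longrightarrow> r < real l"
  shows "lambda_gf K z \<le> 1 / (r * (1 - z))"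
proof -
  have 1: "(\<lambda>l. 1 / r * z ^ l) sums (1 / r * (1 / (1 - z)))"
    using assms by (intro sums_mult geometric_sums) simp
  have 2: "lambda_term K z l \<le> 1 / r * z ^ l" for l
  proof (cases "l \<in> K")
    case True
    then have l: "r < real l" using assms by auto
    have "z ^ l / (2 * real l) \<le> z ^ l / r" using l assms by (intro divide_left_mono) auto
    then show ?thesis using True by (simp add: lambda_term_def)
  qed (use assms in \<open>simp add: lambda_term_def\<close>)
  from sums_le[OF 2 lambda_gf_sums[OF assms(1,2)] 1] show ?thesis by simp
qed

lemma exp_minus_one_le: "exp y - 1 \<le> y * exp (y :: real)"
proof -
  have "exp y * (1 - y) \<le> exp y * exp (- y)" using exp_ge_add_one_self[of "-y"] by (intro mult_left_mono) auto
  then show ?thesis by (simp add: exp_minus algebra_simps)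
qed

lemma one_minus_exp_ge: "0 \<le> x \<Longrightarrow> x \<le> 1 \<Longrightarrow> x / 2 \<le> 1 - exp (- x :: real)"
proof -
  assume x: "0 \<le> x" "x \<le> 1"
  have "exp (- x) \<le> 1 / (1 + x)" using exp_ge_add_one_self[of x] x by (simp add: exp_minus inverse_eq_divide frac_le)
  moreover have "1 / (1 + x) \<le> 1 - x / 2"
  proof -
    have "x * x \<le> x" using x by (simp add: mult_left_le)
    then have "1 \<le> (1 - x / 2) * (1 + x)" by (simp add: algebra_simps)
    then show ?thesis using x by (simp add: divide_le_eq)
  qed
  ultimately show ?thesis by simp
qed

lemma half_le: "0 \<le> x \<Longrightarrow> x / 2 \<le> (x :: real)" by simp

text \<open>\<open>A\<close> bounds the position in the window, \<open>al\<close> stands for the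
  solution \<alpha> of the critical equation with \<open>a\<close> as positive lower bound, and
  \<open>r\<close> is the cutoff for the cycle lengths that are kept. \<open>B = A + 2\<close>
  leaves room for rounding and for the lower reference density.\<close>

locale critical_estimates = critical_window V M M0 t B D for V :: "'a set" and M M0 t B D +
  fixes A al a r :: real and L :: "nat set"
  assumes A1: "1 \<le> A" and BA: "B = A + 2" and Mz: "\<bar>2 * real M / real (card V) - 1\<bar> \<le> A / t"
    and al: "a \<le> al" "al \<le> A + 1" "0 < a" and r: "0 < r" "r \<le> t" and L: "L \<subseteq> {3..}"
begin

definition Lr :: "nat set" where "Lr = {l \<in> L. real l \<le> r}"

abbreviation "R \<equiv> exp B"
abbreviation "w \<equiv> exp (- al / t)"

lemma tA: "A + 2 \<le> t" "1 \<le> t" "0 < t"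
proof -
  have "4 * (1 + B + 2 * D) = 4 + 4 * B + 8 * D" by (simp add: algebra_simps)
  then show "A + 2 \<le> t" "1 \<le> t" "0 < t" using t B D BA by linarith+
qed

lemma w_bounds: "0 \<le> w" "w < 1"
  using al tA by auto

lemma rho_le: "CC.rho \<le> 1 + B / t"
proof -
  have n: "2 \<le> real n" using n_ge by simp
  have "CC.rho = real M * (real n / real N)" by (simp add: CC.rho_def)
  also have "real n / real N = 2 / (real n - 1)" by (rule CC.n_over_N)
  finally have rho: "CC.rho = 2 * real M / (real n - 1)" by simp
  have "2 * real M / real n \<le> 1 + A / t" using Mz by linarith
  then have "2 * real M \<le> real n * (1 + A / t)" using n by (simp add: field_simps)
  also have "\<dots> = real n + A * t\<^sup>2" unfolding nt using tA by (simp add: field_simps power_numeral_reduce)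
  \<comment> \<open>The difference of 2 between \<open>B\<close> and \<open>A\<close> absorbs the
    replacement of \<open>n\<close> by \<open>n - 1\<close>.\<close>
  also have "\<dots> \<le> (1 + B / t) * (real n - 1)"
  proof -
    have "(1 + B / t) * (real n - 1) = real n + B * t\<^sup>2 - 1 - B / t"
      unfolding nt using tA by (simp add: field_simps power_numeral_reduce)
    moreover have "B / t \<le> 1" using tA BA by simp
    moreover have "B * t\<^sup>2 = A * t\<^sup>2 + 2 * t\<^sup>2" unfolding BA by (simp add: algebra_simps)
    ultimately show ?thesis using t2_ge by linarith
  qed
  finally show ?thesis unfolding rho using n by (simp add: divide_le_eq)
qed

lemma power_le_exp:
  assumes "0 \<le> x" "x \<le> 1 + c / t" "0 \<le> c" shows "x ^ l \<le> exp (c * (real l / t))"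
proof -
  have "x \<le> exp (c / t)" using assms(2) exp_ge_add_one_self[of "c / t"] by linarith
  then have "x ^ l \<le> (exp (c / t)) ^ l" using assms(1) by (rule power_mono)
  also have "\<dots> = exp (c * (real l / t))" by (simp add: exp_of_nat_mult[symmetric] algebra_simps)
  finally show ?thesis .
qed

lemma power_le_R:
  assumes "0 \<le> x" "x \<le> 1 + c / t" "0 \<le> c" "c \<le> B" "real l \<le> t" shows "x ^ l \<le> R"
proof -
  have "c * (real l / t) \<le> B * 1" using assms tA by (intro mult_mono) auto
  then have "exp (c * (real l / t)) \<le> R" by simp
  with power_le_exp[OF assms(1-3)] show ?thesis by (rule order_trans)
qed

lemma lens_Lr: "CC.lens Lr = Lr" "finite Lr" "real (card Lr) \<le> r"
proof -
  have "t \<le> real n"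
  proof -
    have "t * 1 \<le> t * t\<^sup>2" using t2_ge tA by (intro mult_left_mono) auto
    then show ?thesis by (simp add: nt power3_eq_cube power2_eq_square)
  qed
  then show "CC.lens Lr = Lr" using r L by (auto simp: CC.lens_def Lr_def)
  then show f: "finite Lr" by (metis CC.finite_lens)
  have "Lr \<subseteq> {1..nat \<lfloor>r\<rfloor>}" using L r by (auto simp: Lr_def le_nat_floor)
  then have "card Lr \<le> nat \<lfloor>r\<rfloor>" using card_mono[of "{1..nat \<lfloor>r\<rfloor>}" Lr] by simp
  also have "real (nat \<lfloor>r\<rfloor>) \<le> r" using r by simp
  finally show "real (card Lr) \<le> r" by simp
qed

lemma Lr_le: "l \<in> Lr \<Longrightarrow> real l \<le> t" "l \<in> Lr \<Longrightarrow> 3 \<le> l"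
  using r L by (auto simp: Lr_def)

lemma sum_rho_le: "(\<Sum>l\<in>CC.lens Lr. CC.rho ^ l) \<le> r * R" "(\<Sum>l\<in>CC.lens Lr. CC.rho ^ (l - 1)) \<le> r * R"
proof -
  have p: "CC.rho ^ k \<le> R" if "real k \<le> t" for k
    by (rule power_le_R[OF CC.rho_nonneg rho_le _ order_refl that]) (use B in simp)
  have "real (l - 1) \<le> t" if "l \<in> Lr" for l using Lr_le(1)[OF that] by linarith
  then have "(\<Sum>l\<in>Lr. CC.rho ^ (l - 1)) \<le> (\<Sum>l\<in>Lr. R)" by (intro sum_mono p)
  moreover have "(\<Sum>l\<in>Lr. CC.rho ^ l) \<le> (\<Sum>l\<in>Lr. R)" by (intro sum_mono p Lr_le(1))
  moreover have "(\<Sum>l\<in>Lr. R) \<le> r * R" using lens_Lr(3) by (simp add: mult_right_mono)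
  ultimately show "(\<Sum>l\<in>CC.lens Lr. CC.rho ^ l) \<le> r * R" "(\<Sum>l\<in>CC.lens Lr. CC.rho ^ (l - 1)) \<le> r * R"
    unfolding lens_Lr(1) by linarith+
qed

lemma B1_critical: "CC.B1 Lr \<le> cK * R * (r / t)"
proof -
  have "CC.B1 Lr \<le> cK / (2 * t) * (\<Sum>l\<in>CC.lens Lr. CC.rho ^ l)" by (rule critical_B1) (rule Lr_le)
  also have "\<dots> \<le> cK / (2 * t) * (r * R)" using sum_rho_le cK_pos tA by (intro mult_left_mono) auto
  also have "\<dots> = cK * R * (r / t) / 2" by (simp add: mult_ac)
  also have "\<dots> \<le> cK * R * (r / t)"
  proof -
    have "0 \<le> cK * R * (r / t)" using cK_pos r tA by (intro mult_nonneg_nonneg) auto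
    then show ?thesis by (rule half_le)
  qed
  finally show ?thesis .
qed

lemma rt_n: "r / real n \<le> r / t" "r * r / real n \<le> r / t"
proof -
  have "t \<le> real n" unfolding nt using tA power_increasing[of 1 3 t] by simp
  then show "r / real n \<le> r / t" using r tA by (intro divide_left_mono) auto
  have "r * r / real n \<le> r * t / real n" using r by (intro divide_right_mono mult_left_mono) auto
  also have "\<dots> = r / t\<^sup>2" unfolding nt using tA by (simp add: field_simps power_numeral_reduce)
  also have "\<dots> \<le> r / t" using r tA t2_ge by (intro divide_left_mono) auto
  finally show "r * r / real n \<le> r / t" .
qed

lemma B2_critical: "CC.B2 Lr \<le> R\<^sup>2 * (r / t)"
proof -
  have n: "2 \<le> real n" using n_ge by simp
  have "CC.B2 Lr \<le> (\<Sum>l\<in>CC.lens Lr. CC.rho ^ l) * (\<Sum>l\<in>CC.lens Lr. CC.rho ^ (l - 1)) / (2 * (real n - 1))"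
    by (rule CC.B2_le)
  also have "\<dots> \<le> (r * R) * (r * R) / (2 * (real n - 1))"
    using sum_rho_le n r CC.rho_nonneg by (intro divide_right_mono mult_mono sum_nonneg) auto
  also have "\<dots> \<le> (r * R) * (r * R) / real n"
    using n r by (intro divide_left_mono) auto
  also have "\<dots> = R\<^sup>2 * (r * r / real n)" by (simp add: power2_eq_square)
  also have "\<dots> \<le> R\<^sup>2 * (r / t)" using rt_n by (intro mult_left_mono) auto
  finally show ?thesis .
qed

lemma B3_critical: "CC.B3 Lr \<le> R\<^sup>2 * (r / t)"
proof -
  have "CC.rho ^ 1 \<le> R" by (rule power_le_R[OF CC.rho_nonneg rho_le]) (use B tA in auto)
  then have rR: "CC.rho \<le> R" by simp
  have "CC.B3 Lr \<le> CC.rho / real n * (\<Sum>l\<in>CC.lens Lr. CC.rho ^ l)" by (rule CC.B3_le)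
  also have "\<dots> \<le> R / real n * (r * R)"
    using sum_rho_le rR CC.rho_nonneg by (intro mult_mono divide_right_mono sum_nonneg) auto
  also have "\<dots> = R\<^sup>2 * (r / real n)" by (simp add: power2_eq_square)
  also have "\<dots> \<le> R\<^sup>2 * (r / t)" using rt_n by (intro mult_left_mono) auto
  finally show ?thesis .
qed

definition E :: real where "E = B * R + 2 * R + A + 1"

text \<open>For lengths up to \<open>t\<close> both quantities are 1 + O(l/t): the density is
  critical up to a relative error of order 1/t, and \<open>w\<close> is 1 - O(1/t). Each is compared
  with 1 rather than directly with the other.\<close>

lemma weight_critical:
  assumes l: "l \<in> Lr"
  shows "\<bar>cycle_weight n N M l - w ^ l\<bar> \<le> E * (real l / t)"
proof -
  define x where "x = real l / t"
  have lt: "real l \<le> t" "3 \<le> l" using Lr_le l by auto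
  have x: "0 \<le> x" "x \<le> 1" using lt tA by (auto simp: x_def)
  have n: "0 < n" using n_ge by simp
  let ?z = "2 * real M / real n"
  have z: "0 \<le> ?z" "?z \<le> 1 + A / t" "1 - A / t \<le> ?z" using Mz by auto
  have At: "A / t \<le> 1" using tA by simp
  have z2: "?z \<le> 2" using z(2) At by linarith
  have up: "cycle_weight n N M l \<le> 1 + B * R * x"
  proof -
    have "cycle_weight n N M l \<le> CC.rho ^ l" unfolding CC.rho_def by (rule cycle_weight_le[OF M_le])
    also have "\<dots> \<le> exp (B * x)" unfolding x_def by (rule power_le_exp[OF CC.rho_nonneg rho_le]) (use B in simp)
    also have "\<dots> \<le> 1 + B * x * exp (B * x)" using exp_minus_one_le[of "B * x"] by simp
    also have "\<dots> \<le> 1 + B * x * R"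
    proof -
      have "B * x \<le> B" using x B by (simp add: mult_left_le)
      then show ?thesis using x B by (intro add_left_mono mult_left_mono) auto
    qed
    finally show ?thesis by (simp add: mult_ac)
  qed
  have lo: "1 - (A + 2 * R) * x \<le> cycle_weight n N M l"
  proof -
    have "?z ^ l - 2 * ?z ^ (l - 1) * (real l)\<^sup>2 / real n \<le> cycle_weight n N M l"
      by (rule cycle_weight_ge) (use lt M_le CC.two_N_le n z2 in auto)
    moreover have "1 - A * x \<le> ?z ^ l"
    proof (cases "?z \<le> 1")
      case True
      have "1 - real l * (1 - ?z) \<le> ?z ^ l" using one_minus_power_le[OF True z(1)] .
      moreover have "real l * (1 - ?z) \<le> real l * (A / t)" using z by (intro mult_left_mono) auto
      ultimately show ?thesis by (simp add: x_def mult.commute)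
    next
      case False
      then have "1 \<le> ?z ^ l" by (simp add: one_le_power)
      moreover have "0 \<le> A * x" using A1 x by simp
      ultimately show ?thesis by linarith
    qed
    moreover have "2 * ?z ^ (l - 1) * (real l)\<^sup>2 / real n \<le> 2 * R * x"
    proof -
      have "?z ^ (l - 1) \<le> R" by (rule power_le_R[OF z(1,2)]) (use A1 BA lt in auto)
      moreover have "(real l)\<^sup>2 / real n \<le> x"
      proof -
        have "(real l)\<^sup>2 / real n = x * (x / t)" unfolding nt x_def using tA by (simp add: field_simps power_numeral_reduce)
        also have "\<dots> \<le> x * 1" using x tA by (intro mult_left_mono) auto
        finally show ?thesis by simp
      qed
      ultimately have "2 * ?z ^ (l - 1) * ((real l)\<^sup>2 / real n) \<le> 2 * R * x" using z x by (intro mult_mono) auto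
      then show ?thesis by simp
    qed
    ultimately show ?thesis by (simp add: algebra_simps)
  qed
  have we: "w ^ l = exp (- (al * x))" by (simp add: x_def exp_of_nat_mult[symmetric] algebra_simps)
  have "1 - al * x \<le> w ^ l" unfolding we using exp_ge_add_one_self[of "- (al * x)"] by simp
  moreover have "al * x \<le> (A + 1) * x" using al x by (intro mult_right_mono) auto
  ultimately have w1: "1 - (A + 1) * x \<le> w ^ l" by linarith
  have w2: "w ^ l \<le> 1" using w_bounds by (intro power_le_one) auto
  have "E * x = B * R * x + 2 * R * x + (A + 1) * x" by (simp add: E_def algebra_simps)
  moreover have "0 \<le> B * R * x" "0 \<le> 2 * R * x" "0 \<le> (A + 1) * x" using B A1 x by auto
  moreover have "(A + 2 * R) * x = (A + 1) * x + 2 * R * x - x" by (simp add: algebra_simps)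
  ultimately show ?thesis unfolding x_def[symmetric] using up lo w1 w2 x by linarith
qed

text \<open>Each of the at most \<open>r\<close> kept lengths contributes O(1/t), since the factor l
  of \<open>weight_critical\<close> cancels the weight 1/(2l). The discarded lengths appear only in
  the target parameter and form the tail.\<close>

lemma Lam_critical: "\<bar>CC.Lam Lr M - lambda_gf L w\<bar> \<le> E * (r / t) + lambda_gf (L - Lr) w"
proof -
  have "lambda_gf L w = (\<Sum>l\<in>Lr. w ^ l / (2 * real l)) + lambda_gf (L - Lr) w"
    using lambda_gf_split[OF w_bounds, of Lr L] lambda_gf_finite[OF w_bounds lens_Lr(2)] by (simp add: Lr_def)
  moreover have "\<bar>CC.Lam Lr M - (\<Sum>l\<in>Lr. w ^ l / (2 * real l))\<bar> \<le> E * (r / t)"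
  proof -
    have E0: "0 \<le> E" using B A1 by (simp add: E_def)
    have "CC.Lam Lr M - (\<Sum>l\<in>Lr. w ^ l / (2 * real l)) = (\<Sum>l\<in>Lr. (cycle_weight n N M l - w ^ l) / (2 * real l))"
      unfolding CC.Lam_eq lens_Lr(1) by (simp add: sum_subtractf diff_divide_distrib)
    also have "\<bar>\<dots>\<bar> \<le> (\<Sum>l\<in>Lr. \<bar>(cycle_weight n N M l - w ^ l) / (2 * real l)\<bar>)" by (rule sum_abs)
    also have "\<dots> \<le> (\<Sum>l\<in>Lr. E / t)"
    proof (rule sum_mono)
      fix l assume l: "l \<in> Lr"
      have l0: "0 < real l" using Lr_le(2)[OF l] by simp
      have "\<bar>(cycle_weight n N M l - w ^ l) / (2 * real l)\<bar> = \<bar>cycle_weight n N M l - w ^ l\<bar> / (2 * real l)" using l0 by simp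
      also have "\<dots> \<le> E * (real l / t) / (2 * real l)" using weight_critical[OF l] l0 by (intro divide_right_mono) auto
      also have "\<dots> = E / t / 2" using l0 by simp
      also have "\<dots> \<le> E / t"
      proof -
        have "0 \<le> E / t" using E0 tA by simp
        then show ?thesis by (rule half_le)
      qed
      finally show "\<bar>(cycle_weight n N M l - w ^ l) / (2 * real l)\<bar> \<le> E / t" .
    qed
    also have "\<dots> = real (card Lr) * (E / t)" by simp
    also have "\<dots> \<le> r * (E / t)" using lens_Lr(3) E0 tA by (intro mult_right_mono) auto
    finally show ?thesis by (simp add: mult_ac)
  qed
  moreover have "0 \<le> lambda_gf (L - Lr) w" by (rule lambda_gf_nonneg[OF w_bounds])
  ultimately show ?thesis by linarith
qed

text \<open>At \<open>M0\<close> the expected number of all cycles of discarded lengths is bounded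
  by a tail of \<open>lambda_gf\<close> at 1 - 1/t, which is finite although the series may diverge
  at 1.\<close>

lemma truncation_critical:
  "avg (pairs V) M (\<lambda>G. real (num_L_cycles (L - Lr) V G))
    \<le> exp (32 * B\<^sup>2 * D + 64 * B * D\<^sup>2) * lambda_gf (L - Lr) (1 - 1 / t) + cK / D"
proof -
  have z: "0 \<le> 1 - 1 / t" "1 - 1 / t < 1" using tA by auto
  have "(\<Sum>C\<in>CC.cyc (L - Lr). incl_prob N M0 (card C)) = CC.Lam (L - Lr) M0" by (simp add: CC.Lam_def)
  also have "\<dots> \<le> (\<Sum>l\<in>CC.lens (L - Lr). (real n * (real M0 / real N)) ^ l / (2 * real l))"
    using M0_le M_le by (intro CC.Lam_le) simp
  also have "\<dots> \<le> (\<Sum>l\<in>CC.lens (L - Lr). (1 - 1 / t) ^ l / (2 * real l))"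
    using rho0 by (intro sum_mono divide_right_mono power_mono) auto
  also have "\<dots> = lambda_gf (CC.lens (L - Lr)) (1 - 1 / t)"
    by (rule lambda_gf_finite[OF z, symmetric]) simp
  also have "\<dots> \<le> lambda_gf (L - Lr) (1 - 1 / t)" by (rule lambda_gf_mono_set[OF z]) (auto simp: CC.lens_def)
  finally have "exp (32 * B\<^sup>2 * D + 64 * B * D\<^sup>2) * (\<Sum>C\<in>CC.cyc (L - Lr). incl_prob N M0 (card C))
    \<le> exp (32 * B\<^sup>2 * D + 64 * B * D\<^sup>2) * lambda_gf (L - Lr) (1 - 1 / t)" by (intro mult_left_mono) auto
  then show ?thesis using expected_isolated_critical[of "L - Lr"] unfolding CC.X_eq_num by linarith
qed

lemma tail_le: "l \<in> L - Lr \<Longrightarrow> r < real l" by (auto simp: Lr_def)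

text \<open>Beyond \<open>r\<close> the weight 1/(2l) is below 1/r, and both arguments have distance
  of order 1/t from 1, so a geometric series remains. For r = t / \<omega> the tails are
  O(\<omega>).\<close>

lemma tail_bounds: "lambda_gf (L - Lr) w \<le> 2 / a * (t / r)" "lambda_gf (L - Lr) (1 - 1 / t) \<le> t / r"
proof -
  have "al / t / 2 \<le> 1 - w"
    using one_minus_exp_ge[of "al / t"] al tA by simp
  moreover have "a / t / 2 \<le> al / t / 2" using al tA by (intro divide_right_mono) auto
  ultimately have w: "a / t / 2 \<le> 1 - w" by (rule order_trans[rotated])
  have "lambda_gf (L - Lr) w \<le> 1 / (r * (1 - w))"
    by (rule lambda_gf_tail_le[OF w_bounds r(1) tail_le])
  also have "\<dots> \<le> 1 / (r * (a / t / 2))"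
    using w r al tA w_bounds by (intro divide_left_mono mult_left_mono mult_pos_pos) auto
  also have "\<dots> = 2 / a * (t / r)" by (simp add: mult_ac)
  finally show "lambda_gf (L - Lr) w \<le> 2 / a * (t / r)" .
  have "lambda_gf (L - Lr) (1 - 1 / t) \<le> 1 / (r * (1 - (1 - 1 / t)))"
    by (rule lambda_gf_tail_le[OF _ _ r(1) tail_le]) (use tA in auto)
  also have "\<dots> = t / r" by simp
  finally show "lambda_gf (L - Lr) (1 - 1 / t) \<le> t / r" .
qed

end

subsection \<open>The critical regime\<close>

lemma crit_alpha_pos: "crit_alpha \<mu> > 0" and crit_alpha_eq: "\<mu> = 1 / crit_alpha \<mu> - crit_alpha \<mu>"
  using theI'[OF crit_alpha_ex1[of \<mu>]] unfolding crit_alpha_def[symmetric] by auto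

lemma crit_alpha_bounds:
  assumes "\<bar>\<mu>\<bar> \<le> A" shows "crit_alpha \<mu> \<le> A + 1" "1 / (1 + 2 * A) \<le> crit_alpha \<mu>"
proof -
  let ?a = "crit_alpha \<mu>"
  have p: "0 < ?a" by (rule crit_alpha_pos)
  have e: "\<mu> = 1 / ?a - ?a" by (rule crit_alpha_eq)
  have A: "0 \<le> A" using assms by linarith
  show le: "?a \<le> A + 1"
  proof (cases "?a \<le> 1")
    case False
    then have "1 / ?a \<le> 1" by simp
    then show ?thesis using e assms by linarith
  qed (use A in simp)
  have "1 / ?a \<le> 1 + 2 * A" using e le assms by linarith
  then show "1 / (1 + 2 * A) \<le> ?a" using p A by (simp add: field_simps)
qed

lemma cube_root_at_top: "filterlim (\<lambda>n. real n powr (1 / 3)) at_top sequentially"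
  unfolding filterlim_at_top_gt[of _ _ 0]
proof (intro allI impI)
  fix Z :: real assume Z: "0 < Z"
  have "\<forall>\<^sub>F n in sequentially. nat \<lceil>Z ^ 3\<rceil> \<le> n" by (rule eventually_ge_at_top)
  then show "\<forall>\<^sub>F n in sequentially. Z \<le> real n powr (1 / 3)"
  proof eventually_elim
    case (elim n)
    have "Z = (Z ^ 3) powr (1 / 3)" using Z by (simp add: powr_powr flip: powr_numeral)
    also have "\<dots> \<le> real n powr (1 / 3)" using elim Z by (intro powr_mono2) (auto simp: nat_le_iff ceiling_le_iff)
    finally show ?case .
  qed
qed

lemma cube_root_pow3: "(real n powr (1 / 3)) ^ 3 = real n"
  by (cases "n = 0") (auto simp: powr_powr simp flip: powr_numeral)

text \<open>When the series converges at 1, its tail there bounds the tails at all smaller arguments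
  uniformly.\<close>

lemma lambda_gf_tail_le_suminf:
  fixes z :: real
  assumes z: "0 \<le> z" "z < 1" and K: "K \<subseteq> L" "\<And>l. l \<in> K \<Longrightarrow> m \<le> l" and q: "summable (lambda_term L 1)"
  shows "lambda_gf K z \<le> (\<Sum>i. lambda_term L 1 (i + m))"
proof -
  have s: "lambda_term K z sums lambda_gf K z" by (rule lambda_gf_sums[OF z])
  have z0: "(\<Sum>i<m. lambda_term K z i) = 0" using K(2) by (intro sum.neutral) (force simp: lambda_term_def)
  have "(\<lambda>i. lambda_term K z (i + m)) sums lambda_gf K z"
    using s z0 by (simp add: sums_iff_shift)
  moreover have "(\<lambda>i. lambda_term L 1 (i + m)) sums (\<Sum>i. lambda_term L 1 (i + m))"
    using q by (intro summable_sums) (simp add: summable_iff_shift)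
  moreover have "lambda_term K z (i + m) \<le> lambda_term L 1 (i + m)" for i
    using K(1) z by (auto simp: lambda_term_def intro!: divide_right_mono power_le_one)
  ultimately show ?thesis by (rule sums_le[rotated])
qed

locale critical_sequence =
  fixes L :: "nat set" and M :: "nat \<Rightarrow> nat" and \<mu> :: "nat \<Rightarrow> real" and A :: real and lam :: "nat \<Rightarrow> real"
  assumes L: "L \<subseteq> {3..}" and M: "\<And>n. real (M n) = real n / 2 * (1 + \<mu> n * real n powr (- 1 / 3))"
    and A: "1 \<le> A" "\<forall>\<^sub>F n in sequentially. \<bar>\<mu> n\<bar> \<le> A"
    and lam: "lam = (\<lambda>n. lambda_gf L (exp (- crit_alpha (\<mu> n) * real n powr (- 1 / 3))))"
begin

definition t :: "nat \<Rightarrow> real" where "t n = real n powr (1 / 3)"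
text \<open>\<open>M\<close> is at least n/2 - A t^2 / 2 up to finitely many n. Subtracting a
  further t^2 / 2 keeps \<open>M0\<close> below \<open>M\<close> and, as \<open>A\<close> is at
  least 1, makes it subcritical by 1/t.\<close>

definition M0 :: "nat \<Rightarrow> nat" where "M0 n = nat \<lfloor>real n / 2 - (A + 1) * (t n)\<^sup>2 / 2\<rfloor>"

abbreviation "B \<equiv> A + 2"
abbreviation "al n \<equiv> crit_alpha (\<mu> n)"
abbreviation "a \<equiv> 1 / (1 + 2 * A)"

lemma t_top: "filterlim t at_top sequentially" unfolding t_def by (rule cube_root_at_top)

lemma ev_t: "\<forall>\<^sub>F n in sequentially. c \<le> t n" using t_top by (simp add: filterlim_at_top)

lemma lam_eq: "lam n = lambda_gf L (exp (- al n / t n))"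
proof -
  have "real n powr (- 1 / 3) = 1 / t n" unfolding t_def using powr_minus_divide[of "real n" "1 / 3"] by simp
  then show ?thesis unfolding lam by simp
qed

lemma estimates:
  assumes D: "1 \<le> D" and \<omega>: "\<forall>\<^sub>F n in sequentially. 1 \<le> \<omega> n"
  shows "\<forall>\<^sub>F n in sequentially. critical_estimates {1..n} (M n) (M0 n) (t n) B D A (al n) a (t n / \<omega> n) L"
  using A(2) \<omega> ev_t[of "4 * (1 + B + 2 * D)"]
proof eventually_elim
  case (elim n)
  have "4 * (1 + B + 2 * D) = 4 + 4 * B + 8 * D" by (simp add: algebra_simps)
  then have "4 + 4 * A + 8 + 8 * D \<le> t n" using elim(3) by simp
  then have t: "16 \<le> t n" "A + 2 \<le> t n" using A(1) D by simp_all
  have t2: "t n \<le> (t n)\<^sup>2" "1 \<le> (t n)\<^sup>2" using t by (auto simp: power2_eq_square intro: order_trans[of 1 "t n"])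
  have n: "real n = (t n) ^ 3" unfolding t_def by (rule cube_root_pow3[symmetric])
  then have n2: "real n = t n * (t n)\<^sup>2" by (simp add: power3_eq_cube power2_eq_square)
  have np: "0 < real n" using t unfolding n by simp
  have nt: "real n powr (- 1 / 3) = 1 / t n" unfolding t_def using powr_minus_divide[of "real n" "1 / 3"] by simp
  have Mr: "real (M n) = real n / 2 + \<mu> n * (t n)\<^sup>2 / 2"
  proof -
    have "real n / t n = (t n)\<^sup>2" using t unfolding n2 by simp
    moreover have "real (M n) = real n / 2 + \<mu> n * (real n / t n) / 2" unfolding M nt by (simp add: algebra_simps)
    ultimately show ?thesis by simp
  qed
  have mu: "\<mu> n * (t n)\<^sup>2 \<le> A * (t n)\<^sup>2" "- (A * (t n)\<^sup>2) \<le> \<mu> n * (t n)\<^sup>2"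
    using elim(1) mult_right_mono[of "\<mu> n" A "(t n)\<^sup>2"] mult_right_mono[of "- A" "\<mu> n" "(t n)\<^sup>2"] by (auto simp: abs_le_iff)
  have At: "A * (t n)\<^sup>2 + 2 * (t n)\<^sup>2 \<le> real n"
  proof -
    have "(A + 2) * (t n)\<^sup>2 \<le> t n * (t n)\<^sup>2" using t by (intro mult_right_mono) auto
    then show ?thesis unfolding n2 by (simp add: algebra_simps)
  qed
  have e1: "(A + 1) * (t n)\<^sup>2 = A * (t n)\<^sup>2 + (t n)\<^sup>2" by (simp add: algebra_simps)
  have A0: "0 \<le> A * (t n)\<^sup>2" using A by simp
  have x0: "0 \<le> real n / 2 - (A + 1) * (t n)\<^sup>2 / 2" proof -
    have "0 \<le> real n - (A + 1) * (t n)\<^sup>2" unfolding e1 using At t2 by linarith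
    then show ?thesis by simp
  qed
  have M0: "real (M0 n) \<le> real n / 2 - (A + 1) * (t n)\<^sup>2 / 2" "real n / 2 - (A + 1) * (t n)\<^sup>2 / 2 - 1 \<le> real (M0 n)"
    proof -
    define y where "y = real n / 2 - (A + 1) * (t n)\<^sup>2 / 2"
    have "real (M0 n) = real_of_int \<lfloor>y\<rfloor>" using x0 unfolding M0_def y_def[symmetric] by simp
    moreover have "real_of_int \<lfloor>y\<rfloor> \<le> y" "y - 1 \<le> real_of_int \<lfloor>y\<rfloor>" by linarith+
    ultimately show "real (M0 n) \<le> real n / 2 - (A + 1) * (t n)\<^sup>2 / 2" "real n / 2 - (A + 1) * (t n)\<^sup>2 / 2 - 1 \<le> real (M0 n)"
      unfolding y_def[symmetric] by simp_all
  qed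
  have B2: "B * (t n)\<^sup>2 = A * (t n)\<^sup>2 + 2 * (t n)\<^sup>2" by (simp add: algebra_simps)
  have N: "real (card (pairs {1..n})) = real n * (real n - 1) / 2" by (simp add: card_pairs real_choose_two)
  have n16: "16 \<le> real n"
  proof -
    have "16 * 1 \<le> t n * (t n)\<^sup>2" using t t2 by (intro mult_mono) auto
    then show ?thesis using n2 by simp
  qed
  define s where "s = (t n)\<^sup>2"
  define As where "As = A * s"
  define m where "m = \<mu> n * s"
  note sdefs = s_def[symmetric] As_def[symmetric] m_def[symmetric]
  have M02: "2 * real (M0 n) \<le> real n - As - s" "real n - As - s - 2 \<le> 2 * real (M0 n)"
    using M0 unfolding e1 sdefs by (simp_all add: field_simps As_def)
  have M2: "2 * real (M n) = real n + m" using Mr unfolding sdefs by simp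
  note bounds = mu[unfolded sdefs] At[unfolded sdefs] A0[unfolded sdefs] t2[unfolded sdefs]
  have B2': "B * (t n)\<^sup>2 = As + 2 * s" using B2 unfolding sdefs .
  show ?case
  proof unfold_locales
    show "real (card {1..n}) = (t n) ^ 3" using n by simp
    show "real (card {1..n}) / 2 - B * (t n)\<^sup>2 \<le> real (M0 n)" unfolding B2'
    proof -
      have "real n - 2 * As - 4 * s \<le> 2 * real (M0 n)" using M02(2) bounds by linarith
      then show "real (card {1..n}) / 2 - (As + 2 * s) \<le> real (M0 n)" by simp
    qed
    have "real (M0 n) \<le> real (M n)" using M02(1) M2 bounds by linarith
    then show "M0 n \<le> M n" by simp
    show "real (M n) \<le> real (card {1..n}) / 2 + B * (t n)\<^sup>2" unfolding B2'
    proof -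
      have "2 * real (M n) \<le> real n + 2 * As + 4 * s" using M2 bounds by linarith
      then show "real (M n) \<le> real (card {1..n}) / 2 + (As + 2 * s)" by simp
    qed
    have "real n * 2 \<le> real n * (real n - 1)" using n16 by (intro mult_left_mono) auto
    then have "2 * real (M n) \<le> real n * (real n - 1)" using M2 bounds by linarith
    then have "real (M n) \<le> real (card (pairs {1..n}))" unfolding N by simp
    then show "M n \<le> card (pairs {1..n})" by simp
    show "real (card {1..n}) * (real (M0 n) / real (card (pairs {1..n}))) \<le> 1 - 1 / t n"
    proof -
      have "real n * (real (M0 n) / real (card (pairs {1..n}))) = 2 * real (M0 n) / (real n - 1)"
        unfolding N using n16 by (simp add: field_simps)
      also have "\<dots> \<le> (1 - 1 / t n) * (real n - 1) / (real n - 1)"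
      proof (rule divide_right_mono)
        have "(1 - 1 / t n) * (real n - 1) = real n - real n / t n - 1 + 1 / t n" by (simp add: algebra_simps diff_divide_distrib)
        moreover have "real n / t n = (t n)\<^sup>2" using t unfolding n2 by simp
        moreover have "0 \<le> 1 / t n" using t by simp
        moreover have "s \<le> As" using A(1) mult_right_mono[of 1 A s] unfolding As_def by (simp add: s_def)
        ultimately show "2 * real (M0 n) \<le> (1 - 1 / t n) * (real n - 1)" using M02(1) bounds unfolding sdefs by linarith
      qed (use n16 in simp)
      also have "\<dots> = 1 - 1 / t n" using n16 by simp
      finally show ?thesis by simp
    qed
    show "\<bar>2 * real (M n) / real (card {1..n}) - 1\<bar> \<le> A / t n"
    proof -
      have "2 * real (M n) / real n - 1 = \<mu> n / t n"
        unfolding M nt using np by (simp add: field_simps)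
      then show ?thesis using elim(1) t by (simp add: abs_divide divide_right_mono)
    qed
    show "a \<le> al n" "al n \<le> A + 1" using crit_alpha_bounds[OF elim(1)] by auto
    show "0 < t n / \<omega> n" using elim t by simp
    show "t n / \<omega> n \<le> t n" using elim t by (simp add: divide_le_eq)
  qed (use A D L elim in auto)
qed

definition Lr :: "(nat \<Rightarrow> real) \<Rightarrow> nat \<Rightarrow> nat set" where
  "Lr \<omega> n = {l \<in> L. real l \<le> t n / \<omega> n}"

lemma small: "filterlim \<omega> at_top sequentially \<Longrightarrow> (\<lambda>n. c * (1 / \<omega> n)) \<longlonglongrightarrow> (0 :: real)"
  using tendsto_mult[OF tendsto_const tendsto_inverse_0_at_top, of \<omega> sequentially c] by (simp add: inverse_eq_divide)

text \<open>With the cutoff t / \<omega> the error terms are all O(1/\<omega>), so any divergent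
  \<omega> will do. How fast it may grow is decided by the discarded tail, separately for the two
  limit laws.\<close>

lemma truncated:
  assumes \<omega>: "filterlim \<omega> at_top sequentially"
  shows "truncated_sequence L (Lr \<omega>) M lam"
proof -
  have \<omega>1: "\<forall>\<^sub>F n in sequentially. 1 \<le> \<omega> n" using \<omega> by (simp add: filterlim_at_top)
  define c1 where "c1 = critical_window.cK B * exp B"
  define c2 where "c2 = (exp B)\<^sup>2"
  have ev: "\<forall>\<^sub>F n in sequentially. (2 \<le> n \<and> M n \<le> card (pairs {1..n}) \<and> 0 \<le> lam n)
    \<and> (0 \<le> cycle_count.B1 {1..n} (Lr \<omega> n) (M n) \<and> cycle_count.B1 {1..n} (Lr \<omega> n) (M n) \<le> c1 * (1 / \<omega> n))
    \<and> (0 \<le> cycle_count.B2 {1..n} (Lr \<omega> n) (M n) \<and> cycle_count.B2 {1..n} (Lr \<omega> n) (M n) \<le> c2 * (1 / \<omega> n))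
    \<and> (0 \<le> cycle_count.B3 {1..n} (Lr \<omega> n) (M n) \<and> cycle_count.B3 {1..n} (Lr \<omega> n) (M n) \<le> c2 * (1 / \<omega> n))"
    using estimates[OF order_refl \<omega>1] \<omega>1
  proof eventually_elim
    case (elim n)
    interpret E: critical_estimates "{1..n}" "M n" "M0 n" "t n" B 1 A "al n" a "t n / \<omega> n" L by (rule elim(1))
    have Lr: "Lr \<omega> n = E.Lr" by (simp add: Lr_def E.Lr_def)
    have rt: "t n / \<omega> n / t n = 1 / \<omega> n" using E.tA(3) by simp
    have l0: "0 \<le> lam n" unfolding lam_eq by (rule lambda_gf_nonneg[OF E.w_bounds])
    show ?case
      using E.n_ge E.M_le l0 E.CC.B1_nonneg E.CC.B2_nonneg E.CC.B3_nonneg E.B1_critical E.B2_critical E.B3_critical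
      unfolding Lr rt c1_def c2_def by simp
  qed
  have sandwich: "f \<longlonglongrightarrow> 0" if "\<forall>\<^sub>F n in sequentially. 0 \<le> f n \<and> f n \<le> c * (1 / \<omega> n)" for f :: "nat \<Rightarrow> real" and c
  proof (rule tendsto_sandwich[OF _ _ tendsto_const small[OF \<omega>]])
    show "\<forall>\<^sub>F n in sequentially. 0 \<le> f n" using that by eventually_elim simp
    show "\<forall>\<^sub>F n in sequentially. f n \<le> c * (1 / \<omega> n)" using that by eventually_elim simp
  qed
  show ?thesis
  proof
    show "\<forall>\<^sub>F n in sequentially. 2 \<le> n \<and> M n \<le> card (pairs {1..n}) \<and> 0 \<le> lam n" using ev by eventually_elim simp
    show "(\<lambda>n. cycle_count.B1 {1..n} (Lr \<omega> n) (M n)) \<longlonglongrightarrow> 0"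
      by (rule sandwich[of _ c1]) (use ev in eventually_elim, simp)
    show "(\<lambda>n. cycle_count.B2 {1..n} (Lr \<omega> n) (M n)) \<longlonglongrightarrow> 0"
      by (rule sandwich[of _ c2]) (use ev in eventually_elim, simp)
    show "(\<lambda>n. cycle_count.B3 {1..n} (Lr \<omega> n) (M n)) \<longlonglongrightarrow> 0"
      by (rule sandwich[of _ c2]) (use ev in eventually_elim, simp)
  qed (auto simp: Lr_def)
qed

lemma truncation_error_nonneg: "0 \<le> truncation_error L (Lr \<omega>) M n"
  unfolding truncation_error_def by (rule avg_nonneg) simp

text \<open>As n grows, the argument of \<open>lambda_gf\<close> tends to 1, so each partial sum at
  1 is a limit of partial sums that are bounded by \<open>K\<close>. A bounded parameter therefore
  forces the sum of 1/(2l) over \<open>L\<close> to converge.\<close>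

lemma summable_tail:
  assumes "\<forall>\<^sub>F n in sequentially. lam n \<le> K"
  shows "summable (lambda_term L 1)"
proof (rule summableI_nonneg_bounded)
  fix m
  have w1: "(\<lambda>n. exp (- al n / t n)) \<longlonglongrightarrow> 1"
  proof -
    have "(\<lambda>n. al n / t n) \<longlonglongrightarrow> 0"
    proof (rule tendsto_sandwich[OF _ _ tendsto_const small[OF t_top]])
      show "\<forall>\<^sub>F n in sequentially. 0 \<le> al n / t n"
        using ev_t[of 1] by eventually_elim (simp add: crit_alpha_pos less_imp_le)
      show "\<forall>\<^sub>F n in sequentially. al n / t n \<le> (A + 1) * (1 / t n)"
        using ev_t[of 1] A(2)
      proof eventually_elim
        case (elim n)
        then have "al n / t n \<le> (A + 1) / t n" using crit_alpha_bounds[OF elim(2)] by (intro divide_right_mono) auto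
        then show ?case by simp
      qed
    qed
    from tendsto_exp[OF tendsto_minus[OF this]] show ?thesis by simp
  qed
  have "(\<lambda>n. \<Sum>i<m. lambda_term L (exp (- al n / t n)) i) \<longlonglongrightarrow> (\<Sum>i<m. lambda_term L 1 i)"
  proof (rule tendsto_sum)
    fix i
    show "(\<lambda>n. lambda_term L (exp (- al n / t n)) i) \<longlonglongrightarrow> lambda_term L 1 i"
    proof (cases "i \<in> L")
      case True
      then have "0 < i" using L by auto
      then have "(\<lambda>n. exp (- al n / t n) ^ i / (2 * real i)) \<longlonglongrightarrow> 1 ^ i / (2 * real i)"
        by (intro tendsto_intros w1) auto
      then show ?thesis using True by (simp add: lambda_term_def)
    qed (simp add: lambda_term_def)
  qed
  moreover have "\<forall>\<^sub>F n in sequentially. (\<Sum>i<m. lambda_term L (exp (- al n / t n)) i) \<le> K"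
    using assms ev_t[of 1]
  proof eventually_elim
    case (elim n)
    have w: "0 \<le> exp (- al n / t n)" "exp (- al n / t n) < 1" using elim crit_alpha_pos[of "\<mu> n"] by auto
    have "(\<Sum>i<m. lambda_term L (exp (- al n / t n)) i) \<le> (\<Sum>i. lambda_term L (exp (- al n / t n)) i)"
      using lambda_term_nonneg[OF w(1)] by (intro sum_le_suminf sums_summable[OF lambda_gf_sums[OF w]]) auto
    also have "\<dots> = lam n" unfolding lam_eq by (rule sums_unique[OF lambda_gf_sums[OF w], symmetric])
    finally show ?case using elim by linarith
  qed
  ultimately show "(\<Sum>i<m. lambda_term L 1 i) \<le> K"
    by (rule tendsto_upperbound) simp
qed (simp add: lambda_term_nonneg)

text \<open>The cutoff t / \<omega> equals sqrt t and tends to infinity, so by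
  \<open>summable_tail\<close> the contribution of the discarded lengths vanishes uniformly.\<close>

proposition Poisson_limit:
  assumes K: "\<forall>\<^sub>F n in sequentially. lam n \<le> K"
  shows "asymp_Poisson L M lam"
proof -
  define \<omega> where "\<omega> n = sqrt (t n)" for n
  have \<omega>: "filterlim \<omega> at_top sequentially" unfolding \<omega>_def by (rule filterlim_compose[OF sqrt_at_top t_top])
  have \<omega>1: "\<forall>\<^sub>F n in sequentially. 1 \<le> \<omega> n" using \<omega> by (simp add: filterlim_at_top)
  interpret T: truncated_sequence L "Lr \<omega>" M lam by (rule truncated[OF \<omega>])
  note q = summable_tail[OF K]
  define \<tau> where "\<tau> n = (\<Sum>i. lambda_term L 1 (i + nat \<lfloor>t n / \<omega> n\<rfloor>))" for n
  have \<tau>0: "\<tau> \<longlonglongrightarrow> 0"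
  proof (rule tendstoI)
    fix e :: real assume "0 < e"
    then obtain N where N: "\<And>m. N \<le> m \<Longrightarrow> norm (\<Sum>i. lambda_term L 1 (i + m)) < e"
      using suminf_exist_split[OF _ q] by blast
    have "\<forall>\<^sub>F n in sequentially. real N \<le> \<omega> n" using \<omega> by (simp add: filterlim_at_top)
    then show "\<forall>\<^sub>F n in sequentially. dist (\<tau> n) 0 < e"
      using ev_t[of 1]
    proof eventually_elim
      case (elim n)
      have "t n / \<omega> n = \<omega> n" using elim by (simp add: \<omega>_def real_div_sqrt)
      then have "N \<le> nat \<lfloor>t n / \<omega> n\<rfloor>" using elim by (simp add: le_nat_floor)
      then show ?case using N unfolding \<tau>_def by simp
    qed
  qed
  have tail: "lambda_gf (L - Lr \<omega> n) z \<le> \<tau> n" if "0 \<le> z" "z < 1" for n z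
    unfolding \<tau>_def
  proof (rule lambda_gf_tail_le_suminf[OF that _ _ q])
    fix l assume "l \<in> L - Lr \<omega> n"
    then have "t n / \<omega> n < real l" by (auto simp: Lr_def)
    then show "nat \<lfloor>t n / \<omega> n\<rfloor> \<le> l" by linarith
  qed auto
  have LamE: "\<forall>\<^sub>F n in sequentially. \<bar>T.Lam n - lam n\<bar> \<le> critical_estimates.E B A * (1 / \<omega> n) + \<tau> n"
    using estimates[OF order_refl \<omega>1]
  proof eventually_elim
    case (elim n)
    interpret E: critical_estimates "{1..n}" "M n" "M0 n" "t n" B 1 A "al n" a "t n / \<omega> n" L by (rule elim)
    have Lr: "Lr \<omega> n = E.Lr" by (simp add: Lr_def E.Lr_def)
    have rt: "t n / \<omega> n / t n = 1 / \<omega> n" using E.tA(3) by simp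
    show ?case using E.Lam_critical[unfolded rt] tail[OF E.w_bounds, of n] unfolding Lr lam_eq by linarith
  qed
  have Lam0: "(\<lambda>n. T.Lam n - lam n) \<longlonglongrightarrow> 0"
  proof (rule tendsto_rabs_zero_cancel, rule tendsto_sandwich[OF _ LamE tendsto_const])
    show "(\<lambda>n. critical_estimates.E B A * (1 / \<omega> n) + \<tau> n) \<longlonglongrightarrow> 0"
      using tendsto_add[OF small[OF \<omega>] \<tau>0] by simp
  qed simp
  have "truncation_error L (Lr \<omega>) M \<longlonglongrightarrow> 0"
  proof (rule tendstoI)
    fix e :: real assume e: "0 < e"
    let ?c = "critical_window.cK B"
    \<comment> \<open>First \<open>D\<close> is fixed so large that the share of big components is
      below e / 2, which is possible since \<open>cK\<close> depends on \<open>B\<close> only. The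
      factor \<open>?X\<close> is then a constant, and the vanishing tail brings the other share
      below e / 2.\<close>
    define D where "D = max 1 (2 * \<bar>?c\<bar> / e + 1)"
    have D: "1 \<le> D" by (simp add: D_def)
    have cD: "?c / D < e / 2"
    proof -
      have "2 * \<bar>?c\<bar> / e < D" by (simp add: D_def)
      then have "2 * \<bar>?c\<bar> < e * D" using e by (simp add: field_simps)
      then have "?c < e / 2 * D" by (simp add: abs_le_iff)
      then show ?thesis using D by (simp add: divide_less_eq)
    qed
    let ?X = "exp (32 * B\<^sup>2 * D + 64 * B * D\<^sup>2)"
    have "(\<lambda>n. ?X * \<tau> n) \<longlonglongrightarrow> 0" using tendsto_mult_right_zero[OF \<tau>0] .
    then have "\<forall>\<^sub>F n in sequentially. ?X * \<tau> n < e / 2" by (rule order_tendstoD(2)) (use e in simp)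
    then show "\<forall>\<^sub>F n in sequentially. dist (truncation_error L (Lr \<omega>) M n) 0 < e"
      using estimates[OF D \<omega>1]
    proof eventually_elim
      case (elim n)
      interpret E: critical_estimates "{1..n}" "M n" "M0 n" "t n" B D A "al n" a "t n / \<omega> n" L by (rule elim(2))
      have Lr: "Lr \<omega> n = E.Lr" by (simp add: Lr_def E.Lr_def)
      have "?X * lambda_gf (L - Lr \<omega> n) (1 - 1 / t n) \<le> ?X * \<tau> n"
        using E.tA by (intro mult_left_mono tail) auto
      then have "truncation_error L (Lr \<omega>) M n \<le> ?X * \<tau> n + ?c / D"
        using E.truncation_critical unfolding truncation_error_def Lr by linarith
      then have "truncation_error L (Lr \<omega>) M n < e" using elim(1) cD by linarith
      then show ?case using truncation_error_nonneg[of \<omega> n] by simp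
    qed
  qed
  then show ?thesis by (rule T.Poisson_limit[OF K Lam0])
qed

text \<open>The series may diverge at 1, so the tails need not vanish; they only have to be small
  compared with the standard deviation sqrt lam. Choosing \<omega> as the fourth root of lam makes
  them O(\<omega>) against \<omega>^2.\<close>

proposition normal_limit:
  assumes top: "filterlim lam at_top sequentially"
  shows "asymp_normal L M lam"
proof -
  define \<omega> where "\<omega> n = sqrt (sqrt (lam n))" for n
  have sq: "filterlim (\<lambda>n. sqrt (lam n)) at_top sequentially" by (rule filterlim_compose[OF sqrt_at_top top])
  have \<omega>: "filterlim \<omega> at_top sequentially" unfolding \<omega>_def by (rule filterlim_compose[OF sqrt_at_top sq])
  have \<omega>1: "\<forall>\<^sub>F n in sequentially. 1 \<le> \<omega> n" using \<omega> by (simp add: filterlim_at_top)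
  interpret T: truncated_sequence L "Lr \<omega>" M lam by (rule truncated[OF \<omega>])
  have sqrt_lam: "sqrt (lam n) = \<omega> n * \<omega> n" if "1 \<le> \<omega> n" for n
  proof -
    have "0 \<le> sqrt (lam n)"
    proof (rule ccontr)
      assume "\<not> 0 \<le> sqrt (lam n)"
      then have "\<omega> n < 0" unfolding \<omega>_def by simp
      then show False using that by simp
    qed
    then show ?thesis unfolding \<omega>_def by simp
  qed
  let ?c = "critical_window.cK B" and ?X = "exp (32 * B\<^sup>2 * 1 + 64 * B * 1\<^sup>2)" and ?E = "critical_estimates.E B A"
  have ev: "\<forall>\<^sub>F n in sequentially. \<bar>(T.Lam n - lam n) / sqrt (lam n)\<bar> \<le> (\<bar>?E\<bar> + 2 / a) * (1 / \<omega> n)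
     \<and> truncation_error L (Lr \<omega>) M n / sqrt (lam n) \<le> (?X + \<bar>?c\<bar>) * (1 / \<omega> n)"
    using estimates[OF order_refl \<omega>1] \<omega>1
  proof eventually_elim
    case (elim n)
    interpret E: critical_estimates "{1..n}" "M n" "M0 n" "t n" B 1 A "al n" a "t n / \<omega> n" L by (rule elim(1))
    have Lr: "Lr \<omega> n = E.Lr" by (simp add: Lr_def E.Lr_def)
    have rt: "t n / \<omega> n / t n = 1 / \<omega> n" "t n / (t n / \<omega> n) = \<omega> n" using E.tA(3) elim(2) by auto
    note sl = sqrt_lam[OF elim(2)]
    have w: "0 < \<omega> n" "1 / \<omega> n \<le> \<omega> n" "1 \<le> \<omega> n" using elim(2) by (auto simp: divide_le_eq intro: order_trans[of 1 "\<omega> n"])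
    have scale: "x / sqrt (lam n) \<le> C * (1 / \<omega> n)" if "x \<le> C * \<omega> n" for x C
    proof -
      have "x / (\<omega> n * \<omega> n) \<le> C * \<omega> n / (\<omega> n * \<omega> n)" using that w by (intro divide_right_mono) auto
      then show ?thesis unfolding sl using w by simp
    qed
    have "\<bar>T.Lam n - lam n\<bar> \<le> (\<bar>?E\<bar> + 2 / a) * \<omega> n"
    proof -
      have "?E * (1 / \<omega> n) \<le> \<bar>?E\<bar> * \<omega> n" using w by (intro mult_mono) auto
      moreover have "\<bar>T.Lam n - lam n\<bar> \<le> ?E * (1 / \<omega> n) + 2 / a * \<omega> n"
        using E.Lam_critical E.tail_bounds(1) unfolding Lr lam_eq rt by linarith
      ultimately show ?thesis unfolding distrib_right by linarith
    qed
    then have 1: "\<bar>T.Lam n - lam n\<bar> / sqrt (lam n) \<le> (\<bar>?E\<bar> + 2 / a) * (1 / \<omega> n)" by (rule scale)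
    have "0 < sqrt (lam n)" unfolding sl using w by simp
    then have 2: "\<bar>(T.Lam n - lam n) / sqrt (lam n)\<bar> = \<bar>T.Lam n - lam n\<bar> / sqrt (lam n)" by (simp add: abs_divide)
    have "truncation_error L (Lr \<omega>) M n \<le> (?X + \<bar>?c\<bar>) * \<omega> n"
    proof -
      have "?X * lambda_gf (L - E.Lr) (1 - 1 / t n) \<le> ?X * \<omega> n"
        using E.tail_bounds(2) unfolding rt by (intro mult_left_mono) auto
      moreover have "?c / 1 \<le> \<bar>?c\<bar> * \<omega> n"
      proof -
        have "\<bar>?c\<bar> * 1 \<le> \<bar>?c\<bar> * \<omega> n" using w by (intro mult_left_mono) auto
        then show ?thesis by simp
      qed
      ultimately show ?thesis
        using E.truncation_critical unfolding truncation_error_def Lr distrib_right by linarith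
    qed
    then have 3: "truncation_error L (Lr \<omega>) M n / sqrt (lam n) \<le> (?X + \<bar>?c\<bar>) * (1 / \<omega> n)" by (rule scale)
    show ?case using 1 3 unfolding 2 by (rule conjI)
  qed
  show ?thesis
  proof (rule T.normal_limit[OF top])
    show "(\<lambda>n. (T.Lam n - lam n) / sqrt (lam n)) \<longlonglongrightarrow> 0"
    proof (rule tendsto_rabs_zero_cancel, rule tendsto_sandwich[OF _ _ tendsto_const small[OF \<omega>]])
      show "\<forall>\<^sub>F n in sequentially. \<bar>(T.Lam n - lam n) / sqrt (lam n)\<bar> \<le> (\<bar>?E\<bar> + 2 / a) * (1 / \<omega> n)"
        using ev by eventually_elim (rule conjunct1)
    qed simp
    show "(\<lambda>n. truncation_error L (Lr \<omega>) M n / sqrt (lam n)) \<longlonglongrightarrow> 0"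
    proof (rule tendsto_sandwich[OF _ _ tendsto_const small[OF \<omega>]])
      show "\<forall>\<^sub>F n in sequentially. truncation_error L (Lr \<omega>) M n / sqrt (lam n) \<le> (?X + \<bar>?c\<bar>) * (1 / \<omega> n)"
        using ev by eventually_elim (rule conjunct2)
      show "\<forall>\<^sub>F n in sequentially. 0 \<le> truncation_error L (Lr \<omega>) M n / sqrt (lam n)"
        using \<omega>1 by eventually_elim (simp add: truncation_error_nonneg sqrt_lam)
    qed
  qed
qed

end

lemma limsup_gap:
  assumes "limsup (\<lambda>n. ereal (c n)) < ereal (1 / 2)"
  obtains c0 where "c0 < 1 / 2" "\<forall>\<^sub>F n in sequentially. c n < c0"
proof -
  obtain y where y: "limsup (\<lambda>n. ereal (c n)) < y" "y < ereal (1 / 2)" using dense[OF assms] by auto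
  have ev: "\<forall>\<^sub>F n in sequentially. ereal (c n) < y" by (rule Limsup_lessD[OF y(1)])
  show ?thesis
  proof (cases y)
    case (real r)
    then show ?thesis using that[of r] ev y(2) by simp
  next
    case PInf
    then show ?thesis using y(2) by simp
  next
    case MInf
    then have "\<forall>\<^sub>F n in sequentially. False" using ev by simp
    then show ?thesis by simp
  qed
qed

theorem theorem1:
  fixes L :: "nat set"
  assumes "L \<subseteq> {3..}" and "L \<noteq> {}"
  shows
    "(\<forall>(M :: nat \<Rightarrow> nat) (c :: nat \<Rightarrow> real).
        (\<forall>n. real (M n) = c n * real n) \<longrightarrow>
        0 < limsup (\<lambda>n. ereal (c n)) \<longrightarrow>
        limsup (\<lambda>n. ereal (c n)) < ereal (1 / 2) \<longrightarrow>
        asymp_Poisson L M (\<lambda>n. lambda_gf L (2 * c n)))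
   \<and> (\<forall>(M :: nat \<Rightarrow> nat) (\<mu> :: nat \<Rightarrow> real).
        (\<forall>n. real (M n) = real n / 2 * (1 - \<mu> n * real n powr (- 1 / 3))) \<longrightarrow>
        filterlim \<mu> at_top sequentially \<longrightarrow>
        \<mu> \<in> o(\<lambda>n. real n powr (1 / 3)) \<longrightarrow>
        (let lam = (\<lambda>n. lambda_gf L (2 * real (M n) / real n)) in
          (convergent lam \<longrightarrow> asymp_Poisson L M lam) \<and>
          (filterlim lam at_top sequentially \<longrightarrow> asymp_normal L M lam)))
   \<and> (\<forall>(M :: nat \<Rightarrow> nat) (\<mu> :: nat \<Rightarrow> real).
        (\<forall>n. real (M n) = real n / 2 * (1 + \<mu> n * real n powr (- 1 / 3))) \<longrightarrow>
        \<mu> \<in> O(\<lambda>_. 1) \<longrightarrow>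
        (let lam = (\<lambda>n. lambda_gf L (exp (- crit_alpha (\<mu> n) * real n powr (- 1 / 3)))) in
          (convergent lam \<longrightarrow> asymp_Poisson L M lam) \<and>
          (filterlim lam at_top sequentially \<longrightarrow> asymp_normal L M lam)))"
proof (intro conjI allI impI)
  fix M :: "nat \<Rightarrow> nat" and c :: "nat \<Rightarrow> real"
  assume M: "\<forall>n. real (M n) = c n * real n" and ls: "limsup (\<lambda>n. ereal (c n)) < ereal (1 / 2)"
  obtain c0 where c0: "c0 < 1 / 2" "\<forall>\<^sub>F n in sequentially. c n < c0" using limsup_gap[OF ls] .
  have z: "2 * real (M n) / real n = 2 * c n" if "1 \<le> n" for n using M that by simp
  have cpos: "0 \<le> c n" if "1 \<le> n" for n
  proof -
    have "0 \<le> c n * real n" using M by (metis of_nat_0_le_iff)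
    then show ?thesis using that by (simp add: zero_le_mult_iff)
  qed
  show "asymp_Poisson L M (\<lambda>n. lambda_gf L (2 * c n))"
  proof (rule subcritical_limit(1)[OF assms(1)])
    show "\<forall>\<^sub>F n in sequentially. 2 * real (M n) < real n"
      using c0(2) eventually_ge_at_top[of 1]
    proof eventually_elim
      case (elim n)
      then have "2 * c n * real n < 1 * real n" using c0(1) by (intro mult_strict_right_mono) auto
      then show ?case using M by simp
    qed
    \<comment> \<open>A gap bounded away from 0 makes this quantity grow linearly in
      \<open>n\<close>.\<close>
    show "filterlim (\<lambda>n. real n * (1 - 2 * real (M n) / real n) ^ 3) at_top sequentially"
    proof (rule filterlim_at_top_mono)
      show "filterlim (\<lambda>n. (1 - 2 * c0) ^ 3 * real n) at_top sequentially"
        using c0(1) by (intro filterlim_tendsto_pos_mult_at_top[OF tendsto_const] filterlim_real_sequentially) simp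
      show "\<forall>\<^sub>F n in sequentially. (1 - 2 * c0) ^ 3 * real n \<le> real n * (1 - 2 * real (M n) / real n) ^ 3"
        using c0(2) eventually_ge_at_top[of 1]
      proof eventually_elim
        case (elim n)
        have "(1 - 2 * c0) ^ 3 \<le> (1 - 2 * c n) ^ 3" using elim c0(1) by (intro power_mono) auto
        then show ?case unfolding z[OF elim(2)] by (simp add: mult.commute mult_left_mono)
      qed
    qed
    show "\<forall>\<^sub>F n in sequentially. lambda_gf L (2 * c n) = lambda_gf L (2 * real (M n) / real n)"
      using eventually_ge_at_top[of 1] by eventually_elim (simp only: z)
    show "\<forall>\<^sub>F n in sequentially. lambda_gf L (2 * c n) \<le> 1 / (1 - 2 * c0)"
      using c0(2) eventually_ge_at_top[of 1]
    proof eventually_elim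
      case (elim n)
      have "lambda_gf L (2 * c n) \<le> 1 / (1 - 2 * c n)"
        using elim c0(1) cpos[OF elim(2)] by (intro lambda_gf_le) auto
      also have "\<dots> \<le> 1 / (1 - 2 * c0)" using elim c0(1) by (intro divide_left_mono) auto
      finally show ?case .
    qed
  qed
next
  fix M :: "nat \<Rightarrow> nat" and \<mu> :: "nat \<Rightarrow> real"
  assume M: "\<forall>n. real (M n) = real n / 2 * (1 - \<mu> n * real n powr (- 1 / 3))"
    and top: "filterlim \<mu> at_top sequentially"
  have z: "1 - 2 * real (M n) / real n = \<mu> n / real n powr (1 / 3)" if "1 \<le> n" for n
  proof -
    have "real n powr (- 1 / 3) = 1 / real n powr (1 / 3)" using powr_minus_divide[of "real n" "1 / 3"] by simp
    moreover have "2 * real (M n) / real n = 1 - \<mu> n * real n powr (- 1 / 3)"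
      unfolding M[rule_format, of n] using that by simp
    ultimately show ?thesis by simp
  qed
  have pos: "\<forall>\<^sub>F n in sequentially. 0 < \<mu> n" using top by (simp add: filterlim_at_top_dense)
  have sub: "\<forall>\<^sub>F n in sequentially. 2 * real (M n) < real n"
    using pos eventually_ge_at_top[of 1]
  proof eventually_elim
    case (elim n)
    then have "0 < 1 - 2 * real (M n) / real n" unfolding z[OF elim(2)] by simp
    then show ?case using elim(2) by (simp add: field_simps)
  qed
  \<comment> \<open>The relative gap is \<mu> / n^(1/3), so the quantity equals \<mu>^3.\<close>
  have gap: "filterlim (\<lambda>n. real n * (1 - 2 * real (M n) / real n) ^ 3) at_top sequentially"
  proof (rule filterlim_cong[THEN iffD1, OF refl refl _ filterlim_pow_at_top[OF _ top, of 3]])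
    show "\<forall>\<^sub>F n in sequentially. \<mu> n ^ 3 = real n * (1 - 2 * real (M n) / real n) ^ 3"
      using eventually_ge_at_top[of 1]
      by eventually_elim (simp add: z power_divide cube_root_pow3)
  qed simp
  show "let lam = (\<lambda>n. lambda_gf L (2 * real (M n) / real n)) in
          (convergent lam \<longrightarrow> asymp_Poisson L M lam) \<and>
          (filterlim lam at_top sequentially \<longrightarrow> asymp_normal L M lam)"
    unfolding Let_def
  proof (intro conjI impI)
    assume "convergent (\<lambda>n. lambda_gf L (2 * real (M n) / real n))"
    then obtain l where "(\<lambda>n. lambda_gf L (2 * real (M n) / real n)) \<longlonglongrightarrow> l" by (auto simp: convergent_def)
    then have "\<forall>\<^sub>F n in sequentially. lambda_gf L (2 * real (M n) / real n) < l + 1" by (rule order_tendstoD(2)) simp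
    then have "\<forall>\<^sub>F n in sequentially. lambda_gf L (2 * real (M n) / real n) \<le> l + 1" by eventually_elim simp
    then show "asymp_Poisson L M (\<lambda>n. lambda_gf L (2 * real (M n) / real n))"
      by (rule subcritical_limit(1)[OF assms(1) sub gap, rotated]) simp
  next
    assume "filterlim (\<lambda>n. lambda_gf L (2 * real (M n) / real n)) at_top sequentially"
    then show "asymp_normal L M (\<lambda>n. lambda_gf L (2 * real (M n) / real n))"
      by (rule subcritical_limit(2)[OF assms(1) sub gap, rotated]) simp
  qed
next
  fix M :: "nat \<Rightarrow> nat" and \<mu> :: "nat \<Rightarrow> real"
  assume M: "\<forall>n. real (M n) = real n / 2 * (1 + \<mu> n * real n powr (- 1 / 3))" and O: "\<mu> \<in> O(\<lambda>_. 1)"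
  obtain C where C: "\<forall>\<^sub>F n in sequentially. norm (\<mu> n) \<le> C * norm (1 :: real)"
    using landau_o.bigE[OF O] by blast
  define lam where "lam = (\<lambda>n. lambda_gf L (exp (- crit_alpha (\<mu> n) * real n powr (- 1 / 3))))"
  \<comment> \<open>The bound from the Landau symbol is raised to at least 1, as the locale
    requires.\<close>
  interpret S: critical_sequence L M \<mu> "max 1 C" lam
  proof
    show "\<forall>\<^sub>F n in sequentially. \<bar>\<mu> n\<bar> \<le> max 1 C" using C by eventually_elim simp
  qed (use assms(1) M in \<open>auto simp: lam_def\<close>)
  have "asymp_Poisson L M lam" if conv: "convergent lam"
  proof -
    obtain l where "lam \<longlonglongrightarrow> l" using conv unfolding convergent_def by blast
    then have "\<forall>\<^sub>F n in sequentially. lam n < l + 1" by (rule order_tendstoD(2)) simp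
    then have "\<forall>\<^sub>F n in sequentially. lam n \<le> l + 1" by eventually_elim simp
    then show ?thesis by (rule S.Poisson_limit)
  qed
  then show "let lam = (\<lambda>n. lambda_gf L (exp (- crit_alpha (\<mu> n) * real n powr (- 1 / 3)))) in
          (convergent lam \<longrightarrow> asymp_Poisson L M lam) \<and>
          (filterlim lam at_top sequentially \<longrightarrow> asymp_normal L M lam)"
    unfolding Let_def lam_def[symmetric] using S.normal_limit by blast
qed

end
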